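(* Let $H$, $H_h$ ($h>0$) and $\gamma$ be the operators and the exponent arising from admissible data $(\varphi_0,\psi_0,V,G_0)$. Let $\mu>0$ be such that $(-\infty,-\mu]\subseteq\rho(H)\cap\rho(H_h)$ for all $h>0$. Let $-\mu<a\le b$ and $K=[a,b]$. Then there exist $C>0$ and $h_0>0$ such that $$\mathrm d_{\mathrm H,K}\bigl(\sigma(H_h),\sigma(H)\bigr)\le (b+\mu)^2\,C\,h^\gamma\qquad\text{for all }0<h\le h_0,$$ where the constant $C$ does not depend on $a$ and $b$.
   Context: $\sigma(\cdot)$ and $\rho(\cdot)$ denote spectrum and resolvent set. For a compact set $K\subset\mathbf C$ and closed non-empty sets $X,Y\subseteq\mathbf C$, the local Hausdorff distance is $\mathrm d_{\mathrm H,K}(X,Y)=\max\{0,\ \sup_{x\in X\cap K}\mathrm{dist}(x,Y),\ \sup_{y\in Y\cap K}\mathrm{dist}(y,X)\}$, with the convention $\sup\emptyset=-\infty$. Spaces and Fourier transforms. Fix $d\ge1$. $\mathcal H=L^2(\mathbf R^d)$, with inner product $\langle\cdot,\cdot\rangle$ linear in the second argument and identity $I$. For $h>0$, $\mathcal H_h=\ell^2(h\mathbf Z^d)$ is the space of $u_h\colon\mathbf Z^d\to\mathbf C$ with norm $\|u_h\|=(h^d\sum_{n\in\mathbf Z^d}|u_h(n)|^2)^{1/2}<\infty$, with identity $I_h$. $\hat f(\xi)=(\mathcal F f)(\xi)=(2\pi)^{-d/2}\int_{\mathbf R^d} e^{-ix\cdot\xi}f(x)\,dx$ is the unitary Fourier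 transform. With $\mathbf T_h^d=[-\pi/h,\pi/h]^d$, the unitary discrete Fourier transform $\mathsf F_h\colon\mathcal H_h\to L^2(\mathbf T_h^d)$ is $(\mathsf F_hu_h)(\xi)=\frac{h^d}{(2\pi)^{d/2}}\sum_{n\in\mathbf Z^d}u_h(n)e^{-ihn\cdot\xi}$. Riesz sequences. Sequences $\{u_k\},\{v_k\}$ indexed by $\mathbf Z^d$ in a Hilbert space are biorthogonal if $\langle u_k,v_n\rangle=\delta_{k,n}$. $\{u_k\}$ is a Riesz sequence if there are $A,B>0$ with $A\sum|c_k|^2\le\|\sum c_ku_k\|^2\le B\sum|c_k|^2$ for all $\{c_k\}\in\ell^2(\mathbf Z^d)$. Admissible data $(\varphi_0,\psi_0,V,G_0)$ means all of the following. (a) $\varphi_0,\psi_0\in\mathcal H$; the sequences $\{\varphi_0(\cdot-k)\}_{k\in\mathbf Z^d}$ and $\{\psi_0(\cdot-k)\}_{k\in\mathbf Z^d}$ are biorthogonal Riesz sequences in $\mathcal H$; $\hat\varphi_0,\hat\psi_0$ are essentially bounded and supported in $[-3\pi/2,3\pi/2]^d$; and there is $c_0>0$ with $|\hat\varphi_0(\xi)|\ge c_0$ and $|\hat\psi_0(\xi)|\ge c_0$ for $\xi\in[-\pi/2,\pi/2]^d$. (b) $V\colon\mathbf R^d\to\mathbf R$ is bounded and Hölder continuous with exponent $\theta\in(0,1]$. If $V\not\equiv0$, there are $\tau>d$ and $C'>0$ with $|\psi_0(x)|\le C'(1+|x|)^{-\tau}$ for all $x\in\mathbf R^d$, and $\theta'$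 is defined by $\frac1{\theta'}=\frac1\theta+\frac1{\tau-d}$. (c) $G_0\colon\mathbf R^d\to\mathbf R$ satisfies one of: (i) (parameters $\alpha,\beta$) $\alpha>\frac12$, $\beta>-\frac12$, $\alpha\le1+\beta<2\alpha\le3+\beta$; $G_0\in C^1(\mathbf R^d)$ is real-valued and non-negative; $G_0(0)=0$; there are $c>0$, $c_0>0$ with $G_0(\xi)\ge c|\xi|^\alpha$ for $|\xi|\ge c_0$; for some $c'>0$, $|\nabla G_0(\xi)|\le c'|\xi|^\beta$ for all $\xi$; $G_0(\xi_1,\dots,\xi_d)=G_0(|\xi_1|,\dots,|\xi_d|)$ for all $\xi$. (ii) (parameters $\alpha,\tilde\beta$) $\frac12<\alpha\le1$, $\tilde\beta\ge0$, $1+\tilde\beta<2\alpha$; $G_0(\xi)=|\xi|^\alpha+\widetilde G_0(\xi)$ with $\widetilde G_0\in C^1(\mathbf R^d)$ real-valued and non-negative; $\widetilde G_0(0)=0$; there are $c>0$, $c_0>0$ with $|\nabla\widetilde G_0(\xi)|\le c|\xi|^{\tilde\beta}$ for $|\xi|\ge c_0$; $\widetilde G_0(\xi_1,\dots,\xi_d)=\widetilde G_0(|\xi_1|,\dots,|\xi_d|)$ for all $\xi$. (iii) $G_0(\xi)=|\xi|^\alpha$ with $0<\alpha\le1$. The exponent is $\gamma=\min\{2\alpha-1,2\alpha-\beta-1,\theta'\}$ in case (i), $\gamma=\min\{2\alpha-\tilde\beta-1,\theta'\}$ in case (ii), $\gamma=\min\{\alpha,\theta'\}$ in case (iii), with $\theta'$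 omitted if $V\equiv0$. Operators. $G_{0,h}(\xi)=G_0(\frac2h\sin(\frac h2\xi_1),\dots,\frac2h\sin(\frac h2\xi_d))$; $H_0=\mathcal F^*G_0(\cdot)\mathcal F$ on $\mathcal H$ with domain $\{f:G_0\hat f\in L^2\}$; $H_{0,h}=\mathsf F_h^*G_{0,h}(\cdot)\mathsf F_h$ on $\mathcal H_h$ ($G(\cdot)$ denotes multiplication by $G$). $V$ acts by multiplication, $V_h$ is multiplication by $V_h(k)=V(hk)$, $k\in\mathbf Z^d$. $H=H_0+V$ (self-adjoint, domain that of $H_0$) and $H_h=H_{0,h}+V_h$ (bounded, self-adjoint). Such $\mu$ exist since $H_0,H_{0,h}\ge0$ and $V$ is bounded. *)

theory Defs
  imports "HOL-Analysis.Analysis"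
begin

section \<open>The Hilbert space of square-integrable functions\<close>

text \<open>
  Elements of \<open>L\<^sup>2(M)\<close> are represented by functions; two functions represent the same
  element iff they agree almost everywhere.  All notions below respect this identification.
\<close>

definition L2 :: "'a measure \<Rightarrow> ('a \<Rightarrow> complex) set" where
  "L2 M = {f \<in> borel_measurable M. integrable M (\<lambda>x. (cmod (f x))\<^sup>2)}"

definition L2_norm :: "'a measure \<Rightarrow> ('a \<Rightarrow> complex) \<Rightarrow> real" where
  "L2_norm M f = sqrt (LINT x|M. (cmod (f x))\<^sup>2)"

definition L2_inner :: "'a measure \<Rightarrow> ('a \<Rightarrow> complex) \<Rightarrow> ('a \<Rightarrow> complex) \<Rightarrow> complex" where
  "L2_inner M f g = (LINT x|M. cnj (f x) * g x)"

definition L2_tendsto ::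
  "'a measure \<Rightarrow> 'i filter \<Rightarrow> ('i \<Rightarrow> 'a \<Rightarrow> complex) \<Rightarrow> ('a \<Rightarrow> complex) \<Rightarrow> bool" where
  "L2_tendsto M F s g \<longleftrightarrow> g \<in> L2 M \<and> (\<forall>\<^sub>F i in F. s i \<in> L2 M) \<and>
     ((\<lambda>i. L2_norm M (\<lambda>x. s i x - g x)) \<longlongrightarrow> 0) F"

definition L2_lim :: "'a measure \<Rightarrow> 'i filter \<Rightarrow> ('i \<Rightarrow> 'a \<Rightarrow> complex) \<Rightarrow> 'a \<Rightarrow> complex" where
  "L2_lim M F s = (SOME g. L2_tendsto M F s g)"

definition L2_adjoint :: "'a measure \<Rightarrow> 'b measure \<Rightarrow> (('a \<Rightarrow> complex) \<Rightarrow> 'b \<Rightarrow> complex) \<Rightarrow>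
    ('b \<Rightarrow> complex) \<Rightarrow> 'a \<Rightarrow> complex" where
  "L2_adjoint M N A g =
     (SOME f. f \<in> L2 M \<and> (\<forall>u \<in> L2 M. L2_inner M f u = L2_inner N g (A u)))"

text \<open>
  Resolvent set of an operator \<open>T\<close> with domain \<open>D\<close>: \<open>T - z\<close> is a bijection from \<open>D\<close> onto
  \<open>L\<^sup>2(M)\<close> (modulo almost everywhere equality) whose inverse is bounded.
\<close>

definition resolvent_set ::
  "'a measure \<Rightarrow> ('a \<Rightarrow> complex) set \<Rightarrow> (('a \<Rightarrow> complex) \<Rightarrow> 'a \<Rightarrow> complex) \<Rightarrow> complex set" where
  "resolvent_set M D T = {z. \<exists>B. \<forall>g \<in> L2 M. \<exists>f \<in> D.
     (AE x in M. T f x - z * f x = g x) \<and> L2_norm M f \<le> B * L2_norm M g \<and>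
     (\<forall>f' \<in> D. (AE x in M. T f' x - z * f' x = g x) \<longrightarrow> (AE x in M. f' x = f x))}"

definition spectrum ::
  "'a measure \<Rightarrow> ('a \<Rightarrow> complex) set \<Rightarrow> (('a \<Rightarrow> complex) \<Rightarrow> 'a \<Rightarrow> complex) \<Rightarrow> complex set" where
  "spectrum M D T = - resolvent_set M D T"

text \<open>Local Hausdorff distance of non-empty closed sets; in \<open>ereal\<close>, \<open>SUP\<close> over \<open>{}\<close> is \<open>-\<infinity>\<close>.\<close>

definition local_hausdorff :: "complex set \<Rightarrow> complex set \<Rightarrow> complex set \<Rightarrow> ereal" where
  "local_hausdorff K X Y =
     max 0 (max (SUP x \<in> X \<inter> K. ereal (infdist x Y)) (SUP y \<in> Y \<inter> K. ereal (infdist y X)))"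


section \<open>Fourier transforms\<close>

definition cube :: "real \<Rightarrow> (real ^ 'n) set" where
  "cube r = {\<xi>. \<forall>i. - r \<le> \<xi> $ i \<and> \<xi> $ i \<le> r}"

definition zvec :: "int ^ 'n \<Rightarrow> real ^ 'n" where
  "zvec k = (\<chi> i. of_int (k $ i))"

text \<open>
  The integral over \<open>\<real>\<^sup>d\<close> need not exist for square-integrable \<open>f\<close>; as usual, the unitary
  transform is the \<open>L\<^sup>2\<close>-limit of the integrals over balls of radius \<open>R\<close>, as \<open>R \<rightarrow> \<infinity>\<close>.
\<close>

definition fourier :: "(real ^ 'n \<Rightarrow> complex) \<Rightarrow> real ^ 'n \<Rightarrow> complex" where
  "fourier f = L2_lim lborel at_top (\<lambda>R::real. \<lambda>\<xi>.
     of_real ((2 * pi) powr (- real CARD('n) / 2)) *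
     (LINT x|lborel. indicator (ball 0 R) x * (exp (- \<i> * of_real (x \<bullet> \<xi>)) * f x)))"

text \<open>
  \<open>\<ell>\<^sup>2(h\<int>\<^sup>d)\<close> is the \<open>L\<^sup>2\<close>-space of the measure on \<open>\<int>\<^sup>d\<close> giving mass \<open>h\<^sup>d\<close> to each point;
  see \<open>L2_lattice_iff\<close> and \<open>L2_norm_lattice\<close> below.
\<close>

definition lattice :: "real \<Rightarrow> (int ^ 'n) measure" where
  "lattice h = density (count_space UNIV) (\<lambda>_. ennreal (h ^ CARD('n)))"

definition torus :: "real \<Rightarrow> (real ^ 'n) measure" where
  "torus h = restrict_space lborel (cube (pi / h))"

text \<open>The Fourier series of an \<open>\<ell>\<^sup>2\<close>-sequence converges (unconditionally) in \<open>L\<^sup>2\<close>.\<close>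

definition dft :: "real \<Rightarrow> (int ^ 'n \<Rightarrow> complex) \<Rightarrow> real ^ 'n \<Rightarrow> complex" where
  "dft h u = L2_lim (torus h) (finite_subsets_at_top UNIV) (\<lambda>S \<xi>.
     of_real (h ^ CARD('n) / (2 * pi) powr (real CARD('n) / 2)) *
     (\<Sum>n\<in>S. u n * exp (- \<i> * of_real (h * (zvec n \<bullet> \<xi>)))))"


section \<open>The operators\<close>

definition H_dom :: "(real ^ 'n \<Rightarrow> real) \<Rightarrow> (real ^ 'n \<Rightarrow> complex) set" where
  "H_dom G0 = {f \<in> L2 lborel. (\<lambda>\<xi>. of_real (G0 \<xi>) * fourier f \<xi>) \<in> L2 lborel}"

definition H_op :: "(real ^ 'n \<Rightarrow> real) \<Rightarrow> (real ^ 'n \<Rightarrow> real) \<Rightarrow>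
    (real ^ 'n \<Rightarrow> complex) \<Rightarrow> real ^ 'n \<Rightarrow> complex" where
  "H_op G0 V f = (\<lambda>x.
     L2_adjoint lborel lborel fourier (\<lambda>\<xi>. of_real (G0 \<xi>) * fourier f \<xi>) x + of_real (V x) * f x)"

definition G0_disc :: "(real ^ 'n \<Rightarrow> real) \<Rightarrow> real \<Rightarrow> real ^ 'n \<Rightarrow> real" where
  "G0_disc G0 h \<xi> = G0 (\<chi> i. 2 / h * sin (h / 2 * \<xi> $ i))"

definition Hh_op :: "(real ^ 'n \<Rightarrow> real) \<Rightarrow> (real ^ 'n \<Rightarrow> real) \<Rightarrow> real \<Rightarrow>
    (int ^ 'n \<Rightarrow> complex) \<Rightarrow> int ^ 'n \<Rightarrow> complex" where
  "Hh_op G0 V h u = (\<lambda>k.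
     L2_adjoint (lattice h) (torus h) (dft h) (\<lambda>\<xi>. of_real (G0_disc G0 h \<xi>) * dft h u \<xi>) k +
     of_real (V (h *\<^sub>R zvec k)) * u k)"

abbreviation resolvent_H :: "(real ^ 'n \<Rightarrow> real) \<Rightarrow> (real ^ 'n \<Rightarrow> real) \<Rightarrow> complex set" where
  "resolvent_H G0 V \<equiv> resolvent_set lborel (H_dom G0) (H_op G0 V)"

abbreviation spectrum_H :: "(real ^ 'n \<Rightarrow> real) \<Rightarrow> (real ^ 'n \<Rightarrow> real) \<Rightarrow> complex set" where
  "spectrum_H G0 V \<equiv> spectrum lborel (H_dom G0) (H_op G0 V)"

abbreviation resolvent_Hh ::
    "(real ^ 'n \<Rightarrow> real) \<Rightarrow> (real ^ 'n \<Rightarrow> real) \<Rightarrow> real \<Rightarrow> complex set" where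
  "resolvent_Hh G0 V h \<equiv> resolvent_set (lattice h) (L2 (lattice h)) (Hh_op G0 V h)"

abbreviation spectrum_Hh ::
    "(real ^ 'n \<Rightarrow> real) \<Rightarrow> (real ^ 'n \<Rightarrow> real) \<Rightarrow> real \<Rightarrow> complex set" where
  "spectrum_Hh G0 V h \<equiv> spectrum (lattice h) (L2 (lattice h)) (Hh_op G0 V h)"


section \<open>Admissible data\<close>

definition translates :: "(real ^ 'n \<Rightarrow> complex) \<Rightarrow> int ^ 'n \<Rightarrow> real ^ 'n \<Rightarrow> complex" where
  "translates f k = (\<lambda>x. f (x - zvec k))"

definition biorthogonal ::
    "'a measure \<Rightarrow> ('k \<Rightarrow> 'a \<Rightarrow> complex) \<Rightarrow> ('k \<Rightarrow> 'a \<Rightarrow> complex) \<Rightarrow> bool" where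
  "biorthogonal M u v \<longleftrightarrow> (\<forall>k n. L2_inner M (u k) (v n) = (if k = n then 1 else 0))"

definition riesz_sequence :: "'a measure \<Rightarrow> ('k \<Rightarrow> 'a \<Rightarrow> complex) \<Rightarrow> bool" where
  "riesz_sequence M u \<longleftrightarrow> (\<exists>A>0. \<exists>B>0. \<forall>c :: 'k \<Rightarrow> complex.
     (\<lambda>k. (cmod (c k))\<^sup>2) summable_on UNIV \<longrightarrow>
     (\<exists>g. L2_tendsto M (finite_subsets_at_top UNIV) (\<lambda>S x. \<Sum>k\<in>S. c k * u k x) g \<and>
        A * (\<Sum>\<^sub>\<infinity>k. (cmod (c k))\<^sup>2) \<le> (L2_norm M g)\<^sup>2 \<and>
        (L2_norm M g)\<^sup>2 \<le> B * (\<Sum>\<^sub>\<infinity>k. (cmod (c k))\<^sup>2)))"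

definition admissible_pair :: "(real ^ 'n \<Rightarrow> complex) \<Rightarrow> (real ^ 'n \<Rightarrow> complex) \<Rightarrow> bool" where
  "admissible_pair \<phi>0 \<psi>0 \<longleftrightarrow>
     \<phi>0 \<in> L2 lborel \<and> \<psi>0 \<in> L2 lborel \<and>
     biorthogonal lborel (translates \<phi>0) (translates \<psi>0) \<and>
     riesz_sequence lborel (translates \<phi>0) \<and> riesz_sequence lborel (translates \<psi>0) \<and>
     (\<exists>B. AE \<xi> in lborel. cmod (fourier \<phi>0 \<xi>) \<le> B) \<and>
     (\<exists>B. AE \<xi> in lborel. cmod (fourier \<psi>0 \<xi>) \<le> B) \<and>
     (AE \<xi> in lborel. \<xi> \<notin> cube (3 * pi / 2) \<longrightarrow> fourier \<phi>0 \<xi> = 0 \<and> fourier \<psi>0 \<xi> = 0) \<and>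
     (\<exists>c0>0. AE \<xi> in lborel. \<xi> \<in> cube (pi / 2) \<longrightarrow>
        cmod (fourier \<phi>0 \<xi>) \<ge> c0 \<and> cmod (fourier \<psi>0 \<xi>) \<ge> c0)"

definition admissible_potential ::
    "(real ^ 'n \<Rightarrow> real) \<Rightarrow> (real ^ 'n \<Rightarrow> complex) \<Rightarrow> real \<Rightarrow> real \<Rightarrow> bool" where
  "admissible_potential V \<psi>0 \<theta> \<tau> \<longleftrightarrow>
     bounded (range V) \<and> 0 < \<theta> \<and> \<theta> \<le> 1 \<and>
     (\<exists>L. \<forall>x y. \<bar>V x - V y\<bar> \<le> L * dist x y powr \<theta>) \<and>
     ((\<exists>x. V x \<noteq> 0) \<longrightarrow>
        \<tau> > real CARD('n) \<and>
        (\<exists>C'>0. \<forall>x. cmod (\<psi>0 x) \<le> C' * (1 + norm x) powr (- \<tau>)))"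

definition reflection_symmetric :: "(real ^ 'n \<Rightarrow> real) \<Rightarrow> bool" where
  "reflection_symmetric G \<longleftrightarrow> (\<forall>\<xi>. G \<xi> = G (\<chi> i. \<bar>\<xi> $ i\<bar>))"

text \<open>
  In case (i) the gradient bound is required for \<open>\<xi> \<noteq> 0\<close> only: at \<open>0\<close> it is void for \<open>\<beta> < 0\<close>
  (where \<open>\<bar>0\<bar>\<^sup>\<beta> = \<infinity>\<close>) and follows by continuity of the gradient for \<open>\<beta> \<ge> 0\<close>, whereas
  \<open>0 powr \<beta> = 0\<close> for all \<open>\<beta>\<close>.
\<close>

definition symbol_i :: "real \<Rightarrow> real \<Rightarrow> (real ^ 'n \<Rightarrow> real) \<Rightarrow> bool" where
  "symbol_i \<alpha> \<beta> G0 \<longleftrightarrow>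
     \<alpha> > 1/2 \<and> \<beta> > -1/2 \<and> \<alpha> \<le> 1 + \<beta> \<and> 1 + \<beta> < 2 * \<alpha> \<and> 2 * \<alpha> \<le> 3 + \<beta> \<and>
     (\<forall>\<xi>. G0 \<xi> \<ge> 0) \<and> G0 0 = 0 \<and>
     (\<exists>c>0. \<exists>c0>0. \<forall>\<xi>. norm \<xi> \<ge> c0 \<longrightarrow> G0 \<xi> \<ge> c * norm \<xi> powr \<alpha>) \<and>
     (\<exists>dG. continuous_on UNIV dG \<and> (\<forall>\<xi>. GDERIV G0 \<xi> :> dG \<xi>) \<and>
        (\<exists>c'>0. \<forall>\<xi>. \<xi> \<noteq> 0 \<longrightarrow> norm (dG \<xi>) \<le> c' * norm \<xi> powr \<beta>)) \<and>
     reflection_symmetric G0"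

definition symbol_ii :: "real \<Rightarrow> real \<Rightarrow> (real ^ 'n \<Rightarrow> real) \<Rightarrow> bool" where
  "symbol_ii \<alpha> \<beta> G0 \<longleftrightarrow>
     1/2 < \<alpha> \<and> \<alpha> \<le> 1 \<and> \<beta> \<ge> 0 \<and> 1 + \<beta> < 2 * \<alpha> \<and>
     (\<exists>G1. (\<forall>\<xi>. G0 \<xi> = norm \<xi> powr \<alpha> + G1 \<xi>) \<and>
        (\<forall>\<xi>. G1 \<xi> \<ge> 0) \<and> G1 0 = 0 \<and>
        (\<exists>dG. continuous_on UNIV dG \<and> (\<forall>\<xi>. GDERIV G1 \<xi> :> dG \<xi>) \<and>
           (\<exists>c>0. \<exists>c0>0. \<forall>\<xi>. norm \<xi> \<ge> c0 \<longrightarrow> norm (dG \<xi>) \<le> c * norm \<xi> powr \<beta>)) \<and>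
        reflection_symmetric G1)"

definition symbol_iii :: "real \<Rightarrow> (real ^ 'n \<Rightarrow> real) \<Rightarrow> bool" where
  "symbol_iii \<alpha> G0 \<longleftrightarrow> 0 < \<alpha> \<and> \<alpha> \<le> 1 \<and> (\<forall>\<xi>. G0 \<xi> = norm \<xi> powr \<alpha>)"

datatype symbol_params = Case_i real real | Case_ii real real | Case_iii real

fun admissible_symbol :: "symbol_params \<Rightarrow> (real ^ 'n \<Rightarrow> real) \<Rightarrow> bool" where
  "admissible_symbol (Case_i \<alpha> \<beta>) G0 = symbol_i \<alpha> \<beta> G0"
| "admissible_symbol (Case_ii \<alpha> \<beta>) G0 = symbol_ii \<alpha> \<beta> G0"
| "admissible_symbol (Case_iii \<alpha>) G0 = symbol_iii \<alpha> G0"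

definition admissible :: "(real ^ 'n \<Rightarrow> complex) \<Rightarrow> (real ^ 'n \<Rightarrow> complex) \<Rightarrow> (real ^ 'n \<Rightarrow> real) \<Rightarrow>
    (real ^ 'n \<Rightarrow> real) \<Rightarrow> real \<Rightarrow> real \<Rightarrow> symbol_params \<Rightarrow> bool" where
  "admissible \<phi>0 \<psi>0 V G0 \<theta> \<tau> p \<longleftrightarrow>
     admissible_pair \<phi>0 \<psi>0 \<and> admissible_potential V \<psi>0 \<theta> \<tau> \<and> admissible_symbol p G0"

fun symbol_exponent :: "symbol_params \<Rightarrow> real" where
  "symbol_exponent (Case_i \<alpha> \<beta>) = min (2 * \<alpha> - 1) (2 * \<alpha> - \<beta> - 1)"
| "symbol_exponent (Case_ii \<alpha> \<beta>) = 2 * \<alpha> - \<beta> - 1"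
| "symbol_exponent (Case_iii \<alpha>) = \<alpha>"

text \<open>The number \<open>\<theta>'\<close> with \<open>1/\<theta>' = 1/\<theta> + 1/(\<tau> - d)\<close> enters only if \<open>V\<close> is not identically zero.\<close>

definition rate_exponent :: "(real ^ 'n \<Rightarrow> real) \<Rightarrow> real \<Rightarrow> real \<Rightarrow> symbol_params \<Rightarrow> real" where
  "rate_exponent V \<theta> \<tau> p =
     (if \<forall>x. V x = 0 then symbol_exponent p
      else min (symbol_exponent p) (1 / (1 / \<theta> + 1 / (\<tau> - real CARD('n)))))"


section \<open>The lattice space in terms of sums\<close>

lemma integrable_count_space_iff_summable:
  fixes f :: "'a \<Rightarrow> real"
  assumes "\<And>x. f x \<ge> 0"
  shows "integrable (count_space UNIV) f \<longleftrightarrow> f summable_on UNIV"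
  using assms abs_summable_equivalent[of f UNIV]
  by (simp add: Infinite_Set_Sum.abs_summable_on_def)

lemma L2_lattice_iff:
  fixes u :: "int ^ 'n \<Rightarrow> complex"
  assumes "h > 0"
  shows "u \<in> L2 (lattice h) \<longleftrightarrow> (\<lambda>n. (cmod (u n))\<^sup>2) summable_on UNIV"
proof -
  have "u \<in> L2 (lattice h) \<longleftrightarrow>
      integrable (count_space UNIV) (\<lambda>n. h ^ CARD('n) * (cmod (u n))\<^sup>2)"
    using assms by (simp add: L2_def lattice_def integrable_density)
  also have "\<dots> \<longleftrightarrow> integrable (count_space UNIV) (\<lambda>n. (cmod (u n))\<^sup>2)"
    using assms by simp
  finally show ?thesis
    by (simp add: integrable_count_space_iff_summable)
qed

lemma L2_norm_lattice:
  fixes u :: "int ^ 'n \<Rightarrow> complex"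
  assumes "h > 0" "u \<in> L2 (lattice h)"
  shows "L2_norm (lattice h) u = sqrt (h ^ CARD('n) * (\<Sum>\<^sub>\<infinity>n. (cmod (u n))\<^sup>2))"
proof -
  have "(\<lambda>n. (cmod (u n))\<^sup>2) summable_on UNIV"
    using assms L2_lattice_iff by blast
  hence abs: "Infinite_Set_Sum.abs_summable_on (\<lambda>n. (cmod (u n))\<^sup>2) UNIV"
    by (simp add: Infinite_Set_Sum.abs_summable_on_def integrable_count_space_iff_summable)
  have "(LINT n|lattice h. (cmod (u n))\<^sup>2) =
      (LINT n|count_space UNIV. h ^ CARD('n) * (cmod (u n))\<^sup>2)"
    using assms by (simp add: lattice_def integral_density)
  also have "\<dots> = h ^ CARD('n) * (\<Sum>\<^sub>\<infinity>n. (cmod (u n))\<^sup>2)"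
    using infsetsum_infsum[OF abs] by (simp add: infsetsum_def)
  finally show ?thesis
    by (simp add: L2_norm_def)
qed

end

theory Submission
  imports Defs "HOL-Probability.Probability" "HOL-Library.Function_Algebras"
begin

text \<open>
  Let \<open>J\<close> map a lattice function to the function that is constant on the cells of side \<open>h\<close>; it is an
  isometry, and on the cube \<open>[-\<pi>/h, \<pi>/h]\<^sup>d\<close> the Fourier transform of \<open>J u\<close> is a factor \<open>S(h\<xi>)\<close>, close to \<open>1\<close>
  for small \<open>h\<xi>\<close>, times the discrete Fourier transform of \<open>u\<close>. With the weight \<open>\<omega>(\<xi>) = (1 + \<bar>\<xi>\<bar>)\<^sup>\<alpha>\<close> one has
  \<open>\<omega> \<le> C (1 + G\<^sub>0)\<close> and \<open>\<bar>G\<^sub>0 - G\<^bsub>0,h\<^esub>\<bar> \<le> C h\<^sup>\<gamma> \<omega>\<^sup>2\<close> on the cube, and the mass off the cube costs \<open>h\<^sup>\<gamma> \<omega>\<close>. As the resolvents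
  at \<open>-mu\<close> gain one factor \<open>\<omega>\<close> each, their quadratic forms differ by \<open>O(h\<^sup>\<gamma>)\<close>, that is
  \<open>\<parallel>R J - J R\<^sub>h\<parallel> = O(h\<^sup>\<gamma>)\<close>. An approximate eigenvector of one resolvent is then carried by \<open>J\<close> or its
  adjoint to one of the other, and \<open>l = 1/\<kappa> - mu\<close> turns an error \<open>O(h\<^sup>\<gamma>)\<close> in \<open>\<kappa>\<close> into
  \<open>O((l + mu)\<^sup>2 h\<^sup>\<gamma>)\<close>.

  The embedding \<open>J\<close> has first order accuracy only and does not use \<open>\<phi>\<^sub>0\<close>, \<open>\<psi>\<^sub>0\<close>. This suffices: for \<open>V \<noteq> 0\<close>
  the rate satisfies \<open>\<gamma> \<le> \<theta>' < \<theta> \<le> 1\<close>, and for \<open>V = 0\<close> both spectra are ranges of symbols, hence intervals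
  starting at \<open>0\<close>, which agree on \<open>K\<close> once \<open>h\<close> is small.
\<close>

section \<open>Spectra of symmetric operators\<close>

text \<open>The maps \<open>fourier\<close>, \<open>dft\<close> and \<open>L2_adjoint\<close> are
  defined by choice among functions that agree almost everywhere, so none of them need be linear as
  a map on functions. The abstract part therefore works with semi-inner products and derives
  linearity, up to vectors of norm zero, from symmetry or from preserved inner products. Real forms
  suffice because K lies on the real line and both operators are symmetric. The resolvents are
  compared by duality. With w = R f and v = R_h u, the number <f, (R J - J R_h) u> equals <w, J H_h
  v> - <H w, J v>, since the shifts by mu cancel; so the error of the symbol meets two regular
  functions. J is not onto, so an approximate eigenvector of H could be annihilated by the adjoint
  of J. It is not, because it lies near the range of R, whose elements lie within O(h^\<gamma>) of
  cell functions. No constant depends on h, a or b. Only the threshold for h depends on K: passing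
  from \<kappa> back to l requires an error that is small against 1 / (l + mu).\<close>

instantiation "fun" :: (type, real_vector) real_vector
begin

definition "scaleR_fun r f = (\<lambda>x. r *\<^sub>R f x)"

instance
  by standard (simp_all add: scaleR_fun_def fun_eq_iff scaleR_add_right scaleR_add_left)

end

lemma scaleR_fun_apply [simp]: "(r *\<^sub>R f) x = r *\<^sub>R f x"
  by (simp add: scaleR_fun_def)

text \<open>The form may vanish on non-zero vectors, because functions that vanish almost everywhere
  are vectors too. The carrier \<open>S\<close> is a subspace since L2 is a set of functions and not
  a type.\<close>

locale semi_inner =
  fixes S :: "'v::real_vector set" and ip :: "'v \<Rightarrow> 'v \<Rightarrow> real"
  assumes subspace_S: "subspace S"
    and ip_commute: "\<lbrakk>x \<in> S; y \<in> S\<rbrakk> \<Longrightarrow> ip x y = ip y x"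
    and ip_add_left: "\<lbrakk>x \<in> S; y \<in> S; z \<in> S\<rbrakk> \<Longrightarrow> ip (x + y) z = ip x z + ip y z"
    and ip_scale_left: "\<lbrakk>x \<in> S; y \<in> S\<rbrakk> \<Longrightarrow> ip (r *\<^sub>R x) y = r * ip x y"
    and ip_nonneg: "x \<in> S \<Longrightarrow> 0 \<le> ip x x"
begin

definition nrm :: "'v \<Rightarrow> real" where "nrm x = sqrt (ip x x)"

lemma S_closed [simp]:
  "0 \<in> S" "\<lbrakk>x \<in> S; y \<in> S\<rbrakk> \<Longrightarrow> x + y \<in> S" "\<lbrakk>x \<in> S; y \<in> S\<rbrakk> \<Longrightarrow> x - y \<in> S"
  "x \<in> S \<Longrightarrow> r *\<^sub>R x \<in> S" "x \<in> S \<Longrightarrow> - x \<in> S"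
  using subspace_S by (auto simp: subspace_0 subspace_add subspace_diff subspace_scale subspace_neg)

lemma ip_minus_left: "\<lbrakk>x \<in> S; y \<in> S\<rbrakk> \<Longrightarrow> ip (- x) y = - ip x y"
  using ip_scale_left[of x y "-1"] by simp

lemma ip_diff_left: "\<lbrakk>x \<in> S; y \<in> S; z \<in> S\<rbrakk> \<Longrightarrow> ip (x - y) z = ip x z - ip y z"
  using ip_add_left[of x "-y" z] by (simp add: ip_minus_left)

lemma ip_add_right: "\<lbrakk>x \<in> S; y \<in> S; z \<in> S\<rbrakk> \<Longrightarrow> ip z (x + y) = ip z x + ip z y"
  by (simp add: ip_commute[of z] ip_add_left)

lemma ip_diff_right: "\<lbrakk>x \<in> S; y \<in> S; z \<in> S\<rbrakk> \<Longrightarrow> ip z (x - y) = ip z x - ip z y"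
  by (simp add: ip_commute[of z] ip_diff_left)

lemma ip_scale_right: "\<lbrakk>x \<in> S; y \<in> S\<rbrakk> \<Longrightarrow> ip y (r *\<^sub>R x) = r * ip y x"
  by (simp add: ip_commute[of y] ip_scale_left)

lemmas ip_simps = ip_add_left ip_diff_left ip_scale_left ip_minus_left
  ip_add_right ip_diff_right ip_scale_right

lemma nrm_nonneg [simp]: "x \<in> S \<Longrightarrow> 0 \<le> nrm x"
  by (simp add: nrm_def ip_nonneg)

lemma nrm_sq: "x \<in> S \<Longrightarrow> (nrm x)\<^sup>2 = ip x x"
  by (simp add: nrm_def ip_nonneg)

lemma Cauchy_Schwarz:
  assumes "x \<in> S" "y \<in> S"
  shows "\<bar>ip x y\<bar> \<le> nrm x * nrm y"
proof -
  have q: "0 \<le> ip x x + 2 * t * ip x y + t\<^sup>2 * ip y y" for t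
    using ip_nonneg[of "x + t *\<^sub>R y"] assms
    by (simp add: ip_simps ip_commute[of y x] algebra_simps power2_eq_square)
  have "(ip x y)\<^sup>2 \<le> ip x x * ip y y"
  proof (cases "ip y y = 0")
    case True
    have "ip x y = 0"
    proof (rule ccontr)
      \<comment> \<open>For \<open>ip y y = 0\<close> the quadratic in t is affine; the chosen t
        gives it the value -1.\<close>
      assume "ip x y \<noteq> 0"
      then show False
        using q[of "- (ip x x + 1) / (2 * ip x y)"] True by (simp add: field_simps)
    qed
    then show ?thesis using assms ip_nonneg by simp
  next
    case False
    then have pos: "ip y y > 0" using ip_nonneg[OF assms(2)] by simp
    have "0 \<le> ip x x - (ip x y)\<^sup>2 / ip y y"
      using q[of "- ip x y / ip y y"] pos
      by (simp add: field_simps power2_eq_square)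
    then show ?thesis using pos by (simp add: field_simps)
  qed
  also have "\<dots> = (nrm x * nrm y)\<^sup>2"
    using assms by (simp add: power_mult_distrib nrm_sq)
  finally show ?thesis
    using assms by (intro abs_le_square_iff[THEN iffD2, of "ip x y" "nrm x * nrm y", simplified abs_mult, THEN order_trans]) auto
qed

lemma nrm_triangle:
  assumes "x \<in> S" "y \<in> S"
  shows "nrm (x + y) \<le> nrm x + nrm y"
proof (rule power2_le_imp_le)
  show "(nrm (x + y))\<^sup>2 \<le> (nrm x + nrm y)\<^sup>2"
    using Cauchy_Schwarz[OF assms] assms
    by (simp add: nrm_sq ip_simps ip_commute[of y x] power2_sum)
qed (use assms in simp)

lemma nrm_scale: "x \<in> S \<Longrightarrow> nrm (r *\<^sub>R x) = \<bar>r\<bar> * nrm x"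
  by (simp add: nrm_def ip_simps real_sqrt_mult[symmetric] power2_eq_square[symmetric] mult.assoc[symmetric] real_sqrt_mult)

lemma nrm_minus: "x \<in> S \<Longrightarrow> nrm (- x) = nrm x"
  using nrm_scale[of x "-1"] by simp

lemma nrm_commute: "\<lbrakk>x \<in> S; y \<in> S\<rbrakk> \<Longrightarrow> nrm (x - y) = nrm (y - x)"
  using nrm_minus[of "x - y"] by simp

lemma nrm_triangle_diff: "\<lbrakk>x \<in> S; y \<in> S; z \<in> S\<rbrakk> \<Longrightarrow> nrm (x - z) \<le> nrm (x - y) + nrm (y - z)"
  using nrm_triangle[of "x - y" "y - z"] by simp

lemma nrm_triangle_le: "\<lbrakk>x \<in> S; y \<in> S\<rbrakk> \<Longrightarrow> nrm x \<le> nrm y + nrm (x - y)"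
  using nrm_triangle[of "y" "x - y"] by simp

lemma nrm_diff_le: "\<lbrakk>x \<in> S; y \<in> S\<rbrakk> \<Longrightarrow> nrm (x - y) \<le> nrm x + nrm y"
  using nrm_triangle[of x "-y"] by (simp add: nrm_minus)

lemma nrm_zero_cong: "\<lbrakk>x \<in> S; y \<in> S; nrm (x - y) = 0\<rbrakk> \<Longrightarrow> nrm x = nrm y"
  using nrm_triangle_le[of x y] nrm_triangle_le[of y x] nrm_commute[of x y] by simp

lemma nrm_zero [simp]: "nrm 0 = 0"
  using nrm_scale[of 0 0] by simp

lemma ip_null: "\<lbrakk>x \<in> S; y \<in> S; nrm x = 0\<rbrakk> \<Longrightarrow> ip x y = 0"
  using Cauchy_Schwarz[of x y] by simp

text \<open>Take \<open>z = x\<close> and cancel one factor. This turns bounds on forms into bounds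
  on norms.\<close>

lemma nrm_le_dual:
  assumes "x \<in> S" "0 \<le> K" "\<And>z. z \<in> S \<Longrightarrow> ip z x \<le> K * nrm z"
  shows "nrm x \<le> K"
proof (cases "nrm x = 0")
  case False
  then have "nrm x > 0" using nrm_nonneg[OF assms(1)] by linarith
  moreover have "nrm x * nrm x \<le> K * nrm x"
    using assms(3)[OF assms(1)] nrm_sq[OF assms(1)] by (simp add: power2_eq_square)
  ultimately show ?thesis by simp
qed (use assms in simp)

text \<open>Approximate eigenvectors in the sense of Weyl. The condition \<open>0 < nrm v\<close>
  stands for a non-zero vector; \<open>v \<noteq> 0\<close> would admit null vectors.\<close>

definition approx_eigenvalue :: "('v \<Rightarrow> 'v) \<Rightarrow> real \<Rightarrow> bool" where
  "approx_eigenvalue R s \<longleftrightarrow> (\<forall>e>0. \<exists>v\<in>S. 0 < nrm v \<and> nrm (R v - s *\<^sub>R v) \<le> e * nrm v)"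

lemma not_approx_eigenvalueD:
  assumes "\<not> approx_eigenvalue R s" "R ` S \<subseteq> S"
  obtains c where "c > 0" "\<And>v. v \<in> S \<Longrightarrow> c * nrm v \<le> nrm (R v - s *\<^sub>R v)"
proof -
  obtain e where e: "e > 0" "\<forall>v\<in>S. 0 < nrm v \<longrightarrow> e * nrm v < nrm (R v - s *\<^sub>R v)"
    using assms by (auto simp: approx_eigenvalue_def not_le)
  show ?thesis
  proof (rule that[OF e(1)])
    fix v assume v: "v \<in> S"
    then show "e * nrm v \<le> nrm (R v - s *\<^sub>R v)"
      using e(2)[rule_format, OF v] assms(2) nrm_nonneg[OF v]
      by (cases "nrm v = 0") (auto simp: image_subset_iff less_le)
  qed
qed

text \<open>
  Additivity of \<open>B\<close> need not be assumed: symmetry makes \<open>B\<close> linear up to vectors of norm zero.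
\<close>

definition symmetric_bounded :: "('v \<Rightarrow> 'v) \<Rightarrow> real \<Rightarrow> bool" where
  "symmetric_bounded B M \<longleftrightarrow> B ` S \<subseteq> S \<and> (\<forall>x\<in>S. \<forall>y\<in>S. ip (B x) y = ip x (B y)) \<and>
     (\<forall>x\<in>S. nrm (B x) \<le> M * nrm x)"

lemma symmetric_boundedD:
  assumes "symmetric_bounded B M" "x \<in> S"
  shows "B x \<in> S" "y \<in> S \<Longrightarrow> ip (B x) y = ip x (B y)" "nrm (B x) \<le> M * nrm x"
  using assms by (auto simp: symmetric_bounded_def)

text \<open>Symmetry moves \<open>B\<close> to the test vector, so the defect is orthogonal to all
  of \<open>S\<close> and in particular to itself.\<close>

lemma symmetric_bounded_linear:
  assumes B: "symmetric_bounded B M" and xy: "x \<in> S" "y \<in> S"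
  shows "nrm (B (x + r *\<^sub>R y) - (B x + r *\<^sub>R B y)) = 0"
proof -
  note [simp] = symmetric_boundedD(1)[OF B]
  let ?d = "B (x + r *\<^sub>R y) - (B x + r *\<^sub>R B y)"
  have "ip ?d z = 0" if "z \<in> S" for z
    using that xy by (simp add: ip_simps symmetric_boundedD(2)[OF B])
  then show ?thesis using xy by (simp add: nrm_def)
qed

lemma symmetric_bounded_shift:
  assumes B: "symmetric_bounded B M"
  shows "symmetric_bounded (\<lambda>x. B x - s *\<^sub>R x) (M + \<bar>s\<bar>)"
  unfolding symmetric_bounded_def
proof (intro conjI ballI)
  note [simp] = symmetric_boundedD(1)[OF B]
  show "(\<lambda>x. B x - s *\<^sub>R x) ` S \<subseteq> S" by auto
  show "ip (B x - s *\<^sub>R x) y = ip x (B y - s *\<^sub>R y)" if "x \<in> S" "y \<in> S" for x y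
    using that by (simp add: ip_simps symmetric_boundedD(2)[OF B])
  show "nrm (B x - s *\<^sub>R x) \<le> (M + \<bar>s\<bar>) * nrm x" if "x \<in> S" for x
    using nrm_diff_le[of "B x" "s *\<^sub>R x"] symmetric_boundedD(3)[OF B that] that
    by (simp add: nrm_scale algebra_simps)
qed

text \<open>
  With \<open>B = R - \<kappa>\<close> and \<open>r0 = inf \<parallel>B u\<parallel> / \<parallel>u\<parallel>\<close>, the form \<open>\<parallel>B u\<parallel>\<^sup>2 - r0\<^sup>2 \<parallel>u\<parallel>\<^sup>2\<close> is non-negative
  with infimum \<open>0\<close> on the unit sphere; by Cauchy--Schwarz for this form,
  \<open>B\<^sup>2 - r0\<^sup>2 = (B - r0) (B + r0)\<close> is not bounded below, so one of the factors is not.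
\<close>

lemma approx_eigenvalue_near:
  assumes R: "symmetric_bounded R M" and u0: "u0 \<in> S" "0 < nrm u0"
    and r: "nrm (R u0 - k *\<^sub>R u0) \<le> r * nrm u0"
  shows "\<exists>s. \<bar>s - k\<bar> \<le> r \<and> approx_eigenvalue R s"
proof -
  define B where "B = (\<lambda>x. R x - k *\<^sub>R x)"
  define N where "N = \<bar>M\<bar> + \<bar>k\<bar> + 1"
  note [simp] = symmetric_boundedD(1)[OF R]
  have B1: "symmetric_bounded B (M + \<bar>k\<bar>)"
    unfolding B_def by (rule symmetric_bounded_shift[OF R])
  have B: "symmetric_bounded B N"
    unfolding symmetric_bounded_def
  proof (intro conjI ballI)
    fix x assume x: "x \<in> S"
    have "(M + \<bar>k\<bar>) * nrm x \<le> N * nrm x"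
      using x unfolding N_def by (intro mult_right_mono) auto
    then show "nrm (B x) \<le> N * nrm x" using symmetric_boundedD(3)[OF B1 x] by linarith
  qed (use B1 in \<open>auto simp: symmetric_bounded_def\<close>)
  note [simp] = symmetric_boundedD(1)[OF B]
  note Bsym = symmetric_boundedD(2)[OF B]
  have N: "N > 0" by (simp add: N_def)
  define W where "W = (\<lambda>u. nrm (B u) / nrm u) ` {u \<in> S. 0 < nrm u}"
  define r0 where "r0 = Inf W"
  have bdd: "bdd_below W" by (rule bdd_belowI[of _ 0]) (auto simp: W_def)
  have "W \<noteq> {}" using u0 by (auto simp: W_def)
  have r0_nonneg: "0 \<le> r0" unfolding r0_def
    by (rule cInf_greatest) (use \<open>W \<noteq> {}\<close> in \<open>auto simp: W_def\<close>)
  have "nrm (B u0) / nrm u0 \<in> W" using u0 by (auto simp: W_def)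
  then have "r0 \<le> nrm (B u0) / nrm u0" unfolding r0_def using bdd by (rule cInf_lower)
  also have "\<dots> \<le> r" using r u0 by (simp add: B_def field_simps)
  finally have r0_le: "r0 \<le> r" .
  have low: "r0 * nrm u \<le> nrm (B u)" if "u \<in> S" for u
  proof (cases "nrm u = 0")
    case False
    then have pos: "0 < nrm u" using nrm_nonneg[OF that] by linarith
    then have "r0 \<le> nrm (B u) / nrm u"
      unfolding r0_def using bdd that by (intro cInf_lower) (auto simp: W_def)
    then show ?thesis using pos by (simp add: field_simps)
  qed (use that in simp)
  have approx: "\<exists>u\<in>S. 0 < nrm u \<and> nrm (B u) < (r0 + e) * nrm u" if "e > 0" for e
  proof -
    have "Inf W < r0 + e" using that by (simp add: r0_def)
    then obtain w where "w \<in> W" "w < r0 + e"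
      using cInf_lessD[OF \<open>W \<noteq> {}\<close>] by blast
    then show ?thesis by (auto simp: W_def field_simps)
  qed
  define q where "q = (\<lambda>x y. ip (B x) (B y) - r0\<^sup>2 * ip x y)"
  interpret Q: semi_inner S q
  proof
    show "subspace S" by (rule subspace_S)
    show "q x y = q y x" if "x \<in> S" "y \<in> S" for x y
      using that by (simp add: q_def ip_commute[of "B x"] ip_commute[of x])
    show "q (x + y) z = q x z + q y z" if "x \<in> S" "y \<in> S" "z \<in> S" for x y z
      using that by (simp add: q_def Bsym ip_simps algebra_simps)
    show "q (t *\<^sub>R x) y = t * q x y" if "x \<in> S" "y \<in> S" for x y t
      using that by (simp add: q_def Bsym ip_simps algebra_simps)
    show "0 \<le> q x x" if "x \<in> S" for x
    proof -
      have "(r0 * nrm x)\<^sup>2 \<le> (nrm (B x))\<^sup>2"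
        using low[OF that] r0_nonneg that by (intro power_mono) auto
      then show ?thesis using that by (simp add: q_def power_mult_distrib nrm_sq)
    qed
  qed
  define C where "C = (\<lambda>u. B (B u) - r0\<^sup>2 *\<^sub>R u)"
  have C_mem [simp]: "C u \<in> S" if "u \<in> S" for u using that by (simp add: C_def)
  \<comment> \<open>Since \<open>q u v\<close> is \<open>ip (C u) v\<close>, Cauchy-Schwarz for
    \<open>q\<close> with second argument \<open>C u\<close> bounds the square of
    \<open>nrm (C u)\<close>. One factor cancels because \<open>Q.nrm\<close> is at most
    \<open>N\<close> times \<open>nrm\<close>.\<close>
  have C_small: "nrm (C u) \<le> N * Q.nrm u" if u: "u \<in> S" for u
  proof (cases "nrm (C u) = 0")
    case True
    then show ?thesis using N u by simp
  next
    case False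
    then have pos: "0 < nrm (C u)" using nrm_nonneg[OF C_mem[OF u]] by linarith
    have "nrm (C u) * nrm (C u) = q u (C u)"
    proof -
      have "ip (C u) (C u) = ip (B (B u)) (C u) - r0\<^sup>2 * ip u (C u)"
        using u by (subst (1) C_def) (simp add: ip_simps)
      then show ?thesis
        using u nrm_sq[of "C u"] by (simp add: q_def Bsym power2_eq_square)
    qed
    also have "\<dots> \<le> Q.nrm u * Q.nrm (C u)"
      using Q.Cauchy_Schwarz[of u "C u"] u by simp
    also have "Q.nrm (C u) \<le> N * nrm (C u)"
    proof (rule power2_le_imp_le)
      have "(Q.nrm (C u))\<^sup>2 \<le> (nrm (B (C u)))\<^sup>2"
        using u ip_nonneg[of "C u"]
        unfolding Q.nrm_sq[OF C_mem[OF u]] by (simp add: nrm_sq q_def)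
      also have "\<dots> \<le> (N * nrm (C u))\<^sup>2"
        using symmetric_boundedD(3)[OF B, of "C u"] u by (intro power_mono) auto
      finally show "(Q.nrm (C u))\<^sup>2 \<le> (N * nrm (C u))\<^sup>2" .
    qed (use u N in simp)
    finally have "nrm (C u) * nrm (C u) \<le> (Q.nrm u * N) * nrm (C u)"
      using u by (simp add: mult_left_mono mult.assoc)
    then show ?thesis using pos by (simp add: mult.commute)
  qed
  have C_apx: "\<exists>u\<in>S. 0 < nrm u \<and> nrm (C u) < d * nrm u" if d: "d > 0" for d
  proof -
    \<comment> \<open>By e <= 1, the difference (r0 + e)^2 - r0^2 is at most e (2 r0 + 1). Keeping
      this below \<open>t\<close> keeps \<open>N * Q.nrm u\<close> below
      \<open>d * nrm u\<close>.\<close>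
    define t where "t = (d / N)\<^sup>2"
    have t: "t > 0" using d N by (simp add: t_def)
    define e where "e = min 1 (t / (2 * (2 * r0 + 1)))"
    have e: "e > 0" "e \<le> 1" using t r0_nonneg by (auto simp: e_def)
    have "e * (2 * r0 + 1) \<le> t / (2 * (2 * r0 + 1)) * (2 * r0 + 1)"
      using r0_nonneg by (intro mult_right_mono) (auto simp: e_def)
    also have "\<dots> < t" using r0_nonneg t by (simp add: field_simps add_pos_nonneg)
    finally have et: "e * (2 * r0 + 1) < t" .
    obtain u where u: "u \<in> S" "0 < nrm u" "nrm (B u) < (r0 + e) * nrm u"
      using approx[OF e(1)] by blast
    have "(nrm (B u))\<^sup>2 \<le> ((r0 + e) * nrm u)\<^sup>2" using u by (intro power_mono) auto
    then have "(Q.nrm u)\<^sup>2 \<le> ((r0 + e)\<^sup>2 - r0\<^sup>2) * (nrm u)\<^sup>2"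
      using u unfolding Q.nrm_sq[OF u(1)]
      by (simp add: q_def nrm_sq[symmetric] power_mult_distrib left_diff_distrib)
    also have "(r0 + e)\<^sup>2 - r0\<^sup>2 \<le> e * (2 * r0 + 1)"
      using e mult_left_mono[of e 1 e] by (simp add: power2_eq_square algebra_simps)
    also have "\<dots> < t" by (rule et)
    finally have "(Q.nrm u)\<^sup>2 < t * (nrm u)\<^sup>2" using u(2) by simp
    also have "\<dots> = (d / N * nrm u)\<^sup>2" by (simp only: t_def power_mult_distrib)
    finally have "Q.nrm u < d / N * nrm u"
      by (rule power2_less_imp_less) (use d N u in simp)
    then have "N * Q.nrm u < d * nrm u" using N by (simp add: field_simps)
    then show ?thesis using C_small[OF u(1)] u by force
  qed
  have "approx_eigenvalue R (k + r0) \<or> approx_eigenvalue R (k - r0)"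
  proof (rule ccontr)
    assume neg: "\<not> ?thesis"
    have RS: "R ` S \<subseteq> S" by auto
    obtain c1 where c1: "c1 > 0" "\<And>v. v \<in> S \<Longrightarrow> c1 * nrm v \<le> nrm (R v - (k + r0) *\<^sub>R v)"
      using neg not_approx_eigenvalueD[OF _ RS, of "k + r0"] by blast
    obtain c2 where c2: "c2 > 0" "\<And>v. v \<in> S \<Longrightarrow> c2 * nrm v \<le> nrm (R v - (k - r0) *\<^sub>R v)"
      using neg not_approx_eigenvalueD[OF _ RS, of "k - r0"] by blast
    obtain u where u: "u \<in> S" "0 < nrm u" "nrm (C u) < (c1 * c2) * nrm u"
      using C_apx[of "c1 * c2"] c1 c2 by auto
    define y where "y = B u + r0 *\<^sub>R u"
    have y: "y \<in> S" using u by (simp add: y_def)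
    \<comment> \<open>The factorisation of B^2 - r0^2 into B - r0 and B + r0 holds only up to a null
      vector, because \<open>B\<close> is linear only up to null vectors.\<close>
    have "nrm (B y - r0 *\<^sub>R y) = nrm (C u)"
    proof (rule nrm_zero_cong)
      have eq: "B y - r0 *\<^sub>R y - C u = B y - (B (B u) + r0 *\<^sub>R B u)"
        by (simp add: y_def C_def algebra_simps power2_eq_square)
      show "nrm (B y - r0 *\<^sub>R y - C u) = 0"
        unfolding eq using symmetric_bounded_linear[OF B, of "B u" u r0] u by (simp add: y_def)
    qed (use u y in auto)
    moreover have "c1 * nrm y \<le> nrm (B y - r0 *\<^sub>R y)"
      using c1(2)[OF y] by (simp add: B_def algebra_simps)
    moreover have "c2 * nrm u \<le> nrm y"
      using c2(2)[OF u(1)] by (simp add: B_def y_def algebra_simps)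
    ultimately have "c1 * (c2 * nrm u) \<le> nrm (C u)"
      using c1(1) by (smt (verit, best) mult_left_mono)
    then show False using u by (simp add: mult.assoc)
  qed
  then show ?thesis
    using r0_le r0_nonneg by (elim disjE) (auto intro: exI[of _ "k + r0"] exI[of _ "k - r0"])
qed

end

text \<open>Completeness is asked for sequences with summable steps only. This is the form in which
  the theorem of Riesz and Fischer is proved, and the iterations below have geometrically decreasing
  steps.\<close>

locale semi_hilbert = semi_inner +
  assumes complete: "\<lbrakk>\<And>n. s n \<in> S; summable (\<lambda>n. nrm (s (Suc n) - s n))\<rbrakk>
     \<Longrightarrow> \<exists>x\<in>S. (\<lambda>n::nat. nrm (s n - x)) \<longlonglongrightarrow> 0"
begin

text \<open>
  Gradient descent for \<open>\<parallel>B u - g\<parallel>\<^sup>2\<close> with step \<open>1 / M\<^sup>2\<close>: the residual contracts by the factor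
  \<open>(1 - c\<^sup>2 / M\<^sup>2)\<^sup>1\<^sup>/\<^sup>2\<close> in each step.
\<close>

lemma bounded_below_surjective:
  assumes B: "symmetric_bounded B M" and c: "c > 0" "\<And>v. v \<in> S \<Longrightarrow> c * nrm v \<le> nrm (B v)"
    and g: "g \<in> S"
  shows "\<exists>u\<in>S. nrm (B u - g) = 0"
proof (cases "\<forall>v\<in>S. nrm v = 0")
  \<comment> \<open>If all vectors are null, any vector is a solution. Otherwise a vector of
    positive norm yields 0 < c <= M, which the step size needs.\<close>
  case True
  note [simp] = symmetric_boundedD(1)[OF B]
  show ?thesis using True g by (intro bexI[of _ 0]) auto
next
  case False
  note [simp] = symmetric_boundedD(1)[OF B]
  note Bsym = symmetric_boundedD(2)[OF B]
  obtain v where v: "v \<in> S" "nrm v > 0" using False nrm_nonneg by (metis less_eq_real_def)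
  have "c * nrm v \<le> M * nrm v" using c(2)[OF v(1)] symmetric_boundedD(3)[OF B v(1)] by linarith
  then have cM: "c \<le> M" using v by simp
  then have M: "M > 0" using c by linarith
  define q where "q = sqrt (1 - (c / M)\<^sup>2)"
  have "(c / M)\<^sup>2 \<le> 1" using cM c M by (simp add: power_le_one_iff abs_square_le_1)
  then have q2: "q\<^sup>2 = 1 - (c / M)\<^sup>2" and q0: "0 \<le> q" by (auto simp: q_def)
  have "q\<^sup>2 < 1" using q2 c M by simp
  then have q1: "q < 1" using power2_less_imp_less[of q 1] by simp
  define u where "u = rec_nat 0 (\<lambda>_ x. x - (1 / M\<^sup>2) *\<^sub>R B (B x - g))"
  have u0: "u 0 = 0" and uS: "u (Suc n) = u n - (1 / M\<^sup>2) *\<^sub>R B (B (u n) - g)" for n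
    by (auto simp: u_def)
  have um [simp]: "u n \<in> S" for n
    by (induction n) (use g in \<open>auto simp: u0 uS\<close>)
  define e where "e = (\<lambda>n. B (u n) - g)"
  have em [simp]: "e n \<in> S" for n using g by (simp add: e_def)
  have step: "nrm (e (Suc n)) \<le> q * nrm (e n)" for n
  proof (rule power2_le_imp_le)
    let ?E = "e n + (- (1 / M\<^sup>2)) *\<^sub>R B (B (e n))"
    have "nrm (e (Suc n)) = nrm ?E"
    proof (rule nrm_zero_cong)
      have eq: "e (Suc n) - ?E = B (u n + (- (1 / M\<^sup>2)) *\<^sub>R B (e n)) - (B (u n) + (- (1 / M\<^sup>2)) *\<^sub>R B (B (e n)))"
        by (simp add: e_def uS algebra_simps)
      show "nrm (e (Suc n) - ?E) = 0"
        unfolding eq by (rule symmetric_bounded_linear[OF B]) auto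
    qed auto
    then have "(nrm (e (Suc n)))\<^sup>2 = ip ?E ?E" by (simp add: nrm_sq)
    also have "\<dots> = ip (e n) (e n) - 2 / M\<^sup>2 * ip (e n) (B (B (e n))) + ip (B (B (e n))) (B (B (e n))) / M^4"
      by (simp add: ip_simps ip_commute[of "B (B (e n))" "e n"] power2_eq_square power4_eq_xxxx
          diff_divide_distrib)
    also have "ip (e n) (B (B (e n))) = (nrm (B (e n)))\<^sup>2"
      using Bsym[of "e n" "B (e n)"] by (simp add: nrm_sq)
    also have "ip (e n) (e n) - 2 / M\<^sup>2 * (nrm (B (e n)))\<^sup>2 + ip (B (B (e n))) (B (B (e n))) / M^4
        = (nrm (e n))\<^sup>2 - 2 / M\<^sup>2 * (nrm (B (e n)))\<^sup>2 + (nrm (B (B (e n))))\<^sup>2 / M^4"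
      by (simp add: nrm_sq)
    also have "(nrm (B (B (e n))))\<^sup>2 \<le> (M * nrm (B (e n)))\<^sup>2"
      using symmetric_boundedD(3)[OF B, of "B (e n)"] by (intro power_mono) auto
    also have "\<dots> / M^4 = (nrm (B (e n)))\<^sup>2 / M\<^sup>2"
      using M by (simp add: power_mult_distrib power2_eq_square power4_eq_xxxx)
    also have "(nrm (e n))\<^sup>2 - 2 / M\<^sup>2 * (nrm (B (e n)))\<^sup>2 + (nrm (B (e n)))\<^sup>2 / M\<^sup>2
        = (nrm (e n))\<^sup>2 - (nrm (B (e n)))\<^sup>2 / M\<^sup>2"
      by (simp add: field_simps)
    also have "\<dots> \<le> (nrm (e n))\<^sup>2 - (c * nrm (e n))\<^sup>2 / M\<^sup>2"
      using c(2)[of "e n"] c(1) M by (intro diff_left_mono divide_right_mono power_mono) auto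
    also have "\<dots> = (q * nrm (e n))\<^sup>2"
      by (simp add: power_mult_distrib q2 algebra_simps power_divide)
    finally show "(nrm (e (Suc n)))\<^sup>2 \<le> (q * nrm (e n))\<^sup>2"
      using M by (simp add: divide_right_mono)
  qed (use q0 in simp)
  have e_le: "nrm (e n) \<le> q ^ n * nrm (e 0)" for n
  proof (induction n)
    case (Suc n)
    show ?case using step[of n] mult_left_mono[OF Suc q0] by (simp add: mult.assoc)
  qed simp
  have "summable (\<lambda>n. nrm (u (Suc n) - u n))"
  proof (rule summable_comparison_test')
    show "summable (\<lambda>n. (1 / M * nrm (e 0)) * q ^ n)"
      using q0 q1 by (intro summable_mult summable_geometric) auto
    fix n :: nat
    have "u (Suc n) - u n = (- (1 / M\<^sup>2)) *\<^sub>R B (e n)" by (simp add: uS e_def)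
    then have "nrm (u (Suc n) - u n) = 1 / M\<^sup>2 * nrm (B (e n))" by (simp only: nrm_scale symmetric_boundedD(1)[OF B] em) simp
    also have "\<dots> \<le> 1 / M\<^sup>2 * (M * (q ^ n * nrm (e 0)))"
    proof (rule mult_left_mono)
      show "nrm (B (e n)) \<le> M * (q ^ n * nrm (e 0))"
        by (rule order_trans[OF symmetric_boundedD(3)[OF B em] mult_left_mono[OF e_le]]) (use M in simp)
    qed simp
    finally show "norm (nrm (u (Suc n) - u n)) \<le> (1 / M * nrm (e 0)) * q ^ n"
      using M by (simp add: power2_eq_square mult_ac)
  qed
  then obtain x where x: "x \<in> S" "(\<lambda>n. nrm (u n - x)) \<longlonglongrightarrow> 0"
    using complete[of u] by auto
  \<comment> \<open>The residual at \<open>x\<close> differs from the residual at \<open>u n\<close>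
    by at most M times the distance of \<open>x\<close> and \<open>u n\<close>; both bounds tend to
    0.\<close>
  have "nrm (B x - g) \<le> M * nrm (u n - x) + q ^ n * nrm (e 0)" for n
  proof -
    have "nrm (B x - B (u n)) = nrm (B (x - u n))"
    proof (rule nrm_zero_cong)
      have "nrm (B (x - u n) - (B x - B (u n))) = 0"
        using symmetric_bounded_linear[OF B, of x "u n" "-1"] x by simp
      then show "nrm (B x - B (u n) - B (x - u n)) = 0"
        using x by (subst nrm_commute) auto
    qed (use x in auto)
    also have "\<dots> \<le> M * nrm (u n - x)"
      using symmetric_boundedD(3)[OF B, of "x - u n"] x by (simp add: nrm_commute)
    finally show ?thesis
      using nrm_triangle_diff[of "B x" "B (u n)" g] e_le[of n] x g by (simp add: e_def)
  qed
  moreover have "(\<lambda>n. M * nrm (u n - x) + q ^ n * nrm (e 0)) \<longlonglongrightarrow> M * 0 + 0 * nrm (e 0)"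
    using q0 q1 x by (intro tendsto_intros LIMSEQ_realpow_zero) auto
  ultimately have "nrm (B x - g) \<le> 0" using LIMSEQ_le_const by force
  then have "nrm (B x - g) = 0" using x g by (intro antisym) auto
  then show ?thesis using x by blast
qed

end

text \<open>Applied to \<open>dft\<close> and to \<open>cell_embed\<close>. Preserved inner products
  make \<open>A\<close> linear up to null vectors, which is all that can be expected of a map
  defined by choice.\<close>

locale semi_isometry = dom: semi_hilbert S2 ip2 + cod: semi_inner S1 ip1
  for S2 :: "'w::real_vector set" and ip2 :: "'w \<Rightarrow> 'w \<Rightarrow> real"
    and S1 :: "'v::real_vector set" and ip1 :: "'v \<Rightarrow> 'v \<Rightarrow> real" +
  fixes A :: "'w \<Rightarrow> 'v"
  assumes A_mem: "x \<in> S2 \<Longrightarrow> A x \<in> S1"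
    and A_ip: "\<lbrakk>x \<in> S2; y \<in> S2\<rbrakk> \<Longrightarrow> ip1 (A x) (A y) = ip2 x y"
begin

lemma A_nrm: "x \<in> S2 \<Longrightarrow> cod.nrm (A x) = dom.nrm x"
  by (simp add: cod.nrm_def dom.nrm_def A_ip)

lemma A_linear:
  assumes xy: "x \<in> S2" "y \<in> S2"
  shows "cod.nrm (A (x + r *\<^sub>R y) - (A x + r *\<^sub>R A y)) = 0"
proof -
  have "ip1 (A (x + r *\<^sub>R y) - (A x + r *\<^sub>R A y)) (A (x + r *\<^sub>R y) - (A x + r *\<^sub>R A y)) = 0"
    using xy by (simp add: cod.ip_simps dom.ip_simps A_mem A_ip algebra_simps)
  then show ?thesis by (simp add: cod.nrm_def)
qed

lemma A_linear_ip:
  assumes "x \<in> S2" "y \<in> S2" "z \<in> S1"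
  shows "ip1 (A (x + r *\<^sub>R y)) z = ip1 (A x) z + r * ip1 (A y) z"
proof -
  have "ip1 (A (x + r *\<^sub>R y) - (A x + r *\<^sub>R A y)) z = 0"
    using assms A_linear by (intro cod.ip_null) (auto simp: A_mem)
  then show ?thesis using assms by (simp add: cod.ip_simps A_mem)
qed

text \<open>Riesz representation of \<open>\<lambda>x. ip1 (A x) w\<close> by the direct method:
  \<open>E\<close> is bounded below, the parallelogram identity makes a minimising sequence Cauchy,
  and the vanishing first variation at the minimiser is the asserted equation.\<close>

lemma adjoint_exists:
  assumes w: "w \<in> S1"
  shows "\<exists>y\<in>S2. \<forall>x\<in>S2. ip1 (A x) w = ip2 x y"
proof -
  define E where "E = (\<lambda>v. (dom.nrm v)\<^sup>2 - 2 * ip1 (A v) w)"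
  define d where "d = Inf (E ` S2)"
  have lin: "ip1 (A (x + r *\<^sub>R y)) w = ip1 (A x) w + r * ip1 (A y) w" if "x \<in> S2" "y \<in> S2" for x y r
    using A_linear_ip that w by blast
  have bdd: "bdd_below (E ` S2)"
  proof (rule bdd_belowI[of _ "- (cod.nrm w)\<^sup>2"])
    fix t assume "t \<in> E ` S2"
    then obtain v where v: "v \<in> S2" "t = E v" by auto
    have "ip1 (A v) w \<le> dom.nrm v * cod.nrm w"
      using cod.Cauchy_Schwarz[of "A v" w] v w by (simp add: A_mem A_nrm)
    moreover have "0 \<le> (dom.nrm v - cod.nrm w)\<^sup>2" by simp
    ultimately show "- (cod.nrm w)\<^sup>2 \<le> t" by (simp add: v E_def power2_diff)
  qed
  have ne: "E ` S2 \<noteq> {}" using dom.S_closed(1) by blast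
  have d_le: "d \<le> E v" if "v \<in> S2" for v
    unfolding d_def using bdd that by (intro cInf_lower) auto
  \<comment> \<open>An excess of (1/4)^n makes successive distances at most 2 (1/2)^n, hence
    summable.\<close>
  have "\<exists>v\<in>S2. E v < d + (1/4)^n" for n :: nat
    using cInf_lessD[OF ne, of "d + (1/4)^n"] by (auto simp: d_def)
  then obtain v where v [simp]: "\<And>n. v n \<in> S2" and vE: "\<And>n::nat. E (v n) < d + (1/4)^n" by metis
  have E_quad: "E (x + t *\<^sub>R z) = E x + 2 * t * (ip2 x z - ip1 (A z) w) + t\<^sup>2 * (dom.nrm z)\<^sup>2"
    if "x \<in> S2" "z \<in> S2" for x z t
  proof -
    have "(dom.nrm (x + t *\<^sub>R z))\<^sup>2 = (dom.nrm x)\<^sup>2 + 2 * t * ip2 x z + t * (t * (dom.nrm z)\<^sup>2)"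
      using that by (simp add: dom.nrm_sq dom.ip_simps dom.ip_commute[of z x] algebra_simps)
    then show ?thesis
      using that by (simp add: E_def lin power2_eq_square[of t] algebra_simps)
  qed
  \<comment> \<open>\<open>E\<close> is at least \<open>d\<close> at the midpoint;
    \<open>E_quad\<close> at t = 1/2 and at t = 1 eliminates the linear term.\<close>
  have par: "(dom.nrm (y - x))\<^sup>2 \<le> 2 * (E x - d) + 2 * (E y - d)" if xy: "x \<in> S2" "y \<in> S2" for x y
  proof -
    have e1: "E y = E (x + 1 *\<^sub>R (y - x))" by simp
    have "d \<le> E (x + (1/2) *\<^sub>R (y - x))" using xy by (intro d_le) auto
    then show ?thesis
      using xy e1 E_quad[of x "y - x" "1/2"] E_quad[of x "y - x" 1]
      by (simp add: power2_eq_square field_simps)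
  qed
  have "summable (\<lambda>n. dom.nrm (v (Suc n) - v n))"
  proof (rule summable_comparison_test')
    show "summable (\<lambda>n. 2 * (1/2::real) ^ n)" by (intro summable_mult summable_geometric) auto
    fix n :: nat
    have "(dom.nrm (v (Suc n) - v n))\<^sup>2 \<le> (2 * (1/2) ^ n)\<^sup>2"
    proof -
      have "d + (1/4::real)^Suc n \<le> d + (1/4)^n" by simp
      then have "E (v (Suc n)) < d + (1/4)^n" using vE[of "Suc n"] by (rule less_le_trans[rotated])
      moreover define p where "p = (1/4::real)^n"
      ultimately have "(dom.nrm (v (Suc n) - v n))\<^sup>2 \<le> 4 * p"
        using par[OF v v, of "Suc n" n] vE[of n] by (simp add: algebra_simps)
      also have "\<dots> = (2 * (1/2) ^ n)\<^sup>2"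
      proof -
        have "(1/2::real) ^ n * (1/2) ^ n = (1/2 * (1/2)) ^ n" by (rule power_mult_distrib[symmetric])
        then show ?thesis by (simp add: p_def power2_eq_square)
      qed
      finally show ?thesis .
    qed
    then show "norm (dom.nrm (v (Suc n) - v n)) \<le> 2 * (1/2) ^ n"
      using power2_le_imp_le[of "dom.nrm (v (Suc n) - v n)" "2 * (1/2) ^ n"] by simp
  qed
  then obtain y where y: "y \<in> S2" "(\<lambda>n. dom.nrm (v n - y)) \<longlonglongrightarrow> 0"
    using dom.complete[of v] by auto
  have Ev: "(\<lambda>n. E (v n)) \<longlonglongrightarrow> d"
  proof (rule tendsto_sandwich[of "\<lambda>_. d" _ _ "\<lambda>n. d + (1/4)^n"])
    have "(\<lambda>n. d + (1/4::real)^n) \<longlonglongrightarrow> d + 0"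
      by (intro tendsto_intros LIMSEQ_realpow_zero) auto
    then show "(\<lambda>n. d + (1/4)^n) \<longlonglongrightarrow> d" by simp
  qed (use vE d_le in \<open>auto intro!: always_eventually less_imp_le\<close>)
  have Ey: "E y \<le> d"
  proof -
    define K where "K = \<bar>E y - d\<bar>"
    have grad: "E (v n) \<ge> E y - 2 * (dom.nrm y + cod.nrm w) * dom.nrm (v n - y)" for n
    proof -
      have "E (v n) = E (y + 1 *\<^sub>R (v n - y))" by simp
      also have "\<dots> = E y + 2 * (ip2 y (v n - y) - ip1 (A (v n - y)) w) + (dom.nrm (v n - y))\<^sup>2"
        using E_quad[of y "v n - y" 1] y by simp
      finally have "E (v n) \<ge> E y + 2 * (ip2 y (v n - y) - ip1 (A (v n - y)) w)" by simp
      moreover have "\<bar>ip2 y (v n - y)\<bar> \<le> dom.nrm y * dom.nrm (v n - y)"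
        using y by (intro dom.Cauchy_Schwarz) auto
      moreover have "\<bar>ip1 (A (v n - y)) w\<bar> \<le> dom.nrm (v n - y) * cod.nrm w"
        using cod.Cauchy_Schwarz[of "A (v n - y)" w] y w by (simp add: A_mem A_nrm)
      ultimately show ?thesis by (simp add: algebra_simps)
    qed
    have "(\<lambda>n. E y - 2 * (dom.nrm y + cod.nrm w) * dom.nrm (v n - y))
        \<longlonglongrightarrow> E y - 2 * (dom.nrm y + cod.nrm w) * 0"
      by (intro tendsto_intros y)
    then have "E y - 2 * (dom.nrm y + cod.nrm w) * 0 \<le> d"
      by (rule LIMSEQ_le[OF _ Ev]) (use grad in auto)
    then show ?thesis by simp
  qed
  show ?thesis
  proof (intro bexI[of _ y] ballI)
    fix x assume x: "x \<in> S2"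
    define a where "a = ip2 y x - ip1 (A x) w"
    have "0 \<le> 2 * t * a + t\<^sup>2 * (dom.nrm x)\<^sup>2" for t
      using E_quad[OF y(1) x, of t] Ey d_le[of "y + t *\<^sub>R x"] x y by (simp add: a_def)
    note quad = this
    \<comment> \<open>The value t = -a / N minimises 2 t a + t^2 N and leads to -a^2 / N >= 0. The
      summand 1 keeps \<open>N\<close> positive when \<open>x\<close> is a null vector.\<close>
    define N where "N = (dom.nrm x)\<^sup>2 + 1"
    define t where "t = - a / N"
    have N: "N > 0" by (simp add: N_def add_nonneg_pos)
    have "t * N = - a" using N by (simp add: t_def)
    then have tt: "t\<^sup>2 * N = - (t * a)" unfolding power2_eq_square by (metis mult.assoc mult_minus_right)
    have "t\<^sup>2 * (dom.nrm x)\<^sup>2 \<le> t\<^sup>2 * N" unfolding N_def by (intro mult_left_mono) auto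
    then have "0 \<le> t * a" using quad[of t] tt by linarith
    then have "0 \<le> - (a\<^sup>2 / N)" by (simp add: t_def power2_eq_square)
    then have "a\<^sup>2 / N \<le> 0" by linarith
    then have "a\<^sup>2 \<le> 0" using N by (metis divide_pos_pos not_le)
    then have "a = 0" by simp
    then show "ip1 (A x) w = ip2 x y" using x y dom.ip_commute[of y x] by (simp add: a_def)
  qed (rule y)
qed

end

section \<open>Square-integrable functions\<close>

lemma borel_measurable_cnj [measurable (raw)]:
  "f \<in> borel_measurable M \<Longrightarrow> (\<lambda>x. cnj (f x) :: complex) \<in> borel_measurable M"
  by (rule borel_measurable_continuous_on[OF continuous_on_cnj[OF continuous_on_id]])

lemma L2I: "f \<in> borel_measurable M \<Longrightarrow> integrable M (\<lambda>x. (cmod (f x))\<^sup>2) \<Longrightarrow> f \<in> L2 M"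
  by (simp add: L2_def)

lemma L2_measurable [measurable_dest]: "f \<in> L2 M \<Longrightarrow> f \<in> borel_measurable M"
  by (simp add: L2_def)

lemma L2_integrable: "f \<in> L2 M \<Longrightarrow> integrable M (\<lambda>x. (cmod (f x))\<^sup>2)"
  by (simp add: L2_def)

lemma L2_iff_nn_integral:
  assumes [measurable]: "f \<in> borel_measurable M"
  shows "f \<in> L2 M \<longleftrightarrow> (\<integral>\<^sup>+x. ennreal ((cmod (f x))\<^sup>2) \<partial>M) < \<infinity>"
  by (simp add: L2_def integrable_iff_bounded)

lemma L2_nn_integral:
  assumes "f \<in> L2 M"
  shows "(\<integral>\<^sup>+x. ennreal ((cmod (f x))\<^sup>2) \<partial>M) = ennreal ((L2_norm M f)\<^sup>2)"
  using nn_integral_eq_integral[OF L2_integrable[OF assms]]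
  by (simp add: L2_norm_def)

lemma L2_norm_nonneg [simp]: "0 \<le> L2_norm M f"
  by (simp add: L2_norm_def)

lemma L2_nn_bound:
  assumes [measurable]: "f \<in> borel_measurable M" and "0 \<le> B"
    and "(\<integral>\<^sup>+x. ennreal ((cmod (f x))\<^sup>2) \<partial>M) \<le> ennreal (B\<^sup>2)"
  shows "f \<in> L2 M" "L2_norm M f \<le> B"
proof -
  show f: "f \<in> L2 M"
    using assms(3) by (simp add: L2_iff_nn_integral) (use le_less_trans in fastforce)
  then have "(L2_norm M f)\<^sup>2 \<le> B\<^sup>2" using assms L2_nn_integral[OF f] by simp
  then show "L2_norm M f \<le> B" using assms(2) by (rule power2_le_imp_le)
qed

lemma L2_dominated:
  assumes f: "f \<in> L2 M" and [measurable]: "g \<in> borel_measurable M" and B: "0 \<le> B"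
    and le: "AE x in M. cmod (g x) \<le> B * cmod (f x)"
  shows "g \<in> L2 M" "L2_norm M g \<le> B * L2_norm M f"
proof -
  have "(\<integral>\<^sup>+x. ennreal ((cmod (g x))\<^sup>2) \<partial>M) \<le> (\<integral>\<^sup>+x. ennreal (B\<^sup>2) * ennreal ((cmod (f x))\<^sup>2) \<partial>M)"
  proof (rule nn_integral_mono_AE)
    show "AE x in M. ennreal ((cmod (g x))\<^sup>2) \<le> ennreal (B\<^sup>2) * ennreal ((cmod (f x))\<^sup>2)"
      using le
    proof eventually_elim
      case (elim x)
      then have "(cmod (g x))\<^sup>2 \<le> (B * cmod (f x))\<^sup>2" by (intro power_mono) auto
      then show ?case by (simp add: power_mult_distrib flip: ennreal_mult)
    qed
  qed
  also have "\<dots> = ennreal (B\<^sup>2) * ennreal ((L2_norm M f)\<^sup>2)"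
    using f L2_nn_integral[OF f] by (subst nn_integral_cmult) auto
  also have "\<dots> = ennreal ((B * L2_norm M f)\<^sup>2)"
    by (simp add: power_mult_distrib flip: ennreal_mult)
  finally have *: "(\<integral>\<^sup>+x. ennreal ((cmod (g x))\<^sup>2) \<partial>M) \<le> ennreal ((B * L2_norm M f)\<^sup>2)" .
  show "g \<in> L2 M" "L2_norm M g \<le> B * L2_norm M f"
    using L2_nn_bound[OF _ _ *] B by auto
qed

lemma L2_bounded_mult:
  assumes "f \<in> L2 M" "g \<in> borel_measurable M" "0 \<le> B" "\<And>x. x \<in> space M \<Longrightarrow> cmod (g x) \<le> B"
  shows "(\<lambda>x. g x * f x) \<in> L2 M" "L2_norm M (\<lambda>x. g x * f x) \<le> B * L2_norm M f"
  by (rule L2_dominated[OF assms(1) _ assms(3)];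
      use assms in \<open>auto simp: norm_mult intro!: AE_I2 mult_right_mono\<close>)+

lemma L2_cmult: "f \<in> L2 M \<Longrightarrow> (\<lambda>x. c * f x) \<in> L2 M"
  using L2_bounded_mult(1)[of f M "\<lambda>_. c" "cmod c"] by simp

lemma L2_norm_cmult: "L2_norm M (\<lambda>x. c * f x) = cmod c * L2_norm M f"
  by (simp add: L2_norm_def norm_mult power_mult_distrib real_sqrt_mult)

lemma L2_cnj: "f \<in> L2 M \<Longrightarrow> (\<lambda>x. cnj (f x)) \<in> L2 M"
  using borel_measurable_cnj[of f M] by (simp add: L2_def)

lemma L2_norm_cnj: "L2_norm M (\<lambda>x. cnj (f x)) = L2_norm M f"
  by (simp add: L2_norm_def)

lemma L2_add: 
  assumes "f \<in> L2 M" "g \<in> L2 M"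
  shows "f + g \<in> L2 M"
proof (rule L2I)
  have [measurable]: "f \<in> borel_measurable M" "g \<in> borel_measurable M"
    using assms by (auto dest: L2_measurable)
  show m: "f + g \<in> borel_measurable M" by (simp add: plus_fun_def)
  show "integrable M (\<lambda>x. (cmod ((f + g) x))\<^sup>2)"
  proof (rule Bochner_Integration.integrable_bound)
    show "integrable M (\<lambda>x. 2 * (cmod (f x))\<^sup>2 + 2 * (cmod (g x))\<^sup>2)"
      using assms by (auto simp: L2_def)
    show "AE x in M. norm ((cmod ((f + g) x))\<^sup>2) \<le> norm (2 * (cmod (f x))\<^sup>2 + 2 * (cmod (g x))\<^sup>2)"
    proof (rule AE_I2)
      fix x
      have "(cmod (f x + g x))\<^sup>2 \<le> (cmod (f x) + cmod (g x))\<^sup>2"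
        by (intro power_mono norm_triangle_ineq) auto
      also have "\<dots> \<le> 2 * (cmod (f x))\<^sup>2 + 2 * (cmod (g x))\<^sup>2"
        using sum_squares_ge_zero[of "cmod (f x) - cmod (g x)" 0] by (simp add: power2_eq_square algebra_simps)
      finally show "norm ((cmod ((f + g) x))\<^sup>2) \<le> norm (2 * (cmod (f x))\<^sup>2 + 2 * (cmod (g x))\<^sup>2)" by simp
    qed
  qed (use m in simp)
qed

lemma L2_subspace: "subspace (L2 M)"
proof (rule subspaceI)
  show "0 \<in> L2 M" by (simp add: L2_def zero_fun_def)
  show "f + g \<in> L2 M" if "f \<in> L2 M" "g \<in> L2 M" for f g using that by (rule L2_add)
  show "c *\<^sub>R f \<in> L2 M" if "f \<in> L2 M" for c f
    using L2_cmult[OF that, of "of_real c"] by (simp add: scaleR_fun_def scaleR_conv_of_real)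
qed

lemma L2_prod_integrable:
  assumes "f \<in> L2 M" "g \<in> L2 M"
  shows "integrable M (\<lambda>x. cnj (f x) * g x)"
proof (rule Bochner_Integration.integrable_bound)
  have [measurable]: "f \<in> borel_measurable M" "g \<in> borel_measurable M"
    using assms by (auto dest: L2_measurable)
  show "integrable M (\<lambda>x. (cmod (f x))\<^sup>2 + (cmod (g x))\<^sup>2)"
    using assms by (auto simp: L2_def)
  show "AE x in M. norm (cnj (f x) * g x) \<le> norm ((cmod (f x))\<^sup>2 + (cmod (g x))\<^sup>2)"
  proof (rule AE_I2)
    fix x
    have "2 * (cmod (f x) * cmod (g x)) \<le> (cmod (f x))\<^sup>2 + (cmod (g x))\<^sup>2"
      using sum_squares_ge_zero[of "cmod (f x) - cmod (g x)" 0] by (simp add: power2_eq_square algebra_simps)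
    moreover have "0 \<le> cmod (f x) * cmod (g x)" by simp
    ultimately have "cmod (f x) * cmod (g x) \<le> (cmod (f x))\<^sup>2 + (cmod (g x))\<^sup>2" by linarith
    then show "norm (cnj (f x) * g x) \<le> norm ((cmod (f x))\<^sup>2 + (cmod (g x))\<^sup>2)"
      by (simp add: norm_mult)
  qed
  show "(\<lambda>x. cnj (f x) * g x) \<in> borel_measurable M" by measurable
qed

text \<open>The real part makes complex L2 a real semi-inner product space, so that the locales
  above apply. The imaginary part is recovered through multiplication by the imaginary unit, see
  \<open>L2_ip_imag\<close>.\<close>

definition L2_ip :: "'a measure \<Rightarrow> ('a \<Rightarrow> complex) \<Rightarrow> ('a \<Rightarrow> complex) \<Rightarrow> real" where
  "L2_ip M f g = Re (L2_inner M f g)"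

lemma L2_inner_self: "L2_inner M f f = complex_of_real ((L2_norm M f)\<^sup>2)"
proof -
  have "L2_inner M f f = (LINT x|M. complex_of_real ((cmod (f x))\<^sup>2))"
    unfolding L2_inner_def
    by (intro Bochner_Integration.integral_cong refl) (simp add: complex_norm_square[symmetric] mult.commute)
  also have "\<dots> = complex_of_real (LINT x|M. (cmod (f x))\<^sup>2)" by (rule integral_complex_of_real)
  finally show ?thesis by (simp add: L2_norm_def)
qed

lemma L2_inner_add_left:
  assumes "f \<in> L2 M" "g \<in> L2 M" "h \<in> L2 M"
  shows "L2_inner M (f + g) h = L2_inner M f h + L2_inner M g h"
  using L2_prod_integrable[OF assms(1,3)] L2_prod_integrable[OF assms(2,3)]
  by (simp add: L2_inner_def distrib_right)

lemma L2_inner_cmult_left: "L2_inner M (\<lambda>x. c * f x) h = cnj c * L2_inner M f h"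
  by (simp add: L2_inner_def mult.assoc)

lemma L2_inner_cmult_right: "L2_inner M f (\<lambda>x. c * h x) = c * L2_inner M f h"
  by (simp add: L2_inner_def mult.left_commute)

lemma L2_inner_commute: "L2_inner M g f = cnj (L2_inner M f g)"
proof -
  have "cnj (L2_inner M f g) = (LINT x|M. cnj (cnj (f x) * g x))"
    by (simp only: L2_inner_def Bochner_Integration.integral_cnj)
  then show ?thesis by (simp add: L2_inner_def mult.commute)
qed

lemma L2_ip_imag: "Im (L2_inner M f g) = L2_ip M (\<lambda>x. \<i> * f x) g"
  by (simp add: L2_ip_def L2_inner_cmult_left)

lemma semi_inner_L2: "semi_inner (L2 M) (L2_ip M)"
proof
  show "subspace (L2 M)" by (rule L2_subspace)
  show "L2_ip M x y = L2_ip M y x" for x y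
    by (simp add: L2_ip_def L2_inner_commute[of M x y])
  show "L2_ip M (x + y) z = L2_ip M x z + L2_ip M y z" if "x \<in> L2 M" "y \<in> L2 M" "z \<in> L2 M" for x y z
    using that by (simp add: L2_ip_def L2_inner_add_left)
  show "L2_ip M (r *\<^sub>R x) y = r * L2_ip M x y" for r x y
    using L2_inner_cmult_left[of M "of_real r" x y] by (simp add: L2_ip_def scaleR_fun_def scaleR_conv_of_real)
  show "0 \<le> L2_ip M x x" for x by (simp add: L2_ip_def L2_inner_self)
qed

lemma nrm_L2: "semi_inner.nrm (L2_ip M) = L2_norm M"
  by (rule ext) (simp add: semi_inner.nrm_def[OF semi_inner_L2] L2_ip_def L2_inner_self)

interpretation L2: semi_inner "L2 M" "L2_ip M"
  rewrites "semi_inner.nrm (L2_ip M) = L2_norm M"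
  for M :: "'a measure"
  by (rule semi_inner_L2) (rule nrm_L2)

lemma L2_norm_eq_0_iff:
  assumes "f \<in> L2 M"
  shows "L2_norm M f = 0 \<longleftrightarrow> (AE x in M. f x = 0)"
  using integral_nonneg_eq_0_iff_AE[OF L2_integrable[OF assms]] by (simp add: L2_norm_def)

lemma L2_norm_diff_eq_0_iff:
  assumes "f \<in> L2 M" "g \<in> L2 M"
  shows "L2_norm M (f - g) = 0 \<longleftrightarrow> (AE x in M. f x = g x)"
  using L2_norm_eq_0_iff[of "f - g" M] assms by simp

lemma L2_norm_cong_AE:
  assumes [measurable]: "f \<in> borel_measurable M" "g \<in> borel_measurable M" and "AE x in M. f x = g x"
  shows "L2_norm M f = L2_norm M g"
  unfolding L2_norm_def by (intro arg_cong[where f=sqrt] integral_cong_AE) (use assms(3) in auto)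

lemma L2_inner_cong_AE:
  assumes [measurable]: "f \<in> borel_measurable M" "g \<in> borel_measurable M"
     "f' \<in> borel_measurable M" "g' \<in> borel_measurable M"
    and "AE x in M. f x = f' x" "AE x in M. g x = g' x"
  shows "L2_inner M f g = L2_inner M f' g'"
  unfolding L2_inner_def by (intro integral_cong_AE) (use assms(5,6) in auto)

lemma L2_cong_AE:
  assumes "f \<in> L2 M" "g \<in> borel_measurable M" "AE x in M. f x = g x"
  shows "g \<in> L2 M"
  using assms by (intro L2_dominated(1)[OF assms(1), of g 1]) auto

text \<open>Riesz-Fischer. Monotone convergence for the partial sums of the absolute increments
  gives convergence almost everywhere, and Fatou's lemma bounds the distance to the limit by the
  tail \<open>t n\<close> of the sum of the norms.\<close>

lemma L2_complete:
  fixes s :: "nat \<Rightarrow> 'a \<Rightarrow> complex"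
  assumes s: "\<And>n. s n \<in> L2 M" and sum: "summable (\<lambda>n. L2_norm M (s (Suc n) - s n))"
  shows "\<exists>f\<in>L2 M. (\<lambda>n. L2_norm M (s n - f)) \<longlonglongrightarrow> 0"
proof -
  have [measurable]: "s n \<in> borel_measurable M" for n using s by (rule L2_measurable)
  define a where "a = (\<lambda>n. L2_norm M (s (Suc n) - s n))"
  define A where "A = suminf a"
  have a0: "a n \<ge> 0" for n by (simp add: a_def)
  have sa: "summable a" using sum by (simp add: a_def)
  define d where "d = (\<lambda>n x. s (Suc n) x - s n x)"
  have [measurable]: "d n \<in> borel_measurable M" for n by (simp add: d_def)
  have d_L2: "d n \<in> L2 M" for n
    using L2.S_closed(3)[OF s s, of "Suc n" n] by (simp add: d_def fun_diff_def)
  define g where "g = (\<lambda>N x. complex_of_real (\<Sum>n<N. cmod (d n x)))"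
  have g: "g N \<in> L2 M \<and> L2_norm M (g N) \<le> (\<Sum>n<N. a n)" for N
  proof (induction N)
    case 0
    show ?case by (simp add: g_def L2_def L2_norm_def)
  next
    case (Suc N)
    have c: "(\<lambda>x. complex_of_real (cmod (d N x))) \<in> L2 M"
      using d_L2[of N] by (simp add: L2_def)
    have eq: "g (Suc N) = g N + (\<lambda>x. complex_of_real (cmod (d N x)))"
      by (simp add: g_def fun_eq_iff)
    have "L2_norm M (\<lambda>x. complex_of_real (cmod (d N x))) = a N"
      by (simp add: a_def L2_norm_def d_def)
    then have "L2_norm M (g (Suc N)) \<le> L2_norm M (g N) + a N"
      unfolding eq using Suc c L2.nrm_triangle[of "g N" M "\<lambda>x. complex_of_real (cmod (d N x))"]
      by linarith
    moreover have "g (Suc N) \<in> L2 M" unfolding eq using Suc c by (intro L2_add) auto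
    ultimately show ?case using Suc by simp
  qed
  have [measurable]: "g N \<in> borel_measurable M" for N using g by (auto dest: L2_measurable)
  have gA: "(\<integral>\<^sup>+x. ennreal ((cmod (g N x))\<^sup>2) \<partial>M) \<le> ennreal (A\<^sup>2)" for N
  proof -
    have "L2_norm M (g N) \<le> A"
      using g[of N] sum_le_suminf[OF sa, of "{..<N}"] a0 by (auto simp: A_def)
    then show ?thesis using g[of N] by (simp add: L2_nn_integral ennreal_leI power_mono)
  qed
  have inc: "incseq (\<lambda>N x. ennreal ((cmod (g N x))\<^sup>2))"
  proof (intro incseq_SucI le_funI ennreal_leI power_mono)
    show "cmod (g N x) \<le> cmod (g (Suc N) x)" for N x
      unfolding g_def by (simp only: norm_of_real) (simp add: sum_nonneg)
  qed simp
  have "(\<integral>\<^sup>+x. (SUP N. ennreal ((cmod (g N x))\<^sup>2)) \<partial>M) = (SUP N. \<integral>\<^sup>+x. ennreal ((cmod (g N x))\<^sup>2) \<partial>M)"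
    using inc by (intro nn_integral_monotone_convergence_SUP) measurable
  also have "\<dots> \<le> ennreal (A\<^sup>2)" using gA by (intro SUP_least) auto
  finally have fin: "(\<integral>\<^sup>+x. (SUP N. ennreal ((cmod (g N x))\<^sup>2)) \<partial>M) \<noteq> \<infinity>"
    using le_less_trans[of _ "ennreal (A\<^sup>2)" \<infinity>] by (auto simp: less_top)
  have "AE x in M. (SUP N. ennreal ((cmod (g N x))\<^sup>2)) \<noteq> \<infinity>"
  proof (rule nn_integral_PInf_AE[OF _ fin])
    show "(\<lambda>x. SUP N. ennreal ((cmod (g N x))\<^sup>2)) \<in> borel_measurable M" by measurable
  qed
  then have conv: "AE x in M. convergent (\<lambda>n. s n x)"
  proof eventually_elim
    case (elim x)
    then obtain b where b: "(SUP N. ennreal ((cmod (g N x))\<^sup>2)) = ennreal b" "0 \<le> b"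
      by (cases "SUP N. ennreal ((cmod (g N x))\<^sup>2)") auto
    have "(\<Sum>n<N. cmod (d n x)) \<le> sqrt b" for N
    proof (rule real_le_rsqrt)
      have "ennreal ((cmod (g N x))\<^sup>2) \<le> ennreal b"
        unfolding b(1)[symmetric] by (rule SUP_upper) simp
      then show "(\<Sum>n<N. cmod (d n x))\<^sup>2 \<le> b" using b(2) by (simp add: g_def norm_of_real del: of_real_sum)
    qed
    then have "summable (\<lambda>n. cmod (d n x))"
      by (intro summableI_nonneg_bounded[of _ "sqrt b"]) auto
    then have "summable (\<lambda>n. d n x)" by (rule summable_norm_cancel)
    then have "convergent (\<lambda>N. \<Sum>n<N. d n x)" by (simp add: summable_iff_convergent)
    then have "convergent (\<lambda>N. s 0 x + (\<Sum>n<N. d n x))" by (intro convergent_add convergent_const)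
    moreover have "s 0 x + (\<Sum>n<N. d n x) = s N x" for N
    proof (induction N)
      case (Suc N)
      have "s 0 x + (\<Sum>n<Suc N. d n x) = (s 0 x + (\<Sum>n<N. d n x)) + d N x"
        by (simp add: add.assoc)
      then show ?case unfolding Suc by (simp add: d_def)
    qed simp
    ultimately show ?case by simp
  qed
  define f where "f = (\<lambda>x. lim (\<lambda>n. s n x))"
  have [measurable]: "f \<in> borel_measurable M" unfolding f_def by measurable
  define t where "t = (\<lambda>n. \<Sum>k. a (k + n))"
  have t0: "t n \<ge> 0" for n unfolding t_def using sa a0 by (intro suminf_nonneg summable_ignore_initial_segment) auto
  have tele: "L2_norm M (s (n + m) - s n) \<le> (\<Sum>k<m. a (k + n))" for n m
  proof (induction m)
    case (Suc m)
    have "L2_norm M (s (n + Suc m) - s n) \<le> a (m + n) + L2_norm M (s (n + m) - s n)"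
      using L2.nrm_triangle_diff[of "s (n + Suc m)" M "s (n + m)" "s n", OF s s s] by (simp add: a_def add.commute)
    then show ?case unfolding sum.lessThan_Suc using Suc.IH by linarith
  qed (simp add: L2_norm_def)
  \<comment> \<open>Fatou along m: \<open>s n - s (n + m)\<close> tends to \<open>s n - f\<close>
    almost everywhere, and its norm is at most \<open>t n\<close> for every m.\<close>
  have bound: "(\<integral>\<^sup>+x. ennreal ((cmod ((s n - f) x))\<^sup>2) \<partial>M) \<le> ennreal ((t n)\<^sup>2)" for n
  proof -
    have "(\<integral>\<^sup>+x. ennreal ((cmod ((s n - f) x))\<^sup>2) \<partial>M) \<le> (\<integral>\<^sup>+x. liminf (\<lambda>m. ennreal ((cmod (s n x - s (n + m) x))\<^sup>2)) \<partial>M)"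
    proof (rule nn_integral_mono_AE)
      show "AE x in M. ennreal ((cmod ((s n - f) x))\<^sup>2) \<le> liminf (\<lambda>m. ennreal ((cmod (s n x - s (n + m) x))\<^sup>2))"
        using conv
      proof eventually_elim
        case (elim x)
        then have "(\<lambda>m. s m x) \<longlonglongrightarrow> f x" by (simp add: f_def convergent_LIMSEQ_iff)
        then have "(\<lambda>m. s (n + m) x) \<longlonglongrightarrow> f x" by (subst add.commute) (rule LIMSEQ_ignore_initial_segment)
        then have "(\<lambda>m. ennreal ((cmod (s n x - s (n + m) x))\<^sup>2)) \<longlonglongrightarrow> ennreal ((cmod (s n x - f x))\<^sup>2)"
          by (intro tendsto_intros tendsto_ennrealI)
        then show ?case using lim_imp_Liminf[of sequentially] by fastforce
      qed
    qed
    also have "\<dots> \<le> liminf (\<lambda>m. \<integral>\<^sup>+x. ennreal ((cmod (s n x - s (n + m) x))\<^sup>2) \<partial>M)"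
      by (rule nn_integral_liminf) measurable
    also have "\<dots> \<le> liminf (\<lambda>m. ennreal ((t n)\<^sup>2))"
    proof (rule Liminf_mono, rule always_eventually, rule allI)
      fix m
      have "L2_norm M (s n - s (n + m)) \<le> (\<Sum>k<m. a (k + n))"
        using tele[of n m] L2.nrm_commute[OF s s] by metis
      also have "\<dots> \<le> t n"
        unfolding t_def using sa a0 by (intro sum_le_suminf summable_ignore_initial_segment) auto
      finally have "L2_norm M (s n - s (n + m)) \<le> t n" .
      then have "ennreal ((L2_norm M (s n - s (n + m)))\<^sup>2) \<le> ennreal ((t n)\<^sup>2)"
        by (intro ennreal_leI power_mono) auto
      moreover have "(\<integral>\<^sup>+x. ennreal ((cmod (s n x - s (n + m) x))\<^sup>2) \<partial>M) = ennreal ((L2_norm M (s n - s (n + m)))\<^sup>2)"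
        using L2_nn_integral[OF L2.S_closed(3)[OF s s, of n "n + m"]] by simp
      ultimately show "(\<integral>\<^sup>+x. ennreal ((cmod (s n x - s (n + m) x))\<^sup>2) \<partial>M) \<le> ennreal ((t n)\<^sup>2)" by simp
    qed
    also have "\<dots> = ennreal ((t n)\<^sup>2)" by (simp add: Liminf_const)
    finally show ?thesis .
  qed
  have m: "s n - f \<in> borel_measurable M" for n by (simp add: fun_diff_def)
  have sf: "s n - f \<in> L2 M" "L2_norm M (s n - f) \<le> t n" for n
    by (rule L2_nn_bound[OF m t0 bound])+
  have "f = s 0 - (s 0 - f)" by simp
  then have f: "f \<in> L2 M" using L2.S_closed(3)[OF s sf(1), of 0 0] by simp
  have "t \<longlonglongrightarrow> 0" unfolding t_def using suminf_exist_split2[OF sa] by simp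
  then have "(\<lambda>n. L2_norm M (s n - f)) \<longlonglongrightarrow> 0"
    by (rule tendsto_sandwich[of "\<lambda>_. 0", rotated 3]) (use sf in auto)
  then show ?thesis using f by blast
qed

lemma semi_hilbert_L2: "semi_hilbert (L2 M) (L2_ip M)"
proof -
  interpret semi_inner "L2 M" "L2_ip M" by (rule semi_inner_L2)
  show ?thesis
    by unfold_locales (unfold nrm_L2, rule L2_complete)
qed

interpretation L2: semi_hilbert "L2 M" "L2_ip M"
  rewrites "semi_inner.nrm (L2_ip M) = L2_norm M"
  for M :: "'a measure"
  by (rule semi_hilbert_L2) (rule nrm_L2)

lemma L2_Cauchy_Schwarz:
  assumes "f \<in> L2 M" "g \<in> L2 M"
  shows "cmod (L2_inner M f g) \<le> L2_norm M f * L2_norm M g"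
proof -
  define z where "z = L2_inner M f g"
  \<comment> \<open>A number of modulus 1 that rotates the inner product onto the positive axis,
    where it equals the real form. For z = 0 any such number will do.\<close>
  define c where "c = (if z = 0 then 1 else cnj z / cmod z)"
  have "cmod c = 1" by (simp add: c_def norm_divide)
  have "c * z = cmod z"
    by (simp add: c_def complex_norm_square[symmetric] power2_eq_square mult.commute[of "cnj z"])
  then have "cmod z = L2_ip M f (\<lambda>x. c * g x)"
    by (simp add: L2_ip_def L2_inner_cmult_right z_def)
  also have "\<dots> \<le> L2_norm M f * L2_norm M (\<lambda>x. c * g x)"
    using L2.Cauchy_Schwarz[OF assms(1) L2_cmult[OF assms(2), of c]] by simp
  also have "\<dots> = L2_norm M f * L2_norm M g"
    using \<open>cmod c = 1\<close> by (simp add: L2_norm_cmult)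
  finally show ?thesis by (simp add: z_def)
qed

section \<open>Convergence in L2 along filters\<close>

lemma L2_tendsto_alt:
  "L2_tendsto M F s g \<longleftrightarrow> g \<in> L2 M \<and> (\<forall>\<^sub>F i in F. s i \<in> L2 M) \<and>
     ((\<lambda>i. L2_norm M (s i - g)) \<longlongrightarrow> 0) F"
  by (simp add: L2_tendsto_def fun_diff_def)

lemma L2_tendsto_unique:
  assumes "F \<noteq> bot" "L2_tendsto M F s f" "L2_tendsto M F s g"
  shows "AE x in M. f x = g x"
proof -
  have f: "f \<in> L2 M" and g: "g \<in> L2 M" using assms by (auto simp: L2_tendsto_def)
  have "((\<lambda>i. L2_norm M (s i - f) + L2_norm M (s i - g)) \<longlongrightarrow> 0 + 0) F"
    using assms by (intro tendsto_add) (auto simp: L2_tendsto_alt)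
  moreover have "\<forall>\<^sub>F i in F. L2_norm M (f - g) \<le> L2_norm M (s i - f) + L2_norm M (s i - g)"
  proof -
    have "\<forall>\<^sub>F i in F. s i \<in> L2 M" using assms(2) by (simp add: L2_tendsto_def)
    then show ?thesis
    proof eventually_elim
      case (elim i)
      show ?case using L2.nrm_triangle_diff[OF f elim g] L2.nrm_commute[OF f elim] by simp
    qed
  qed
  ultimately have "L2_norm M (f - g) \<le> 0 + 0"
    using assms(1) by (rule tendsto_lowerbound)
  then show ?thesis using L2_norm_diff_eq_0_iff[OF f g] by (simp add: antisym)
qed

lemma L2_lim_tendsto:
  assumes "\<exists>g. L2_tendsto M F s g"
  shows "L2_tendsto M F s (L2_lim M F s)"
  unfolding L2_lim_def using assms by (rule someI_ex)

lemma L2_tendsto_norm: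
  assumes s: "L2_tendsto M F s f"
  shows "((\<lambda>i. L2_norm M (s i)) \<longlongrightarrow> L2_norm M f) F"
proof -
  have f: "f \<in> L2 M" and ev: "\<forall>\<^sub>F i in F. s i \<in> L2 M"
    and lim: "((\<lambda>i. L2_norm M (s i - f)) \<longlongrightarrow> 0) F"
    using s by (auto simp: L2_tendsto_alt)
  from ev have "\<forall>\<^sub>F i in F. norm (L2_norm M (s i) - L2_norm M f) \<le> norm (L2_norm M (s i - f))"
  proof eventually_elim
    case (elim i)
    show ?case
      using L2.nrm_triangle_le[OF elim f] L2.nrm_triangle_le[OF f elim] L2.nrm_commute[OF elim f] by simp
  qed
  then have "((\<lambda>i. L2_norm M (s i) - L2_norm M f) \<longlongrightarrow> 0) F"
    using lim by (rule Lim_transform_bound)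
  then show ?thesis by (rule LIM_zero_cancel)
qed

lemma L2_tendsto_add:
  assumes "L2_tendsto M F s f" "L2_tendsto M F t g"
  shows "L2_tendsto M F (\<lambda>i. s i + t i) (f + g)"
  unfolding L2_tendsto_alt
proof (intro conjI)
  have fg: "f \<in> L2 M" "g \<in> L2 M" and ev: "\<forall>\<^sub>F i in F. s i \<in> L2 M \<and> t i \<in> L2 M"
    using assms by (auto simp: L2_tendsto_def intro: eventually_conj)
  show "f + g \<in> L2 M" using fg by simp
  show "\<forall>\<^sub>F i in F. s i + t i \<in> L2 M" using ev by (auto elim: eventually_mono)
  have lim: "((\<lambda>i. L2_norm M (s i - f) + L2_norm M (t i - g)) \<longlongrightarrow> 0) F"
    using assms tendsto_add[of "\<lambda>i. L2_norm M (s i - f)" 0 F "\<lambda>i. L2_norm M (t i - g)" 0]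
    by (auto simp: L2_tendsto_alt)
  show "((\<lambda>i. L2_norm M (s i + t i - (f + g))) \<longlongrightarrow> 0) F"
  proof (rule tendsto_sandwich[OF _ _ tendsto_const lim])
    show "\<forall>\<^sub>F i in F. L2_norm M (s i + t i - (f + g)) \<le> L2_norm M (s i - f) + L2_norm M (t i - g)"
      using ev
    proof eventually_elim
      case (elim i)
      have eq: "s i + t i - (f + g) = (s i - f) + (t i - g)" by simp
      show ?case unfolding eq using elim fg by (intro L2.nrm_triangle) auto
    qed
  qed auto
qed

lemma L2_tendsto_cmult:
  assumes "L2_tendsto M F s f"
  shows "L2_tendsto M F (\<lambda>i x. c * s i x) (\<lambda>x. c * f x)"
proof -
  have "(\<lambda>x. c * s i x - c * f x) = (\<lambda>x. c * (s i x - f x))" for i by (simp add: algebra_simps)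
  then have "((\<lambda>i. L2_norm M (\<lambda>x. c * s i x - c * f x)) \<longlongrightarrow> cmod c * 0) F"
    using assms by (simp only: L2_norm_cmult) (intro tendsto_intros, auto simp: L2_tendsto_def)
  then show ?thesis
    using assms by (auto simp: L2_tendsto_def L2_cmult elim: eventually_mono)
qed

lemma L2_tendsto_inner:
  assumes s: "L2_tendsto M F s f" and g: "g \<in> L2 M"
  shows "((\<lambda>i. L2_inner M (s i) g) \<longlongrightarrow> L2_inner M f g) F"
proof -
  have f: "f \<in> L2 M" and ev: "\<forall>\<^sub>F i in F. s i \<in> L2 M"
    and lim: "((\<lambda>i. L2_norm M (s i - f)) \<longlongrightarrow> 0) F"
    using s by (auto simp: L2_tendsto_alt)
  from ev have "\<forall>\<^sub>F i in F. norm (L2_inner M (s i) g - L2_inner M f g) \<le> norm (L2_norm M (s i - f) * L2_norm M g)"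
  proof eventually_elim
    case (elim i)
    have "L2_inner M ((s i - f) + f) g = L2_inner M (s i - f) g + L2_inner M f g"
      using elim f g by (intro L2_inner_add_left) auto
    then show ?case using L2_Cauchy_Schwarz[of "s i - f" M g] elim f g by simp
  qed
  moreover have "((\<lambda>i. L2_norm M (s i - f) * L2_norm M g) \<longlongrightarrow> 0) F"
    using tendsto_mult_left_zero[OF lim] by simp
  ultimately have "((\<lambda>i. L2_inner M (s i) g - L2_inner M f g) \<longlongrightarrow> 0) F"
    by (rule Lim_transform_bound)
  then show ?thesis by (rule LIM_zero_cancel)
qed

lemma L2_tendsto_inner_right:
  assumes s: "L2_tendsto M F s f" and g: "g \<in> L2 M"
  shows "((\<lambda>i. L2_inner M g (s i)) \<longlongrightarrow> L2_inner M g f) F"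
  using tendsto_cnj[OF L2_tendsto_inner[OF assms]] by (simp flip: L2_inner_commute)

text \<open>Reduction to sequences: indices \<open>c n\<close> that satisfy the Cauchy conditions of
  all orders k <= n have summable steps, and the limit of that sequence is the limit along
  \<open>F\<close>. The filters in question are \<open>at_top\<close> on the reals and the finite
  subsets of the lattice.\<close>

lemma L2_Cauchy_tendsto:
  assumes F: "F \<noteq> bot" and ev: "\<forall>\<^sub>F i in F. s i \<in> L2 M"
    and Cauchy: "\<And>e. e > 0 \<Longrightarrow> \<exists>P. eventually P F \<and> (\<forall>i j. P i \<longrightarrow> P j \<longrightarrow> L2_norm M (s i - s j) < e)"
  shows "\<exists>g. L2_tendsto M F s g"
proof -
  have "\<exists>P. eventually P F \<and> (\<forall>i j. P i \<longrightarrow> P j \<longrightarrow> L2_norm M (s i - s j) < (1/2)^n)" for n :: nat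
    by (rule Cauchy) simp
  then obtain P where P: "\<And>n. eventually (P n) F"
      and PC: "\<And>n i j. P n i \<Longrightarrow> P n j \<Longrightarrow> L2_norm M (s i - s j) < (1/2)^n" for n :: nat
    by metis
  have "\<exists>i. s i \<in> L2 M \<and> (\<forall>k\<le>n. P k i)" for n :: nat
  proof -
    have "\<forall>\<^sub>F i in F. s i \<in> L2 M \<and> (\<forall>k\<in>{..n}. P k i)"
      using P ev by (intro eventually_conj eventually_ball_finite) auto
    then show ?thesis using eventually_happens'[OF F] by fastforce
  qed
  then obtain c where c: "\<And>n. s (c n) \<in> L2 M" "\<And>n k. k \<le> n \<Longrightarrow> P k (c n)" by metis
  have sm: "summable (\<lambda>n. L2_norm M (s (c (Suc n)) - s (c n)))"
  proof (rule summable_comparison_test')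
    show "summable (\<lambda>n. (1/2::real) ^ n)" by (intro summable_geometric) auto
    show "norm (L2_norm M (s (c (Suc n)) - s (c n))) \<le> (1/2) ^ n" for n
      using PC[of n "c (Suc n)" "c n"] c by simp
  qed
  obtain g where g: "g \<in> L2 M" "(\<lambda>n. L2_norm M (s (c n) - g)) \<longlonglongrightarrow> 0"
    using L2.complete[of "\<lambda>n. s (c n)", OF c(1) sm] by auto
  have "((\<lambda>i. L2_norm M (s i - g)) \<longlongrightarrow> 0) F"
    unfolding tendsto_iff
  proof (intro allI impI)
    fix e :: real assume e: "e > 0"
    have "\<forall>\<^sub>F n in sequentially. dist (L2_norm M (s (c n) - g)) 0 < e / 2"
      using g(2) e unfolding tendsto_iff by (auto dest: spec[of _ "e/2"])
    moreover have "(\<lambda>n. (1/2::real)^n) \<longlonglongrightarrow> 0" by (rule LIMSEQ_realpow_zero) auto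
    then have "\<forall>\<^sub>F n in sequentially. dist ((1/2::real)^n) 0 < e / 2"
      using e unfolding tendsto_iff by (auto dest: spec[of _ "e/2"])
    ultimately have "\<forall>\<^sub>F n in sequentially. L2_norm M (s (c n) - g) < e / 2 \<and> (1/2::real)^n < e / 2"
      by eventually_elim auto
    then obtain n where n: "L2_norm M (s (c n) - g) < e / 2" "(1/2::real)^n < e / 2"
      using eventually_happens by fastforce
    show "\<forall>\<^sub>F i in F. dist (L2_norm M (s i - g)) 0 < e"
      using P[of n] ev
    proof eventually_elim
      case (elim i)
      then show ?case
        using L2.nrm_triangle_diff[of "s i" M "s (c n)" g] PC[of n i "c n"] c g n by fastforce
    qed
  qed
  then show ?thesis using g ev by (auto simp: L2_tendsto_alt)
qed

text \<open>A family with the same mutual distances as a convergent one is Cauchy. This is how the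
  Fourier integral extends from cut-off functions to L2.\<close>

lemma L2_tendsto_isometric:
  assumes F: "F \<noteq> bot" and s: "L2_tendsto M F s f"
    and t: "\<And>i. s i \<in> L2 M \<Longrightarrow> t i \<in> L2 N"
    and iso: "\<And>i j. s i \<in> L2 M \<Longrightarrow> s j \<in> L2 M \<Longrightarrow> L2_norm N (t i - t j) = L2_norm M (s i - s j)"
  shows "\<exists>g. L2_tendsto N F t g"
proof (rule L2_Cauchy_tendsto[OF F])
  have f: "f \<in> L2 M" and ev: "\<forall>\<^sub>F i in F. s i \<in> L2 M" and lim: "((\<lambda>i. L2_norm M (s i - f)) \<longlongrightarrow> 0) F"
    using s by (auto simp: L2_tendsto_alt)
  show "\<forall>\<^sub>F i in F. t i \<in> L2 N" using ev by eventually_elim (rule t)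
  fix e :: real assume e: "e > 0"
  have "\<forall>\<^sub>F i in F. dist (L2_norm M (s i - f)) 0 < e / 2"
    using lim e unfolding tendsto_iff by (auto dest: spec[of _ "e/2"])
  then have "\<forall>\<^sub>F i in F. s i \<in> L2 M \<and> L2_norm M (s i - f) < e / 2"
    using ev by eventually_elim auto
  moreover have "L2_norm N (t i - t j) < e" if "s i \<in> L2 M \<and> L2_norm M (s i - f) < e / 2"
    "s j \<in> L2 M \<and> L2_norm M (s j - f) < e / 2" for i j
    using L2.nrm_triangle_diff[of "s i" M f "s j"] L2.nrm_commute[of "s j" M f] iso[of i j] that f by simp
  ultimately show "\<exists>P. eventually P F \<and> (\<forall>i j. P i \<longrightarrow> P j \<longrightarrow> L2_norm N (t i - t j) < e)"
    by (intro exI[of _ "\<lambda>i. s i \<in> L2 M \<and> L2_norm M (s i - f) < e / 2"]) auto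
qed

section \<open>The Fourier transform\<close>

lemma L2_dominated_convergence:
  fixes s :: "nat \<Rightarrow> 'a \<Rightarrow> complex"
  assumes [measurable]: "\<And>n. s n \<in> borel_measurable M" "f \<in> borel_measurable M" and w: "w \<in> L2 M"
    and lim: "AE x in M. (\<lambda>n. s n x) \<longlonglongrightarrow> f x"
    and bound: "\<And>n. AE x in M. cmod (s n x) \<le> cmod (w x)"
  shows "L2_tendsto M sequentially s f"
proof -
  have [measurable]: "w \<in> borel_measurable M" using w by (rule L2_measurable)
  have s: "s n \<in> L2 M" for n
    using bound[of n] by (intro L2_dominated(1)[OF w, of _ 1]) auto
  have bf: "AE x in M. cmod (f x) \<le> cmod (w x)"
  proof -
    have "AE x in M. \<forall>n. cmod (s n x) \<le> cmod (w x)" using bound by (simp add: AE_all_countable)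
    with lim show ?thesis
    proof eventually_elim
      case (elim x)
      then show ?case by (intro LIMSEQ_le_const2[OF tendsto_norm]) auto
    qed
  qed
  have f: "f \<in> L2 M" using bf by (intro L2_dominated(1)[OF w, of _ 1]) auto
  have "(\<lambda>n. LINT x|M. (cmod (s n x - f x))\<^sup>2) \<longlonglongrightarrow> (LINT x|M. 0)"
  proof (rule integral_dominated_convergence[where w="\<lambda>x. 4 * (cmod (w x))\<^sup>2"])
    show "integrable M (\<lambda>x. 4 * (cmod (w x))\<^sup>2)" using L2_integrable[OF w] by simp
    show "AE x in M. (\<lambda>n. (cmod (s n x - f x))\<^sup>2) \<longlonglongrightarrow> 0"
      using lim
    proof eventually_elim
      case (elim x)
      then have "(\<lambda>n. (cmod (s n x - f x))\<^sup>2) \<longlonglongrightarrow> (cmod (f x - f x))\<^sup>2" by (intro tendsto_intros)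
      then show ?case by simp
    qed
    show "AE x in M. norm ((cmod (s n x - f x))\<^sup>2) \<le> 4 * (cmod (w x))\<^sup>2" for n
      using bound[of n] bf
    proof eventually_elim
      case (elim x)
      then have "cmod (s n x - f x) \<le> 2 * cmod (w x)"
        using norm_triangle_ineq4[of "s n x" "f x"] by linarith
      then have "(cmod (s n x - f x))\<^sup>2 \<le> (2 * cmod (w x))\<^sup>2" by (intro power_mono) auto
      then show ?case by (simp add: power_mult_distrib)
    qed
  qed auto
  then have "(\<lambda>n. sqrt (LINT x|M. (cmod (s n x - f x))\<^sup>2)) \<longlonglongrightarrow> sqrt 0"
    by (intro tendsto_real_sqrt) simp
  then show ?thesis
    using s f by (simp add: L2_tendsto_def L2_norm_def)
qed

lemma L2_indicator:
  assumes "A \<in> sets M" "emeasure M A < \<infinity>"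
  shows "(\<lambda>x. indicator A x :: complex) \<in> L2 M"
proof (rule L2I)
  have "(\<lambda>x. (cmod (indicator A x))\<^sup>2) = (indicator A :: _ \<Rightarrow> real)"
    by (auto simp: indicator_def)
  then show "integrable M (\<lambda>x. (cmod (indicator A x))\<^sup>2)" using assms by simp
qed (use assms in simp)

lemma L2_indicator_bounded:
  fixes A :: "'a::euclidean_space set"
  assumes "A \<in> sets borel" "bounded A"
  shows "(\<lambda>x. indicator A x :: complex) \<in> L2 lborel"
  using assms emeasure_bounded_finite[of A] by (intro L2_indicator) auto

text \<open>Dynkin's argument with the open boxes as generator stable under intersections.
  Intersecting with one fixed box keeps the indicators of complements square-integrable.\<close>

lemma bounded_borel_induct_indicator:
  fixes A :: "'a::euclidean_space set"
  assumes A: "A \<in> sets borel"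
    and box: "\<And>a b. P (\<lambda>x. indicator (box a b) x :: complex)"
    and add: "\<And>f g. P f \<Longrightarrow> P g \<Longrightarrow> P (f + g)"
    and cmult: "\<And>c f. P f \<Longrightarrow> P (\<lambda>x. c * f x)"
    and lim: "\<And>s f. (\<And>n. P (s n)) \<Longrightarrow> L2_tendsto lborel sequentially s f \<Longrightarrow> P f"
  shows "P (\<lambda>x. indicator (A \<inter> box a b) x :: complex)"
proof -
  let ?G = "range (\<lambda>(a, b). box a b :: 'a set)"
  have 1: "Int_stable ?G" "?G \<subseteq> Pow UNIV" by (auto simp: Int_stable_def box_Int_box)
  have P0: "P (\<lambda>x. 0)" using cmult[OF box, of 0 a b] by simp
  have "A \<in> sigma_sets UNIV ?G" using A by (simp add: borel_eq_box)
  with 1 show ?thesis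
  proof (induction A rule: sigma_sets_induct_disjoint)
    case (basic A)
    then obtain c d where "A = box c d" by auto
    then show ?case using box by (auto simp: box_Int_box)
  next
    case empty show ?case using P0 by simp
  next
    case (compl A)
    have "(\<lambda>x. indicator ((UNIV - A) \<inter> box a b) x :: complex)
        = (\<lambda>x. indicator (box a b) x) + (\<lambda>x. (-1) * indicator (A \<inter> box a b) x)"
      by (auto simp: indicator_def fun_eq_iff)
    then show ?case using add[OF box cmult[OF compl(2)]] by (simp only:)
  next
    case (union A)
    have [measurable]: "A i \<in> sets borel" for i
      using union(2) by (auto simp: borel_eq_box)
    define s where "s = (\<lambda>n x. \<Sum>i<n. indicator (A i \<inter> box a b) x :: complex)"
    have Ps: "P (s n)" for n
    proof (induction n)
      case 0 show ?case using P0 by (simp add: s_def)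
    next
      case (Suc n)
      have "s (Suc n) = s n + (\<lambda>x. indicator (A n \<inter> box a b) x)" by (auto simp: s_def fun_eq_iff)
      then show ?case using add[OF Suc union(3)[of n]] by (simp only:)
    qed
    have s_eq: "s n x = indicator ((\<Union>i<n. A i) \<inter> box a b) x" for n x
    proof -
      have "disjoint_family_on (\<lambda>i. A i \<inter> box a b) {..<n}"
        using union(1) by (auto simp: disjoint_family_on_def)
      then have "s n x = indicator (\<Union>i<n. A i \<inter> box a b) x"
        unfolding s_def by (subst indicator_UN_disjoint) auto
      then show ?thesis by (simp add: Int_UN_distrib2 flip: UN_extend_simps)
    qed
    have "L2_tendsto lborel sequentially s (\<lambda>x. indicator ((\<Union>i. A i) \<inter> box a b) x)"
    proof (rule L2_dominated_convergence[where w="\<lambda>x. indicator (box a b) x"])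
      show "s n \<in> borel_measurable lborel" for n unfolding s_def by measurable
      show "(\<lambda>x. indicator (box a b) x :: complex) \<in> L2 lborel" by (rule L2_indicator_bounded) auto
      show "AE x in lborel. (\<lambda>n. s n x) \<longlonglongrightarrow> indicator ((\<Union>i. A i) \<inter> box a b) x"
      proof (rule AE_I2)
        fix x
        have "\<forall>\<^sub>F n in sequentially. s n x = indicator ((\<Union>i. A i) \<inter> box a b) x"
        proof (cases "x \<in> (\<Union>i. A i)")
          case True
          then obtain i where "x \<in> A i" by auto
          then show ?thesis
            by (intro eventually_sequentiallyI[of "Suc i"]) (auto simp: s_eq indicator_def)
        qed (auto simp: s_eq indicator_def)
        then show "(\<lambda>n. s n x) \<longlonglongrightarrow> indicator ((\<Union>i. A i) \<inter> box a b) x"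
          by (rule tendsto_eventually)
      qed
      show "AE x in lborel. cmod (s n x) \<le> cmod (indicator (box a b) x)" for n
        by (auto simp: s_eq indicator_def)
    qed simp
    then show ?case by (rule lim[OF Ps])
  qed
qed

text \<open>A property that survives linear combinations and L2 limits needs to be checked on boxes
  only: simple functions cut off to growing boxes approximate \<open>f\<close> and are dominated by
  2 |f|.\<close>

lemma L2_lborel_induct [consumes 1, case_names box add cmult lim]:
  fixes f :: "'a::euclidean_space \<Rightarrow> complex"
  assumes f: "f \<in> L2 lborel"
    and box: "\<And>a b. P (\<lambda>x. indicator (box a b) x :: complex)"
    and add: "\<And>f g. P f \<Longrightarrow> P g \<Longrightarrow> P (f + g)"
    and cmult: "\<And>c f. P f \<Longrightarrow> P (\<lambda>x. c * f x)"
    and lim: "\<And>s f. (\<And>n. P (s n)) \<Longrightarrow> L2_tendsto lborel sequentially s f \<Longrightarrow> P f"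
  shows "P f"
proof -
  have [measurable]: "f \<in> borel_measurable lborel" using f by (rule L2_measurable)
  obtain S where S: "\<And>i. simple_function lborel (S i)" "\<And>x. (\<lambda>i. S i x) \<longlonglongrightarrow> f x"
     "\<And>i x. dist (S i x) 0 \<le> 2 * dist (f x) 0"
    using borel_measurable_implies_sequence_metric[of f lborel 0] by auto
  define B where "B = (\<lambda>i::nat. box (- real i *\<^sub>R One) (real i *\<^sub>R One) :: 'a set)"
  have [measurable]: "S i \<in> borel_measurable lborel" for i
    using S(1) by (rule borel_measurable_simple_function)
  have [measurable]: "B i \<in> sets borel" for i by (simp add: B_def)
  define s where "s = (\<lambda>i x. indicator (B i) x * S i x)"
  have fin: "finite (range (S i))" for i using S(1)[of i] by (simp add: simple_function_def)
  have "P (\<lambda>x. \<Sum>y\<in>Y. y * indicator (S i -` {y} \<inter> B i) x)" if "finite Y" for Y i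
    using that
  proof (induction Y)
    case empty
    show ?case using cmult[OF box, of 0] by simp
  next
    case (insert y Y)
    have "S i -` {y} \<inter> space lborel \<in> sets lborel" by (intro measurable_sets[of _ _ borel]) auto
    then have "S i -` {y} \<in> sets borel" by simp
    then have "P (\<lambda>x. indicator (S i -` {y} \<inter> B i) x)"
      unfolding B_def by (rule bounded_borel_induct_indicator[OF _ box add cmult lim])
    from add[OF cmult[OF this, of y] insert.IH]
    show ?case by (simp only: sum.insert[OF insert.hyps] plus_fun_def)
  qed
  from this[OF fin] have "P (\<lambda>x. \<Sum>y\<in>range (S i). y * indicator (S i -` {y} \<inter> B i) x)" for i .
  moreover have "(\<lambda>x. \<Sum>y\<in>range (S i). y * indicator (S i -` {y} \<inter> B i) x) = s i" for i
  proof
    fix x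
    have "(\<Sum>y\<in>range (S i). y * indicator (S i -` {y} \<inter> B i) x)
        = (\<Sum>y\<in>range (S i). if y = S i x then y * indicator (B i) x else 0)"
      by (intro sum.cong) (auto simp: indicator_def)
    also have "\<dots> = s i x" using fin[of i] by (simp add: s_def)
    finally show "(\<Sum>y\<in>range (S i). y * indicator (S i -` {y} \<inter> B i) x) = s i x" .
  qed
  ultimately have Ps: "P (s i)" for i by simp
  have "L2_tendsto lborel sequentially s f"
  proof (rule L2_dominated_convergence[where w="\<lambda>x. 2 * f x"])
    show "s i \<in> borel_measurable lborel" for i unfolding s_def by measurable
    show "(\<lambda>x. 2 * f x) \<in> L2 lborel" using f by (rule L2_cmult)
    show "AE x in lborel. (\<lambda>i. s i x) \<longlonglongrightarrow> f x"
    proof (rule AE_I2)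
      fix x :: 'a
      obtain n :: nat where n: "norm x < real n" using reals_Archimedean2 by blast
      have "x \<in> B i" if "i \<ge> n" for i
      proof -
        have "- real i < x \<bullet> b \<and> x \<bullet> b < real i" if "b \<in> Basis" for b
          using Basis_le_norm[OF that, of x] n \<open>i \<ge> n\<close> by linarith
        then show ?thesis
          by (simp add: B_def box_def inner_sum_left inner_Basis sum.If_cases)
      qed
      then have "\<forall>\<^sub>F i in sequentially. S i x = s i x"
        by (intro eventually_sequentiallyI[of n]) (auto simp: s_def)
      then show "(\<lambda>i. s i x) \<longlonglongrightarrow> f x" using S(2) by (rule Lim_transform_eventually[rotated])
    qed
    show "AE x in lborel. cmod (s i x) \<le> cmod (2 * f x)" for i
      using S(3)[of i] by (intro AE_I2) (auto simp: s_def norm_mult indicator_def)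
  qed simp
  then show ?thesis by (rule lim[OF Ps])
qed

section \<open>Affine substitutions, continuity of translations, Gaussian integrals\<close>

lemma lborel_integral_affine:
  fixes f :: "'a::euclidean_space \<Rightarrow> 'b::{banach, second_countable_topology}"
  assumes [measurable]: "f \<in> borel_measurable borel" and c: "c > 0"
  shows "(LINT x|lborel. f x) = c ^ DIM('a) *\<^sub>R (LINT x|lborel. f (t + c *\<^sub>R x))"
  using c by (subst lborel_affine[of c t]) (simp_all add: integral_density integral_distr)

lemma lborel_integrable_affine_iff:
  fixes f :: "'a::euclidean_space \<Rightarrow> 'b::{banach, second_countable_topology}"
  assumes [measurable]: "f \<in> borel_measurable borel" and c: "c > 0"
  shows "integrable lborel (\<lambda>x. f (t + c *\<^sub>R x)) \<longleftrightarrow> integrable lborel f"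
proof -
  let ?d = "c ^ DIM('a)"
  have "integrable lborel (\<lambda>x. f (t + c *\<^sub>R x))" if "integrable lborel (\<lambda>x. ?d *\<^sub>R f (t + c *\<^sub>R x))"
    using integrable_scaleR_right[of "inverse ?d", OF that] c by simp
  then have "integrable lborel (\<lambda>x. ?d *\<^sub>R f (t + c *\<^sub>R x)) \<longleftrightarrow> integrable lborel (\<lambda>x. f (t + c *\<^sub>R x))"
    by auto
  then show ?thesis
    using c by (subst (2) lborel_affine[of c t]) (simp_all add: integrable_density integrable_distr_eq)
qed

lemma lborel_integral_translate:
  fixes f :: "'a::euclidean_space \<Rightarrow> 'b::{banach, second_countable_topology}"
  assumes "f \<in> borel_measurable borel"
  shows "(LINT x|lborel. f (x + t)) = (LINT x|lborel. f x)"
  using lborel_integral_affine[of f 1 t] assms by (simp add: add.commute)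

lemma L2_translate:
  fixes f :: "'a::euclidean_space \<Rightarrow> complex"
  assumes f: "f \<in> L2 lborel"
  shows "(\<lambda>x. f (x + t)) \<in> L2 lborel" "L2_norm lborel (\<lambda>x. f (x + t)) = L2_norm lborel f"
proof -
  have [measurable]: "f \<in> borel_measurable borel" using L2_measurable[OF f] by simp
  show "(\<lambda>x. f (x + t)) \<in> L2 lborel"
    using lborel_integrable_affine_iff[of "\<lambda>x. (cmod (f x))\<^sup>2" 1 t] L2_integrable[OF f]
    by (intro L2I) (auto simp: add.commute)
  show "L2_norm lborel (\<lambda>x. f (x + t)) = L2_norm lborel f"
    using lborel_integral_translate[of "\<lambda>x. (cmod (f x))\<^sup>2" t] by (simp add: L2_norm_def)
qed

text \<open>For indicators of boxes this is dominated convergence. The limit step is a three-epsilon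
  argument, which works because translations are isometries.\<close>

lemma L2_translate_continuous:
  fixes f :: "'a::euclidean_space \<Rightarrow> complex" and t :: "nat \<Rightarrow> 'a"
  assumes f: "f \<in> L2 lborel" and t: "t \<longlonglongrightarrow> 0"
  shows "L2_tendsto lborel sequentially (\<lambda>n x. f (x + t n)) f"
  using f
proof (induction f rule: L2_lborel_induct)
  case (box a b)
  obtain T where T: "\<And>n. norm (t n) \<le> T"
    using convergent_imp_Bseq[of t] t by (auto simp: convergent_def Bseq_def)
  obtain r where r: "box a b \<subseteq> cball 0 r"
    using bounded_subset_ballD[OF bounded_box[of a b], of 0] ball_subset_cball[of 0] by (meson order_trans)
  show ?case
  proof (rule L2_dominated_convergence[where w="\<lambda>x. indicator (cball 0 (r + T)) x"])
    show "(\<lambda>x. indicator (cball 0 (r + T)) x :: complex) \<in> L2 lborel"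
      by (rule L2_indicator_bounded) auto
    show "AE x in lborel. cmod (indicator (box a b) (x + t n)) \<le> cmod (indicator (cball 0 (r + T)) x)" for n
    proof (rule AE_I2)
      fix x :: 'a
      have "x \<in> cball 0 (r + T)" if "x + t n \<in> box a b"
        using subsetD[OF r that] T[of n] norm_triangle_ineq4[of "x + t n" "t n"] by simp
      then show "cmod (indicator (box a b) (x + t n)) \<le> cmod (indicator (cball 0 (r + T)) x)"
        by (auto simp: indicator_def)
    qed
    \<comment> \<open>Off the boundary, a null set, the indicator of a box is locally
      constant.\<close>
    have "AE x in lborel. x \<notin> cbox a b - box a b" by (rule AE_not_in[OF null_sets_cbox_Diff_box])
    then show "AE x in lborel. (\<lambda>n. indicator (box a b) (x + t n) :: complex) \<longlonglongrightarrow> indicator (box a b) x"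
    proof eventually_elim
      case (elim x)
      have lim: "(\<lambda>n. x + t n) \<longlonglongrightarrow> x" using tendsto_add[OF tendsto_const[of x] t] by simp
      have "\<forall>\<^sub>F n in sequentially. indicator (box a b) (x + t n) = (indicator (box a b) x :: complex)"
      proof (cases "x \<in> box a b")
        case True
        then have "\<forall>\<^sub>F n in sequentially. x + t n \<in> box a b"
          using topological_tendstoD[OF lim open_box] by blast
        then show ?thesis by (rule eventually_mono) (use True in simp)
      next
        case False
        then have "x \<in> - cbox a b" using elim by auto
        then have "\<forall>\<^sub>F n in sequentially. x + t n \<in> - cbox a b"
          using topological_tendstoD[OF lim, of "- cbox a b"] by auto
        then show ?thesis
        proof eventually_elim
          case (elim n)
          then have "x + t n \<notin> box a b" using box_subset_cbox by blast
          then show ?case using False by simp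
        qed
      qed
      then show ?case by (rule tendsto_eventually)
    qed
  qed auto
next
  case (add f g)
  from L2_tendsto_add[OF add] show ?case by (simp add: plus_fun_def)
next
  case (cmult c f)
  then show ?case by (rule L2_tendsto_cmult)
next
  case (lim s f)
  have f: "f \<in> L2 lborel" and s: "\<And>n. s n \<in> L2 lborel" and s_lim: "(\<lambda>n. L2_norm lborel (s n - f)) \<longlonglongrightarrow> 0"
    using lim by (auto simp: L2_tendsto_alt)
  let ?T = "\<lambda>n f x. f (x + t n)"
  show ?case
    unfolding L2_tendsto_alt
  proof (intro conjI f always_eventually allI)
    show Tf: "?T n f \<in> L2 lborel" for n using f by (rule L2_translate)
    show "(\<lambda>n. L2_norm lborel (?T n f - f)) \<longlonglongrightarrow> 0"
    proof (rule LIMSEQ_I)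
      fix e :: real assume e: "e > 0"
      obtain m where m: "L2_norm lborel (s m - f) < e / 3"
        using LIMSEQ_D[OF s_lim, of "e/3"] e by auto
      have "(\<lambda>n. L2_norm lborel (?T n (s m) - s m)) \<longlonglongrightarrow> 0"
        using lim.IH[of m] by (simp add: L2_tendsto_alt)
      then obtain N where N: "\<And>n. n \<ge> N \<Longrightarrow> L2_norm lborel (?T n (s m) - s m) < e / 3"
        using LIMSEQ_D[of _ 0 "e/3"] e by fastforce
      have "norm (L2_norm lborel (?T n f - f) - 0) < e" if "n \<ge> N" for n
      proof -
        have Ts: "?T n (s m) \<in> L2 lborel" using s by (rule L2_translate)
        have "L2_norm lborel (?T n f - ?T n (s m)) = L2_norm lborel (f - s m)"
          using L2_translate(2)[OF L2.S_closed(3)[OF f s[of m]], of "t n"] by (simp add: fun_diff_def)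
        then have "L2_norm lborel (?T n f - f) \<le> L2_norm lborel (f - s m) + L2_norm lborel (?T n (s m) - s m) + L2_norm lborel (s m - f)"
          using L2.nrm_triangle_diff[OF Tf[of n] Ts f] L2.nrm_triangle_diff[OF Ts s[of m] f] by linarith
        then show ?thesis using N[OF that] m L2.nrm_commute[OF f s[of m]] by simp
      qed
      then show "\<exists>N. \<forall>n\<ge>N. norm (L2_norm lborel (?T n f - f) - 0) < e" by blast
    qed
  qed
qed

text \<open>\<open>lborel\<close> is the image of a product of one-dimensional measures under the
  coordinate sum, so Fubini for products applies.\<close>

lemma lborel_integral_prod:
  fixes f :: "'a::euclidean_space \<Rightarrow> real \<Rightarrow> complex"
  assumes f: "\<And>b. b \<in> Basis \<Longrightarrow> integrable lborel (f b)"
  shows "integrable lborel (\<lambda>x::'a. \<Prod>b\<in>Basis. f b (x \<bullet> b))" (is ?int)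
    and "integral\<^sup>L lborel (\<lambda>x::'a. \<Prod>b\<in>Basis. f b (x \<bullet> b)) = (\<Prod>b\<in>Basis. LINT x|lborel. f b x)" (is ?eq)
proof -
  interpret product_sigma_finite "\<lambda>_::'a. lborel :: real measure" ..
  have [measurable]: "f b \<in> borel_measurable borel" if "b \<in> Basis" for b using f[OF that] by auto
  have m: "(\<lambda>x::'a. \<Prod>b\<in>Basis. f b (x \<bullet> b)) \<in> borel_measurable borel" by measurable
  have T: "(\<lambda>g. \<Sum>b\<in>Basis. g b *\<^sub>R b) \<in> Pi\<^sub>M Basis (\<lambda>_. lborel) \<rightarrow>\<^sub>M (borel :: 'a measure)" by measurable
  have eq: "(lborel :: 'a measure) = distr (\<Pi>\<^sub>M b\<in>Basis. lborel) borel (\<lambda>g. \<Sum>b\<in>Basis. g b *\<^sub>R b)"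
    by (rule lborel_eq)
  have coord: "(\<Prod>b\<in>Basis. f b ((\<Sum>b\<in>Basis. g b *\<^sub>R b) \<bullet> b)) = (\<Prod>b\<in>Basis. f b (g b))" for g
    by (intro prod.cong) auto
  have "integrable (distr (\<Pi>\<^sub>M b\<in>Basis. lborel) borel (\<lambda>g. \<Sum>b\<in>Basis. g b *\<^sub>R b)) (\<lambda>x::'a. \<Prod>b\<in>Basis. f b (x \<bullet> b))"
    unfolding integrable_distr_eq[OF T m] coord using f by (intro product_integrable_prod) auto
  then show ?int by (simp only: eq)
  have "integral\<^sup>L (distr (\<Pi>\<^sub>M b\<in>Basis. lborel) borel (\<lambda>g. \<Sum>b\<in>Basis. g b *\<^sub>R b)) (\<lambda>x::'a. \<Prod>b\<in>Basis. f b (x \<bullet> b))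
     = (\<Prod>b\<in>Basis. LINT x|lborel. f b x)"
    unfolding integral_distr[OF T m] coord using f by (intro product_integral_prod) auto
  then show ?eq by (simp only: eq)
qed

text \<open>The characteristic function of the standard normal distribution, rescaled by y = e x and
  evaluated at -t / e.\<close>

lemma gaussian_fourier_1:
  fixes e t :: real
  assumes e: "e > 0"
  defines "g \<equiv> \<lambda>x. exp (- \<i> * of_real (t * x)) * complex_of_real (exp (- (e * x)\<^sup>2 / 2))"
  shows "integrable lborel g" "(LINT x|lborel. g x) = of_real (sqrt (2 * pi) / e * exp (- (t / e)\<^sup>2 / 2))"
proof -
  define s where "s = - t / e"
  define f where "f = (\<lambda>y. std_normal_density y *\<^sub>R iexp (s * y))"
  have m [measurable]: "f \<in> borel_measurable borel" unfolding f_def by measurable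
  have f_int: "integrable lborel f"
    by (rule Bochner_Integration.integrable_bound[OF integrable_normal_density[of 1 0]])
       (auto simp: f_def simp del: of_real_mult)
  have "(LINT y|lborel. f y) = char std_normal_distribution s"
    unfolding char_def f_def by (subst integral_density) auto
  also have "\<dots> = of_real (exp (- (t / e)\<^sup>2 / 2))"
    by (simp add: char_std_normal_distribution s_def)
  finally have I: "(LINT y|lborel. f y) = of_real (exp (- (t / e)\<^sup>2 / 2))" .
  have g: "g x = of_real (sqrt (2 * pi)) * f (0 + e *\<^sub>R x)" for x
    using e by (simp add: g_def f_def s_def std_normal_density_def scaleR_conv_of_real)
  show "integrable lborel g"
    unfolding g[abs_def]
    using lborel_integrable_affine_iff[OF m e, of 0] f_int by (intro integrable_mult_right) simp
  have "(LINT x|lborel. g x) = of_real (sqrt (2 * pi)) * (LINT x|lborel. f (0 + e *\<^sub>R x))"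
    unfolding g by simp
  also have "(LINT x|lborel. f (0 + e *\<^sub>R x)) = (1 / e) *\<^sub>R of_real (exp (- (t / e)\<^sup>2 / 2))"
    using lborel_integral_affine[OF m e, of 0] e I by (simp add: field_simps)
  finally show "(LINT x|lborel. g x) = of_real (sqrt (2 * pi) / e * exp (- (t / e)\<^sup>2 / 2))"
    by (simp add: scaleR_conv_of_real)
qed

lemma gaussian_fourier:
  fixes z :: "real ^ 'n" and e :: real
  assumes e: "e > 0"
  defines "g \<equiv> \<lambda>\<xi>. exp (- \<i> * of_real (z \<bullet> \<xi>)) * complex_of_real (exp (- (e * norm \<xi>)\<^sup>2 / 2))"
  shows "integrable lborel g"
    "(LINT \<xi>|lborel. g \<xi>) = of_real ((2 * pi) powr (real CARD('n) / 2) / e ^ CARD('n) * exp (- (norm z / e)\<^sup>2 / 2))"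
proof -
  define f where "f = (\<lambda>(b::real ^ 'n) x. exp (- \<i> * of_real ((z \<bullet> b) * x)) * complex_of_real (exp (- (e * x)\<^sup>2 / 2)))"
  have nsq: "(norm x)\<^sup>2 = (\<Sum>b\<in>Basis. (x \<bullet> b)\<^sup>2)" for x :: "real ^ 'n"
    by (subst power2_norm_eq_inner, subst euclidean_inner) (simp add: power2_eq_square)
  have g: "g \<xi> = (\<Prod>b\<in>Basis. f b (\<xi> \<bullet> b))" for \<xi>
  proof -
    have "- \<i> * of_real (z \<bullet> \<xi>) = (\<Sum>b\<in>Basis. - \<i> * of_real ((z \<bullet> b) * (\<xi> \<bullet> b)))"
      by (subst euclidean_inner) (simp add: sum_distrib_left sum_negf)
    then have 1: "exp (- \<i> * of_real (z \<bullet> \<xi>)) = (\<Prod>b\<in>Basis. exp (- \<i> * of_real ((z \<bullet> b) * (\<xi> \<bullet> b))))"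
      by (simp only: exp_sum[OF finite_Basis])
    have "- (e * norm \<xi>)\<^sup>2 / 2 = (\<Sum>b\<in>Basis. - (e * (\<xi> \<bullet> b))\<^sup>2 / 2)"
      by (simp add: power_mult_distrib nsq sum_distrib_left sum_negf flip: sum_divide_distrib)
    then have "exp (- (e * norm \<xi>)\<^sup>2 / 2) = (\<Prod>b\<in>Basis. exp (- (e * (\<xi> \<bullet> b))\<^sup>2 / 2))"
      by (simp only: exp_sum[OF finite_Basis])
    then show ?thesis unfolding g_def 1 by (simp add: f_def prod.distrib)
  qed
  note f1 = gaussian_fourier_1[OF e, folded f_def]
  have f_int: "integrable lborel (f b)" for b
    unfolding f_def by (rule gaussian_fourier_1[OF e])
  show "integrable lborel g" unfolding g[abs_def] by (rule lborel_integral_prod) (rule f_int)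
  have "(LINT \<xi>|lborel. g \<xi>) = (\<Prod>b\<in>Basis. LINT x|lborel. f b x)"
    unfolding g by (rule lborel_integral_prod) (rule f_int)
  also have "\<dots> = (\<Prod>b\<in>Basis. of_real (sqrt (2 * pi) / e * exp (- ((z \<bullet> b) / e)\<^sup>2 / 2)))"
    by (intro prod.cong refl) (simp only: f_def gaussian_fourier_1[OF e])
  also have "\<dots> = of_real (\<Prod>b\<in>(Basis :: (real ^ 'n) set). sqrt (2 * pi) / e * exp (- ((z \<bullet> b) / e)\<^sup>2 / 2))"
    by simp
  also have "(\<Prod>b\<in>(Basis :: (real ^ 'n) set). sqrt (2 * pi) / e * exp (- ((z \<bullet> b) / e)\<^sup>2 / 2))
      = (sqrt (2 * pi) / e) ^ CARD('n) * exp (\<Sum>b\<in>Basis. - ((z \<bullet> b) / e)\<^sup>2 / 2)"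
    by (simp only: prod.distrib prod_constant exp_sum[OF finite_Basis]) simp
  also have "(\<Sum>b\<in>Basis. - ((z \<bullet> b) / e)\<^sup>2 / 2) = - (norm z / e)\<^sup>2 / 2"
    by (simp add: power_divide nsq sum_negf flip: sum_divide_distrib)
  also have "(sqrt (2 * pi) / e) ^ CARD('n) = (2 * pi) powr (real CARD('n) / 2) / e ^ CARD('n)"
  proof -
    have "sqrt (2 * pi) ^ CARD('n) = (2 * pi) powr (real CARD('n) / 2)"
      by (simp add: powr_half_sqrt[symmetric] powr_realpow[symmetric] powr_powr)
    then show ?thesis by (simp add: power_divide)
  qed
  finally show "(LINT \<xi>|lborel. g \<xi>) = of_real ((2 * pi) powr (real CARD('n) / 2) / e ^ CARD('n) * exp (- (norm z / e)\<^sup>2 / 2))" .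
qed

text \<open>The integrand is dominated by |a(x)| |b(y)|, so the double integral converges
  absolutely.\<close>

lemma Fubini_kernel:
  fixes a :: "'a::euclidean_space \<Rightarrow> complex" and b :: "'b::euclidean_space \<Rightarrow> complex"
  assumes a: "integrable lborel a" and b: "integrable lborel b"
    and k [measurable]: "(\<lambda>(x, y). k x y) \<in> borel_measurable (lborel \<Otimes>\<^sub>M lborel)"
    and le: "\<And>x y. cmod (k x y) \<le> 1"
  shows "(LINT y|lborel. (LINT x|lborel. k x y * a x) * b y) = (LINT x|lborel. a x * (LINT y|lborel. k x y * b y))"
proof -
  have [measurable]: "a \<in> borel_measurable borel" "b \<in> borel_measurable borel" using a b by auto
  have [measurable]: "k x \<in> borel_measurable borel" for x
    using measurable_compose[OF measurable_Pair1'[of x lborel lborel] k] by simp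
  have bd: "cmod (k x y * a x * b y) \<le> cmod (a x) * cmod (b y)" for x y
    using le[of x y] mult_right_mono[of "cmod (k x y)" 1 "cmod (a x) * cmod (b y)"]
    by (simp add: norm_mult mult.assoc)
  have sec: "integrable lborel (\<lambda>y. k x y * a x * b y)" for x
    by (rule Bochner_Integration.integrable_bound[of _ "\<lambda>y. cmod (a x) * cmod (b y)"])
       (use b bd in auto)
  have I: "integrable (lborel \<Otimes>\<^sub>M lborel) (\<lambda>(x, y). k x y * a x * b y)"
  proof (rule lborel_pair.Fubini_integrable)
    show "(\<lambda>(x, y). k x y * a x * b y) \<in> borel_measurable (lborel \<Otimes>\<^sub>M lborel)"
      by measurable
    show "integrable lborel (\<lambda>x. LINT y|lborel. norm (case (x, y) of (x, y) \<Rightarrow> k x y * a x * b y))"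
    proof (rule Bochner_Integration.integrable_bound)
      show "integrable lborel (\<lambda>x. cmod (a x) * (LINT y|lborel. cmod (b y)))" using a by auto
      show "AE x in lborel. norm (LINT y|lborel. norm (case (x, y) of (x, y) \<Rightarrow> k x y * a x * b y))
          \<le> norm (cmod (a x) * (LINT y|lborel. cmod (b y)))"
      proof (rule AE_I2)
        fix x
        have "(LINT y|lborel. cmod (k x y * a x * b y)) \<le> (LINT y|lborel. cmod (a x) * cmod (b y))"
          using b sec[of x] bd by (intro integral_mono) auto
        then show "norm (LINT y|lborel. norm (case (x, y) of (x, y) \<Rightarrow> k x y * a x * b y))
          \<le> norm (cmod (a x) * (LINT y|lborel. cmod (b y)))" by simp
      qed
    qed measurable
  qed (use sec in auto)
  have "(LINT y|lborel. (LINT x|lborel. k x y * a x) * b y) = (LINT y|lborel. LINT x|lborel. k x y * a x * b y)"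
    by simp
  also have "\<dots> = (LINT x|lborel. LINT y|lborel. k x y * a x * b y)"
    by (rule lborel_pair.Fubini_integral[OF I])
  also have "\<dots> = (LINT x|lborel. LINT y|lborel. a x * (k x y * b y))"
    by (simp only: mult.assoc mult.left_commute)
  also have "\<dots> = (LINT x|lborel. a x * (LINT y|lborel. k x y * b y))" by simp
  finally show ?thesis .
qed

section \<open>Plancherel's theorem for integrable functions\<close>

lemma L2_prod_norm_le:
  assumes "f \<in> L2 M" "g \<in> L2 M"
  shows "(LINT x|M. cmod (f x) * cmod (g x)) \<le> L2_norm M f * L2_norm M g"
proof -
  have [measurable]: "f \<in> borel_measurable M" "g \<in> borel_measurable M"
    using assms by (auto dest: L2_measurable)
  have 1: "(\<lambda>x. complex_of_real (cmod (f x))) \<in> L2 M" "(\<lambda>x. complex_of_real (cmod (g x))) \<in> L2 M"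
    using assms by (auto simp: L2_def)
  have "complex_of_real (LINT x|M. cmod (f x) * cmod (g x))
      = L2_inner M (\<lambda>x. complex_of_real (cmod (f x))) (\<lambda>x. complex_of_real (cmod (g x)))"
    unfolding L2_inner_def by (simp flip: of_real_mult)
  then have "cmod (complex_of_real (LINT x|M. cmod (f x) * cmod (g x))) \<le> L2_norm M f * L2_norm M g"
    using L2_Cauchy_Schwarz[OF 1] by (simp add: L2_norm_def)
  then show ?thesis by simp
qed

text \<open>The pointwise transform, meaningful for integrable \<open>f\<close>, as opposed to
  \<open>fourier\<close>, which is a limit in the mean. They agree almost everywhere on integrable
  elements of L2, see \<open>fourier_eq_integral\<close>.\<close>

definition fourier_integral :: "(real ^ 'n \<Rightarrow> complex) \<Rightarrow> real ^ 'n \<Rightarrow> complex" where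
  "fourier_integral f \<xi> = of_real ((2 * pi) powr (- real CARD('n) / 2)) *
     (LINT x|lborel. exp (- \<i> * of_real (x \<bullet> \<xi>)) * f x)"

lemma fourier_integral_measurable [measurable]:
  "f \<in> borel_measurable borel \<Longrightarrow> fourier_integral f \<in> borel_measurable borel"
proof -
  assume [measurable]: "f \<in> borel_measurable borel"
  have "(\<lambda>\<xi>. LINT x|lborel. exp (- \<i> * of_real (x \<bullet> \<xi>)) * f x) \<in> borel_measurable borel"
    by (rule lborel.borel_measurable_lebesgue_integral) measurable
  then show ?thesis unfolding fourier_integral_def[abs_def] by simp
qed

lemma norm_exp_minus_i [simp]: "cmod (exp (- (\<i> * complex_of_real x))) = 1"
  by (simp add: norm_exp_eq_Re)

lemma exp_kernel_integrable:
  fixes f :: "'a::euclidean_space \<Rightarrow> complex"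
  assumes f: "integrable lborel f"
  shows "integrable lborel (\<lambda>x. exp (- \<i> * of_real (x \<bullet> \<xi>)) * f x)"
proof (rule Bochner_Integration.integrable_bound[OF f])
  have [measurable]: "f \<in> borel_measurable borel" using f by auto
  show "(\<lambda>x. exp (- \<i> * of_real (x \<bullet> \<xi>)) * f x) \<in> borel_measurable lborel" by measurable
qed (auto simp: norm_mult)

lemma fourier_integral_bounded:
  fixes f :: "real ^ 'n \<Rightarrow> complex"
  assumes f: "integrable lborel f"
  shows "cmod (fourier_integral f \<xi>) \<le> (2 * pi) powr (- real CARD('n) / 2) * (LINT x|lborel. cmod (f x))"
proof -
  have "cmod (LINT x|lborel. exp (- \<i> * of_real (x \<bullet> \<xi>)) * f x)
     \<le> (LINT x|lborel. cmod (exp (- \<i> * of_real (x \<bullet> \<xi>)) * f x))"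
    by (rule integral_norm_bound)
  also have "\<dots> = (LINT x|lborel. cmod (f x))" by (simp add: norm_mult)
  finally show ?thesis
    by (simp add: fourier_integral_def norm_mult mult_left_mono)
qed

lemma exp_kernel_measurable:
  "(\<lambda>(x, \<xi>). exp (- \<i> * of_real (x \<bullet> \<xi>))) \<in> borel_measurable (lborel \<Otimes>\<^sub>M (lborel :: 'a::euclidean_space measure))"
  by measurable

text \<open>
  Multiplying \<open>\<bar>F f\<bar>\<^sup>2\<close> by a Gaussian makes the triple integral absolutely convergent; the
  inner integral over \<open>\<xi>\<close> is again a Gaussian.
\<close>

lemma plancherel_regularized:
  fixes f :: "real ^ 'n \<Rightarrow> complex"
  assumes f: "f \<in> L2 lborel" "integrable lborel f" and e: "e > 0"
  shows "integrable lborel (\<lambda>\<xi>. (cmod (fourier_integral f \<xi>))\<^sup>2 * exp (- (e * norm \<xi>)\<^sup>2 / 2))"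
    "of_real (LINT \<xi>|lborel. (cmod (fourier_integral f \<xi>))\<^sup>2 * exp (- (e * norm \<xi>)\<^sup>2 / 2))
      = (LINT z|lborel. of_real ((2 * pi) powr (- real CARD('n) / 2) * exp (- (norm z)\<^sup>2 / 2)) *
           L2_inner lborel (\<lambda>x. f (x + e *\<^sub>R z)) f)"
proof -
  have [measurable]: "f \<in> borel_measurable borel" using f by auto
  define d where "d = CARD('n)"
  define c where "c = complex_of_real ((2 * pi) powr (- real d / 2))"
  define F where "F = fourier_integral f"
  define E where "E = (\<lambda>\<xi>::real ^ 'n. complex_of_real (exp (- (e * norm \<xi>)\<^sup>2 / 2)))"
  define K where "K = (\<lambda>x \<xi>::real ^ 'n. exp (- \<i> * complex_of_real (x \<bullet> \<xi>)))"
  have [measurable]: "F \<in> borel_measurable borel" "E \<in> borel_measurable borel" "K x \<in> borel_measurable borel" for x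
    by (auto simp: F_def E_def K_def)
  have K1 [simp]: "cmod (K x \<xi>) = 1" for x \<xi> by (simp add: K_def)
  have Km: "(\<lambda>(x, \<xi>). K x \<xi>) \<in> borel_measurable (lborel \<Otimes>\<^sub>M lborel)"
    unfolding K_def by (rule exp_kernel_measurable)
  have Km': "(\<lambda>(x, \<xi>). cnj (K x \<xi>)) \<in> borel_measurable (lborel \<Otimes>\<^sub>M lborel)"
    using borel_measurable_cnj[OF Km] by (simp add: case_prod_beta')
  have F: "F \<xi> = c * (LINT x|lborel. K x \<xi> * f x)" for \<xi>
    by (simp add: F_def fourier_integral_def c_def K_def d_def)
  have E_int: "integrable lborel E"
    using gaussian_fourier(1)[OF e, of "0 :: real ^ 'n"] by (simp add: E_def)
  obtain B where B: "\<And>\<xi>. cmod (F \<xi>) \<le> B" using fourier_integral_bounded[OF f(2)] by (auto simp: F_def)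
  have B0: "0 \<le> B" using B[of 0] norm_ge_zero order_trans by blast
  have FE_int: "integrable lborel (\<lambda>\<xi>. cnj (F \<xi>) * E \<xi>)"
  proof (rule Bochner_Integration.integrable_bound[of _ "\<lambda>\<xi>. of_real B * E \<xi>"])
    show "integrable lborel (\<lambda>\<xi>. of_real B * E \<xi>)" using E_int by simp
    show "AE \<xi> in lborel. norm (cnj (F \<xi>) * E \<xi>) \<le> norm (of_real B * E \<xi>)"
      using B B0 by (auto simp: norm_mult intro!: mult_right_mono)
  qed measurable
  have cE: "complex_of_real ((cmod (F \<xi>))\<^sup>2 * exp (- (e * norm \<xi>)\<^sup>2 / 2)) = F \<xi> * (cnj (F \<xi>) * E \<xi>)" for \<xi>
    by (simp add: E_def complex_norm_square[symmetric] flip: mult.assoc)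
  have "integrable lborel (\<lambda>\<xi>. F \<xi> * (cnj (F \<xi>) * E \<xi>))"
  proof (rule Bochner_Integration.integrable_bound[of _ "\<lambda>\<xi>. of_real B * (cnj (F \<xi>) * E \<xi>)"])
    show "integrable lborel (\<lambda>\<xi>. of_real B * (cnj (F \<xi>) * E \<xi>))" using FE_int by simp
    show "AE \<xi> in lborel. norm (F \<xi> * (cnj (F \<xi>) * E \<xi>)) \<le> norm (of_real B * (cnj (F \<xi>) * E \<xi>))"
      using B B0 by (auto simp: norm_mult intro!: mult_right_mono)
  qed measurable
  then show int: "integrable lborel (\<lambda>\<xi>. (cmod (fourier_integral f \<xi>))\<^sup>2 * exp (- (e * norm \<xi>)\<^sup>2 / 2))"
    unfolding cE[symmetric] complex_of_real_integrable_eq by (simp add: F_def)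
  \<comment> \<open>Fubini puts the integral over \<xi> inside, where it is the Gaussian transform
    at x - y. Substituting y = x + e z absorbs the factor 1 / e^d, and the powers of 2 pi
    cancel.\<close>
  have inner: "(LINT \<xi>|lborel. K x \<xi> * (cnj (F \<xi>) * E \<xi>))
      = (LINT z|lborel. cnj (f (x + e *\<^sub>R z)) * of_real (exp (- (norm z)\<^sup>2 / 2)))" for x
  proof -
    have KE: "integrable lborel (\<lambda>\<xi>. K x \<xi> * E \<xi>)"
      using gaussian_fourier(1)[OF e, of x] by (simp add: K_def E_def)
    have "(LINT \<xi>|lborel. K x \<xi> * (cnj (F \<xi>) * E \<xi>))
        = (LINT \<xi>|lborel. c * ((LINT y|lborel. cnj (K y \<xi>) * cnj (f y)) * (K x \<xi> * E \<xi>)))"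
    proof (rule Bochner_Integration.integral_cong[OF refl])
      fix \<xi>
      have "cnj (F \<xi>) = c * (LINT y|lborel. cnj (K y \<xi> * f y))"
        unfolding F by (subst Bochner_Integration.integral_cnj) (simp add: c_def)
      then show "K x \<xi> * (cnj (F \<xi>) * E \<xi>) = c * ((LINT y|lborel. cnj (K y \<xi>) * cnj (f y)) * (K x \<xi> * E \<xi>))"
        by simp
    qed
    also have "\<dots> = c * (LINT \<xi>|lborel. (LINT y|lborel. cnj (K y \<xi>) * cnj (f y)) * (K x \<xi> * E \<xi>))"
      by simp
    also have "\<dots> = c * (LINT y|lborel. cnj (f y) * (LINT \<xi>|lborel. cnj (K y \<xi>) * (K x \<xi> * E \<xi>)))"
      using f KE by (subst Fubini_kernel[OF _ _ Km']) auto
    also have "\<dots> = c * (LINT y|lborel. cnj (f y) * of_real ((2 * pi) powr (real d / 2) / e ^ d * exp (- (norm (x - y) / e)\<^sup>2 / 2)))"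
    proof -
      have eq: "cnj (K y \<xi>) * (K x \<xi> * E \<xi>) = exp (- \<i> * of_real ((x - y) \<bullet> \<xi>)) * of_real (exp (- (e * norm \<xi>)\<^sup>2 / 2))" for y \<xi>
        by (simp add: K_def E_def exp_cnj inner_diff_left algebra_simps flip: exp_add)
      show ?thesis unfolding eq gaussian_fourier(2)[OF e] d_def ..
    qed
    also have "\<dots> = c * (e ^ d *\<^sub>R (LINT z|lborel. cnj (f (x + e *\<^sub>R z)) * of_real ((2 * pi) powr (real d / 2) / e ^ d * exp (- (norm (x - (x + e *\<^sub>R z)) / e)\<^sup>2 / 2))))"
      by (subst lborel_integral_affine[OF _ e, of _ x]) (auto simp: d_def)
    also have "\<dots> = c * (e ^ d *\<^sub>R (LINT z|lborel. of_real ((2 * pi) powr (real d / 2) / e ^ d) * (cnj (f (x + e *\<^sub>R z)) * of_real (exp (- (norm z)\<^sup>2 / 2)))))"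
      using e by (simp add: mult_ac)
    also have "\<dots> = (c * (of_real (e ^ d) * of_real ((2 * pi) powr (real d / 2) / e ^ d))) * (LINT z|lborel. cnj (f (x + e *\<^sub>R z)) * of_real (exp (- (norm z)\<^sup>2 / 2)))"
      unfolding integral_mult_right_zero by (simp only: scaleR_conv_of_real mult.assoc)
    also have "c * (of_real (e ^ d) * of_real ((2 * pi) powr (real d / 2) / e ^ d)) = of_real ((2 * pi) powr (- real d / 2) * (2 * pi) powr (real d / 2))"
      using e by (simp add: c_def)
    also have "\<dots> = 1" by (simp flip: powr_add)
    finally show ?thesis by simp
  qed
  define g where "g = (\<lambda>z::real ^ 'n. complex_of_real (exp (- (norm z)\<^sup>2 / 2)))"
  have [measurable]: "g \<in> borel_measurable borel" by (simp add: g_def)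
  have g_int: "integrable lborel g"
    using gaussian_fourier(1)[of 1 "0 :: real ^ 'n"] by (simp add: g_def)
  have ft: "(\<lambda>x. f (x + e *\<^sub>R z)) \<in> L2 lborel" for z using f(1) by (rule L2_translate)
  have sec: "integrable lborel (\<lambda>x. g z * (cnj (f (x + e *\<^sub>R z)) * f x))" for z
    using L2_prod_integrable[OF ft f(1)] by simp
  \<comment> \<open>By Cauchy-Schwarz and translation invariance, the integral over x of the
    absolute value is at most |g(z)| times the squared norm of \<open>f\<close>.\<close>
  have I: "integrable (lborel \<Otimes>\<^sub>M lborel) (\<lambda>(z, x). g z * (cnj (f (x + e *\<^sub>R z)) * f x))"
  proof (rule lborel_pair.Fubini_integrable)
    show "integrable lborel (\<lambda>z. LINT x|lborel. norm (case (z, x) of (z, x) \<Rightarrow> g z * (cnj (f (x + e *\<^sub>R z)) * f x)))"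
    proof (rule Bochner_Integration.integrable_bound)
      show "integrable lborel (\<lambda>z. g z * of_real ((L2_norm lborel f)\<^sup>2))" using g_int by simp
      show "AE z in lborel. norm (LINT x|lborel. norm (case (z, x) of (z, x) \<Rightarrow> g z * (cnj (f (x + e *\<^sub>R z)) * f x)))
          \<le> norm (g z * of_real ((L2_norm lborel f)\<^sup>2))"
      proof (rule AE_I2)
        fix z
        have "(LINT x|lborel. cmod (g z * (cnj (f (x + e *\<^sub>R z)) * f x))) = cmod (g z) * (LINT x|lborel. cmod (f (x + e *\<^sub>R z)) * cmod (f x))"
          by (simp add: norm_mult)
        also have "\<dots> \<le> cmod (g z) * (L2_norm lborel f)\<^sup>2"
          using L2_prod_norm_le[OF ft f(1), of z] L2_translate(2)[OF f(1)]
          by (intro mult_left_mono) (auto simp: power2_eq_square)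
        finally show "norm (LINT x|lborel. norm (case (z, x) of (z, x) \<Rightarrow> g z * (cnj (f (x + e *\<^sub>R z)) * f x)))
          \<le> norm (g z * of_real ((L2_norm lborel f)\<^sup>2))" by (simp add: norm_mult norm_power)
      qed
    qed measurable
  qed (use sec in auto)
  have "of_real (LINT \<xi>|lborel. (cmod (F \<xi>))\<^sup>2 * exp (- (e * norm \<xi>)\<^sup>2 / 2)) = (LINT \<xi>|lborel. F \<xi> * (cnj (F \<xi>) * E \<xi>))"
    unfolding cE[symmetric] by (rule integral_complex_of_real[symmetric])
  also have "\<dots> = (LINT \<xi>|lborel. c * ((LINT x|lborel. K x \<xi> * f x) * (cnj (F \<xi>) * E \<xi>)))"
    by (subst (1) F) (simp only: mult.assoc)
  also have "\<dots> = c * (LINT \<xi>|lborel. (LINT x|lborel. K x \<xi> * f x) * (cnj (F \<xi>) * E \<xi>))" by simp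
  also have "\<dots> = c * (LINT x|lborel. f x * (LINT \<xi>|lborel. K x \<xi> * (cnj (F \<xi>) * E \<xi>)))"
    using f FE_int by (subst Fubini_kernel[OF _ _ Km]) auto
  also have "\<dots> = c * (LINT x|lborel. LINT z|lborel. g z * (cnj (f (x + e *\<^sub>R z)) * f x))"
    unfolding inner g_def by (simp add: mult_ac flip: integral_mult_right_zero)
  also have "\<dots> = c * (LINT z|lborel. LINT x|lborel. g z * (cnj (f (x + e *\<^sub>R z)) * f x))"
    using lborel_pair.Fubini_integral[OF I] by simp
  also have "\<dots> = (LINT z|lborel. of_real ((2 * pi) powr (- real CARD('n) / 2) * exp (- (norm z)\<^sup>2 / 2)) *
           L2_inner lborel (\<lambda>x. f (x + e *\<^sub>R z)) f)"
    by (simp add: L2_inner_def c_def g_def d_def mult.assoc flip: integral_mult_right_zero)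
  finally show "of_real (LINT \<xi>|lborel. (cmod (fourier_integral f \<xi>))\<^sup>2 * exp (- (e * norm \<xi>)\<^sup>2 / 2))
      = (LINT z|lborel. of_real ((2 * pi) powr (- real CARD('n) / 2) * exp (- (norm z)\<^sup>2 / 2)) *
           L2_inner lborel (\<lambda>x. f (x + e *\<^sub>R z)) f)"
    by (simp add: F_def)
qed

text \<open>As \<open>e\<close> decreases to 0, the damped integrals increase to the integral of |F
  f|^2. The other side of \<open>plancherel_regularized\<close> averages <f(. + e z), f> against a
  normal density in z, and tends to the squared norm of \<open>f\<close> by continuity of
  translations.\<close>

lemma plancherel_integral:
  fixes f :: "real ^ 'n \<Rightarrow> complex"
  assumes f: "f \<in> L2 lborel" "integrable lborel f"
  shows "fourier_integral f \<in> L2 lborel" "L2_norm lborel (fourier_integral f) = L2_norm lborel f"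
proof -
  have [measurable]: "f \<in> borel_measurable borel" using f by auto
  define F where "F = fourier_integral f"
  have [measurable]: "F \<in> borel_measurable borel" by (simp add: F_def)
  define e where "e = (\<lambda>n. 1 / real (Suc n))"
  have e0: "e n > 0" for n by (simp add: e_def)
  have e_lim: "e \<longlonglongrightarrow> 0" unfolding e_def using LIMSEQ_Suc[OF lim_1_over_n] by simp
  define G where "G = (\<lambda>n (\<xi>::real ^ 'n). (cmod (F \<xi>))\<^sup>2 * exp (- (e n * norm \<xi>)\<^sup>2 / 2))"
  have [measurable]: "G n \<in> borel_measurable borel" for n by (simp add: G_def)
  define I where "I = (\<lambda>n. LINT \<xi>|lborel. G n \<xi>)"
  define k where "k = (\<lambda>z::real ^ 'n. complex_of_real ((2 * pi) powr (- real CARD('n) / 2) * exp (- (norm z)\<^sup>2 / 2)))"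
  have [measurable]: "k \<in> borel_measurable borel" unfolding k_def by measurable
  have k: "integrable lborel k" "(LINT z|lborel. k z) = 1"
  proof -
    have eq: "k = (\<lambda>z. of_real ((2 * pi) powr (- real CARD('n) / 2)) * (exp (- \<i> * of_real (0 \<bullet> z)) * of_real (exp (- (1 * norm z)\<^sup>2 / 2))))"
      by (simp add: k_def fun_eq_iff)
    show "integrable lborel k" unfolding eq by (intro integrable_mult_right gaussian_fourier) auto
    have "(LINT z|lborel. k z) = of_real ((2 * pi) powr (- real CARD('n) / 2)) * of_real ((2 * pi) powr (real CARD('n) / 2))"
      unfolding eq integral_mult_right_zero by (subst gaussian_fourier) auto
    also have "\<dots> = of_real ((2 * pi) powr (- real CARD('n) / 2) * (2 * pi) powr (real CARD('n) / 2))" by simp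
    also have "\<dots> = 1" by (simp flip: powr_add)
    finally show "(LINT z|lborel. k z) = 1" .
  qed
  have I_eq: "complex_of_real (I n) = (LINT z|lborel. k z * L2_inner lborel (\<lambda>x. f (x + e n *\<^sub>R z)) f)" for n
    unfolding I_def G_def F_def k_def by (rule plancherel_regularized(2)[OF f e0])
  have "(\<lambda>n. LINT z|lborel. k z * L2_inner lborel (\<lambda>x. f (x + e n *\<^sub>R z)) f) \<longlonglongrightarrow> (LINT z|lborel. k z * L2_inner lborel f f)"
  proof (rule integral_dominated_convergence)
    show "integrable lborel (\<lambda>z. cmod (k z) * (L2_norm lborel f)\<^sup>2)" using k by simp
    show "(\<lambda>z. k z * L2_inner lborel (\<lambda>x. f (x + e n *\<^sub>R z)) f) \<in> borel_measurable lborel" for n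
      unfolding L2_inner_def by measurable
    show "AE z in lborel. (\<lambda>n. k z * L2_inner lborel (\<lambda>x. f (x + e n *\<^sub>R z)) f) \<longlonglongrightarrow> k z * L2_inner lborel f f"
    proof (intro AE_I2 tendsto_mult tendsto_const L2_tendsto_inner f L2_translate_continuous)
      show "(\<lambda>n. e n *\<^sub>R z) \<longlonglongrightarrow> 0" for z :: "real ^ 'n"
        using tendsto_scaleR[OF e_lim tendsto_const[of z]] by simp
    qed
    show "AE z in lborel. norm (k z * L2_inner lborel (\<lambda>x. f (x + e n *\<^sub>R z)) f) \<le> cmod (k z) * (L2_norm lborel f)\<^sup>2" for n
    proof (rule AE_I2)
      fix z
      have "cmod (L2_inner lborel (\<lambda>x. f (x + e n *\<^sub>R z)) f) \<le> (L2_norm lborel f)\<^sup>2"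
        using L2_Cauchy_Schwarz[OF L2_translate(1)[OF f(1)] f(1)] L2_translate(2)[OF f(1)]
        by (simp add: power2_eq_square)
      then show "norm (k z * L2_inner lborel (\<lambda>x. f (x + e n *\<^sub>R z)) f) \<le> cmod (k z) * (L2_norm lborel f)\<^sup>2"
        by (simp add: norm_mult mult_left_mono)
    qed
  qed measurable
  then have "(\<lambda>n. complex_of_real (I n)) \<longlonglongrightarrow> of_real ((L2_norm lborel f)\<^sup>2)"
    using k by (simp add: I_eq L2_inner_self)
  then have I_lim: "I \<longlonglongrightarrow> (L2_norm lborel f)\<^sup>2" by (simp only: tendsto_of_real_iff)
  have nnG: "(\<integral>\<^sup>+\<xi>. ennreal (G n \<xi>) \<partial>lborel) = ennreal (I n)" for n
    unfolding I_def G_def F_def by (intro nn_integral_eq_integral plancherel_regularized(1)[OF f e0]) auto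
  have inc: "incseq (\<lambda>n \<xi>. ennreal (G n \<xi>))"
  proof (intro incseq_SucI le_funI ennreal_leI)
    fix n and \<xi> :: "real ^ 'n"
    have "e (Suc n) \<le> e n" by (simp add: e_def frac_le)
    then have "e (Suc n) * norm \<xi> \<le> e n * norm \<xi>" by (intro mult_right_mono) auto
    then have "(e (Suc n) * norm \<xi>)\<^sup>2 \<le> (e n * norm \<xi>)\<^sup>2" using e0[of "Suc n"] by (intro power_mono) auto
    then show "G n \<xi> \<le> G (Suc n) \<xi>" unfolding G_def by (intro mult_left_mono) auto
  qed
  have "(\<integral>\<^sup>+\<xi>. ennreal ((cmod (F \<xi>))\<^sup>2) \<partial>lborel) = (\<integral>\<^sup>+\<xi>. (SUP n. ennreal (G n \<xi>)) \<partial>lborel)"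
  proof (rule nn_integral_cong)
    fix \<xi>
    have "(\<lambda>n. G n \<xi>) \<longlonglongrightarrow> (cmod (F \<xi>))\<^sup>2 * exp (- (0 * norm \<xi>)\<^sup>2 / 2)"
      unfolding G_def by (intro tendsto_intros e_lim) simp
    then have "(\<lambda>n. ennreal (G n \<xi>)) \<longlonglongrightarrow> ennreal ((cmod (F \<xi>))\<^sup>2)" by (intro tendsto_ennrealI) simp
    moreover have "(\<lambda>n. ennreal (G n \<xi>)) \<longlonglongrightarrow> (SUP n. ennreal (G n \<xi>))"
      using inc by (intro LIMSEQ_SUP) (auto simp: incseq_def le_fun_def)
    ultimately show "ennreal ((cmod (F \<xi>))\<^sup>2) = (SUP n. ennreal (G n \<xi>))" by (rule LIMSEQ_unique)
  qed
  also have "\<dots> = (SUP n. ennreal (I n))"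
    unfolding nnG[symmetric] by (rule nn_integral_monotone_convergence_SUP[OF inc]) measurable
  also have "\<dots> = ennreal ((L2_norm lborel f)\<^sup>2)"
  proof (rule LIMSEQ_unique)
    have "incseq (\<lambda>n. ennreal (I n))"
      unfolding nnG[symmetric] using inc
      by (intro incseq_SucI nn_integral_mono) (auto simp: incseq_Suc_iff le_fun_def)
    then show "(\<lambda>n. ennreal (I n)) \<longlonglongrightarrow> (SUP n. ennreal (I n))" by (rule LIMSEQ_SUP)
    show "(\<lambda>n. ennreal (I n)) \<longlonglongrightarrow> ennreal ((L2_norm lborel f)\<^sup>2)" using I_lim by (rule tendsto_ennrealI)
  qed
  finally have nn: "(\<integral>\<^sup>+\<xi>. ennreal ((cmod (F \<xi>))\<^sup>2) \<partial>lborel) = ennreal ((L2_norm lborel f)\<^sup>2)" .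
  then have F: "F \<in> L2 lborel" by (subst L2_iff_nn_integral) auto
  then have "(L2_norm lborel F)\<^sup>2 = (L2_norm lborel f)\<^sup>2" using nn L2_nn_integral[OF F] by simp
  then have "L2_norm lborel F = L2_norm lborel f" by simp
  then show "fourier_integral f \<in> L2 lborel" "L2_norm lborel (fourier_integral f) = L2_norm lborel f"
    using F by (auto simp: F_def)
qed

text \<open>Polarisation: the norm of f + g determines the real part, and replacing f by i f
  determines the imaginary part. Additivity and homogeneity hold only almost everywhere, which is
  enough for norms.\<close>

lemma isometry_preserves_inner:
  assumes A: "\<And>f. f \<in> L2 M \<Longrightarrow> A f \<in> L2 N" "\<And>f. f \<in> L2 M \<Longrightarrow> L2_norm N (A f) = L2_norm M f"
    and add: "\<And>f g. f \<in> L2 M \<Longrightarrow> g \<in> L2 M \<Longrightarrow> AE x in N. A (f + g) x = A f x + A g x"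
    and cmult: "\<And>c f. f \<in> L2 M \<Longrightarrow> AE x in N. A (\<lambda>y. c * f y) x = c * A f x"
    and fg: "f \<in> L2 M" "g \<in> L2 M"
  shows "L2_inner N (A f) (A g) = L2_inner M f g"
proof -
  have Re: "L2_ip N (A f) (A g) = L2_ip M f g" if f: "f \<in> L2 M" for f
  proof -
    have s: "f + g \<in> L2 M" using f fg by simp
    have "L2_norm N (A (f + g)) = L2_norm N (A f + A g)"
      using L2_norm_cong_AE[of "A (f + g)" N "A f + A g"] add[OF f fg(2)] A(1)[OF s]
        L2.S_closed(2)[OF A(1)[OF f] A(1)[OF fg(2)]]
      by (auto dest: L2_measurable)
    then have "L2_norm N (A f + A g) = L2_norm M (f + g)" using A(2)[OF s] by simp
    then have "(L2_norm N (A f + A g))\<^sup>2 = (L2_norm M (f + g))\<^sup>2" by simp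
    moreover have "(L2_norm N (A f + A g))\<^sup>2 = (L2_norm N (A f))\<^sup>2 + 2 * L2_ip N (A f) (A g) + (L2_norm N (A g))\<^sup>2"
      using A(1)[OF f] A(1)[OF fg(2)] L2.ip_commute[of "A g" N "A f"] by (simp add: L2.nrm_sq L2.ip_simps)
    moreover have "(L2_norm M (f + g))\<^sup>2 = (L2_norm M f)\<^sup>2 + 2 * L2_ip M f g + (L2_norm M g)\<^sup>2"
      using f fg L2.ip_commute[of g M f] by (simp add: L2.nrm_sq L2.ip_simps)
    ultimately show ?thesis using A(2)[OF f] A(2)[OF fg(2)] by simp
  qed
  have if_L2: "(\<lambda>x. \<i> * f x) \<in> L2 M" using fg(1) by (rule L2_cmult)
  have "L2_ip N (\<lambda>x. \<i> * A f x) (A g) = L2_ip N (A (\<lambda>x. \<i> * f x)) (A g)"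
    unfolding L2_ip_def
    using cmult[OF fg(1), of \<i>] A(1)[OF if_L2] A(1)[OF fg(2)] L2_cmult[OF A(1)[OF fg(1)], of \<i>]
    by (intro arg_cong[where f=Re] L2_inner_cong_AE) (auto dest: L2_measurable)
  also have "\<dots> = L2_ip M (\<lambda>x. \<i> * f x) g" by (rule Re[OF if_L2])
  finally have "Im (L2_inner N (A f) (A g)) = Im (L2_inner M f g)" by (simp add: L2_ip_imag)
  moreover have "Re (L2_inner N (A f) (A g)) = Re (L2_inner M f g)"
    using Re[OF fg(1)] by (simp add: L2_ip_def)
  ultimately show ?thesis by (simp add: complex_eq_iff)
qed

definition unitary_L2 :: "'a measure \<Rightarrow> 'b measure \<Rightarrow> (('a \<Rightarrow> complex) \<Rightarrow> 'b \<Rightarrow> complex) \<Rightarrow> bool" where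
  "unitary_L2 M N A \<longleftrightarrow> (\<forall>f\<in>L2 M. A f \<in> L2 N) \<and>
     (\<forall>f\<in>L2 M. \<forall>g\<in>L2 M. L2_inner N (A f) (A g) = L2_inner M f g) \<and>
     (\<forall>w\<in>L2 N. \<exists>f\<in>L2 M. AE x in N. A f x = w x)"

lemma L2_tendsto_cnj:
  assumes "L2_tendsto M F s f"
  shows "L2_tendsto M F (\<lambda>i x. cnj (s i x)) (\<lambda>x. cnj (f x))"
proof -
  have "L2_norm M (\<lambda>x. cnj (s i x) - cnj (f x)) = L2_norm M (\<lambda>x. s i x - f x)" for i
    using L2_norm_cnj[of M "\<lambda>x. s i x - f x"] by simp
  then show ?thesis
    using assms by (auto simp: L2_tendsto_def L2_cnj elim: eventually_mono)
qed

section \<open>The Fourier transform on all of L2\<close>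

lemma L2_cut_integrable:
  fixes f :: "'a::euclidean_space \<Rightarrow> complex"
  assumes f: "f \<in> L2 lborel"
  shows "integrable lborel (\<lambda>x. indicator (ball 0 R) x * f x)"
proof (rule Bochner_Integration.integrable_bound)
  have [measurable]: "f \<in> borel_measurable borel" "ball 0 R \<in> sets (borel :: 'a measure)"
    using L2_measurable[OF f] by auto
  show "integrable lborel (\<lambda>x. indicator (ball 0 R) x + (cmod (f x))\<^sup>2)"
    using L2_integrable[OF f] emeasure_bounded_finite[of "ball 0 R :: 'a set"] by auto
  show "AE x in lborel. norm (indicator (ball 0 R) x * f x) \<le> norm (indicator (ball 0 R) x + (cmod (f x))\<^sup>2)"
  proof (rule AE_I2)
    fix x
    have "2 * cmod (f x) \<le> 1 + (cmod (f x))\<^sup>2"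
      using sum_squares_ge_zero[of "cmod (f x) - 1" 0] by (simp add: power2_eq_square algebra_simps)
    then have "cmod (f x) \<le> 1 + (cmod (f x))\<^sup>2" using norm_ge_zero[of "f x"] by linarith
    then show "norm (indicator (ball 0 R) x * f x) \<le> norm (indicator (ball 0 R) x + (cmod (f x))\<^sup>2)"
      by (auto simp: indicator_def)
  qed
  show "(\<lambda>x. indicator (ball 0 R) x * f x) \<in> borel_measurable lborel" by measurable
qed

lemma L2_cut:
  fixes f :: "'a::euclidean_space \<Rightarrow> complex"
  assumes f: "f \<in> L2 lborel"
  shows "(\<lambda>x. indicator (ball 0 R) x * f x) \<in> L2 lborel"
  by (rule L2_bounded_mult(1)[OF f, of _ 1]) (auto simp: indicator_def)

lemma L2_cut_tendsto:
  fixes f :: "'a::euclidean_space \<Rightarrow> complex"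
  assumes f: "f \<in> L2 lborel"
  shows "L2_tendsto lborel at_top (\<lambda>R x. indicator (ball 0 R) x * f x) f"
proof -
  have [measurable]: "f \<in> borel_measurable borel" "ball 0 R \<in> sets (borel :: 'a measure)" for R
    using L2_measurable[OF f] by auto
  let ?s = "\<lambda>R x. indicator (ball 0 R) x * f x"
  have seq: "L2_tendsto lborel sequentially (\<lambda>n. ?s (real n)) f"
  proof (rule L2_dominated_convergence[OF _ _ f])
    show "AE x in lborel. (\<lambda>n. ?s (real n) x) \<longlonglongrightarrow> f x"
    proof (rule AE_I2)
      fix x :: 'a
      obtain n :: nat where n: "norm x < real n" using reals_Archimedean2 by blast
      have "\<forall>\<^sub>F i in sequentially. ?s (real i) x = f x"
        using n by (intro eventually_sequentiallyI[of n]) (auto simp: indicator_def)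
      then show "(\<lambda>n. ?s (real n) x) \<longlonglongrightarrow> f x" by (rule tendsto_eventually)
    qed
    show "AE x in lborel. cmod (?s (real n) x) \<le> cmod (f x)" for n
      by (auto simp: indicator_def)
  qed measurable
  have "((\<lambda>R. L2_norm lborel (?s R - f)) \<longlongrightarrow> 0) at_top"
    unfolding tendsto_iff
  proof (intro allI impI)
    fix e :: real assume "e > 0"
    then obtain n where n: "L2_norm lborel (?s (real n) - f) < e"
      using seq unfolding L2_tendsto_alt by (metis (no_types, lifting) LIMSEQ_D abs_less_iff diff_zero le_refl real_norm_def)
    \<comment> \<open>The distance to \<open>f\<close> decreases as the radius grows; this carries
      convergence from integer radii over to all radii.\<close>
    have "L2_norm lborel (?s R - f) \<le> L2_norm lborel (?s (real n) - f)" if "R \<ge> real n" for R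
    proof -
      have "AE x in lborel. cmod ((?s R - f) x) \<le> 1 * cmod ((?s (real n) - f) x)"
        using that by (auto simp: indicator_def)
      moreover have "?s (real n) - f \<in> L2 lborel" "?s R - f \<in> L2 lborel"
        using L2.S_closed(3)[OF L2_cut[OF f] f] by auto
      ultimately show ?thesis
        using L2_dominated(2)[of "?s (real n) - f" lborel "?s R - f" 1] by (auto dest: L2_measurable)
    qed
    then show "\<forall>\<^sub>F R in at_top. dist (L2_norm lborel (?s R - f)) 0 < e"
      using n by (intro eventually_mono[OF eventually_ge_at_top[of "real n"]]) fastforce
  qed
  then show ?thesis using f L2_cut[OF f] by (auto simp: L2_tendsto_alt)
qed

lemma fourier_integral_add:
  assumes "integrable lborel f" "integrable lborel g"
  shows "fourier_integral (f + g) = fourier_integral f + fourier_integral g"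
proof
  fix \<xi>
  show "fourier_integral (f + g) \<xi> = (fourier_integral f + fourier_integral g) \<xi>"
    using exp_kernel_integrable[OF assms(1), of \<xi>] exp_kernel_integrable[OF assms(2), of \<xi>]
    by (simp add: fourier_integral_def distrib_left)
qed

lemma fourier_integral_cmult:
  "fourier_integral (\<lambda>x. c * f x) = (\<lambda>\<xi>. c * fourier_integral f \<xi>)"
  by (simp add: fourier_integral_def mult.left_commute fun_eq_iff)

lemma fourier_integral_diff:
  assumes "integrable lborel f" "integrable lborel g"
  shows "fourier_integral (f - g) = fourier_integral f - fourier_integral g"
proof
  fix \<xi>
  show "fourier_integral (f - g) \<xi> = (fourier_integral f - fourier_integral g) \<xi>"
    using exp_kernel_integrable[OF assms(1), of \<xi>] exp_kernel_integrable[OF assms(2), of \<xi>]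
    by (simp add: fourier_integral_def right_diff_distrib)
qed

lemma fourier_def':
  "fourier f = L2_lim lborel at_top (\<lambda>R. fourier_integral (\<lambda>x. indicator (ball 0 R) x * f x))"
  unfolding fourier_def fourier_integral_def by (simp only: mult.left_commute)

text \<open>The choice in \<open>L2_lim\<close> is made from a non-empty set: the cut-offs of
  \<open>f\<close> converge, and their Fourier integrals have the same mutual distances.\<close>

lemma fourier_tendsto:
  assumes f: "f \<in> L2 lborel"
  shows "L2_tendsto lborel at_top (\<lambda>R. fourier_integral (\<lambda>x. indicator (ball 0 R) x * f x)) (fourier f)"
  unfolding fourier_def'
proof (rule L2_lim_tendsto, rule L2_tendsto_isometric[OF _ L2_cut_tendsto[OF f]])
  let ?s = "\<lambda>R x. indicator (ball 0 R) x * f x"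
  show "fourier_integral (?s R) \<in> L2 lborel" for R
    by (rule plancherel_integral(1)[OF L2_cut[OF f] L2_cut_integrable[OF f]])
  show "L2_norm lborel (fourier_integral (?s R) - fourier_integral (?s R')) = L2_norm lborel (?s R - ?s R')" for R R'
  proof -
    have int: "integrable lborel (?s R - ?s R')"
      using L2_cut_integrable[OF f] by (simp add: fun_diff_def)
    show ?thesis
      unfolding fourier_integral_diff[OF L2_cut_integrable[OF f] L2_cut_integrable[OF f], symmetric]
      by (rule plancherel_integral(2)[OF L2.S_closed(3)[OF L2_cut[OF f] L2_cut[OF f]] int])
  qed
qed auto

lemma fourier_L2: "f \<in> L2 lborel \<Longrightarrow> fourier f \<in> L2 lborel"
  using fourier_tendsto by (auto simp: L2_tendsto_def)

lemma fourier_norm: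
  assumes f: "f \<in> L2 lborel"
  shows "L2_norm lborel (fourier f) = L2_norm lborel f"
proof -
  let ?s = "\<lambda>R x. indicator (ball 0 R) x * f x"
  have "L2_norm lborel (fourier_integral (?s R)) = L2_norm lborel (?s R)" for R
    by (rule plancherel_integral(2)[OF L2_cut[OF f] L2_cut_integrable[OF f]])
  then have "((\<lambda>R. L2_norm lborel (?s R)) \<longlongrightarrow> L2_norm lborel (fourier f)) at_top"
    using L2_tendsto_norm[OF fourier_tendsto[OF f]] by simp
  then show ?thesis
    using L2_tendsto_norm[OF L2_cut_tendsto[OF f]] by (rule tendsto_unique[rotated]) auto
qed

lemma fourier_add:
  assumes f: "f \<in> L2 lborel" "g \<in> L2 lborel"
  shows "AE x in lborel. fourier (f + g) x = fourier f x + fourier g x"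
proof -
  have "L2_tendsto lborel at_top (\<lambda>R. fourier_integral (\<lambda>x. indicator (ball 0 R) x * (f + g) x)) (fourier f + fourier g)"
  proof -
    have "(\<lambda>x. indicator (ball 0 R) x * (f + g) x) = (\<lambda>x. indicator (ball 0 R) x * f x) + (\<lambda>x. indicator (ball 0 R) x * g x)" for R
      by (auto simp: fun_eq_iff distrib_left)
    then show ?thesis
      using L2_tendsto_add[OF fourier_tendsto[OF f(1)] fourier_tendsto[OF f(2)]]
      by (simp only: fourier_integral_add[OF L2_cut_integrable[OF f(1)] L2_cut_integrable[OF f(2)]])
  qed
  from L2_tendsto_unique[OF _ fourier_tendsto[OF L2_add[OF f]] this] show ?thesis by simp
qed

lemma fourier_cmult:
  assumes f: "f \<in> L2 lborel"
  shows "AE x in lborel. fourier (\<lambda>y. c * f y) x = c * fourier f x"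
proof -
  have "L2_tendsto lborel at_top (\<lambda>R. fourier_integral (\<lambda>x. indicator (ball 0 R) x * (c * f x))) (\<lambda>x. c * fourier f x)"
  proof -
    have "(\<lambda>x. indicator (ball 0 R) x * (c * f x)) = (\<lambda>x. c * (indicator (ball 0 R) x * f x))" for R
      by (auto simp: fun_eq_iff)
    then show ?thesis
      using L2_tendsto_cmult[OF fourier_tendsto[OF f], of c] by (simp only: fourier_integral_cmult)
  qed
  from L2_tendsto_unique[OF _ fourier_tendsto[OF L2_cmult[OF f]] this] show ?thesis by simp
qed

lemma fourier_inner:
  assumes "f \<in> L2 lborel" "g \<in> L2 lborel"
  shows "L2_inner lborel (fourier f) (fourier g) = L2_inner lborel f g"
  by (rule isometry_preserves_inner[OF fourier_L2 fourier_norm fourier_add fourier_cmult assms])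

lemma fourier_eq_integral:
  assumes f: "f \<in> L2 lborel" "integrable lborel f"
  shows "AE \<xi> in lborel. fourier f \<xi> = fourier_integral f \<xi>"
proof -
  let ?s = "\<lambda>R x. indicator (ball 0 R) x * f x"
  have fi: "fourier_integral f \<in> L2 lborel" by (rule plancherel_integral(1)[OF f])
  have si: "fourier_integral (?s R) \<in> L2 lborel" for R
    by (rule plancherel_integral(1)[OF L2_cut[OF f(1)] L2_cut_integrable[OF f(1)]])
  have "L2_norm lborel (fourier_integral (?s R) - fourier_integral f) = L2_norm lborel (?s R - f)" for R
  proof -
    have "integrable lborel (?s R - f)" using L2_cut_integrable[OF f(1)] f(2) by (simp add: fun_diff_def)
    then show ?thesis
      using plancherel_integral(2)[OF L2.S_closed(3)[OF L2_cut[OF f(1)] f(1)]]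
        fourier_integral_diff[OF L2_cut_integrable[OF f(1)] f(2)] by simp
  qed
  then have "L2_tendsto lborel at_top (\<lambda>R. fourier_integral (?s R)) (fourier_integral f)"
    using L2_cut_tendsto[OF f(1)] si fi by (simp add: L2_tendsto_alt)
  from L2_tendsto_unique[OF _ fourier_tendsto[OF f(1)] this] show ?thesis by simp
qed

text \<open>The multiplication formula. The kernel is symmetric in x and \<xi>, and Fubini exchanges
  the two integrations.\<close>

lemma fourier_integral_symmetric:
  assumes f: "integrable lborel f" and g: "integrable lborel g"
  shows "(LINT \<xi>|lborel. fourier_integral f \<xi> * g \<xi>) = (LINT x|lborel. f x * fourier_integral g x)"
proof -
  let ?K = "\<lambda>x \<xi>. exp (- \<i> * complex_of_real (x \<bullet> \<xi>))"
  have "(LINT \<xi>|lborel. (LINT x|lborel. ?K x \<xi> * f x) * g \<xi>) = (LINT x|lborel. f x * (LINT \<xi>|lborel. ?K x \<xi> * g \<xi>))"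
    by (rule Fubini_kernel[OF f g exp_kernel_measurable]) simp
  note sym = this
  define c where "c = complex_of_real ((2 * pi) powr (- real CARD('a) / 2))"
  have 1: "fourier_integral f \<xi> * g \<xi> = c * ((LINT x|lborel. ?K x \<xi> * f x) * g \<xi>)" for \<xi>
    by (simp add: fourier_integral_def c_def)
  have 2: "f x * fourier_integral g x = c * (f x * (LINT \<xi>|lborel. ?K x \<xi> * g \<xi>))" for x
    by (simp add: fourier_integral_def c_def inner_commute[of x])
  show ?thesis unfolding 1 2 integral_mult_right_zero sym ..
qed

lemma fourier_symmetric:
  assumes f: "f \<in> L2 lborel" and g: "g \<in> L2 lborel"
  shows "(LINT \<xi>|lborel. fourier f \<xi> * g \<xi>) = (LINT x|lborel. f x * fourier g x)"
proof -
  define B where "B = (\<lambda>f g. L2_inner lborel (\<lambda>x. cnj (f x)) (g :: real ^ 'a \<Rightarrow> complex))"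
  have B: "B f g = (LINT x|lborel. f x * g x)" for f g by (simp add: B_def L2_inner_def)
  have B_left: "((\<lambda>R. B (s R) g) \<longlongrightarrow> B f g) at_top" if "L2_tendsto lborel at_top s f" "g \<in> L2 lborel" for s f g and R :: real
    unfolding B_def by (rule L2_tendsto_inner[OF L2_tendsto_cnj[OF that(1)] that(2)])
  have B_right: "((\<lambda>R. B g (s R)) \<longlongrightarrow> B g f) at_top" if "L2_tendsto lborel at_top s f" "g \<in> L2 lborel" for s f g and R :: real
    unfolding B_def by (rule L2_tendsto_inner_right[OF that(1) L2_cnj[OF that(2)]])
  let ?s = "\<lambda>f R x. indicator (ball 0 R) x * f x"
  have 1: "B (fourier_integral (?s f R)) (?s g R') = B (?s f R) (fourier_integral (?s g R'))" for R R'
    unfolding B by (rule fourier_integral_symmetric[OF L2_cut_integrable[OF f] L2_cut_integrable[OF g]])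
  have 2: "B (fourier f) (?s g R') = B f (fourier_integral (?s g R'))" for R'
  \<comment> \<open>The cut-offs are removed one argument at a time, as each limit fixes the other
    argument in L2.\<close>
  proof (rule tendsto_unique)
    show "((\<lambda>R. B (fourier_integral (?s f R)) (?s g R')) \<longlongrightarrow> B (fourier f) (?s g R')) at_top"
      by (rule B_left[OF fourier_tendsto[OF f] L2_cut[OF g]])
    show "((\<lambda>R. B (fourier_integral (?s f R)) (?s g R')) \<longlongrightarrow> B f (fourier_integral (?s g R'))) at_top"
      unfolding 1
      by (rule B_left[OF L2_cut_tendsto[OF f] plancherel_integral(1)[OF L2_cut[OF g] L2_cut_integrable[OF g]]])
  qed auto
  have "B (fourier f) g = B f (fourier g)"
  proof (rule tendsto_unique)
    show "((\<lambda>R. B (fourier f) (?s g R)) \<longlongrightarrow> B (fourier f) g) at_top"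
      by (rule B_right[OF L2_cut_tendsto[OF g] fourier_L2[OF f]])
    show "((\<lambda>R. B (fourier f) (?s g R)) \<longlongrightarrow> B f (fourier g)) at_top"
      unfolding 2 by (rule B_right[OF fourier_tendsto[OF g] f])
  qed auto
  then show ?thesis by (simp add: B)
qed

text \<open>The candidate \<open>y\<close> is the inverse transform, written as the conjugate of the
  transform of the conjugate. The multiplication formula gives <w, F y> = |y|^2 = |w|^2, and since
  |F y| = |y| the expansion of |F y - w|^2 vanishes.\<close>

lemma fourier_surj:
  assumes w: "w \<in> L2 lborel"
  shows "\<exists>f\<in>L2 lborel. AE \<xi> in lborel. fourier f \<xi> = w \<xi>"
proof
  define y where "y = (\<lambda>x. cnj (fourier (\<lambda>z. cnj (w z)) x))"
  have cw: "(\<lambda>z. cnj (w z)) \<in> L2 lborel" using w by (rule L2_cnj)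
  show y: "y \<in> L2 lborel" unfolding y_def by (rule L2_cnj[OF fourier_L2[OF cw]])
  have ny: "L2_norm lborel y = L2_norm lborel w"
    unfolding y_def by (simp add: L2_norm_cnj fourier_norm[OF cw])
  have Fy: "fourier y \<in> L2 lborel" by (rule fourier_L2[OF y])
  have "L2_inner lborel w (fourier y) = (LINT x|lborel. fourier (\<lambda>z. cnj (w z)) x * y x)"
    unfolding L2_inner_def by (rule fourier_symmetric[OF cw y, symmetric])
  also have "\<dots> = L2_inner lborel y y" by (simp add: L2_inner_def y_def)
  finally have "L2_ip lborel w (fourier y) = (L2_norm lborel w)\<^sup>2"
    by (simp add: L2_ip_def L2_inner_self ny)
  moreover have "(L2_norm lborel (fourier y - w))\<^sup>2
      = (L2_norm lborel (fourier y))\<^sup>2 - 2 * L2_ip lborel w (fourier y) + (L2_norm lborel w)\<^sup>2"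
    using Fy w L2.ip_commute[OF Fy w] by (simp only: L2.nrm_sq L2.S_closed L2.ip_simps)
  ultimately have "L2_norm lborel (fourier y - w) = 0"
    using fourier_norm[OF y] ny by simp
  then show "AE \<xi> in lborel. fourier y \<xi> = w \<xi>" using L2_norm_diff_eq_0_iff[OF Fy w] by simp
qed

lemma unitary_fourier: "unitary_L2 lborel lborel fourier"
  unfolding unitary_L2_def using fourier_L2 fourier_inner fourier_surj by blast

section \<open>The discrete Fourier transform\<close>

lemma cube_eq_cbox: "cube r = cbox (\<chi> i. - r) (\<chi> i. r)"
  by (auto simp: cube_def mem_box_cart)

lemma cube_sets [measurable, simp]: "cube r \<in> sets borel"
  by (simp add: cube_eq_cbox)

lemma emeasure_cube_finite: "emeasure lborel (cube r) < \<infinity>"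
  using emeasure_bounded_finite[OF bounded_cbox] by (simp add: cube_eq_cbox less_top)

lemma torus_measurable_iff:
  "(f :: _ \<Rightarrow> complex) \<in> borel_measurable (torus h) \<longleftrightarrow> (\<lambda>\<xi>. indicator (cube (pi / h)) \<xi> * f \<xi>) \<in> borel_measurable lborel"
proof -
  have "(\<lambda>\<xi>. indicator (cube (pi / h)) \<xi> *\<^sub>R f \<xi>) = (\<lambda>\<xi>. indicator (cube (pi / h)) \<xi> * f \<xi>)"
    by (rule ext) (simp add: indicator_def)
  then show ?thesis
    unfolding torus_def by (subst borel_measurable_restrict_space_iff) simp_all
qed

lemma torus_AE_iff: "(AE \<xi> in torus h. P \<xi>) \<longleftrightarrow> (AE \<xi> in lborel. \<xi> \<in> cube (pi / h) \<longrightarrow> P \<xi>)"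
  unfolding torus_def by (rule AE_restrict_space_iff) simp

text \<open>Functions on the torus are handled as functions on the whole space times the indicator
  of the cube; there they can be compared with Fourier transforms.\<close>

lemma torus_L2_iff: "f \<in> L2 (torus h) \<longleftrightarrow> (\<lambda>\<xi>. indicator (cube (pi / h)) \<xi> * f \<xi>) \<in> L2 lborel"
proof -
  have "integrable (torus h) (\<lambda>\<xi>. (cmod (f \<xi>))\<^sup>2) \<longleftrightarrow> integrable lborel (\<lambda>\<xi>. (cmod (indicator (cube (pi / h)) \<xi> * f \<xi>))\<^sup>2)"
    unfolding torus_def by (subst integrable_restrict_space) (auto intro!: arg_cong[where f="integrable lborel"] simp: indicator_def)
  then show ?thesis by (simp add: L2_def torus_measurable_iff)
qed

lemma torus_inner:
  "L2_inner (torus h) f g = L2_inner lborel (\<lambda>\<xi>. indicator (cube (pi / h)) \<xi> * f \<xi>) (\<lambda>\<xi>. indicator (cube (pi / h)) \<xi> * g \<xi>)"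
  unfolding L2_inner_def torus_def
  by (subst integral_restrict_space) (auto intro!: Bochner_Integration.integral_cong simp: indicator_def)

lemma torus_norm:
  "L2_norm (torus h) f = L2_norm lborel (\<lambda>\<xi>. indicator (cube (pi / h)) \<xi> * f \<xi>)"
  unfolding L2_norm_def torus_def
  by (subst integral_restrict_space) (auto intro!: Bochner_Integration.integral_cong arg_cong[where f=sqrt] simp: indicator_def)

lemma L2_cube: 
  assumes "f \<in> L2 lborel"
  shows "(\<lambda>\<xi>. indicator (cube r) \<xi> * f \<xi>) \<in> L2 lborel"
    "L2_norm lborel (\<lambda>\<xi>. indicator (cube r) \<xi> * f \<xi>) \<le> L2_norm lborel f"
  using L2_bounded_mult[OF assms, of "\<lambda>\<xi>. indicator (cube r) \<xi>" 1] by (auto simp: indicator_def)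

lemma L2_lborel_torus: "f \<in> L2 lborel \<Longrightarrow> f \<in> L2 (torus h)"
  by (simp add: torus_L2_iff L2_cube)

text \<open>The discrete transform of the unit vector at \<open>n\<close>, see
  \<open>dft_delta\<close>.\<close>

definition lattice_wave :: "real \<Rightarrow> int ^ 'n \<Rightarrow> real ^ 'n \<Rightarrow> complex" where
  "lattice_wave h n \<xi> = of_real (h ^ CARD('n) / (2 * pi) powr (real CARD('n) / 2)) *
     exp (- \<i> * of_real (h * (zvec n \<bullet> \<xi>)))"

lemma zvec_diff: "zvec (m - n) = zvec m - zvec n"
  by (simp add: zvec_def vec_eq_iff)

lemma lattice_wave_measurable [measurable]: "lattice_wave h n \<in> borel_measurable borel"
  unfolding lattice_wave_def[abs_def] by measurable

lemma lattice_wave_L2: "lattice_wave h n \<in> L2 (torus h)"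
proof -
  define B where "B = cmod (of_real (h ^ CARD('a) / (2 * pi) powr (real CARD('a) / 2)))"
  have "(\<lambda>\<xi>. indicator (cube (pi / h)) \<xi> :: complex) \<in> L2 lborel"
    by (rule L2_indicator[OF _ emeasure_cube_finite]) simp
  moreover have "cmod (lattice_wave h n \<xi>) \<le> B" for \<xi>
    unfolding lattice_wave_def norm_mult B_def by (simp add: norm_exp_eq_Re)
  ultimately have "(\<lambda>\<xi>. lattice_wave h n \<xi> * indicator (cube (pi / h)) \<xi>) \<in> L2 lborel"
    by (intro L2_bounded_mult(1)[of _ _ _ B]) (auto simp: B_def)
  then show ?thesis by (simp add: torus_L2_iff mult.commute)
qed

lemma integral_exp_interval:
  fixes h :: real and j :: int
  assumes h: "h > 0"
  defines "f \<equiv> \<lambda>x. indicator {- pi / h..pi / h} x * exp (- \<i> * of_real (h * of_int j * x))"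
  shows "integrable lborel f" "(LINT x|lborel. f x) = (if j = 0 then of_real (2 * pi / h) else 0)"
proof -
  define c where "c = - \<i> * complex_of_real (h * of_int j)"
  define p where "p = pi / h"
  have p: "- p \<le> p" using h by (simp add: p_def)
  have f: "f = (\<lambda>x. indicator {- p..p} x *\<^sub>R exp (c * of_real x))"
    by (auto simp: f_def c_def p_def indicator_def fun_eq_iff mult.assoc)
  have cont: "continuous_on {- p..p} (\<lambda>x. exp (c * of_real x))" by (intro continuous_intros)
  show int: "integrable lborel f"
    unfolding f using borel_integrable_compact[OF _ cont] by auto
  show "(LINT x|lborel. f x) = (if j = 0 then of_real (2 * pi / h) else 0)"
  proof (cases "j = 0")
    case True
    have "(LINT x|lborel. f x) = of_real p - of_real (- p)"
      unfolding f
    proof (rule integral_FTC_Icc[OF p])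
      show "(of_real has_vector_derivative exp (c * of_real x)) (at x within {- p..p})" for x
        using has_vector_derivative_of_real[OF DERIV_ident, of "at x within {- p..p}"] True
        by (simp add: c_def)
    qed (rule cont)
    then show ?thesis using True by (simp add: p_def)
  next
    case False
    then have c0: "c \<noteq> 0" using h by (simp add: c_def)
    have "(LINT x|lborel. f x) = exp (c * of_real p) / c - exp (c * of_real (- p)) / c"
      unfolding f
    proof (rule integral_FTC_Icc[OF p])
      fix x assume "- p \<le> x" "x \<le> p"
      have "((\<lambda>z. exp (c * z) / c) has_field_derivative exp (c * of_real x)) (at (of_real x))"
        using c0 by (auto intro!: derivative_eq_intros)
      then show "((\<lambda>x. exp (c * of_real x) / c) has_vector_derivative exp (c * of_real x)) (at x within {- p..p})"
        using has_vector_derivative_real_field has_vector_derivative_at_within by blast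
    qed (rule cont)
    \<comment> \<open>The exponents at the two ends differ by 2 pi i times the integer -j.\<close>
    also have "exp (c * of_real p) = exp (c * of_real (- p))"
      unfolding exp_eq by (rule exI[of _ "- j"]) (use h in \<open>simp add: c_def p_def\<close>)
    finally show ?thesis using False by simp
  qed
qed

lemma integral_exp_cube:
  fixes m :: "int ^ 'n"
  assumes h: "h > 0"
  shows "(LINT \<xi>|lborel. indicator (cube (pi / h)) \<xi> * exp (- \<i> * of_real (h * (zvec m \<bullet> \<xi>))))
    = (if m = 0 then of_real ((2 * pi / h) ^ CARD('n)) else 0)"
proof -
  define f where "f = (\<lambda>(b::real^'n) x. indicator {- pi / h..pi / h} x * exp (- \<i> * complex_of_real (h * (zvec m \<bullet> b) * x)))"
  have Basis: "b \<in> Basis \<longleftrightarrow> (\<exists>i. b = axis i 1)" for b :: "real ^ 'n"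
    by (auto simp: Basis_vec_def)
  have coord: "zvec m \<bullet> axis i 1 = of_int (m $ i)" for i by (simp add: inner_axis zvec_def)
  have f_int: "integrable lborel (f b)" if "b \<in> Basis" for b
    using that integral_exp_interval(1)[OF h] by (auto simp: Basis f_def coord)
  have f_val: "(LINT x|lborel. f (axis i 1) x) = (if m $ i = 0 then of_real (2 * pi / h) else 0)" for i
    unfolding f_def coord by (rule integral_exp_interval(2)[OF h])
  have eq: "indicator (cube (pi / h)) \<xi> * exp (- \<i> * of_real (h * (zvec m \<bullet> \<xi>))) = (\<Prod>b\<in>Basis. f b (\<xi> \<bullet> b))" for \<xi>
  proof -
    have "- \<i> * of_real (h * (zvec m \<bullet> \<xi>)) = (\<Sum>b\<in>Basis. - \<i> * complex_of_real (h * (zvec m \<bullet> b) * (\<xi> \<bullet> b)))"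
      by (subst euclidean_inner) (simp add: sum_distrib_left sum_negf mult.assoc)
    then have 1: "exp (- \<i> * of_real (h * (zvec m \<bullet> \<xi>))) = (\<Prod>b\<in>Basis. exp (- \<i> * complex_of_real (h * (zvec m \<bullet> b) * (\<xi> \<bullet> b))))"
      by (simp only: exp_sum[OF finite_Basis])
    have 2: "(indicator (cube (pi / h)) \<xi> :: complex) = (\<Prod>b\<in>Basis. indicator {- pi / h..pi / h} (\<xi> \<bullet> b))"
    proof (cases "\<xi> \<in> cube (pi / h)")
      case True
      then show ?thesis by (subst prod.neutral) (auto simp: Basis cube_def inner_axis)
    next
      case False
      then obtain i where "\<not> (- pi / h \<le> \<xi> $ i \<and> \<xi> $ i \<le> pi / h)" by (auto simp: cube_def)
      then have "(indicator {- pi / h..pi / h} (\<xi> \<bullet> axis i 1) :: complex) = 0" by (auto simp: inner_axis indicator_def)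
      then have "(\<Prod>b\<in>Basis. indicator {- pi / h..pi / h} (\<xi> \<bullet> b) :: complex) = 0"
        using Basis[of "axis i 1"] by (subst prod_zero_iff) auto
      then show ?thesis using False by simp
    qed
    show ?thesis unfolding 1 2 f_def by (simp add: prod.distrib)
  qed
  have "(LINT \<xi>|lborel. indicator (cube (pi / h)) \<xi> * exp (- \<i> * of_real (h * (zvec m \<bullet> \<xi>)))) = (\<Prod>b\<in>Basis. LINT x|lborel. f b x)"
    unfolding eq by (rule lborel_integral_prod(2)) (rule f_int)
  also have "\<dots> = (\<Prod>i\<in>UNIV. LINT x|lborel. f (axis i 1) x)"
  proof -
    have B: "Basis = (\<lambda>i. axis i (1::real)) ` (UNIV :: 'n set)" by (auto simp: Basis_vec_def)
    have inj: "inj (\<lambda>i::'n. axis i (1::real))" by (auto simp: inj_on_def axis_eq_axis)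
    show ?thesis unfolding B by (simp add: prod.reindex[OF inj])
  qed
  also have "\<dots> = (\<Prod>i\<in>UNIV. if m $ i = 0 then of_real (2 * pi / h) else 0)" by (simp only: f_val)
  also have "\<dots> = (if m = 0 then of_real ((2 * pi / h) ^ CARD('n)) else 0)"
  proof (cases "m = 0")
    case False
    then obtain i where "m $ i \<noteq> 0" by (auto simp: vec_eq_iff)
    then have "(\<Prod>i\<in>UNIV. if m $ i = 0 then complex_of_real (2 * pi / h) else 0) = 0"
      by (subst prod_zero_iff) auto
    then show ?thesis using False by simp
  qed simp
  finally show ?thesis .
qed

lemma lattice_wave_inner:
  fixes n m :: "int ^ 'n"
  assumes h: "h > 0"
  shows "L2_inner (torus h) (lattice_wave h n) (lattice_wave h m) = (if n = m then of_real (h ^ CARD('n)) else 0)"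
proof -
  define c where "c = h ^ CARD('n) / (2 * pi) powr (real CARD('n) / 2)"
  have eq: "cnj (indicator (cube (pi / h)) \<xi> * lattice_wave h n \<xi>) * (indicator (cube (pi / h)) \<xi> * lattice_wave h m \<xi>)
     = of_real (c\<^sup>2) * (indicator (cube (pi / h)) \<xi> * exp (- \<i> * of_real (h * (zvec (m - n) \<bullet> \<xi>))))" for \<xi>
  proof -
    have lw: "lattice_wave h k \<xi> = of_real c * exp (- \<i> * of_real (h * (zvec k \<bullet> \<xi>)))" for k
      by (simp only: lattice_wave_def c_def)
    have "cnj (exp (- \<i> * of_real a)) * exp (- \<i> * of_real b) = exp (- \<i> * of_real (b - a))" for a b :: real
      by (simp add: exp_cnj algebra_simps flip: exp_add)
    from this[of "h * (zvec n \<bullet> \<xi>)" "h * (zvec m \<bullet> \<xi>)"]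
    have "cnj (exp (- \<i> * of_real (h * (zvec n \<bullet> \<xi>)))) * exp (- \<i> * of_real (h * (zvec m \<bullet> \<xi>)))
        = exp (- \<i> * of_real (h * (zvec (m - n) \<bullet> \<xi>)))"
      by (simp only: zvec_diff inner_diff_left right_diff_distrib)
    then show ?thesis unfolding lw by (cases "\<xi> \<in> cube (pi / h)") (simp_all add: power2_eq_square mult_ac)
  qed
  \<comment> \<open>The volume of the cube turns the squared normalising factor into h^d, the mass
    of one lattice point.\<close>
  have "(c\<^sup>2) * (2 * pi / h) ^ CARD('n) = h ^ CARD('n)"
  proof -
    have "((2 * pi) powr (real CARD('n) / 2))\<^sup>2 = (2 * pi) ^ CARD('n)"
      unfolding power2_eq_square powr_add[symmetric] by (subst powr_realpow[symmetric]) simp_all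
    then show ?thesis using h by (simp add: c_def power_divide power2_eq_square field_simps power_mult_distrib)
  qed
  then have "complex_of_real (c\<^sup>2) * of_real ((2 * pi / h) ^ CARD('n)) = of_real (h ^ CARD('n))"
    by (simp only: of_real_mult[symmetric])
  then show ?thesis
    unfolding torus_inner unfolding L2_inner_def eq integral_mult_right_zero integral_exp_cube[OF h] by auto
qed

lemma lattice_delta_inner:
  fixes k :: "int ^ 'n"
  assumes "h > 0"
  shows "L2_inner (lattice h) (\<lambda>n. if n = k then 1 else 0) g = of_real (h ^ CARD('n)) * g k"
proof -
  have "L2_inner (lattice h) (\<lambda>n. if n = k then 1 else 0) g
      = (LINT n|count_space UNIV. indicator {k} n *\<^sub>R (of_real (h ^ CARD('n)) * g k))"
  proof -
    have "(\<lambda>n. h ^ CARD('n) *\<^sub>R (cnj (if n = k then 1 else 0) * g n))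
        = (\<lambda>n. indicator {k} n *\<^sub>R (of_real (h ^ CARD('n)) * g k))"
      by (auto simp: indicator_def scaleR_conv_of_real)
    then show ?thesis
      unfolding L2_inner_def lattice_def using assms by (subst integral_density) simp_all
  qed
  also have "\<dots> = of_real (h ^ CARD('n)) * g k" by simp
  finally show ?thesis .
qed

lemma lattice_measurable [simp]: "f \<in> borel_measurable (lattice h)"
  by (simp add: lattice_def)

lemma lattice_AE_iff: "h > 0 \<Longrightarrow> (AE n in lattice h. P n) \<longleftrightarrow> (\<forall>n :: int ^ 'n. P n)"
  unfolding lattice_def by (subst AE_density) (auto simp: AE_count_space)

lemma lattice_cut:
  assumes h: "h > 0" and u: "u \<in> L2 (lattice h)"
  shows "(\<lambda>n. indicator S n * u n) \<in> L2 (lattice h)"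
  using L2_bounded_mult(1)[OF u, of "\<lambda>n. indicator S n" 1] by (auto simp: indicator_def)

lemma lattice_cut_norm:
  fixes u :: "int ^ 'n \<Rightarrow> complex"
  assumes h: "h > 0" and S: "finite S"
  shows "(\<lambda>n. indicator S n * u n) \<in> L2 (lattice h)"
    "(L2_norm (lattice h) (\<lambda>n. indicator S n * u n))\<^sup>2 = h ^ CARD('n) * (\<Sum>n\<in>S. (cmod (u n))\<^sup>2)"
proof -
  have hs: "((\<lambda>n. (cmod (indicator S n * u n))\<^sup>2) has_sum (\<Sum>n\<in>S. (cmod (u n))\<^sup>2)) UNIV"
    by (rule has_sum_cong_neutral[THEN iffD1, rotated 3, OF has_sum_finite[OF S]]) (auto simp: indicator_def)
  show mem: "(\<lambda>n. indicator S n * u n) \<in> L2 (lattice h)"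
    using hs by (auto simp: L2_lattice_iff[OF h] summable_on_def)
  show "(L2_norm (lattice h) (\<lambda>n. indicator S n * u n))\<^sup>2 = h ^ CARD('n) * (\<Sum>n\<in>S. (cmod (u n))\<^sup>2)"
    unfolding L2_norm_lattice[OF h mem] infsumI[OF hs] using h by (simp add: sum_nonneg)
qed

lemma eventually_finite_subsets: "\<forall>\<^sub>F S in finite_subsets_at_top A. finite S"
  by (rule eventually_finite_subsets_at_top_weakI) auto

lemma lattice_cut_tendsto:
  fixes u :: "int ^ 'n \<Rightarrow> complex"
  assumes h: "h > 0" and u: "u \<in> L2 (lattice h)"
  shows "L2_tendsto (lattice h) (finite_subsets_at_top UNIV) (\<lambda>S n. indicator S n * u n) u"
  unfolding L2_tendsto_alt
proof (intro conjI u always_eventually allI lattice_cut[OF h u])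
  define a where "a = (\<lambda>n. (cmod (u n))\<^sup>2)"
  have "a summable_on UNIV" using u by (simp add: L2_lattice_iff[OF h] a_def)
  then have lim: "(sum a \<longlongrightarrow> infsum a UNIV) (finite_subsets_at_top UNIV)"
    using has_sum_infsum has_sum_def by blast
  \<comment> \<open>The cut-off is orthogonal to the remainder, so the squared distance is a
    difference of two squared norms and becomes a tail of a convergent sum.\<close>
  have norm: "(L2_norm (lattice h) ((\<lambda>n. indicator S n * u n) - u))\<^sup>2 = h ^ CARD('n) * (infsum a UNIV - sum a S)"
    if S: "finite S" for S
  proof -
    let ?s = "\<lambda>n. indicator S n * u n"
    have s: "?s \<in> L2 (lattice h)" by (rule lattice_cut[OF h u])
    have "L2_ip (lattice h) ?s u = L2_ip (lattice h) ?s ?s"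
      unfolding L2_ip_def L2_inner_def
      by (intro arg_cong[where f=Re] Bochner_Integration.integral_cong) (auto simp: indicator_def)
    then have "(L2_norm (lattice h) (?s - u))\<^sup>2 = (L2_norm (lattice h) u)\<^sup>2 - (L2_norm (lattice h) ?s)\<^sup>2"
      using s u L2.ip_commute[OF u s] by (simp only: L2.nrm_sq L2.S_closed L2.ip_simps)
    also have "(L2_norm (lattice h) u)\<^sup>2 = h ^ CARD('n) * infsum a UNIV"
      using h by (simp add: L2_norm_lattice[OF h u] a_def infsum_nonneg)
    also have "(L2_norm (lattice h) ?s)\<^sup>2 = h ^ CARD('n) * sum a S"
      using lattice_cut_norm(2)[OF h S, of u] unfolding a_def .
    finally show ?thesis by (simp only: right_diff_distrib)
  qed
  have "((\<lambda>S. sqrt (h ^ CARD('n) * (infsum a UNIV - sum a S))) \<longlongrightarrow> sqrt (h ^ CARD('n) * (infsum a UNIV - infsum a UNIV))) (finite_subsets_at_top UNIV)"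
    by (intro tendsto_intros lim)
  then have "((\<lambda>S. sqrt (h ^ CARD('n) * (infsum a UNIV - sum a S))) \<longlongrightarrow> 0) (finite_subsets_at_top UNIV)" by simp
  then show "((\<lambda>S. L2_norm (lattice h) ((\<lambda>n. indicator S n * u n) - u)) \<longlongrightarrow> 0) (finite_subsets_at_top UNIV)"
  proof (rule Lim_transform_eventually)
    show "\<forall>\<^sub>F S in finite_subsets_at_top UNIV. sqrt (h ^ CARD('n) * (infsum a UNIV - sum a S)) = L2_norm (lattice h) ((\<lambda>n. indicator S n * u n) - u)"
      using eventually_finite_subsets
    proof (rule eventually_mono)
      fix S :: "(int ^ 'n) set" assume "finite S"
      from norm[OF this] show "sqrt (h ^ CARD('n) * (infsum a UNIV - sum a S)) = L2_norm (lattice h) ((\<lambda>n. indicator S n * u n) - u)"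
        by (metis L2_norm_nonneg real_sqrt_unique)
    qed
  qed
qed

definition dft_partial :: "real \<Rightarrow> (int ^ 'n \<Rightarrow> complex) \<Rightarrow> (int ^ 'n) set \<Rightarrow> real ^ 'n \<Rightarrow> complex" where
  "dft_partial h u S \<xi> = (\<Sum>n\<in>S. u n * lattice_wave h n \<xi>)"

lemma dft_def': "dft h u = L2_lim (torus h) (finite_subsets_at_top UNIV) (dft_partial h u)"
  unfolding dft_def dft_partial_def[abs_def] lattice_wave_def by (simp add: sum_distrib_left mult.left_commute)

text \<open>Pythagoras, by induction on \<open>S\<close>. The induction also carries the
  orthogonality of the partial sum to every wave that is not yet included.\<close>

lemma dft_partial_norm:
  fixes u :: "int ^ 'n \<Rightarrow> complex"
  assumes h: "h > 0" and S: "finite S"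
  shows "dft_partial h u S \<in> L2 (torus h)"
    "(L2_norm (torus h) (dft_partial h u S))\<^sup>2 = h ^ CARD('n) * (\<Sum>n\<in>S. (cmod (u n))\<^sup>2)"
proof -
  have "dft_partial h u S \<in> L2 (torus h) \<and> (\<forall>m. m \<notin> S \<longrightarrow> L2_inner (torus h) (dft_partial h u S) (lattice_wave h m) = 0) \<and>
    (L2_norm (torus h) (dft_partial h u S))\<^sup>2 = h ^ CARD('n) * (\<Sum>n\<in>S. (cmod (u n))\<^sup>2)"
    using S
  proof (induction S)
    case empty
    have eq: "dft_partial h u {} = 0" by (simp add: dft_partial_def fun_eq_iff)
    have z: "L2_inner (torus h) 0 g = 0" for g by (simp add: L2_inner_def)
    show ?case
      unfolding eq by (simp only: L2.S_closed(1) L2.nrm_zero z) simp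
  next
    case (insert k S)
    define p where "p = dft_partial h u S"
    define q where "q = (\<lambda>\<xi>. u k * lattice_wave h k \<xi>)"
    have p: "p \<in> L2 (torus h)" using insert.IH by (simp add: p_def)
    have q: "q \<in> L2 (torus h)" unfolding q_def by (rule L2_cmult[OF lattice_wave_L2])
    have eq: "dft_partial h u (insert k S) = p + q"
      using insert.hyps by (auto simp: dft_partial_def p_def q_def fun_eq_iff)
    have pk: "L2_inner (torus h) p (lattice_wave h k) = 0" using insert by (simp add: p_def)
    have pq: "L2_inner (torus h) p q = 0" unfolding q_def L2_inner_cmult_right pk by simp
    have "L2_norm (torus h) q = cmod (u k) * L2_norm (torus h) (lattice_wave h k)"
      unfolding q_def by (rule L2_norm_cmult)
    moreover have "(L2_norm (torus h) (lattice_wave h k))\<^sup>2 = h ^ CARD('n)"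
      using lattice_wave_inner[OF h, of k k] unfolding L2_inner_self by (simp only: of_real_eq_iff if_True refl)
    ultimately have nq: "(L2_norm (torus h) q)\<^sup>2 = h ^ CARD('n) * (cmod (u k))\<^sup>2"
      by (simp add: power_mult_distrib mult.commute)
    have "(L2_norm (torus h) (p + q))\<^sup>2 = (L2_norm (torus h) p)\<^sup>2 + (L2_norm (torus h) q)\<^sup>2"
    proof -
      have "L2_ip (torus h) p q = 0" "L2_ip (torus h) q p = 0"
        using pq L2.ip_commute[OF p q] by (auto simp: L2_ip_def)
      then show ?thesis using p q by (simp only: L2.nrm_sq L2.S_closed L2.ip_simps)
    qed
    moreover have "L2_inner (torus h) (p + q) (lattice_wave h m) = 0" if "m \<notin> insert k S" for m
      using that insert.IH L2_inner_add_left[OF p q lattice_wave_L2[of h m]]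
      by (auto simp: p_def q_def L2_inner_cmult_left lattice_wave_inner[OF h])
    moreover have "(L2_norm (torus h) p)\<^sup>2 + (L2_norm (torus h) q)\<^sup>2 = h ^ CARD('n) * (\<Sum>n\<in>insert k S. (cmod (u n))\<^sup>2)"
      using insert nq by (simp add: p_def distrib_left)
    ultimately show ?case
      unfolding eq using L2_add[OF p q] by presburger
  qed
  then show "dft_partial h u S \<in> L2 (torus h)"
    "(L2_norm (torus h) (dft_partial h u S))\<^sup>2 = h ^ CARD('n) * (\<Sum>n\<in>S. (cmod (u n))\<^sup>2)" by auto
qed

lemma dft_partial_diff_norm:
  fixes u :: "int ^ 'n \<Rightarrow> complex"
  assumes h: "h > 0" and S: "finite S" "finite T"
  shows "L2_norm (torus h) (dft_partial h u S - dft_partial h u T)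
     = L2_norm (lattice h) ((\<lambda>n. indicator S n * u n) - (\<lambda>n. indicator T n * u n))"
proof -
  define v where "v = (\<lambda>n. indicator S n * u n - indicator T n * u n)"
  have fin: "finite (S \<union> T)" using S by simp
  have "dft_partial h u S = dft_partial h (\<lambda>n. indicator S n * u n) (S \<union> T)"
    using S unfolding dft_partial_def
    by (intro ext sum.mono_neutral_cong_left) (auto simp: indicator_def)
  moreover have "dft_partial h u T = dft_partial h (\<lambda>n. indicator T n * u n) (S \<union> T)"
    using S unfolding dft_partial_def
    by (intro ext sum.mono_neutral_cong_left) (auto simp: indicator_def)
  ultimately have 1: "dft_partial h u S - dft_partial h u T = dft_partial h v (S \<union> T)"
    by (simp add: dft_partial_def v_def fun_eq_iff left_diff_distrib sum_subtractf)
  have 2: "(\<lambda>n. indicator S n * u n) - (\<lambda>n. indicator T n * u n) = (\<lambda>n. indicator (S \<union> T) n * v n)"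
    by (auto simp: v_def fun_eq_iff indicator_def)
  have "(L2_norm (torus h) (dft_partial h v (S \<union> T)))\<^sup>2 = (L2_norm (lattice h) (\<lambda>n. indicator (S \<union> T) n * v n))\<^sup>2"
    unfolding dft_partial_norm(2)[OF h fin] lattice_cut_norm(2)[OF h fin] ..
  then show ?thesis unfolding 1 2 by (simp add: power2_eq_iff_nonneg)
qed

text \<open>Partial sums over S and T are exactly as far apart as the cut-offs of \<open>u\<close>
  to S and T, and the cut-offs converge to \<open>u\<close>.\<close>

lemma dft_tendsto:
  fixes u :: "int ^ 'n \<Rightarrow> complex"
  assumes h: "h > 0" and u: "u \<in> L2 (lattice h)"
  shows "L2_tendsto (torus h) (finite_subsets_at_top UNIV) (dft_partial h u) (dft h u)"
  unfolding dft_def'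
proof (rule L2_lim_tendsto, rule L2_Cauchy_tendsto)
  let ?s = "\<lambda>S n. indicator S n * u n"
  show "\<forall>\<^sub>F S in finite_subsets_at_top UNIV. dft_partial h u S \<in> L2 (torus h)"
    using eventually_finite_subsets by eventually_elim (rule dft_partial_norm(1)[OF h])
  fix e :: real assume e: "e > 0"
  have "((\<lambda>S. L2_norm (lattice h) (?s S - u)) \<longlongrightarrow> 0) (finite_subsets_at_top UNIV)"
    using lattice_cut_tendsto[OF h u] by (simp add: L2_tendsto_alt)
  then have "\<forall>\<^sub>F S in finite_subsets_at_top UNIV. L2_norm (lattice h) (?s S - u) < e / 2"
    using order_tendstoD(2)[of _ 0 _ "e/2"] e by fastforce
  then have ev: "\<forall>\<^sub>F S in finite_subsets_at_top UNIV. finite S \<and> L2_norm (lattice h) (?s S - u) < e / 2"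
    using eventually_finite_subsets by eventually_elim auto
  have "L2_norm (torus h) (dft_partial h u S - dft_partial h u T) < e"
    if "finite S \<and> L2_norm (lattice h) (?s S - u) < e / 2" "finite T \<and> L2_norm (lattice h) (?s T - u) < e / 2" for S T
    using that L2.nrm_triangle_diff[OF lattice_cut[OF h u] u lattice_cut[OF h u], of S T]
      L2.nrm_commute[OF u lattice_cut[OF h u], of T] dft_partial_diff_norm[OF h, of S T u] by linarith
  then show "\<exists>P. eventually P (finite_subsets_at_top UNIV) \<and> (\<forall>S T. P S \<longrightarrow> P T \<longrightarrow> L2_norm (torus h) (dft_partial h u S - dft_partial h u T) < e)"
    using ev by blast
qed auto

lemma dft_L2: "h > 0 \<Longrightarrow> u \<in> L2 (lattice h) \<Longrightarrow> dft h u \<in> L2 (torus h)"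
  using dft_tendsto by (auto simp: L2_tendsto_def)

lemma dft_norm:
  assumes h: "h > 0" and u: "u \<in> L2 (lattice h)"
  shows "L2_norm (torus h) (dft h u) = L2_norm (lattice h) u"
proof (rule tendsto_unique)
  show "((\<lambda>S. L2_norm (torus h) (dft_partial h u S)) \<longlongrightarrow> L2_norm (torus h) (dft h u)) (finite_subsets_at_top UNIV)"
    by (rule L2_tendsto_norm[OF dft_tendsto[OF h u]])
  show "((\<lambda>S. L2_norm (torus h) (dft_partial h u S)) \<longlongrightarrow> L2_norm (lattice h) u) (finite_subsets_at_top UNIV)"
  proof (rule Lim_transform_eventually[OF L2_tendsto_norm[OF lattice_cut_tendsto[OF h u]]])
    show "\<forall>\<^sub>F S in finite_subsets_at_top UNIV. L2_norm (lattice h) (\<lambda>n. indicator S n * u n) = L2_norm (torus h) (dft_partial h u S)"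
      using eventually_finite_subsets
    proof eventually_elim
      case (elim S)
      have "(L2_norm (lattice h) (\<lambda>n. indicator S n * u n))\<^sup>2 = (L2_norm (torus h) (dft_partial h u S))\<^sup>2"
        unfolding dft_partial_norm(2)[OF h elim] lattice_cut_norm(2)[OF h elim] ..
      then show ?case by (simp add: power2_eq_iff_nonneg)
    qed
  qed
qed auto

lemma dft_add:
  assumes h: "h > 0" and u: "u \<in> L2 (lattice h)" "v \<in> L2 (lattice h)"
  shows "AE \<xi> in torus h. dft h (u + v) \<xi> = dft h u \<xi> + dft h v \<xi>"
proof -
  have eq: "dft_partial h (u + v) = (\<lambda>S. dft_partial h u S + dft_partial h v S)"
    by (simp add: dft_partial_def fun_eq_iff distrib_right sum.distrib)
  have "L2_tendsto (torus h) (finite_subsets_at_top UNIV) (dft_partial h (u + v)) (dft h u + dft h v)"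
    unfolding eq by (rule L2_tendsto_add[OF dft_tendsto[OF h u(1)] dft_tendsto[OF h u(2)]])
  from L2_tendsto_unique[OF _ dft_tendsto[OF h L2_add[OF u]] this] show ?thesis by simp
qed

lemma dft_cmult:
  assumes h: "h > 0" and u: "u \<in> L2 (lattice h)"
  shows "AE \<xi> in torus h. dft h (\<lambda>n. c * u n) \<xi> = c * dft h u \<xi>"
proof -
  have "dft_partial h (\<lambda>n. c * u n) = (\<lambda>S \<xi>. c * dft_partial h u S \<xi>)"
    by (simp add: dft_partial_def fun_eq_iff sum_distrib_left mult.assoc)
  then have "L2_tendsto (torus h) (finite_subsets_at_top UNIV) (dft_partial h (\<lambda>n. c * u n)) (\<lambda>\<xi>. c * dft h u \<xi>)"
    using L2_tendsto_cmult[OF dft_tendsto[OF h u]] by simp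
  from L2_tendsto_unique[OF _ dft_tendsto[OF h L2_cmult[OF u]] this] show ?thesis by simp
qed

lemma dft_inner:
  assumes h: "h > 0" and "u \<in> L2 (lattice h)" "v \<in> L2 (lattice h)"
  shows "L2_inner (torus h) (dft h u) (dft h v) = L2_inner (lattice h) u v"
  by (rule isometry_preserves_inner[OF dft_L2[OF h] dft_norm[OF h] dft_add[OF h] dft_cmult[OF h] assms(2,3)])

lemma dft_delta:
  fixes k :: "int ^ 'n"
  assumes h: "h > 0"
  shows "(\<lambda>n. if n = k then 1 else 0) \<in> L2 (lattice h)"
    "AE \<xi> in torus h. dft h (\<lambda>n. if n = k then 1 else 0) \<xi> = lattice_wave h k \<xi>"
proof -
  let ?d = "\<lambda>n. if n = k then 1 else 0 :: complex"
  show d: "?d \<in> L2 (lattice h)"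
    using lattice_cut_norm(1)[OF h, of "{k}" "\<lambda>_. 1"] by (simp add: indicator_def of_bool_def)
  have ev: "\<forall>\<^sub>F S in finite_subsets_at_top UNIV. lattice_wave h k = dft_partial h ?d S"
    unfolding eventually_finite_subsets_at_top
    by (intro exI[of _ "{k}"]) (auto simp: dft_partial_def fun_eq_iff sum.remove if_distrib cong: if_cong)
  have "L2_tendsto (torus h) (finite_subsets_at_top UNIV) (dft_partial h ?d) (lattice_wave h k)"
    unfolding L2_tendsto_alt
  proof (intro conjI lattice_wave_L2 tendsto_eventually)
    show "\<forall>\<^sub>F S in finite_subsets_at_top UNIV. dft_partial h ?d S \<in> L2 (torus h)"
      using ev by (rule eventually_mono) (metis lattice_wave_L2)
    show "\<forall>\<^sub>F S in finite_subsets_at_top UNIV. L2_norm (torus h) (dft_partial h ?d S - lattice_wave h k) = 0"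
      using ev by (rule eventually_mono) (metis L2.nrm_zero diff_self)
  qed
  from L2_tendsto_unique[OF _ dft_tendsto[OF h d] this]
  show "AE \<xi> in torus h. dft h ?d \<xi> = lattice_wave h k \<xi>" by simp
qed

section \<open>Cell functions\<close>

text \<open>The shift by 1/2 centres the cell of \<open>k\<close> at the lattice point h k. The
  cells are half-open, so they partition the space without exceptional points.\<close>

definition cell_index :: "real \<Rightarrow> real ^ 'n \<Rightarrow> int ^ 'n" where
  "cell_index h x = (\<chi> i. \<lfloor>x $ i / h + 1 / 2\<rfloor>)"

lemma cell_index_eq_iff:
  assumes h: "h > 0"
  shows "cell_index h x = k \<longleftrightarrow> (\<forall>i. h * (of_int (k $ i) - 1 / 2) \<le> x $ i \<and> x $ i < h * (of_int (k $ i) + 1 / 2))"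
proof -
  have "\<lfloor>x $ i / h + 1 / 2\<rfloor> = k $ i \<longleftrightarrow> h * (of_int (k $ i) - 1 / 2) \<le> x $ i \<and> x $ i < h * (of_int (k $ i) + 1 / 2)" for i
    unfolding floor_eq_iff using h by (simp add: field_simps)
  then show ?thesis by (simp add: cell_index_def vec_eq_iff)
qed

lemma cell_index_add:
  assumes h: "h > 0"
  shows "cell_index h (x + h *\<^sub>R zvec k) = cell_index h x + k"
proof -
  have "\<lfloor>(x $ i + h * of_int (k $ i)) / h + 1 / 2\<rfloor> = \<lfloor>x $ i / h + 1 / 2\<rfloor> + k $ i" for i
  proof -
    have "(x $ i + h * of_int (k $ i)) / h + 1 / 2 = (x $ i / h + 1 / 2) + of_int (k $ i)"
      using h by (simp add: field_simps)
    then show ?thesis by (simp only: floor_add_int)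
  qed
  then show ?thesis by (simp add: cell_index_def vec_eq_iff zvec_def)
qed

lemma cell_index_measurable [measurable]: "cell_index h \<in> borel \<rightarrow>\<^sub>M count_space UNIV"
proof -
  have "{x \<in> space borel. \<forall>i. \<lfloor>x $ i / h + 1 / 2\<rfloor> = k $ i} \<in> sets borel" for k :: "int ^ 'a"
    by measurable
  then have "cell_index h -` {k} \<inter> space borel \<in> sets borel" for k :: "int ^ 'a"
    by (simp add: cell_index_def vec_eq_iff vimage_def)
  then show ?thesis by (subst measurable_count_space_eq2_countable) auto
qed

text \<open>The half-open cell lies between an open and a closed box of the same volume.\<close>

lemma emeasure_cell:
  fixes k :: "int ^ 'n"
  assumes h: "h > 0"
  shows "emeasure lborel (cell_index h -` {k}) = ennreal (h ^ CARD('n))"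
proof -
  define l where "l = (\<chi> i. h * (of_int (k $ i) - 1 / 2))"
  define u where "u = (\<chi> i. h * (of_int (k $ i) + 1 / 2))"
  have ul: "u - l = (\<chi> i. h)" by (simp add: u_def l_def vec_eq_iff algebra_simps)
  have le: "l \<bullet> b \<le> u \<bullet> b" if "b \<in> Basis" for b
    using that h by (auto simp: Basis_vec_def inner_axis l_def u_def)
  have prod: "(\<Prod>b\<in>Basis. (u - l) \<bullet> b) = h ^ CARD('n)"
  proof -
    have "(\<Prod>b\<in>(Basis :: (real ^ 'n) set). (u - l) \<bullet> b) = (\<Prod>b\<in>(Basis :: (real ^ 'n) set). h)"
      by (intro prod.cong refl) (auto simp: ul Basis_vec_def inner_axis)
    then show ?thesis by simp
  qed
  have m: "cell_index h -` {k} \<in> sets lborel"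
    using measurable_sets[OF cell_index_measurable[of h], of "{k}"] by simp
  have "emeasure lborel (box l u) \<le> emeasure lborel (cell_index h -` {k})"
    using m by (intro emeasure_mono) (auto simp: mem_box_cart l_def u_def cell_index_eq_iff[OF h] less_imp_le)
  moreover have "emeasure lborel (cell_index h -` {k}) \<le> emeasure lborel (cbox l u)"
  proof (rule emeasure_mono)
    show "cell_index h -` {k} \<subseteq> cbox l u"
    proof
      fix x assume "x \<in> cell_index h -` {k}"
      then have "cell_index h x = k" by simp
      then show "x \<in> cbox l u"
        unfolding cell_index_eq_iff[OF h] by (simp add: mem_box_cart l_def u_def less_imp_le)
    qed
  qed simp
  ultimately show ?thesis
    using le prod by (simp add: emeasure_lborel_box emeasure_lborel_cbox)
qed

text \<open>The lattice measure is the image of Lebesgue measure, so that inner products of cell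
  functions become lattice inner products by a change of variables.\<close>

lemma distr_cell_index:
  assumes h: "h > 0"
  shows "distr lborel (count_space UNIV) (cell_index h) = lattice h"
proof (rule measure_eqI_countable)
  show "sets (distr lborel (count_space UNIV) (cell_index h)) = Pow UNIV" by simp
  show "sets (lattice h) = Pow UNIV" by (simp add: lattice_def)
  fix k :: "int ^ 'a"
  have "emeasure (lattice h) {k} = ennreal (h ^ CARD('a))"
    by (simp add: lattice_def emeasure_density nn_integral_count_space_indicator[symmetric])
  then show "emeasure (distr lborel (count_space UNIV) (cell_index h)) {k} = emeasure (lattice h) {k}"
    using emeasure_cell[OF h, of k] by (simp add: emeasure_distr)
qed auto

text \<open>The map J of the overview. As a composition with \<open>cell_index\<close> it is linear
  at every point, in contrast to the two transforms.\<close>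

definition cell_embed :: "real \<Rightarrow> (int ^ 'n \<Rightarrow> complex) \<Rightarrow> real ^ 'n \<Rightarrow> complex" where
  "cell_embed h u x = u (cell_index h x)"

lemma cell_embed_measurable [measurable]: "cell_embed h u \<in> borel_measurable borel"
  unfolding cell_embed_def[abs_def] by measurable

lemma cell_embed_L2:
  assumes h: "h > 0" and u: "u \<in> L2 (lattice h)"
  shows "cell_embed h u \<in> L2 lborel"
proof (rule L2I)
  have "integrable (distr lborel (count_space UNIV) (cell_index h)) (\<lambda>k. (cmod (u k))\<^sup>2)"
    unfolding distr_cell_index[OF h] by (rule L2_integrable[OF u])
  then show "integrable lborel (\<lambda>x. (cmod (cell_embed h u x))\<^sup>2)"
    by (subst (asm) integrable_distr_eq) (auto simp: cell_embed_def)
qed simp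

lemma cell_embed_inner:
  assumes h: "h > 0"
  shows "L2_inner lborel (cell_embed h u) (cell_embed h v) = L2_inner (lattice h) u v"
  unfolding L2_inner_def distr_cell_index[OF h, symmetric]
  by (subst integral_distr) (auto simp: cell_embed_def)

lemma cell_embed_norm:
  assumes h: "h > 0"
  shows "L2_norm lborel (cell_embed h u) = L2_norm (lattice h) u"
proof -
  have "complex_of_real ((L2_norm lborel (cell_embed h u))\<^sup>2) = complex_of_real ((L2_norm (lattice h) u)\<^sup>2)"
    using cell_embed_inner[OF h, of u u] by (simp only: L2_inner_self)
  then have "(L2_norm lborel (cell_embed h u))\<^sup>2 = (L2_norm (lattice h) u)\<^sup>2" by (simp only: of_real_eq_iff)
  then show ?thesis by (simp add: power2_eq_iff_nonneg)
qed

section \<open>Surjectivity of the discrete Fourier transform\<close>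

lemma L2_adjoint_exists:
  assumes A: "\<And>u. u \<in> L2 M \<Longrightarrow> A u \<in> L2 N"
      "\<And>u v. u \<in> L2 M \<Longrightarrow> v \<in> L2 M \<Longrightarrow> L2_inner N (A u) (A v) = L2_inner M u v"
    and w: "w \<in> L2 N"
  shows "\<exists>y\<in>L2 M. \<forall>u\<in>L2 M. L2_inner N (A u) w = L2_inner M u y"
proof -
  interpret iso: semi_isometry "L2 M" "L2_ip M" "L2 N" "L2_ip N" A
    by unfold_locales (simp_all add: A L2_ip_def)
  obtain y where y: "y \<in> L2 M" "\<forall>u\<in>L2 M. L2_ip N (A u) w = L2_ip M u y"
    using iso.adjoint_exists[OF w] by blast
  have "L2_inner N (A u) w = L2_inner M u y" if u: "u \<in> L2 M" for u
  proof -
    have iu: "(\<lambda>x. \<i> * u x) \<in> L2 M" using u by (rule L2_cmult)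
    \<comment> \<open>The real adjoint settles real parts. For imaginary parts, \<open>A\<close> has
      to commute with the imaginary unit almost everywhere; this follows by expanding the squared
      norm of the difference, as \<open>A\<close> preserves complex inner products.\<close>
    have "L2_inner N (\<lambda>x. \<i> * A u x) w = L2_inner N (A (\<lambda>x. \<i> * u x)) w"
    proof (rule L2_inner_cong_AE)
      have i1: "A (\<lambda>x. \<i> * u x) \<in> L2 N" "(\<lambda>x. \<i> * A u x) \<in> L2 N" using A(1)[OF iu] L2_cmult[OF A(1)[OF u]] by auto
      have "L2_inner N (A (\<lambda>x. \<i> * u x)) (\<lambda>x. \<i> * A u x) = of_real ((L2_norm M u)\<^sup>2)"
        using A(2)[OF iu u] by (simp add: L2_inner_cmult_right L2_inner_cmult_left L2_inner_self)
      then have "L2_ip N (A (\<lambda>x. \<i> * u x)) (\<lambda>x. \<i> * A u x) = (L2_norm M u)\<^sup>2" by (simp add: L2_ip_def)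
      moreover have "(L2_norm N (A (\<lambda>x. \<i> * u x)))\<^sup>2 = (L2_norm M u)\<^sup>2"
        using iso.A_nrm[OF iu] by (simp add: nrm_L2 L2_norm_cmult)
      moreover have "(L2_norm N (\<lambda>x. \<i> * A u x))\<^sup>2 = (L2_norm M u)\<^sup>2"
        using iso.A_nrm[OF u] by (simp add: nrm_L2 L2_norm_cmult)
      ultimately have "(L2_norm N ((\<lambda>x. \<i> * A u x) - A (\<lambda>x. \<i> * u x)))\<^sup>2 = 0"
        using i1 L2.ip_commute[OF i1] by (simp only: L2.nrm_sq L2.S_closed L2.ip_simps)
      then show "AE x in N. \<i> * A u x = A (\<lambda>x. \<i> * u x) x"
        using L2_norm_diff_eq_0_iff[OF i1(2,1)] by simp
      show "(\<lambda>x. \<i> * A u x) \<in> borel_measurable N" "A (\<lambda>x. \<i> * u x) \<in> borel_measurable N"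
        using i1 by (auto dest: L2_measurable)
    qed (use w in \<open>auto dest: L2_measurable\<close>)
    then have "L2_ip N (\<lambda>x. \<i> * A u x) w = L2_ip M (\<lambda>x. \<i> * u x) y"
      using y(2) iu by (simp add: L2_ip_def)
    then have "Im (L2_inner N (A u) w) = Im (L2_inner M u y)" by (simp add: L2_ip_imag)
    moreover have "Re (L2_inner N (A u) w) = Re (L2_inner M u y)" using y(2) u by (simp add: L2_ip_def)
    ultimately show ?thesis by (simp add: complex_eq_iff)
  qed
  then show ?thesis using y(1) by blast
qed

text \<open>Otherwise a whole ball around 0 would be a null set.\<close>

lemma exists_near_zero_AE:
  fixes P :: "'a::euclidean_space \<Rightarrow> bool"
  assumes "AE x in lborel. x \<in> U \<longrightarrow> P x" "open U" "0 \<in> U" "r > 0"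
  shows "\<exists>x. norm x < r \<and> P x"
proof (rule ccontr)
  assume neg: "\<not> ?thesis"
  obtain e where e: "e > 0" "ball 0 e \<subseteq> U" using assms by (auto simp: open_contains_ball)
  define s where "s = min e r"
  have s: "s > 0" using e assms by (simp add: s_def)
  have "AE x in lborel. x \<notin> ball (0::'a) s"
    using assms(1)
  proof eventually_elim
    case (elim x)
    then show ?case using neg e by (auto simp: s_def subset_iff)
  qed
  then have "ball (0::'a) s \<in> null_sets lborel" by (subst (asm) AE_iff_null_sets[symmetric]) auto
  then have "measure lborel (ball (0::'a) s) = 0" by (simp add: measure_eq_0_null_sets)
  then show False using content_ball_pos[OF s, of "0::'a"] by simp
qed

text \<open>Periodisation: split the integral over the cells and translate each cell to the one at
  0.\<close>

lemma nn_integral_cells: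
  fixes G :: "real ^ 'n \<Rightarrow> ennreal"
  assumes h: "h > 0" and [measurable]: "G \<in> borel_measurable borel"
  shows "(\<integral>\<^sup>+x. G x \<partial>lborel)
    = (\<integral>\<^sup>+x. indicator (cell_index h -` {0}) x * (\<integral>\<^sup>+k. G (x + h *\<^sub>R zvec k) \<partial>count_space UNIV) \<partial>lborel)"
proof -
  have [measurable]: "cell_index h -` {k} \<in> sets borel" for k :: "int ^ 'n"
    using measurable_sets[OF cell_index_measurable[of h], of "{k}"] by simp
  have "(\<integral>\<^sup>+x. G x \<partial>lborel) = (\<integral>\<^sup>+x. (\<integral>\<^sup>+k. indicator (cell_index h -` {k}) x * G x \<partial>count_space UNIV) \<partial>lborel)"
  proof (rule nn_integral_cong)
    fix x :: "real ^ 'n"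
    have "(\<integral>\<^sup>+k. indicator (cell_index h -` {k}) x * G x \<partial>count_space UNIV)
        = (\<integral>\<^sup>+k. G x * indicator {cell_index h x} k \<partial>count_space UNIV)"
      by (intro nn_integral_cong) (auto simp: indicator_def)
    also have "\<dots> = G x" by (simp add: nn_integral_cmult_indicator)
    finally show "G x = (\<integral>\<^sup>+k. indicator (cell_index h -` {k}) x * G x \<partial>count_space UNIV)" by simp
  qed
  also have "\<dots> = (\<integral>\<^sup>+k. (\<integral>\<^sup>+x. indicator (cell_index h -` {k}) x * G x \<partial>lborel) \<partial>count_space UNIV)"
    by (rule nn_integral_count_space_nn_integral) auto
  also have "\<dots> = (\<integral>\<^sup>+k. (\<integral>\<^sup>+x. indicator (cell_index h -` {0}) x * G (x + h *\<^sub>R zvec k) \<partial>lborel) \<partial>count_space UNIV)"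
  proof (rule nn_integral_cong)
    fix k :: "int ^ 'n"
    have "(\<integral>\<^sup>+x. indicator (cell_index h -` {k}) x * G x \<partial>lborel)
       = (\<integral>\<^sup>+x. indicator (cell_index h -` {k}) x * G x \<partial>distr lborel borel (\<lambda>x. h *\<^sub>R zvec k + x))"
      by (simp add: lborel_distr_plus)
    also have "\<dots> = (\<integral>\<^sup>+x. indicator (cell_index h -` {k}) (h *\<^sub>R zvec k + x) * G (h *\<^sub>R zvec k + x) \<partial>lborel)"
      by (subst nn_integral_distr) auto
    also have "\<dots> = (\<integral>\<^sup>+x. indicator (cell_index h -` {0}) x * G (x + h *\<^sub>R zvec k) \<partial>lborel)"
    proof (rule nn_integral_cong)
      fix x :: "real ^ 'n"
      have "cell_index h (h *\<^sub>R zvec k + x) = k \<longleftrightarrow> cell_index h x = 0"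
        using cell_index_add[OF h, of x k] by (simp add: add.commute)
      then show "indicator (cell_index h -` {k}) (h *\<^sub>R zvec k + x) * G (h *\<^sub>R zvec k + x)
          = indicator (cell_index h -` {0}) x * G (x + h *\<^sub>R zvec k)"
        by (simp add: indicator_def add.commute)
    qed
    finally show "(\<integral>\<^sup>+x. indicator (cell_index h -` {k}) x * G x \<partial>lborel)
        = (\<integral>\<^sup>+x. indicator (cell_index h -` {0}) x * G (x + h *\<^sub>R zvec k) \<partial>lborel)" .
  qed
  also have "\<dots> = (\<integral>\<^sup>+x. (\<integral>\<^sup>+k. indicator (cell_index h -` {0}) x * G (x + h *\<^sub>R zvec k) \<partial>count_space UNIV) \<partial>lborel)"
    by (rule nn_integral_count_space_nn_integral[symmetric]) auto
  also have "\<dots> = (\<integral>\<^sup>+x. indicator (cell_index h -` {0}) x * (\<integral>\<^sup>+k. G (x + h *\<^sub>R zvec k) \<partial>count_space UNIV) \<partial>lborel)"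
    by (simp add: nn_integral_cmult)
  finally show ?thesis .
qed

lemma norm_iexp_minus_1: "cmod (exp (\<i> * of_real x) - 1) \<le> \<bar>x\<bar>"
  using iexp_approx1[of x 0] by simp

lemma lattice_nn_integral:
  fixes g :: "int ^ 'n \<Rightarrow> ennreal"
  assumes "h > 0"
  shows "(\<integral>\<^sup>+k. g k \<partial>lattice h) = ennreal (h ^ CARD('n)) * (\<integral>\<^sup>+k. g k \<partial>count_space UNIV)"
  unfolding lattice_def by (simp add: nn_integral_density nn_integral_cmult)

lemma cube_bounded: "\<exists>R>0. \<forall>\<xi>\<in>cube r. norm \<xi> \<le> R"
  unfolding cube_eq_cbox using bounded_cbox[of "\<chi> i. - r" "\<chi> i. r"] by (simp add: bounded_pos)

text \<open>
  For \<open>w \<in> L\<^sup>2\<close> of the torus, Bessel's inequality holds for every \<open>e\<^sup>i\<^sup>x\<^sup>\<xi> w\<close>. By Plancherel, its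
  average over the shifts \<open>x\<close> in one cell is an equality, hence it is an equality for almost every \<open>x\<close>,
  and for \<open>x = 0\<close> by continuity.
\<close>

lemma dft_parseval:
  fixes w :: "real ^ 'n \<Rightarrow> complex"
  assumes h: "h > 0" and w: "w \<in> L2 (torus h)"
    and y: "y \<in> L2 (lattice h)" "\<And>u. u \<in> L2 (lattice h) \<Longrightarrow> L2_inner (torus h) (dft h u) w = L2_inner (lattice h) u y"
  shows "L2_norm (lattice h) y = L2_norm (torus h) w"
proof -
  let ?L = "lattice h :: (int ^ 'n) measure" and ?T = "torus h :: (real ^ 'n) measure"
  define d where "d = CARD('n)"
  define W where "W = (\<lambda>\<xi>. indicator (cube (pi / h)) \<xi> * w \<xi>)"
  have W: "W \<in> L2 lborel" using w by (simp add: W_def torus_L2_iff)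
  obtain R where R: "R > 0" "\<And>\<xi> :: real ^ 'n. \<xi> \<in> cube (pi / h) \<Longrightarrow> norm \<xi> \<le> R"
    using cube_bounded by blast
  have cW: "(\<lambda>\<xi>. cnj (W \<xi>)) \<in> L2 lborel" by (rule L2_cnj[OF W])
  have "(\<lambda>\<xi>. indicator (ball 0 (R + 1)) \<xi> * cnj (W \<xi>)) = (\<lambda>\<xi>. cnj (W \<xi>))"
    using R by (force simp: W_def indicator_def fun_eq_iff)
  then have W_int: "integrable lborel (\<lambda>\<xi>. cnj (W \<xi>))" using L2_cut_integrable[OF cW, of "R + 1"] by simp
  \<comment> \<open>Up to conjugation, F(x + h k) is the coefficient at \<open>k\<close> of
    \<open>w\<close> multiplied by exp(i x \<xi>), see \<open>a_val\<close>. Thus shifts in x sample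
    one single function.\<close>
  define F where "F = fourier_integral (\<lambda>\<xi>. cnj (W \<xi>))"
  have F: "F \<in> L2 lborel" "L2_norm lborel F = L2_norm ?T w"
    using plancherel_integral[OF cW W_int, folded F_def] L2_norm_cnj[of lborel W] torus_norm[of h w, folded W_def]
    by simp_all
  have [measurable]: "F \<in> borel_measurable borel" using L2_measurable[OF F(1)] by simp
  define ws where "ws = (\<lambda>x \<xi>. exp (\<i> * of_real (x \<bullet> \<xi>)) * w \<xi>)"
  have ws: "ws x \<in> L2 ?T" "L2_norm ?T (ws x) = L2_norm ?T w" for x
  proof -
    have m: "(\<lambda>\<xi>. exp (\<i> * of_real (x \<bullet> \<xi>))) \<in> borel_measurable ?T"
      unfolding torus_def by (rule measurable_restrict_space1) measurable
    show "ws x \<in> L2 ?T" unfolding ws_def by (rule L2_bounded_mult(1)[OF w m, of 1]) (auto simp: norm_exp_eq_Re)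
    show "L2_norm ?T (ws x) = L2_norm ?T w" by (simp add: L2_norm_def ws_def norm_mult norm_exp_eq_Re)
  qed
  have "\<exists>a\<in>L2 ?L. \<forall>u\<in>L2 ?L. L2_inner ?T (dft h u) (ws x) = L2_inner ?L u a" for x
    by (rule L2_adjoint_exists[OF dft_L2[OF h] dft_inner[OF h] ws(1)])
  then obtain a where a: "\<And>x. a x \<in> L2 ?L"
      "\<And>x u. u \<in> L2 ?L \<Longrightarrow> L2_inner ?T (dft h u) (ws x) = L2_inner ?L u (a x)"
    by metis
  \<comment> \<open>The assumption on \<open>v\<close> and \<open>z\<close> holds when
    \<open>v\<close> is the adjoint image of \<open>z\<close>; Cauchy-Schwarz and the isometry of
    \<open>dft\<close> then give Bessel's inequality.\<close>
  have bessel: "L2_norm ?L v \<le> L2_norm ?T z"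
    if "v \<in> L2 ?L" "z \<in> L2 ?T" "L2_ip ?T (dft h v) z = L2_ip ?L v v" for v z
  proof (cases "L2_norm ?L v = 0")
    case False
    have "L2_norm ?L v * L2_norm ?L v \<le> L2_norm ?L v * L2_norm ?T z"
      using L2.Cauchy_Schwarz[OF dft_L2[OF h that(1)] that(2)] that(3) dft_norm[OF h that(1)] L2.nrm_sq[OF that(1)]
      by (simp add: power2_eq_square)
    moreover have "L2_norm ?L v > 0" using False L2_norm_nonneg[of ?L v] by linarith
    ultimately show ?thesis by simp
  qed simp
  have lip: "L2_norm ?L (a x - y) \<le> norm x * R * L2_norm ?T w" for x
  proof -
    have v: "a x - y \<in> L2 ?L" using a y by simp
    have z: "ws x - w \<in> L2 ?T" using ws w by simp
    have "L2_ip ?T (dft h (a x - y)) (ws x - w) = L2_ip ?L (a x - y) (a x - y)"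
      using a(2)[OF v, of x] y(2)[OF v] v dft_L2[OF h v] ws(1)[of x] w a(1)[of x] y(1)
      by (simp only: L2.ip_diff_right) (simp add: L2_ip_def)
    then have "L2_norm ?L (a x - y) \<le> L2_norm ?T (ws x - w)" by (rule bessel[OF v z])
    also have "\<dots> \<le> (norm x * R) * L2_norm ?T w"
    proof (rule L2_dominated(2)[OF w])
      show "ws x - w \<in> borel_measurable ?T" using z by (rule L2_measurable)
      show "0 \<le> norm x * R" using R by simp
      show "AE \<xi> in ?T. cmod ((ws x - w) \<xi>) \<le> norm x * R * cmod (w \<xi>)"
        unfolding torus_AE_iff
      proof (rule AE_I2, rule impI)
        fix \<xi> :: "real ^ 'n" assume \<xi>: "\<xi> \<in> cube (pi / h)"
        have "(ws x - w) \<xi> = (exp (\<i> * of_real (x \<bullet> \<xi>)) - 1) * w \<xi>" by (simp add: ws_def left_diff_distrib)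
        also have "cmod \<dots> \<le> (norm x * R) * cmod (w \<xi>)"
          unfolding norm_mult
        proof (rule mult_right_mono)
          have "\<bar>x \<bullet> \<xi>\<bar> \<le> norm x * norm \<xi>" by (rule Cauchy_Schwarz_ineq2)
          also have "\<dots> \<le> norm x * R" using R(2)[OF \<xi>] by (intro mult_left_mono) auto
          finally show "cmod (exp (\<i> * of_real (x \<bullet> \<xi>)) - 1) \<le> norm x * R"
            using norm_iexp_minus_1[of "x \<bullet> \<xi>"] by linarith
        qed simp
        finally show "cmod ((ws x - w) \<xi>) \<le> norm x * R * cmod (w \<xi>)" .
      qed
    qed
    finally show ?thesis .
  qed
  have a_le: "L2_norm ?L (a x) \<le> L2_norm ?T w" for x
  proof -
    have "L2_norm ?L (a x) \<le> L2_norm ?T (ws x)"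
      by (rule bessel[OF a(1) ws(1)]) (simp add: L2_ip_def a)
    then show ?thesis by (simp add: ws)
  qed
  have a_val: "a x k = cnj (F (x + h *\<^sub>R zvec k))" for x k
  proof -
    let ?d = "\<lambda>n. if n = k then 1 else 0 :: complex"
    have "of_real (h ^ d) * a x k = L2_inner ?T (dft h ?d) (ws x)"
      using a(2)[OF dft_delta(1)[OF h], of k x] by (simp add: lattice_delta_inner[OF h] d_def)
    also have "\<dots> = L2_inner ?T (lattice_wave h k) (ws x)"
      by (rule L2_inner_cong_AE)
         (use dft_delta[OF h, of k] dft_L2[OF h dft_delta(1)[OF h]] lattice_wave_L2 ws in \<open>auto dest: L2_measurable\<close>)
    also have "\<dots> = (LINT \<xi>|lborel. of_real (h ^ d) * cnj (of_real ((2 * pi) powr (- real d / 2)) * (exp (- \<i> * of_real (\<xi> \<bullet> (x + h *\<^sub>R zvec k))) * cnj (W \<xi>))))"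
      unfolding torus_inner unfolding L2_inner_def
    proof (rule Bochner_Integration.integral_cong[OF refl])
      fix \<xi> :: "real ^ 'n"
      define E1 where "E1 = exp (- \<i> * complex_of_real (h * (zvec k \<bullet> \<xi>)))"
      define E2 where "E2 = exp (\<i> * complex_of_real (x \<bullet> \<xi>))"
      define E3 where "E3 = exp (- \<i> * complex_of_real (\<xi> \<bullet> (x + h *\<^sub>R zvec k)))"
      have e: "cnj (exp (- \<i> * of_real s)) * exp (\<i> * of_real t) = cnj (exp (- \<i> * of_real (s + t)))" for s t :: real
        by (simp add: exp_cnj distrib_left flip: exp_add)
      have "h * (zvec k \<bullet> \<xi>) + x \<bullet> \<xi> = \<xi> \<bullet> (x + h *\<^sub>R zvec k)"
        by (simp add: inner_add_right inner_commute[of \<xi>])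
      then have E: "cnj E3 = cnj E1 * E2" unfolding E1_def E2_def E3_def e by simp
      have "- real d / 2 = - (real d / 2)" by simp
      then have p: "h ^ d / (2 * pi) powr (real d / 2) = h ^ d * (2 * pi) powr (- real d / 2)"
        by (simp only: powr_minus_divide) simp
      have lw: "lattice_wave h k \<xi> = of_real (h ^ d) * of_real ((2 * pi) powr (- real d / 2)) * E1"
        unfolding lattice_wave_def d_def[symmetric] p E1_def of_real_mult ..
      show "cnj (indicator (cube (pi / h)) \<xi> * lattice_wave h k \<xi>) * (indicator (cube (pi / h)) \<xi> * ws x \<xi>)
          = of_real (h ^ d) * cnj (of_real ((2 * pi) powr (- real d / 2)) * (exp (- \<i> * of_real (\<xi> \<bullet> (x + h *\<^sub>R zvec k))) * cnj (W \<xi>)))"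
        unfolding lw ws_def W_def E2_def[symmetric] E3_def[symmetric]
        by (cases "\<xi> \<in> cube (pi / h)") (simp_all add: E mult_ac)
    qed
    also have "\<dots> = of_real (h ^ d) * cnj (F (x + h *\<^sub>R zvec k))"
      by (simp add: F_def fourier_integral_def d_def flip: Bochner_Integration.integral_cnj)
    finally show ?thesis using h by simp
  qed
  define N where "N = (\<lambda>x. \<integral>\<^sup>+k. ennreal ((cmod (F (x + h *\<^sub>R zvec k)))\<^sup>2) \<partial>count_space UNIV)"
  have N: "ennreal (h ^ d) * N x = ennreal ((L2_norm ?L (a x))\<^sup>2)" for x
    using L2_nn_integral[OF a(1), of x] by (simp add: lattice_nn_integral[OF h] N_def a_val d_def)
  have [measurable]: "cell_index h -` {0} \<in> sets (borel :: (real ^ 'n) measure)"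
    using measurable_sets[OF cell_index_measurable[of h], of "{0}"] by simp
  have N_meas [measurable]: "N \<in> borel_measurable borel"
    unfolding N_def
  proof (rule sigma_finite_measure.borel_measurable_nn_integral[OF sigma_finite_measure_count_space])
    have "(\<lambda>p. ennreal ((cmod (F (snd p + h *\<^sub>R zvec (fst p))))\<^sup>2)) \<in> borel_measurable (count_space UNIV \<Otimes>\<^sub>M borel)"
      by (rule measurable_pair_measure_countable1) auto
    from measurable_compose[OF measurable_pair_swap' this]
    show "(\<lambda>(x, k). ennreal ((cmod (F (x + h *\<^sub>R zvec k)))\<^sup>2)) \<in> borel_measurable (borel \<Otimes>\<^sub>M count_space UNIV)"
      by (simp add: case_prod_beta')
  qed
  \<comment> \<open>The defect in Bessel's inequality. Its integral over the cell vanishes, since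
    the samples of |F|^2 at all lattice shifts, integrated over one cell, give the full
    integral.\<close>
  define \<phi> where "\<phi> = (\<lambda>x. ennreal ((L2_norm ?T w)\<^sup>2) - ennreal (h ^ d) * N x)"
  have [measurable]: "\<phi> \<in> borel_measurable borel" unfolding \<phi>_def by measurable
  let ?C = "\<lambda>x::real ^ 'n. indicator (cell_index h -` {0}) x :: ennreal"
  have 1: "(\<integral>\<^sup>+x. ?C x * (ennreal (h ^ d) * N x) \<partial>lborel) = ennreal (h ^ d) * ennreal ((L2_norm ?T w)\<^sup>2)"
  proof -
    have "(\<integral>\<^sup>+x. ?C x * (ennreal (h ^ d) * N x) \<partial>lborel) = ennreal (h ^ d) * (\<integral>\<^sup>+x. ?C x * N x \<partial>lborel)"
      by (subst nn_integral_cmult[symmetric]) (auto simp: mult_ac)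
    also have "(\<integral>\<^sup>+x. ?C x * N x \<partial>lborel) = (\<integral>\<^sup>+x. ennreal ((cmod (F x))\<^sup>2) \<partial>lborel)"
      unfolding N_def by (rule nn_integral_cells[OF h, symmetric]) measurable
    also have "\<dots> = ennreal ((L2_norm ?T w)\<^sup>2)" using L2_nn_integral[OF F(1)] F(2) by simp
    finally show ?thesis .
  qed
  have sum: "ennreal (h ^ d) * N x + \<phi> x = ennreal ((L2_norm ?T w)\<^sup>2)" for x
    unfolding \<phi>_def N using a_le[of x] by (intro add_diff_inverse_ennreal) (simp add: ennreal_leI power_mono)
  have "(\<integral>\<^sup>+x. ?C x * (ennreal (h ^ d) * N x) \<partial>lborel) + (\<integral>\<^sup>+x. ?C x * \<phi> x \<partial>lborel)
      = (\<integral>\<^sup>+x. ?C x * ennreal ((L2_norm ?T w)\<^sup>2) \<partial>lborel)"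
  proof -
    have eq: "?C x * ennreal ((L2_norm ?T w)\<^sup>2) = ?C x * (ennreal (h ^ d) * N x) + ?C x * \<phi> x" for x
      by (simp only: sum[of x, symmetric] distrib_left)
    show ?thesis unfolding eq by (rule nn_integral_add[symmetric]) measurable
  qed
  also have "\<dots> = ennreal (h ^ d) * ennreal ((L2_norm ?T w)\<^sup>2)"
    using emeasure_cell[OF h, of "0 :: int ^ 'n"] by (subst nn_integral_multc) (auto simp: d_def)
  also have "\<dots> = ennreal (h ^ d) * ennreal ((L2_norm ?T w)\<^sup>2) + 0" by simp
  finally have "ennreal (h ^ d) * ennreal ((L2_norm ?T w)\<^sup>2) = \<infinity> \<or> (\<integral>\<^sup>+x. ?C x * \<phi> x \<partial>lborel) = 0"
    unfolding 1 ennreal_add_left_cancel .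
  moreover have "ennreal (h ^ d) * ennreal ((L2_norm ?T w)\<^sup>2) \<noteq> \<infinity>"
    by (simp add: ennreal_mult_eq_top_iff)
  ultimately have "(\<integral>\<^sup>+x. ?C x * \<phi> x \<partial>lborel) = 0" by blast
  then have "AE x in lborel. ?C x * \<phi> x = 0" by (subst (asm) nn_integral_0_iff_AE) auto
  then have AE: "AE x in lborel. x \<in> box (\<chi> i. - h / 2) (\<chi> i. h / 2) \<longrightarrow> L2_norm ?L (a x) = L2_norm ?T w"
  proof eventually_elim
    case (elim x)
    show ?case
    proof
      assume "x \<in> box (\<chi> i. - h / 2) (\<chi> i. h / 2)"
      then have "cell_index h x = 0"
        by (auto simp: cell_index_eq_iff[OF h] mem_box_cart less_imp_le)
      then have "\<phi> x = 0" using elim by simp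
      then have "ennreal ((L2_norm ?L (a x))\<^sup>2) = ennreal ((L2_norm ?T w)\<^sup>2)" using sum[of x] N[of x] by simp
      then have "(L2_norm ?L (a x))\<^sup>2 = (L2_norm ?T w)\<^sup>2" by simp
      then show "L2_norm ?L (a x) = L2_norm ?T w" by (simp add: power2_eq_iff_nonneg)
    qed
  qed
  \<comment> \<open>Equality is known at points x arbitrarily close to 0, and \<open>lip\<close>
    controls the difference of \<open>a x\<close> and \<open>y\<close>.\<close>
  have "\<bar>L2_norm ?L y - L2_norm ?T w\<bar> \<le> e" if e: "e > 0" for e
  proof -
    define r where "r = e / (R * L2_norm ?T w + 1)"
    have den: "R * L2_norm ?T w + 1 > 0" using R by (simp add: add_nonneg_pos)
    then have r: "r > 0" using e by (simp add: r_def)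
    have z: "(0 :: real ^ 'n) \<in> box (\<chi> i. - h / 2) (\<chi> i. h / 2)" using h by (simp add: mem_box_cart)
    obtain x where x: "norm x < r" "L2_norm ?L (a x) = L2_norm ?T w"
      using exists_near_zero_AE[OF AE open_box z r] by blast
    have "\<bar>L2_norm ?L y - L2_norm ?L (a x)\<bar> \<le> L2_norm ?L (a x - y)"
      using L2.nrm_triangle_le[OF a(1) y(1), of x] L2.nrm_triangle_le[OF y(1) a(1), of x] L2.nrm_commute[OF a(1) y(1), of x] by linarith
    also have "\<dots> \<le> norm x * (R * L2_norm ?T w)" using lip[of x] by (simp add: mult.assoc)
    also have "\<dots> \<le> r * (R * L2_norm ?T w + 1)" using x R r by (intro mult_mono) auto
    also have "\<dots> = e" using den by (simp add: r_def)
    finally show ?thesis using x by simp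
  qed
  then have "\<bar>L2_norm ?L y - L2_norm ?T w\<bar> \<le> 0" by (rule field_le_epsilon[of _ 0, simplified])
  then show ?thesis by simp
qed

text \<open>For the adjoint image \<open>y\<close> of \<open>w\<close>, the equality of norms from
  \<open>dft_parseval\<close> makes the expansion of |dft y - w|^2 vanish.\<close>

lemma unitary_dft:
  assumes h: "h > 0"
  shows "unitary_L2 (lattice h) (torus h) (dft h)"
  unfolding unitary_L2_def
proof (intro conjI ballI)
  fix w :: "real ^ 'a \<Rightarrow> complex" assume w: "w \<in> L2 (torus h)"
  obtain y where y: "y \<in> L2 (lattice h)" "\<And>u. u \<in> L2 (lattice h) \<Longrightarrow> L2_inner (torus h) (dft h u) w = L2_inner (lattice h) u y"
    using L2_adjoint_exists[OF dft_L2[OF h] dft_inner[OF h] w] by blast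
  have ny: "L2_norm (lattice h) y = L2_norm (torus h) w" by (rule dft_parseval[OF h w y])
  have D: "dft h y \<in> L2 (torus h)" by (rule dft_L2[OF h y(1)])
  have "L2_ip (torus h) (dft h y) w = (L2_norm (torus h) w)\<^sup>2"
    using y(2)[OF y(1)] ny by (simp add: L2_ip_def L2_inner_self)
  moreover have "(L2_norm (torus h) (dft h y - w))\<^sup>2 = (L2_norm (torus h) (dft h y))\<^sup>2 - 2 * L2_ip (torus h) (dft h y) w + (L2_norm (torus h) w)\<^sup>2"
    using D w L2.ip_commute[OF w D] by (simp only: L2.nrm_sq L2.S_closed L2.ip_simps)
  ultimately have "L2_norm (torus h) (dft h y - w) = 0" using dft_norm[OF h y(1)] ny by simp
  then have "AE \<xi> in torus h. dft h y \<xi> = w \<xi>" using L2_norm_diff_eq_0_iff[OF D w] by simp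
  then show "\<exists>f\<in>L2 (lattice h). AE \<xi> in torus h. dft h f \<xi> = w \<xi>" using y(1) by blast
qed (use dft_L2[OF h] dft_inner[OF h] in auto)

section \<open>The Fourier transform of cell functions\<close>

definition cell_factor :: "real ^ 'n \<Rightarrow> complex" where
  "cell_factor \<xi> = (LINT y|lborel. exp (- \<i> * of_real (y \<bullet> \<xi>)) * indicator (cell_index 1 -` {0}) y)"

lemma cell_sets [measurable]: "cell_index h -` {k} \<in> sets borel"
  using measurable_sets[OF cell_index_measurable[of h], of "{k}"] by simp

lemma integrable_indicator_algebra:
  assumes "A \<in> sets M" "emeasure M A < \<infinity>"
  shows "integrable M (\<lambda>x. indicator A x :: 'b::{real_normed_algebra_1,banach,second_countable_topology})"
proof -
  have "(\<lambda>x. indicator A x :: 'b) = (\<lambda>x. indicator A x *\<^sub>R 1)" by (auto simp: indicator_def)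
  then show ?thesis using assms by simp
qed

lemma unit_cell:
  shows "integrable lborel (\<lambda>y::real ^ 'n. indicator (cell_index 1 -` {0}) y :: 'b::{real_normed_algebra_1,banach,second_countable_topology})"
    and "(LINT y|lborel. indicator (cell_index 1 -` {0}) (y :: real ^ 'n) :: real) = 1"
proof -
  have e: "emeasure lborel (cell_index 1 -` {0} :: (real ^ 'n) set) = 1"
    using emeasure_cell[of 1 "0 :: int ^ 'n"] by simp
  show "integrable lborel (\<lambda>y::real ^ 'n. indicator (cell_index 1 -` {0}) y :: 'b)"
    using e by (intro integrable_indicator_algebra) auto
  show "(LINT y|lborel. indicator (cell_index 1 -` {0}) (y :: real ^ 'n) :: real) = 1"
    using e by (simp add: measure_def)
qed

lemma unit_cell_inner:
  fixes y \<xi> :: "real ^ 'n"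
  assumes "y \<in> cell_index 1 -` {0}"
  shows "\<bar>y \<bullet> \<xi>\<bar> \<le> real CARD('n) * norm \<xi>"
proof -
  have "cell_index 1 y = 0" using assms by simp
  then have "\<bar>y $ i\<bar> \<le> 1" for i
    unfolding cell_index_eq_iff[OF zero_less_one] by (auto simp: abs_le_iff dest: spec[of _ i])
  then have "(\<Sum>i\<in>UNIV. \<bar>y $ i\<bar>) \<le> (\<Sum>i\<in>(UNIV :: 'n set). 1)" by (intro sum_mono) auto
  then have "norm y \<le> real CARD('n)" using norm_le_l1_cart[of y] by simp
  then show ?thesis
    using Cauchy_Schwarz_ineq2[of y \<xi>] mult_right_mono[of "norm y" "real CARD('n)" "norm \<xi>"] by simp
qed

lemma cell_kernel_integrable:
  "integrable lborel (\<lambda>y::real ^ 'n. exp (- \<i> * of_real (y \<bullet> \<xi>)) * indicator (cell_index 1 -` {0}) y)"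
  by (rule exp_kernel_integrable) (rule unit_cell)

lemma cell_factor_measurable [measurable]: "cell_factor \<in> borel_measurable borel"
proof -
  have "(\<lambda>\<xi>::real ^ 'n. LINT y|lborel. exp (- \<i> * of_real (y \<bullet> \<xi>)) * indicator (cell_index 1 -` {0}) y) \<in> borel_measurable borel"
    by (rule lborel.borel_measurable_lebesgue_integral) measurable
  then show ?thesis unfolding cell_factor_def[abs_def] .
qed

lemma cell_factor_le_1: "cmod (cell_factor (\<xi> :: real ^ 'n)) \<le> 1"
proof -
  have "cmod (cell_factor \<xi>) \<le> (LINT y|lborel. cmod (exp (- \<i> * of_real (y \<bullet> \<xi>)) * indicator (cell_index 1 -` {0}) y))"
    unfolding cell_factor_def by (rule integral_norm_bound)
  also have "\<dots> = (LINT y|lborel. indicator (cell_index 1 -` {0}) (y :: real ^ 'n))"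
    by (intro Bochner_Integration.integral_cong) (auto simp: norm_mult indicator_def)
  finally show ?thesis using unit_cell(2)[where 'n='n] by simp
qed

text \<open>\<open>cell_factor\<close> is a product of sinc functions of \<xi>_i / 2, but only
  integral bounds are used. The second bound is quadratic because it measures squared mass off the
  cube; the tail itself is then of first order.\<close>

lemma cell_factor_near_1:
  fixes \<xi> :: "real ^ 'n"
  shows "cmod (1 - cell_factor \<xi>) \<le> real CARD('n) * norm \<xi>"
    "1 - (cmod (cell_factor \<xi>))\<^sup>2 \<le> (real CARD('n) * norm \<xi>)\<^sup>2"
proof -
  let ?C = "cell_index 1 -` {0} :: (real ^ 'n) set"
  define D where "D = real CARD('n) * norm \<xi>"
  have one: "(LINT y|lborel. indicator ?C y :: complex) = 1"
    using unit_cell(2)[where 'n='n] integral_complex_of_real[of lborel "\<lambda>y. indicator ?C y"]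
    by (simp add: of_real_indicator)
  have diff: "1 - cell_factor \<xi> = (LINT y|lborel. indicator ?C y * (1 - exp (- \<i> * of_real (y \<bullet> \<xi>))))"
  proof -
    have "1 - cell_factor \<xi> = (LINT y|lborel. indicator ?C y) - (LINT y|lborel. exp (- \<i> * of_real (y \<bullet> \<xi>)) * indicator ?C y)"
      by (simp only: one cell_factor_def)
    also have "\<dots> = (LINT y|lborel. indicator ?C y - exp (- \<i> * of_real (y \<bullet> \<xi>)) * indicator ?C y)"
      by (rule Bochner_Integration.integral_diff[symmetric, OF unit_cell(1) cell_kernel_integrable])
    finally show ?thesis by (simp add: right_diff_distrib mult.commute)
  qed
  have int: "integrable lborel (\<lambda>y. indicator ?C y * (1 - exp (- \<i> * of_real (y \<bullet> \<xi>))))"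
    using Bochner_Integration.integrable_diff[OF unit_cell(1) cell_kernel_integrable[of \<xi>]]
    by (simp add: right_diff_distrib mult.commute)
  have le: "cmod (1 - exp (- \<i> * of_real (y \<bullet> \<xi>))) \<le> \<bar>y \<bullet> \<xi>\<bar>" for y :: "real ^ 'n"
    using norm_iexp_minus_1[of "- (y \<bullet> \<xi>)"] by (simp add: norm_minus_commute)
  have "cmod (1 - cell_factor \<xi>) \<le> (LINT y|lborel. cmod (indicator ?C y * (1 - exp (- \<i> * of_real (y \<bullet> \<xi>)))))"
    unfolding diff by (rule integral_norm_bound)
  also have "\<dots> \<le> (LINT y|lborel. D * indicator ?C y)"
  proof (rule integral_mono)
    show "integrable lborel (\<lambda>y. cmod (indicator ?C y * (1 - exp (- \<i> * of_real (y \<bullet> \<xi>)))))"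
      using int by (rule integrable_norm)
    show "integrable lborel (\<lambda>y. D * indicator ?C y)" using unit_cell(1) by auto
    show "cmod (indicator ?C y * (1 - exp (- \<i> * of_real (y \<bullet> \<xi>)))) \<le> D * indicator ?C y" for y
      using le[of y] unit_cell_inner[of y \<xi>] by (auto simp: indicator_def D_def)
  qed
  also have "\<dots> = D" using unit_cell(2)[where 'n='n] by simp
  finally show "cmod (1 - cell_factor \<xi>) \<le> real CARD('n) * norm \<xi>" by (simp add: D_def)
  \<comment> \<open>For |e| = 1 one has |e - 1|^2 = 2 (1 - Re e).\<close>
  have Re_le: "1 - Re (exp (- \<i> * of_real t)) \<le> t\<^sup>2 / 2" for t :: real
  proof -
    define e where "e = exp (- \<i> * complex_of_real t)"
    have "cmod e = 1" by (simp add: e_def)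
    then have e2: "(Re e)\<^sup>2 + (Im e)\<^sup>2 = 1" by (simp add: cmod_def)
    have "cmod (e - 1) \<le> \<bar>t\<bar>" using norm_iexp_minus_1[of "- t"] by (simp add: e_def)
    then have "(cmod (e - 1))\<^sup>2 \<le> \<bar>t\<bar>\<^sup>2" by (intro power_mono) auto
    then have "(Re e - 1)\<^sup>2 + (Im e)\<^sup>2 \<le> t\<^sup>2" by (simp add: cmod_power2)
    then have "1 - Re e \<le> t\<^sup>2 / 2" using e2 by (simp add: power2_eq_square algebra_simps)
    then show ?thesis unfolding e_def .
  qed
  have "1 - Re (cell_factor \<xi>) = (LINT y|lborel. Re (indicator ?C y * (1 - exp (- \<i> * of_real (y \<bullet> \<xi>)))))"
    using integral_Re[OF int] diff by (metis minus_complex.sel(1) one_complex.sel(1))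
  also have "\<dots> \<le> (LINT y|lborel. (D\<^sup>2 / 2) * indicator ?C y)"
  proof (rule integral_mono)
    show "integrable lborel (\<lambda>y. Re (indicator ?C y * (1 - exp (- \<i> * of_real (y \<bullet> \<xi>)))))"
      using int by (rule integrable_Re)
    show "integrable lborel (\<lambda>y. (D\<^sup>2 / 2) * indicator ?C y)" using unit_cell(1) by auto
    show "Re (indicator ?C y * (1 - exp (- \<i> * of_real (y \<bullet> \<xi>)))) \<le> (D\<^sup>2 / 2) * indicator ?C y" for y
    proof (cases "y \<in> ?C")
      case True
      have "(y \<bullet> \<xi>)\<^sup>2 \<le> D\<^sup>2"
        using unit_cell_inner[OF True, of \<xi>] power_mono[of "\<bar>y \<bullet> \<xi>\<bar>" D 2] by (simp add: D_def)
      then show ?thesis using Re_le[of "y \<bullet> \<xi>"] True by simp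
    qed simp
  qed
  also have "\<dots> = D\<^sup>2 / 2" using unit_cell(2)[where 'n='n] by simp
  finally have Re: "1 - Re (cell_factor \<xi>) \<le> D\<^sup>2 / 2" .
  have R1: "\<bar>Re (cell_factor \<xi>)\<bar> \<le> 1" using abs_Re_le_cmod cell_factor_le_1 order_trans by blast
  have "1 - (cmod (cell_factor \<xi>))\<^sup>2 \<le> 1 - (Re (cell_factor \<xi>))\<^sup>2"
    by (simp add: cmod_power2)
  also have "\<dots> = (1 - Re (cell_factor \<xi>)) * (1 + Re (cell_factor \<xi>))" by (simp add: power2_eq_square algebra_simps)
  also have "\<dots> \<le> (1 - Re (cell_factor \<xi>)) * 2" using R1 by (intro mult_left_mono) auto
  also have "\<dots> \<le> D\<^sup>2" using Re by simp
  finally show "1 - (cmod (cell_factor \<xi>))\<^sup>2 \<le> (real CARD('n) * norm \<xi>)\<^sup>2" by (simp add: D_def)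
qed

text \<open>In the substitution x = h k + h y, the translation produces the wave and the dilation
  evaluates the factor at h \<xi>.\<close>

lemma fourier_cell_delta:
  fixes k :: "int ^ 'n"
  assumes h: "h > 0"
  shows "AE \<xi> in lborel. fourier (cell_embed h (\<lambda>n. if n = k then 1 else 0)) \<xi> = cell_factor (h *\<^sub>R \<xi>) * lattice_wave h k \<xi>"
proof -
  let ?d = "\<lambda>n. if n = k then 1 else 0 :: complex"
  have eq: "cell_embed h ?d = (\<lambda>x. indicator (cell_index h -` {k}) x)"
    by (auto simp: cell_embed_def fun_eq_iff)
  have m: "cell_embed h ?d \<in> L2 lborel" by (rule cell_embed_L2[OF h dft_delta(1)[OF h]])
  have int: "integrable lborel (cell_embed h ?d)"
    unfolding eq using emeasure_cell[OF h, of k] by (intro integrable_indicator_algebra) auto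
  have "fourier_integral (cell_embed h ?d) \<xi> = cell_factor (h *\<^sub>R \<xi>) * lattice_wave h k \<xi>" for \<xi>
  proof -
    have "(LINT x|lborel. exp (- \<i> * of_real (x \<bullet> \<xi>)) * cell_embed h ?d x)
       = h ^ CARD('n) *\<^sub>R (LINT y|lborel. exp (- \<i> * of_real ((h *\<^sub>R zvec k + h *\<^sub>R y) \<bullet> \<xi>)) * cell_embed h ?d (h *\<^sub>R zvec k + h *\<^sub>R y))"
      by (subst lborel_integral_affine[OF _ h, of _ "h *\<^sub>R zvec k"]) auto
    also have "(LINT y|lborel. exp (- \<i> * of_real ((h *\<^sub>R zvec k + h *\<^sub>R y) \<bullet> \<xi>)) * cell_embed h ?d (h *\<^sub>R zvec k + h *\<^sub>R y))
       = (LINT y|lborel. exp (- \<i> * of_real (h * (zvec k \<bullet> \<xi>))) * (exp (- \<i> * of_real (y \<bullet> (h *\<^sub>R \<xi>))) * indicator (cell_index 1 -` {0}) y))"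
    proof (rule Bochner_Integration.integral_cong[OF refl])
      fix y :: "real ^ 'n"
      have "(\<forall>i. h * (of_int (k $ i) - 1 / 2) \<le> (h *\<^sub>R zvec k + h *\<^sub>R y) $ i \<and> (h *\<^sub>R zvec k + h *\<^sub>R y) $ i < h * (of_int (k $ i) + 1 / 2))
         \<longleftrightarrow> (\<forall>i. 1 * (of_int ((0 :: int ^ 'n) $ i) - 1 / 2) \<le> y $ i \<and> y $ i < 1 * (of_int ((0 :: int ^ 'n) $ i) + 1 / 2))"
      proof (rule all_cong1)
        fix i
        have "h * (of_int (k $ i) - 1 / 2) \<le> h * of_int (k $ i) + h * y $ i \<longleftrightarrow> - 1 / 2 \<le> y $ i"
          using mult_le_cancel_left_pos[OF h, of "- 1 / 2" "y $ i"] by (simp add: right_diff_distrib)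
        moreover have "h * of_int (k $ i) + h * y $ i < h * (of_int (k $ i) + 1 / 2) \<longleftrightarrow> h * y $ i < h * (1 / 2)"
          by (simp add: distrib_left)
        ultimately show "h * (of_int (k $ i) - 1 / 2) \<le> (h *\<^sub>R zvec k + h *\<^sub>R y) $ i \<and> (h *\<^sub>R zvec k + h *\<^sub>R y) $ i < h * (of_int (k $ i) + 1 / 2)
          \<longleftrightarrow> 1 * (of_int ((0 :: int ^ 'n) $ i) - 1 / 2) \<le> y $ i \<and> y $ i < 1 * (of_int ((0 :: int ^ 'n) $ i) + 1 / 2)"
          using h by (simp add: zvec_def)
      qed
      then have "cell_embed h ?d (h *\<^sub>R zvec k + h *\<^sub>R y) = indicator (cell_index 1 -` {0}) y"
        unfolding cell_embed_def cell_index_eq_iff[OF h, symmetric] cell_index_eq_iff[OF zero_less_one, symmetric]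
        by (simp add: indicator_def)
      moreover have "exp (- \<i> * of_real ((h *\<^sub>R zvec k + h *\<^sub>R y) \<bullet> \<xi>)) = exp (- \<i> * of_real (h * (zvec k \<bullet> \<xi>))) * exp (- \<i> * of_real (y \<bullet> (h *\<^sub>R \<xi>)))"
        by (simp add: inner_add_left distrib_left flip: exp_add)
      ultimately show "exp (- \<i> * of_real ((h *\<^sub>R zvec k + h *\<^sub>R y) \<bullet> \<xi>)) * cell_embed h ?d (h *\<^sub>R zvec k + h *\<^sub>R y)
         = exp (- \<i> * of_real (h * (zvec k \<bullet> \<xi>))) * (exp (- \<i> * of_real (y \<bullet> (h *\<^sub>R \<xi>))) * indicator (cell_index 1 -` {0}) y)"
        by (simp only: mult.assoc)
    qed
    also have "\<dots> = exp (- \<i> * of_real (h * (zvec k \<bullet> \<xi>))) * cell_factor (h *\<^sub>R \<xi>)"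
      unfolding cell_factor_def by (rule integral_mult_right_zero)
    finally have I: "(LINT x|lborel. exp (- \<i> * of_real (x \<bullet> \<xi>)) * cell_embed h ?d x)
       = of_real (h ^ CARD('n)) * (exp (- \<i> * of_real (h * (zvec k \<bullet> \<xi>))) * cell_factor (h *\<^sub>R \<xi>))"
      by (simp only: scaleR_conv_of_real)
    have "- real CARD('n) / 2 = - (real CARD('n) / 2)" by simp
    then have p: "h ^ CARD('n) / (2 * pi) powr (real CARD('n) / 2) = (2 * pi) powr (- real CARD('n) / 2) * h ^ CARD('n)"
      by (simp only: powr_minus_divide) simp
    show ?thesis unfolding fourier_integral_def I lattice_wave_def p of_real_mult by (simp only: mult_ac)
  qed
  then show ?thesis using fourier_eq_integral[OF m int] by simp
qed

lemma L2_cube_bounded: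
  assumes "f \<in> L2 (torus h)"
  shows "(\<lambda>\<xi>. indicator (cube (pi / h)) \<xi> * (cell_factor (h *\<^sub>R \<xi>) * f \<xi>)) \<in> L2 lborel"
    "L2_norm lborel (\<lambda>\<xi>. indicator (cube (pi / h)) \<xi> * (cell_factor (h *\<^sub>R \<xi>) * f \<xi>)) \<le> L2_norm (torus h) f"
proof -
  have f: "(\<lambda>\<xi>. indicator (cube (pi / h)) \<xi> * f \<xi>) \<in> L2 lborel" using assms by (simp add: torus_L2_iff)
  have eq: "(\<lambda>\<xi>. indicator (cube (pi / h)) \<xi> * (cell_factor (h *\<^sub>R \<xi>) * f \<xi>)) = (\<lambda>\<xi>. cell_factor (h *\<^sub>R \<xi>) * (indicator (cube (pi / h)) \<xi> * f \<xi>))"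
    by (simp add: fun_eq_iff)
  show "(\<lambda>\<xi>. indicator (cube (pi / h)) \<xi> * (cell_factor (h *\<^sub>R \<xi>) * f \<xi>)) \<in> L2 lborel"
    "L2_norm lborel (\<lambda>\<xi>. indicator (cube (pi / h)) \<xi> * (cell_factor (h *\<^sub>R \<xi>) * f \<xi>)) \<le> L2_norm (torus h) f"
    unfolding eq torus_norm using L2_bounded_mult[OF f, of "\<lambda>\<xi>. cell_factor (h *\<^sub>R \<xi>)" 1, OF _ _ cell_factor_le_1]
    by simp_all
qed

lemma cell_embed_add: "cell_embed h (u + v) = cell_embed h u + cell_embed h v"
  by (simp add: cell_embed_def fun_eq_iff)

lemma cell_embed_cmult: "cell_embed h (\<lambda>n. c * u n) = (\<lambda>x. c * cell_embed h u x)"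
  by (simp add: cell_embed_def fun_eq_iff)

text \<open>True for unit vectors, hence for finitely supported functions, hence in general since
  both sides are bounded by the norm of \<open>u\<close>. The indicator confines the identity to the
  cube, where the values of \<open>dft h u\<close> are determined.\<close>

lemma fourier_cell_embed:
  fixes u :: "int ^ 'n \<Rightarrow> complex"
  assumes h: "h > 0" and u: "u \<in> L2 (lattice h)"
  shows "AE \<xi> in lborel. indicator (cube (pi / h)) \<xi> * fourier (cell_embed h u) \<xi>
     = indicator (cube (pi / h)) \<xi> * (cell_factor (h *\<^sub>R \<xi>) * dft h u \<xi>)"
proof -
  let ?I = "\<lambda>\<xi>. indicator (cube (pi / h)) \<xi> :: complex"
  define X where "X = (\<lambda>(u :: int ^ 'n \<Rightarrow> complex) \<xi>. ?I \<xi> * fourier (cell_embed h u) \<xi>)"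
  define Y where "Y = (\<lambda>(u :: int ^ 'n \<Rightarrow> complex) (\<xi> :: real ^ 'n). ?I \<xi> * (cell_factor (h *\<^sub>R \<xi>) * dft h u \<xi>))"
  let ?P = "\<lambda>u. AE \<xi> in lborel. X u \<xi> = Y u \<xi>"
  have X: "X u \<in> L2 lborel" "L2_norm lborel (X u) \<le> L2_norm (lattice h) u" if "u \<in> L2 (lattice h)" for u
    using L2_cube[OF fourier_L2[OF cell_embed_L2[OF h that]], of "pi / h"]
    by (simp_all add: X_def fourier_norm[OF cell_embed_L2[OF h that]] cell_embed_norm[OF h])
  have Y: "Y u \<in> L2 lborel" "L2_norm lborel (Y u) \<le> L2_norm (lattice h) u" if "u \<in> L2 (lattice h)" for u
    using L2_cube_bounded[OF dft_L2[OF h that]] by (simp_all add: Y_def dft_norm[OF h that])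
  have Xadd: "AE \<xi> in lborel. X (u + v) \<xi> = X u \<xi> + X v \<xi>" if "u \<in> L2 (lattice h)" "v \<in> L2 (lattice h)" for u v
    using fourier_add[OF cell_embed_L2[OF h that(1)] cell_embed_L2[OF h that(2)]]
    by eventually_elim (simp add: X_def cell_embed_add distrib_left)
  have Yadd: "AE \<xi> in lborel. Y (u + v) \<xi> = Y u \<xi> + Y v \<xi>" if "u \<in> L2 (lattice h)" "v \<in> L2 (lattice h)" for u v
    using dft_add[OF h that] unfolding torus_AE_iff
    by eventually_elim (auto simp: Y_def distrib_left indicator_def)
  have Xc: "AE \<xi> in lborel. X (\<lambda>n. c * u n) \<xi> = c * X u \<xi>" if "u \<in> L2 (lattice h)" for u c
    using fourier_cmult[OF cell_embed_L2[OF h that(1)], of c]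
    by eventually_elim (simp add: X_def cell_embed_cmult)
  have Yc: "AE \<xi> in lborel. Y (\<lambda>n. c * u n) \<xi> = c * Y u \<xi>" if "u \<in> L2 (lattice h)" for u c
    using dft_cmult[OF h that, of c] unfolding torus_AE_iff
    by eventually_elim (auto simp: Y_def indicator_def)
  let ?d = "\<lambda>k n. if n = k then 1 else 0 :: complex"
  have P_delta: "?P (\<lambda>n. c * ?d k n)" for k c
  proof -
    have "?P (?d k)"
      using fourier_cell_delta[OF h, of k] dft_delta(2)[OF h, of k] unfolding torus_AE_iff
      by eventually_elim (auto simp: X_def Y_def indicator_def)
    with Xc[OF dft_delta(1)[OF h], of c k] Yc[OF dft_delta(1)[OF h], of c k] show ?thesis
      by eventually_elim simp
  qed
  have P_fin: "?P (\<lambda>n. indicator S n * u n)" if "finite S" for S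
    using that
  proof (induction S)
    case empty
    show ?case using P_delta[of 0] by simp
  next
    case (insert k S)
    have eq: "(\<lambda>n. indicator (insert k S) n * u n) = (\<lambda>n. indicator S n * u n) + (\<lambda>n. u k * ?d k n)"
      using insert.hyps by (auto simp: fun_eq_iff indicator_def)
    have m: "(\<lambda>n. u k * ?d k n) \<in> L2 (lattice h)" by (rule L2_cmult[OF dft_delta(1)[OF h]])
    show ?case unfolding eq
      using insert.IH P_delta[of "u k" k] Xadd[OF lattice_cut[OF h u, of S] m] Yadd[OF lattice_cut[OF h u, of S] m]
      by eventually_elim simp
  qed
  \<comment> \<open>X and Y agree on the cut-off \<open>?s\<close>, so X u - Y u equals Y - X
    evaluated at ?s - u.\<close>
  have bound: "L2_norm lborel (X u - Y u) \<le> 2 * L2_norm (lattice h) ((\<lambda>n. indicator S n * u n) - u)" if S: "finite S" for S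
  proof -
    let ?s = "\<lambda>n. indicator S n * u n"
    let ?v = "(\<lambda>n. (-1) * u n) + ?s"
    have s: "?s \<in> L2 (lattice h)" by (rule lattice_cut[OF h u])
    have nu: "(\<lambda>n. (-1) * u n) \<in> L2 (lattice h)" by (rule L2_cmult[OF u])
    have v: "?v \<in> L2 (lattice h)" using nu s by (rule L2_add)
    have "AE \<xi> in lborel. (X u - Y u) \<xi> = (Y ?v - X ?v) \<xi>"
      using P_fin[OF S] Xadd[OF nu s] Yadd[OF nu s] Xc[OF u, of "-1"] Yc[OF u, of "-1"]
      by eventually_elim simp
    then have "L2_norm lborel (X u - Y u) = L2_norm lborel (Y ?v - X ?v)"
      using L2.S_closed(3)[OF X(1)[OF u] Y(1)[OF u]] L2.S_closed(3)[OF Y(1)[OF v] X(1)[OF v]]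
      by (intro L2_norm_cong_AE) (auto dest: L2_measurable)
    also have "\<dots> \<le> L2_norm lborel (Y ?v) + L2_norm lborel (X ?v)"
      by (rule L2.nrm_diff_le[OF Y(1)[OF v] X(1)[OF v]])
    also have "\<dots> \<le> 2 * L2_norm (lattice h) ?v" using X(2)[OF v] Y(2)[OF v] by linarith
    also have "?v = ?s - u" by (auto simp: fun_eq_iff)
    finally show ?thesis .
  qed
  have "((\<lambda>S. 2 * L2_norm (lattice h) ((\<lambda>n. indicator S n * u n) - u)) \<longlongrightarrow> 2 * 0) (finite_subsets_at_top UNIV)"
    using lattice_cut_tendsto[OF h u] unfolding L2_tendsto_alt by (intro tendsto_intros) auto
  moreover have "\<forall>\<^sub>F S in finite_subsets_at_top UNIV. L2_norm lborel (X u - Y u) \<le> 2 * L2_norm (lattice h) ((\<lambda>n. indicator S n * u n) - u)"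
    using eventually_finite_subsets by eventually_elim (rule bound)
  ultimately have "L2_norm lborel (X u - Y u) \<le> 2 * 0"
    by (rule tendsto_lowerbound) simp
  then have "L2_norm lborel (X u - Y u) = 0" using L2_norm_nonneg[of lborel "X u - Y u"] by linarith
  then show ?thesis
    using L2_norm_diff_eq_0_iff[OF X(1)[OF u] Y(1)[OF u]] by (simp add: X_def Y_def)
qed

text \<open>J and both transforms are isometries, so the mass of the transform of \<open>J u\<close>
  off the cube equals the mass missing inside, namely the integral of (1 - |S(h \<xi>)|^2) |dft h
  u|^2 over the cube.\<close>

lemma fourier_cell_embed_tail:
  fixes u :: "int ^ 'n \<Rightarrow> complex" and \<omega> :: "real ^ 'n \<Rightarrow> real"
  assumes h: "h > 0" and u: "u \<in> L2 (lattice h)" and e: "e \<ge> 0"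
    and \<omega>: "\<And>\<xi>. \<xi> \<in> cube (pi / h) \<Longrightarrow> 1 - (cmod (cell_factor (h *\<^sub>R \<xi>)))\<^sup>2 \<le> (e * \<omega> \<xi>)\<^sup>2"
    and y: "(\<lambda>\<xi>. of_real (\<omega> \<xi>) * dft h u \<xi>) \<in> L2 (torus h)"
  shows "L2_norm lborel (\<lambda>\<xi>. indicator (- cube (pi / h)) \<xi> * fourier (cell_embed h u) \<xi>)
     \<le> e * L2_norm (torus h) (\<lambda>\<xi>. of_real (\<omega> \<xi>) * dft h u \<xi>)"
proof -
  let ?I = "\<lambda>\<xi>. indicator (cube (pi / h)) \<xi> :: complex" and ?O = "\<lambda>\<xi>. indicator (- cube (pi / h)) \<xi> :: complex"
  define f where "f = fourier (cell_embed h u)"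
  define g where "g = dft h u"
  have f: "f \<in> L2 lborel" unfolding f_def by (rule fourier_L2[OF cell_embed_L2[OF h u]])
  have [measurable]: "f \<in> borel_measurable borel" using L2_measurable[OF f] by simp
  have g: "(\<lambda>\<xi>. ?I \<xi> * g \<xi>) \<in> L2 lborel" using dft_L2[OF h u] by (simp add: torus_L2_iff g_def)
  have Sg: "(\<lambda>\<xi>. ?I \<xi> * (cell_factor (h *\<^sub>R \<xi>) * g \<xi>)) \<in> L2 lborel"
    using L2_cube_bounded(1)[OF dft_L2[OF h u]] by (simp add: g_def)
  have If: "(\<lambda>\<xi>. ?I \<xi> * f \<xi>) \<in> L2 lborel" by (rule L2_cube(1)[OF f])
  have Of: "(\<lambda>\<xi>. ?O \<xi> * f \<xi>) \<in> L2 lborel"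
    by (rule L2_bounded_mult(1)[OF f, of _ 1]) (auto simp: indicator_def)
  have wg: "(\<lambda>\<xi>. ?I \<xi> * (of_real (\<omega> \<xi>) * g \<xi>)) \<in> L2 lborel" using y by (simp add: torus_L2_iff g_def)
  have "(L2_norm lborel f)\<^sup>2 = (LINT \<xi>|lborel. (cmod (?I \<xi> * f \<xi>))\<^sup>2 + (cmod (?O \<xi> * f \<xi>))\<^sup>2)"
    unfolding L2_norm_def by (subst real_sqrt_pow2) (auto intro!: Bochner_Integration.integral_cong simp: indicator_def)
  also have "\<dots> = (L2_norm lborel (\<lambda>\<xi>. ?I \<xi> * f \<xi>))\<^sup>2 + (L2_norm lborel (\<lambda>\<xi>. ?O \<xi> * f \<xi>))\<^sup>2"
    using L2_integrable[OF If] L2_integrable[OF Of] by (simp add: L2_norm_def)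
  finally have 1: "(L2_norm lborel f)\<^sup>2 = (L2_norm lborel (\<lambda>\<xi>. ?I \<xi> * f \<xi>))\<^sup>2 + (L2_norm lborel (\<lambda>\<xi>. ?O \<xi> * f \<xi>))\<^sup>2" .
  have "L2_norm lborel f = L2_norm (lattice h) u"
    by (simp add: f_def fourier_norm[OF cell_embed_L2[OF h u]] cell_embed_norm[OF h])
  also have "\<dots> = L2_norm lborel (\<lambda>\<xi>. ?I \<xi> * g \<xi>)" by (simp add: dft_norm[OF h u, symmetric] torus_norm g_def)
  finally have 2: "L2_norm lborel f = L2_norm lborel (\<lambda>\<xi>. ?I \<xi> * g \<xi>)" .
  have 3: "L2_norm lborel (\<lambda>\<xi>. ?I \<xi> * f \<xi>) = L2_norm lborel (\<lambda>\<xi>. ?I \<xi> * (cell_factor (h *\<^sub>R \<xi>) * g \<xi>))"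
    using fourier_cell_embed[OF h u] L2_measurable[OF If] L2_measurable[OF Sg]
    by (intro L2_norm_cong_AE) (auto simp: f_def g_def)
  have "(L2_norm lborel (\<lambda>\<xi>. ?I \<xi> * g \<xi>))\<^sup>2 - (L2_norm lborel (\<lambda>\<xi>. ?I \<xi> * (cell_factor (h *\<^sub>R \<xi>) * g \<xi>)))\<^sup>2
     = (LINT \<xi>|lborel. (cmod (?I \<xi> * g \<xi>))\<^sup>2 - (cmod (?I \<xi> * (cell_factor (h *\<^sub>R \<xi>) * g \<xi>)))\<^sup>2)"
    using L2_integrable[OF g] L2_integrable[OF Sg] by (simp add: L2_norm_def)
  also have "\<dots> \<le> (LINT \<xi>|lborel. e\<^sup>2 * (cmod (?I \<xi> * (of_real (\<omega> \<xi>) * g \<xi>)))\<^sup>2)"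
  proof (rule integral_mono)
    show "integrable lborel (\<lambda>\<xi>. (cmod (?I \<xi> * g \<xi>))\<^sup>2 - (cmod (?I \<xi> * (cell_factor (h *\<^sub>R \<xi>) * g \<xi>)))\<^sup>2)"
      using L2_integrable[OF g] L2_integrable[OF Sg] by (rule Bochner_Integration.integrable_diff)
    show "integrable lborel (\<lambda>\<xi>. e\<^sup>2 * (cmod (?I \<xi> * (of_real (\<omega> \<xi>) * g \<xi>)))\<^sup>2)"
      using L2_integrable[OF wg] by simp
    show "(cmod (?I \<xi> * g \<xi>))\<^sup>2 - (cmod (?I \<xi> * (cell_factor (h *\<^sub>R \<xi>) * g \<xi>)))\<^sup>2 \<le> e\<^sup>2 * (cmod (?I \<xi> * (of_real (\<omega> \<xi>) * g \<xi>)))\<^sup>2" for \<xi>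
    proof (cases "\<xi> \<in> cube (pi / h)")
      case True
      have "(1 - (cmod (cell_factor (h *\<^sub>R \<xi>)))\<^sup>2) * (cmod (g \<xi>))\<^sup>2 \<le> (e * \<omega> \<xi>)\<^sup>2 * (cmod (g \<xi>))\<^sup>2"
        by (rule mult_right_mono[OF \<omega>[OF True]]) simp
      then show ?thesis using True by (simp add: norm_mult power_mult_distrib left_diff_distrib mult.assoc)
    qed simp
  qed
  also have "\<dots> = (e * L2_norm (torus h) (\<lambda>\<xi>. of_real (\<omega> \<xi>) * g \<xi>))\<^sup>2"
    unfolding torus_norm by (simp add: power_mult_distrib L2_norm_def)
  finally have "(L2_norm lborel (\<lambda>\<xi>. ?O \<xi> * f \<xi>))\<^sup>2 \<le> (e * L2_norm (torus h) (\<lambda>\<xi>. of_real (\<omega> \<xi>) * g \<xi>))\<^sup>2"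
    using 1 2 3 by simp
  then show ?thesis
    unfolding f_def g_def by (rule power2_le_imp_le) (use e in simp)
qed

section \<open>Perturbed multipliers\<close>

text \<open>H and H_h are both instances: \<open>A\<close> is the Fourier transform or the discrete
  one, \<open>g\<close> the symbol and \<open>W\<close> the potential.\<close>

locale multiplier_operator =
  fixes M :: "'a measure" and N :: "'b measure" and A :: "('a \<Rightarrow> complex) \<Rightarrow> 'b \<Rightarrow> complex"
    and g :: "'b \<Rightarrow> real" and W :: "'a \<Rightarrow> real" and m :: real
  assumes unitary: "unitary_L2 M N A"
    and g_meas [measurable]: "g \<in> borel_measurable N" and g_nonneg: "\<And>\<xi>. 0 \<le> g \<xi>"
    and W_meas [measurable]: "W \<in> borel_measurable M" and W_bound: "\<And>x. \<bar>W x\<bar> \<le> m"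
begin

definition "opdom = {f \<in> L2 M. (\<lambda>\<xi>. of_real (g \<xi>) * A f \<xi>) \<in> L2 N}"

definition "kin f = L2_adjoint M N A (\<lambda>\<xi>. of_real (g \<xi>) * A f \<xi>)"

definition "op f = (\<lambda>x. L2_adjoint M N A (\<lambda>\<xi>. of_real (g \<xi>) * A f \<xi>) x + of_real (W x) * f x)"

lemma A_L2: "f \<in> L2 M \<Longrightarrow> A f \<in> L2 N"
  and A_inner: "f \<in> L2 M \<Longrightarrow> h \<in> L2 M \<Longrightarrow> L2_inner N (A f) (A h) = L2_inner M f h"
  and A_surj: "w \<in> L2 N \<Longrightarrow> \<exists>f\<in>L2 M. AE x in N. A f x = w x"
  using unitary by (auto simp: unitary_L2_def)

lemma A_norm: "f \<in> L2 M \<Longrightarrow> L2_norm N (A f) = L2_norm M f"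
proof -
  assume f: "f \<in> L2 M"
  have "complex_of_real ((L2_norm N (A f))\<^sup>2) = complex_of_real ((L2_norm M f)\<^sup>2)"
    using A_inner[OF f f] by (simp only: L2_inner_self)
  then have "(L2_norm N (A f))\<^sup>2 = (L2_norm M f)\<^sup>2" by (simp only: of_real_eq_iff)
  then show ?thesis by (simp add: power2_eq_iff_nonneg)
qed

lemma domD:
  assumes "f \<in> opdom"
  shows "f \<in> L2 M" "(\<lambda>\<xi>. of_real (g \<xi>) * A f \<xi>) \<in> L2 N"
  using assms by (auto simp: opdom_def)

text \<open>Surjectivity of \<open>A\<close> supplies some \<open>y\<close> with A y = g A f, which
  has the property that defines \<open>L2_adjoint\<close>. The chosen \<open>kin f\<close> has the
  same inner products, and comparing norms forces A (kin f) = g A f almost everywhere.\<close>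

lemma kin:
  assumes f: "f \<in> opdom"
  shows "kin f \<in> L2 M" "AE \<xi> in N. A (kin f) \<xi> = of_real (g \<xi>) * A f \<xi>"
    "u \<in> L2 M \<Longrightarrow> L2_inner M (kin f) u = L2_inner N (\<lambda>\<xi>. of_real (g \<xi>) * A f \<xi>) (A u)"
proof -
  let ?w = "\<lambda>\<xi>. of_real (g \<xi>) * A f \<xi>"
  have w: "?w \<in> L2 N" by (rule domD(2)[OF f])
  obtain y where y: "y \<in> L2 M" "AE \<xi> in N. A y \<xi> = ?w \<xi>" using A_surj[OF w] by blast
  have wy: "L2_inner N ?w z = L2_inner N (A y) z" if "z \<in> L2 N" for z
    using y A_L2[OF y(1)] w that by (intro L2_inner_cong_AE) (auto dest: L2_measurable)
  have ex: "\<exists>k. k \<in> L2 M \<and> (\<forall>u\<in>L2 M. L2_inner M k u = L2_inner N ?w (A u))"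
    using y(1) by (intro exI[of _ y]) (auto simp: wy A_L2 A_inner)
  have k: "kin f \<in> L2 M \<and> (\<forall>u\<in>L2 M. L2_inner M (kin f) u = L2_inner N ?w (A u))"
    unfolding kin_def L2_adjoint_def by (rule someI_ex[OF ex])
  then show kL: "kin f \<in> L2 M" and kI: "\<And>u. u \<in> L2 M \<Longrightarrow> L2_inner M (kin f) u = L2_inner N ?w (A u)" by auto
  have Ak: "A (kin f) \<in> L2 N" by (rule A_L2[OF kL])
  have 1: "L2_ip N ?w (A (kin f)) = (L2_norm M (kin f))\<^sup>2"
    unfolding L2_ip_def kI[OF kL, symmetric] L2_inner_self by simp
  have "L2_inner N ?w ?w = L2_inner N (A y) ?w" by (rule wy[OF w])
  also have "\<dots> = cnj (L2_inner N ?w (A y))" by (rule L2_inner_commute)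
  also have "\<dots> = cnj (L2_inner M (kin f) y)" using kI[OF y(1)] by simp
  also have "\<dots> = L2_inner M y (kin f)" by (rule L2_inner_commute[symmetric])
  also have "\<dots> = L2_inner N (A y) (A (kin f))" using A_inner[OF y(1) kL] by simp
  also have "\<dots> = L2_inner N ?w (A (kin f))" using wy[OF Ak] by simp
  finally have "L2_ip N ?w ?w = L2_ip N ?w (A (kin f))" by (simp only: L2_ip_def)
  then have 2: "(L2_norm N ?w)\<^sup>2 = (L2_norm M (kin f))\<^sup>2" using 1 L2.nrm_sq[OF w] by simp
  have "(L2_norm N (A (kin f) - ?w))\<^sup>2 = (L2_norm N (A (kin f)))\<^sup>2 - 2 * L2_ip N ?w (A (kin f)) + (L2_norm N ?w)\<^sup>2"
    using Ak w L2.ip_commute[OF Ak w] by (simp only: L2.nrm_sq L2.S_closed L2.ip_simps)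
  then have "L2_norm N (A (kin f) - ?w) = 0" using 1 2 A_norm[OF kL] by simp
  then show "AE \<xi> in N. A (kin f) \<xi> = ?w \<xi>" using L2_norm_diff_eq_0_iff[OF Ak w] by simp
qed

lemma kin_norm: "f \<in> opdom \<Longrightarrow> L2_norm M (kin f) = L2_norm N (\<lambda>\<xi>. of_real (g \<xi>) * A f \<xi>)"
  using L2_norm_cong_AE[OF L2_measurable[OF A_L2[OF kin(1)]] L2_measurable[OF domD(2)] kin(2)]
  by (metis A_norm kin(1))

lemma W_L2:
  assumes "f \<in> L2 M"
  shows "(\<lambda>x. of_real (W x) * f x) \<in> L2 M" "L2_norm M (\<lambda>x. of_real (W x) * f x) \<le> m * L2_norm M f"
proof -
  have m: "0 \<le> m" using W_bound[of undefined] by linarith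
  show "(\<lambda>x. of_real (W x) * f x) \<in> L2 M" "L2_norm M (\<lambda>x. of_real (W x) * f x) \<le> m * L2_norm M f"
    using L2_bounded_mult[OF assms, of "\<lambda>x. of_real (W x)" m] m W_bound by auto
qed

lemma op_eq: "op f = kin f + (\<lambda>x. of_real (W x) * f x)"
  by (simp add: op_def kin_def fun_eq_iff)

lemma op_L2: "f \<in> opdom \<Longrightarrow> op f \<in> L2 M"
  unfolding op_eq by (intro L2_add kin(1) W_L2(1) domD(1))

lemma op_symmetric:
  assumes f: "f \<in> opdom" and h: "h \<in> opdom"
  shows "L2_ip M (op f) h = L2_ip M f (op h)"
proof -
  note fL = domD(1)[OF f] and hL = domD(1)[OF h]
  have "L2_inner M (kin f) h = L2_inner N (\<lambda>\<xi>. of_real (g \<xi>) * A f \<xi>) (A h)" by (rule kin(3)[OF f hL])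
  also have "\<dots> = L2_inner N (A f) (\<lambda>\<xi>. of_real (g \<xi>) * A h \<xi>)"
    unfolding L2_inner_def by (simp add: mult_ac)
  also have "\<dots> = cnj (L2_inner M (kin h) f)"
    by (simp only: kin(3)[OF h fL] L2_inner_commute[of N "A f"])
  also have "\<dots> = L2_inner M f (kin h)" by (rule L2_inner_commute[symmetric])
  finally have 1: "L2_ip M (kin f) h = L2_ip M f (kin h)" by (simp add: L2_ip_def)
  have 2: "L2_ip M (\<lambda>x. of_real (W x) * f x) h = L2_ip M f (\<lambda>x. of_real (W x) * h x)"
    unfolding L2_ip_def L2_inner_def by (simp add: mult_ac)
  show ?thesis
    unfolding op_eq using 1 2 kin(1)[OF f] kin(1)[OF h] W_L2(1)[OF fL] W_L2(1)[OF hL] fL hL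
    by (simp only: L2.ip_add_left L2.ip_add_right)
qed

lemma op_lower:
  assumes f: "f \<in> opdom"
  shows "- m * (L2_norm M f)\<^sup>2 \<le> L2_ip M (op f) f"
proof -
  note fL = domD(1)[OF f]
  have "L2_inner N (\<lambda>\<xi>. of_real (g \<xi>) * A f \<xi>) (A f) = (LINT \<xi>|N. complex_of_real (g \<xi> * (cmod (A f \<xi>))\<^sup>2))"
    unfolding L2_inner_def
    by (intro Bochner_Integration.integral_cong refl) (simp add: complex_norm_square[symmetric] mult.assoc mult.commute[of "cnj _"])
  also have "\<dots> = of_real (LINT \<xi>|N. g \<xi> * (cmod (A f \<xi>))\<^sup>2)" by (rule integral_complex_of_real)
  finally have "L2_ip M (kin f) f = (LINT \<xi>|N. g \<xi> * (cmod (A f \<xi>))\<^sup>2)"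
    using kin(3)[OF f fL] by (simp add: L2_ip_def)
  then have 1: "0 \<le> L2_ip M (kin f) f" using g_nonneg by simp
  have "\<bar>L2_ip M (\<lambda>x. of_real (W x) * f x) f\<bar> \<le> (m * L2_norm M f) * L2_norm M f"
    using L2.Cauchy_Schwarz[OF W_L2(1)[OF fL] fL] mult_right_mono[OF W_L2(2)[OF fL], of "L2_norm M f"] by simp
  then have "- m * (L2_norm M f)\<^sup>2 \<le> L2_ip M (\<lambda>x. of_real (W x) * f x) f"
    by (simp add: power2_eq_square)
  then show ?thesis
    unfolding op_eq using 1 kin(1)[OF f] W_L2(1)[OF fL] fL by (simp only: L2.ip_add_left)
qed

text \<open>If \<open>W = 0\<close>, the operator is unitarily equivalent to multiplication by \<open>g\<close>.\<close>

lemma multiplication_spectrum: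
  assumes W: "\<And>x. W x = 0"
    and w: "\<And>e. e > 0 \<Longrightarrow> \<exists>w\<in>L2 N. 0 < L2_norm N w \<and> (\<lambda>\<xi>. of_real (g \<xi>) * w \<xi>) \<in> L2 N \<and>
       L2_norm N (\<lambda>\<xi>. of_real (g \<xi> - l) * w \<xi>) \<le> e * L2_norm N w"
  shows "complex_of_real l \<notin> resolvent_set M opdom op"
proof
  assume "complex_of_real l \<in> resolvent_set M opdom op"
  then obtain B where B: "\<And>q. q \<in> L2 M \<Longrightarrow> \<exists>f\<in>opdom. (AE x in M. op f x - of_real l * f x = q x) \<and>
      L2_norm M f \<le> B * L2_norm M q \<and> (\<forall>f'\<in>opdom. (AE x in M. op f' x - of_real l * f' x = q x) \<longrightarrow> (AE x in M. f' x = f x))"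
    unfolding resolvent_set_def by blast
  \<comment> \<open>This makes |B| e at most 1/2, so the resolvent bound would give |f| <= |f| / 2
    for a vector of positive norm.\<close>
  define e where "e = 1 / (2 * (\<bar>B\<bar> + 1))"
  have e: "e > 0" by (simp add: e_def)
  obtain w where w: "w \<in> L2 N" "0 < L2_norm N w" "(\<lambda>\<xi>. of_real (g \<xi>) * w \<xi>) \<in> L2 N"
      "L2_norm N (\<lambda>\<xi>. of_real (g \<xi> - l) * w \<xi>) \<le> e * L2_norm N w"
    using w[OF e] by blast
  obtain f where f: "f \<in> L2 M" "AE \<xi> in N. A f \<xi> = w \<xi>" using A_surj[OF w(1)] by blast
  have [measurable]: "A f \<in> borel_measurable N" "w \<in> borel_measurable N"
    using A_L2[OF f(1)] w(1) by (auto dest: L2_measurable)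
  have "AE \<xi> in N. of_real (g \<xi>) * w \<xi> = of_real (g \<xi>) * A f \<xi>"
    using f(2) by eventually_elim simp
  then have "(\<lambda>\<xi>. of_real (g \<xi>) * A f \<xi>) \<in> L2 N" by (rule L2_cong_AE[OF w(3), rotated]) measurable
  then have fd: "f \<in> opdom" using f(1) by (simp add: opdom_def)
  define q where "q = op f - l *\<^sub>R f"
  have q: "q \<in> L2 M" unfolding q_def by (intro L2.S_closed op_L2 fd f)
  have opk: "op f = kin f" unfolding op_eq using W by (simp add: fun_eq_iff)
  have nf: "L2_norm M f = L2_norm N w"
    using A_norm[OF f(1)] L2_norm_cong_AE[OF _ _ f(2)] by simp
  \<comment> \<open>The squares are expanded on both sides, because \<open>A\<close> is not linear
    at single points.\<close>
  have "L2_norm M q = L2_norm N (\<lambda>\<xi>. of_real (g \<xi> - l) * w \<xi>)"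
  proof -
    let ?gw = "\<lambda>\<xi>. of_real (g \<xi>) * A f \<xi>"
    have gw: "?gw \<in> L2 N" by (rule domD(2)[OF fd])
    have Af: "A f \<in> L2 N" by (rule A_L2[OF f(1)])
    have k1: "L2_ip M (kin f) f = L2_ip N ?gw (A f)" using kin(3)[OF fd f(1)] by (simp add: L2_ip_def)
    have "(L2_norm M q)\<^sup>2 = (L2_norm M (kin f))\<^sup>2 - 2 * l * L2_ip M (kin f) f + l\<^sup>2 * (L2_norm M f)\<^sup>2"
      unfolding q_def opk using kin(1)[OF fd] f(1) L2.ip_commute[OF f(1) kin(1)[OF fd]]
      by (simp only: L2.nrm_sq L2.S_closed L2.ip_simps) (simp add: algebra_simps power2_eq_square)
    also have "\<dots> = (L2_norm N ?gw)\<^sup>2 - 2 * l * L2_ip N ?gw (A f) + l\<^sup>2 * (L2_norm N (A f))\<^sup>2"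
      by (simp only: kin_norm[OF fd] k1 A_norm[OF f(1)])
    also have "\<dots> = (L2_norm N (?gw - l *\<^sub>R A f))\<^sup>2"
      using gw Af L2.ip_commute[OF Af gw]
      by (simp only: L2.nrm_sq L2.S_closed L2.ip_simps) (simp add: algebra_simps power2_eq_square)
    also have "L2_norm N (?gw - l *\<^sub>R A f) = L2_norm N (\<lambda>\<xi>. of_real (g \<xi> - l) * w \<xi>)"
    proof (rule L2_norm_cong_AE)
      show "?gw - l *\<^sub>R A f \<in> borel_measurable N"
        using L2.S_closed(3)[OF gw L2.S_closed(4)[OF Af]] by (rule L2_measurable)
      show "AE \<xi> in N. (?gw - l *\<^sub>R A f) \<xi> = of_real (g \<xi> - l) * w \<xi>"
        using f(2) by eventually_elim (simp add: left_diff_distrib scaleR_conv_of_real)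
    qed measurable
    finally show ?thesis by (simp add: power2_eq_iff_nonneg)
  qed
  then have nq: "L2_norm M q \<le> e * L2_norm M f" using w(4) nf by simp
  obtain f0 where f0: "f0 \<in> opdom" "L2_norm M f0 \<le> B * L2_norm M q"
      "\<And>f'. f' \<in> opdom \<Longrightarrow> (AE x in M. op f' x - of_real l * f' x = q x) \<Longrightarrow> (AE x in M. f' x = f0 x)"
    using B[OF q] by blast
  have "AE x in M. f x = f0 x"
    by (rule f0(3)[OF fd]) (simp add: q_def scaleR_conv_of_real)
  then have "L2_norm M f = L2_norm M f0"
    using f(1) domD(1)[OF f0(1)] by (intro L2_norm_cong_AE) (auto dest: L2_measurable)
  also have "\<dots> \<le> \<bar>B\<bar> * L2_norm M q" using f0(2) mult_right_mono[OF abs_ge_self[of B] L2_norm_nonneg[of M q]] by linarith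
  also have "\<dots> \<le> \<bar>B\<bar> * (e * L2_norm M f)" using nq by (intro mult_left_mono) auto
  also have "\<dots> \<le> (1 / 2) * L2_norm M f"
  proof -
    have "\<bar>B\<bar> * e \<le> 1 / 2" by (simp add: e_def field_simps)
    then show ?thesis using mult_right_mono[of "\<bar>B\<bar> * e" "1/2" "L2_norm M f"] by (simp add: mult.assoc)
  qed
  finally show False using w(2) nf by simp
qed

end

text \<open>The bound in \<open>resolvent_set\<close> may depend on the operator, hence on h. The
  condition \<open>m < mu\<close> replaces it by 1 / (mu - m), obtained from the lower bound -m of
  the form, uniformly in h.\<close>

locale resolvent_operator = multiplier_operator +
  fixes mu :: real
  assumes mu: "m < mu" and mu_res: "complex_of_real (- mu) \<in> resolvent_set M opdom op"
begin

definition "R q = (SOME f. f \<in> opdom \<and> (AE x in M. op f x + of_real mu * f x = q x))"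

lemma mu_unique:
  assumes f: "f \<in> opdom" "AE x in M. op f x + of_real mu * f x = q x"
    and f': "f' \<in> opdom" "AE x in M. op f' x + of_real mu * f' x = q x" and q: "q \<in> L2 M"
  shows "AE x in M. f x = f' x"
proof -
  obtain f0 where "\<forall>f'\<in>opdom. (AE x in M. op f' x - of_real (- mu) * f' x = q x) \<longrightarrow> (AE x in M. f' x = f0 x)"
    using mu_res q unfolding resolvent_set_def by blast
  then have "AE x in M. f x = f0 x" "AE x in M. f' x = f0 x" using f f' by auto
  then show ?thesis by eventually_elim simp
qed

lemma R:
  assumes q: "q \<in> L2 M"
  shows "R q \<in> opdom" "AE x in M. op (R q) x + of_real mu * R q x = q x"
proof -
  have "\<exists>f. f \<in> opdom \<and> (AE x in M. op f x + of_real mu * f x = q x)"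
    using mu_res q unfolding resolvent_set_def by fastforce
  then have "R q \<in> opdom \<and> (AE x in M. op (R q) x + of_real mu * R q x = q x)"
    unfolding R_def by (rule someI_ex)
  then show "R q \<in> opdom" "AE x in M. op (R q) x + of_real mu * R q x = q x" by auto
qed

lemma R_L2: "q \<in> L2 M \<Longrightarrow> R q \<in> L2 M"
  using R(1) domD(1) by blast

lemma R_ip:
  assumes q: "q \<in> L2 M" and u: "u \<in> L2 M"
  shows "L2_ip M q u = L2_ip M (op (R q)) u + mu * L2_ip M (R q) u"
proof -
  have o: "op (R q) \<in> L2 M" by (rule op_L2[OF R(1)[OF q]])
  have "L2_ip M q u = L2_ip M (op (R q) + mu *\<^sub>R R q) u"
    unfolding L2_ip_def
  proof (intro arg_cong[where f=Re] L2_inner_cong_AE)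
    show "op (R q) + mu *\<^sub>R R q \<in> borel_measurable M"
      using L2.S_closed(2)[OF o L2.S_closed(4)[OF R_L2[OF q]]] by (rule L2_measurable)
    show "AE x in M. q x = (op (R q) + mu *\<^sub>R R q) x"
      using R(2)[OF q] by eventually_elim (simp add: scaleR_conv_of_real)
  qed (use q u in \<open>auto dest: L2_measurable\<close>)
  then show ?thesis using o R_L2[OF q] u by (simp only: L2.ip_add_left L2.ip_scale_left L2.S_closed)
qed

lemma R_bound:
  assumes q: "q \<in> L2 M"
  shows "L2_norm M (R q) \<le> 1 / (mu - m) * L2_norm M q"
proof (cases "L2_norm M (R q) = 0")
  case True
  then show ?thesis using mu by simp
next
  case False
  have "(mu - m) * (L2_norm M (R q))\<^sup>2 \<le> L2_ip M q (R q)"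
    using R_ip[OF q R_L2[OF q]] op_lower[OF R(1)[OF q]] L2.nrm_sq[OF R_L2[OF q]]
    by (simp add: left_diff_distrib)
  also have "\<dots> \<le> L2_norm M q * L2_norm M (R q)"
    using L2.Cauchy_Schwarz[OF q R_L2[OF q]] by linarith
  finally have "((mu - m) * L2_norm M (R q)) * L2_norm M (R q) \<le> L2_norm M q * L2_norm M (R q)"
    by (simp add: power2_eq_square mult.assoc)
  moreover have "L2_norm M (R q) > 0" using False L2_norm_nonneg[of M "R q"] by linarith
  ultimately have "(mu - m) * L2_norm M (R q) \<le> L2_norm M q" by simp
  then show ?thesis using mu by (simp add: field_simps)
qed

lemma R_symmetric_bounded: "L2.symmetric_bounded M R (1 / (mu - m))"
  unfolding L2.symmetric_bounded_def
proof (intro conjI ballI)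
  show "R ` L2 M \<subseteq> L2 M" using R_L2 by auto
  show "L2_ip M (R q) u = L2_ip M q (R u)" if q: "q \<in> L2 M" and u: "u \<in> L2 M" for q u
  proof -
    have "L2_ip M (R q) u = L2_ip M u (R q)" by (rule L2.ip_commute[OF R_L2[OF q] u])
    also have "\<dots> = L2_ip M (op (R u)) (R q) + mu * L2_ip M (R u) (R q)" by (rule R_ip[OF u R_L2[OF q]])
    also have "\<dots> = L2_ip M (op (R q)) (R u) + mu * L2_ip M (R q) (R u)"
      using op_symmetric[OF R(1)[OF u] R(1)[OF q]] L2.ip_commute[OF R_L2[OF u] op_L2[OF R(1)[OF q]]]
        L2.ip_commute[OF R_L2[OF u] R_L2[OF q]] by simp
    also have "\<dots> = L2_ip M q (R u)" by (rule R_ip[OF q R_L2[OF u], symmetric])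
    finally show ?thesis .
  qed
qed (rule R_bound)

text \<open>If R - k with k = 1 / (l + mu) is bounded below, then it is onto by symmetry. A solution
  of (R - k) u = -k q gives (H - l) R u = u - R u / k = q, so l lies in the resolvent set.\<close>

lemma spectrum_imp_approx:
  assumes l: "- mu < l" "complex_of_real l \<notin> resolvent_set M opdom op"
  shows "L2.approx_eigenvalue M R (1 / (l + mu))"
proof (rule ccontr)
  assume neg: "\<not> ?thesis"
  define k where "k = 1 / (l + mu)"
  have k: "k > 0" "(l + mu) * k = 1" using l by (simp_all add: k_def)
  have lk: "complex_of_real (l + mu) * of_real k = 1" by (simp only: of_real_mult[symmetric] k(2) of_real_1)
  have RS: "R ` L2 M \<subseteq> L2 M" using R_L2 by auto
  obtain c where c: "c > 0" "\<And>v. v \<in> L2 M \<Longrightarrow> c * L2_norm M v \<le> L2_norm M (R v - k *\<^sub>R v)"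
    using L2.not_approx_eigenvalueD[OF neg RS] unfolding k_def by blast
  define b where "b = 1 / (mu - m)"
  have b: "b > 0" using mu by (simp add: b_def)
  note sb = L2.symmetric_bounded_shift[OF R_symmetric_bounded, of k]
  have "complex_of_real l \<in> resolvent_set M opdom op"
    unfolding resolvent_set_def
  proof (rule CollectI, rule exI[of _ "b * k / c"], rule ballI)
    fix q assume q: "q \<in> L2 M"
    have nq: "(- k) *\<^sub>R q \<in> L2 M" using q by (rule L2.S_closed(4))
    obtain u where u: "u \<in> L2 M" "L2_norm M (R u - k *\<^sub>R u - (- k) *\<^sub>R q) = 0"
      using L2.bounded_below_surjective[OF sb c nq] by blast
    have Bu: "R u - k *\<^sub>R u \<in> L2 M" by (rule L2.S_closed(3)[OF R_L2[OF u(1)] L2.S_closed(4)[OF u(1)]])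
    have AEu: "AE x in M. (R u - k *\<^sub>R u) x = ((- k) *\<^sub>R q) x"
      using u(2) L2_norm_diff_eq_0_iff[OF Bu nq] by simp
    have eq: "AE x in M. op (R u) x - of_real l * R u x = q x"
      using AEu R(2)[OF u(1)]
    proof eventually_elim
      case (elim x)
      have "of_real k * (u x - q x) = R u x"
        using elim(1) by (simp add: scaleR_conv_of_real algebra_simps)
      then have "u x - q x = complex_of_real (l + mu) * R u x"
        using lk by (metis mult.assoc mult_1)
      then show ?case using elim(2) by (simp add: algebra_simps)
    qed
    have "L2_norm M (R u) \<le> b * L2_norm M u" using R_bound[OF u(1)] by (simp add: b_def)
    also have "\<dots> \<le> b * (L2_norm M (R u - k *\<^sub>R u) / c)"
      using c(2)[OF u(1)] c(1) b by (intro mult_left_mono) (auto simp: field_simps)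
    also have "L2_norm M (R u - k *\<^sub>R u) = L2_norm M ((- k) *\<^sub>R q)"
      by (rule L2.nrm_zero_cong[OF Bu nq u(2)])
    also have "\<dots> = k * L2_norm M q" using k by (subst L2.nrm_scale[OF q]) simp
    finally have bound: "L2_norm M (R u) \<le> b * k / c * L2_norm M q" by simp
    \<comment> \<open>Any solution is R v with v = (H + mu) f'. The difference v - u is annihilated
      by R - k, hence null by the lower bound.\<close>
    have uniq: "AE x in M. f' x = R u x" if f': "f' \<in> opdom" "AE x in M. op f' x - of_real l * f' x = q x" for f'
    proof -
      have fL: "f' \<in> L2 M" by (rule domD(1)[OF f'(1)])
      define v where "v = op f' + mu *\<^sub>R f'"
      have v: "v \<in> L2 M" unfolding v_def by (rule L2.S_closed(2)[OF op_L2[OF f'(1)] L2.S_closed(4)[OF fL]])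
      have Rv: "AE x in M. f' x = R v x"
        by (rule mu_unique[OF f'(1) _ R(1)[OF v] R(2)[OF v] v]) (simp add: v_def scaleR_conv_of_real)
      define d where "d = v - u"
      have d: "d \<in> L2 M" unfolding d_def by (rule L2.S_closed(3)[OF v u(1)])
      have lin: "L2_norm M (R (v + (-1) *\<^sub>R u) - (R v + (-1) *\<^sub>R R u)) = 0"
        by (rule L2.symmetric_bounded_linear[OF R_symmetric_bounded v u(1)])
      have vd: "v + (-1) *\<^sub>R u = d" by (simp add: d_def)
      have "AE x in M. R d x = (R v + (-1) *\<^sub>R R u) x"
        using lin L2_norm_diff_eq_0_iff[OF R_L2[OF d] L2.S_closed(2)[OF R_L2[OF v] L2.S_closed(4)[OF R_L2[OF u(1)], of "-1"]]]
        unfolding vd by simp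
      then have "AE x in M. (R d - k *\<^sub>R d) x = 0"
        using Rv f'(2) eq R(2)[OF u(1)]
      proof eventually_elim
        case (elim x)
        have "d x = complex_of_real (l + mu) * (f' x - R u x)"
          using elim by (simp add: d_def v_def scaleR_conv_of_real algebra_simps)
        then have "of_real k * d x = f' x - R u x" using lk by (metis mult.assoc mult.commute mult_1)
        then show ?case using elim by (simp add: scaleR_conv_of_real)
      qed
      then have "L2_norm M (R d - k *\<^sub>R d) = 0"
        using L2_norm_eq_0_iff[OF L2.S_closed(3)[OF R_L2[OF d] L2.S_closed(4)[OF d]]] by simp
      then have "L2_norm M d = 0" using c(2)[OF d] c(1) L2_norm_nonneg[of M d]
        by (metis mult_le_0_iff not_less order_antisym_conv)
      then have "AE x in M. v x = u x" unfolding d_def using L2_norm_diff_eq_0_iff[OF v u(1)] by simp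
      then have "AE x in M. op f' x + of_real mu * f' x = u x"
        by eventually_elim (simp add: v_def scaleR_conv_of_real)
      then show ?thesis by (rule mu_unique[OF f'(1) _ R[OF u(1)] u(1)])
    qed
    show "\<exists>f\<in>opdom. (AE x in M. op f x - complex_of_real l * f x = q x) \<and> L2_norm M f \<le> b * k / c * L2_norm M q \<and>
       (\<forall>f'\<in>opdom. (AE x in M. op f' x - complex_of_real l * f' x = q x) \<longrightarrow> (AE x in M. f' x = f x))"
      using R(1)[OF u(1)] eq bound uniq by blast
  qed
  then show False using l by simp
qed

text \<open>For an approximate eigenvector \<open>v\<close> of R, the vector (H - l) R v = v - R v /
  s is small although R v is not, which contradicts a bounded inverse.\<close>

lemma approx_imp_spectrum:
  assumes s: "s > 0" "L2.approx_eigenvalue M R s"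
  shows "complex_of_real (1 / s - mu) \<notin> resolvent_set M opdom op"
proof
  define l where "l = 1 / s - mu"
  assume "complex_of_real (1 / s - mu) \<in> resolvent_set M opdom op"
  then obtain B where B: "\<And>q. q \<in> L2 M \<Longrightarrow> \<exists>f\<in>opdom. (AE x in M. op f x - of_real l * f x = q x) \<and>
      L2_norm M f \<le> B * L2_norm M q \<and> (\<forall>f'\<in>opdom. (AE x in M. op f' x - of_real l * f' x = q x) \<longrightarrow> (AE x in M. f' x = f x))"
    unfolding resolvent_set_def l_def by blast
  \<comment> \<open>Chosen so that the final estimate reads s <= e (s + |B|) / s = s / 2.\<close>
  define e where "e = s\<^sup>2 / (2 * (s + \<bar>B\<bar>))"
  have e: "e > 0" using s by (simp add: e_def add_pos_nonneg)
  obtain v where v: "v \<in> L2 M" "0 < L2_norm M v" "L2_norm M (R v - s *\<^sub>R v) \<le> e * L2_norm M v"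
    using s(2) e unfolding L2.approx_eigenvalue_def by blast
  define q where "q = v - (1 / s) *\<^sub>R R v"
  have Rv: "R v \<in> L2 M" by (rule R_L2[OF v(1)])
  have q: "q \<in> L2 M" unfolding q_def by (rule L2.S_closed(3)[OF v(1) L2.S_closed(4)[OF Rv]])
  have "q = (- 1 / s) *\<^sub>R (R v - s *\<^sub>R v)" using s by (simp add: q_def fun_eq_iff algebra_simps)
  then have "L2_norm M q = (1 / s) * L2_norm M (R v - s *\<^sub>R v)"
    using L2.nrm_scale[OF L2.S_closed(3)[OF Rv L2.S_closed(4)[OF v(1), of s]], of "- 1 / s"] s by simp
  then have nq: "L2_norm M q \<le> (1 / s) * (e * L2_norm M v)" using v(3) s by (simp add: divide_right_mono)
  obtain f0 where f0: "f0 \<in> opdom" "L2_norm M f0 \<le> B * L2_norm M q"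
      "\<And>f'. f' \<in> opdom \<Longrightarrow> (AE x in M. op f' x - of_real l * f' x = q x) \<Longrightarrow> (AE x in M. f' x = f0 x)"
    using B[OF q] by blast
  have "AE x in M. R v x = f0 x"
  proof (rule f0(3)[OF R(1)[OF v(1)]])
    show "AE x in M. op (R v) x - of_real l * R v x = q x"
      using R(2)[OF v(1)]
    proof eventually_elim
      case (elim x)
      have "op (R v) x = v x - of_real mu * R v x" using elim by (simp add: algebra_simps)
      then show ?case by (simp add: q_def l_def scaleR_conv_of_real algebra_simps)
    qed
  qed
  then have "L2_norm M (R v) = L2_norm M f0"
    using Rv domD(1)[OF f0(1)] by (intro L2_norm_cong_AE) (auto dest: L2_measurable)
  also have "\<dots> \<le> \<bar>B\<bar> * L2_norm M q" using f0(2) mult_right_mono[OF abs_ge_self[of B] L2_norm_nonneg[of M q]] by linarith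
  also have "\<dots> \<le> \<bar>B\<bar> * ((1 / s) * (e * L2_norm M v))" using nq by (intro mult_left_mono) auto
  finally have 1: "L2_norm M (R v) \<le> \<bar>B\<bar> * e / s * L2_norm M v" by simp
  have "s * L2_norm M v \<le> L2_norm M (R v) + e * L2_norm M v"
    using L2.nrm_triangle_le[OF L2.S_closed(4)[OF v(1), of s] Rv] L2.nrm_commute[OF L2.S_closed(4)[OF v(1), of s] Rv]
      v(3) L2.nrm_scale[OF v(1), of s] s(1) by simp
  then have "s * L2_norm M v \<le> (\<bar>B\<bar> * e / s + e) * L2_norm M v" using 1 by (simp add: distrib_right)
  then have "s \<le> \<bar>B\<bar> * e / s + e" using v(2) by simp
  also have "\<dots> = e * (s + \<bar>B\<bar>) / s" using s by (simp add: field_simps)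
  also have "\<dots> = s / 2"
  proof -
    define t where "t = s + \<bar>B\<bar>"
    have "t > 0" using s by (simp add: t_def add_pos_nonneg)
    then have "e * (s + \<bar>B\<bar>) = s\<^sup>2 / 2" unfolding e_def t_def[symmetric] by simp
    then show ?thesis using s by (simp add: power2_eq_square)
  qed
  finally show False using s by simp
qed

text \<open>The condition r <= k / 2 keeps the approximate eigenvalue s above k / 2, so |1/s - 1/k|
  = |s - k| / (s k) is at most 2 r / k^2.\<close>

lemma spectrum_near:
  assumes u: "u \<in> L2 M" "0 < L2_norm M u" and k: "k > 0" and r: "r \<le> k / 2"
    and le: "L2_norm M (R u - k *\<^sub>R u) \<le> r * L2_norm M u"
  shows "\<exists>l. complex_of_real l \<notin> resolvent_set M opdom op \<and> \<bar>l - (1 / k - mu)\<bar> \<le> 2 * r / k\<^sup>2"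
proof -
  obtain s where s: "\<bar>s - k\<bar> \<le> r" "L2.approx_eigenvalue M R s"
    using L2.approx_eigenvalue_near[OF R_symmetric_bounded u le] by blast
  have sk: "s \<ge> k / 2" using s(1) r by linarith
  then have s0: "s > 0" using k by linarith
  have "\<bar>(1 / s - mu) - (1 / k - mu)\<bar> = \<bar>s - k\<bar> / (s * k)"
  proof -
    have "(1 / s - mu) - (1 / k - mu) = (k - s) / (s * k)" using s0 k by (simp add: field_simps)
    then show ?thesis using s0 k by (simp add: abs_minus_commute)
  qed
  also have "\<dots> \<le> r / (k / 2 * k)"
    using s sk k r by (intro frac_le mult_right_mono) auto
  also have "\<dots> = 2 * r / k\<^sup>2" by (simp add: power2_eq_square)
  finally show ?thesis using approx_imp_spectrum[OF s0 s(2)] by blast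
qed

lemma not_approx_imp_resolvent:
  assumes "- mu < l" "c > 0" "\<And>v. v \<in> L2 M \<Longrightarrow> c * L2_norm M v \<le> L2_norm M (R v - (1 / (l + mu)) *\<^sub>R v)"
  shows "complex_of_real l \<in> resolvent_set M opdom op"
proof (rule ccontr)
  assume "complex_of_real l \<notin> resolvent_set M opdom op"
  then have "L2.approx_eigenvalue M R (1 / (l + mu))" by (rule spectrum_imp_approx[OF assms(1)])
  then obtain v where v: "v \<in> L2 M" "0 < L2_norm M v" "L2_norm M (R v - (1 / (l + mu)) *\<^sub>R v) \<le> c / 2 * L2_norm M v"
    using assms(2) unfolding L2.approx_eigenvalue_def by (metis half_gt_zero)
  then have "c * L2_norm M v \<le> c / 2 * L2_norm M v" using assms(3)[OF v(1)] by linarith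
  then show False using v(2) assms(2) by simp
qed

text \<open>Here 1 / (l + mu) exceeds 1 / (mu - m), the bound for the norm of
  \<open>R\<close>.\<close>

lemma below_resolvent:
  assumes l: "- mu < l" "l < - m"
  shows "complex_of_real l \<in> resolvent_set M opdom op"
proof (rule not_approx_imp_resolvent[OF l(1)])
  let ?k = "1 / (l + mu)" and ?b = "1 / (mu - m)"
  show "?k - ?b > 0" using l mu by (simp add: divide_strict_left_mono)
  fix v assume v: "v \<in> L2 M"
  have "?k * L2_norm M v \<le> L2_norm M (R v) + L2_norm M (R v - ?k *\<^sub>R v)"
    using L2.nrm_triangle_le[OF L2.S_closed(4)[OF v, of ?k] R_L2[OF v]]
      L2.nrm_commute[OF L2.S_closed(4)[OF v, of ?k] R_L2[OF v]] L2.nrm_scale[OF v, of ?k] l by simp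
  then show "(?k - ?b) * L2_norm M v \<le> L2_norm M (R v - ?k *\<^sub>R v)"
    using R_bound[OF v] unfolding left_diff_distrib by linarith
qed

text \<open>The lower bound \<open>c\<close> for R - k persists as c / 2 when k = 1 / (l + mu) moves
  by less than c / 2.\<close>

lemma resolvent_open_real:
  assumes l0: "- mu < l0" "complex_of_real l0 \<in> resolvent_set M opdom op"
  shows "\<exists>d>0. \<forall>l. \<bar>l - l0\<bar> < d \<longrightarrow> complex_of_real l \<in> resolvent_set M opdom op"
proof -
  define k where "k = (\<lambda>l. 1 / (l + mu))"
  have "\<not> L2.approx_eigenvalue M R (k l0)"
    using approx_imp_spectrum[of "k l0"] l0 by (auto simp: k_def)
  moreover have "R ` L2 M \<subseteq> L2 M" using R_L2 by auto
  ultimately obtain c where c: "c > 0" "\<And>v. v \<in> L2 M \<Longrightarrow> c * L2_norm M v \<le> L2_norm M (R v - k l0 *\<^sub>R v)"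
    using L2.not_approx_eigenvalueD by blast
  have "isCont k l0" unfolding k_def using l0 by (intro continuous_intros) auto
  then obtain d1 where d1: "d1 > 0" "\<And>l. \<bar>l - l0\<bar> < d1 \<Longrightarrow> \<bar>k l - k l0\<bar> < c / 2"
    using c(1) unfolding continuous_at_eps_delta dist_real_def by (metis half_gt_zero)
  have "complex_of_real l \<in> resolvent_set M opdom op" if l: "\<bar>l - l0\<bar> < min d1 (l0 + mu)" for l
  proof (rule not_approx_imp_resolvent)
    show "- mu < l" using l by linarith
    show "c / 2 > 0" using c by simp
    fix v assume v: "v \<in> L2 M"
    have eq: "R v - k l0 *\<^sub>R v = (R v - k l *\<^sub>R v) + (k l - k l0) *\<^sub>R v" by (simp add: algebra_simps)
    have "L2_norm M (R v - k l0 *\<^sub>R v) \<le> L2_norm M (R v - k l *\<^sub>R v) + \<bar>k l - k l0\<bar> * L2_norm M v"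
      unfolding eq using L2.nrm_triangle[OF L2.S_closed(3)[OF R_L2[OF v] L2.S_closed(4)[OF v, of "k l"]] L2.S_closed(4)[OF v, of "k l - k l0"]]
        L2.nrm_scale[OF v, of "k l - k l0"] by linarith
    moreover have "\<bar>k l - k l0\<bar> * L2_norm M v \<le> c / 2 * L2_norm M v"
      using d1(2)[of l] l by (intro mult_right_mono) auto
    ultimately have "c / 2 * L2_norm M v \<le> L2_norm M (R v - k l *\<^sub>R v)" using c(2)[OF v] by argo
    then show "c / 2 * L2_norm M v \<le> L2_norm M (R v - (1 / (l + mu)) *\<^sub>R v)" by (simp only: k_def)
  qed
  then show ?thesis using d1(1) l0(1) by (intro exI[of _ "min d1 (l0 + mu)"]) auto
qed

text \<open>From kin (R q) = q - W R q - mu R q. This is the gain of regularity: the resolvent maps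
  L2 boundedly into functions with square-integrable g A f.\<close>

lemma kin_R_norm:
  assumes q: "q \<in> L2 M"
  shows "L2_norm M (kin (R q)) \<le> (1 + (\<bar>mu\<bar> + m) / (mu - m)) * L2_norm M q"
proof -
  have Rq: "R q \<in> L2 M" by (rule R_L2[OF q])
  have k: "kin (R q) \<in> L2 M" by (rule kin(1)[OF R(1)[OF q]])
  let ?W = "\<lambda>x. of_real (W x) * R q x"
  have m0: "m \<ge> 0" using W_bound[of undefined] by linarith
  have rhs: "q - ?W - mu *\<^sub>R R q \<in> L2 M"
    using q W_L2(1)[OF Rq] Rq by (intro L2.S_closed)
  have "L2_norm M (kin (R q)) = L2_norm M (q - ?W - mu *\<^sub>R R q)"
  proof (rule L2_norm_cong_AE[OF L2_measurable[OF k] L2_measurable[OF rhs]])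
    show "AE x in M. kin (R q) x = (q - ?W - mu *\<^sub>R R q) x"
      using R(2)[OF q] unfolding op_eq by eventually_elim (simp add: scaleR_conv_of_real algebra_simps)
  qed
  also have "\<dots> \<le> L2_norm M (q - ?W) + L2_norm M (mu *\<^sub>R R q)"
    by (rule L2.nrm_diff_le[OF L2.S_closed(3)[OF q W_L2(1)[OF Rq]] L2.S_closed(4)[OF Rq]])
  also have "L2_norm M (q - ?W) \<le> L2_norm M q + L2_norm M ?W"
    by (rule L2.nrm_diff_le[OF q W_L2(1)[OF Rq]])
  also have "L2_norm M ?W \<le> m * L2_norm M (R q)" by (rule W_L2(2)[OF Rq])
  also have "L2_norm M (mu *\<^sub>R R q) = \<bar>mu\<bar> * L2_norm M (R q)" by (rule L2.nrm_scale[OF Rq])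
  also have "L2_norm M q + m * L2_norm M (R q) + \<bar>mu\<bar> * L2_norm M (R q) = L2_norm M q + (\<bar>mu\<bar> + m) * L2_norm M (R q)"
    by (simp add: distrib_right)
  also have "\<dots> \<le> L2_norm M q + (\<bar>mu\<bar> + m) * (1 / (mu - m) * L2_norm M q)"
    using R_bound[OF q] m0 by (intro add_left_mono mult_left_mono) auto
  finally show ?thesis by (simp add: distrib_right)
qed

end

section \<open>The discretised symbol\<close>

definition disc_point :: "real \<Rightarrow> real ^ 'n \<Rightarrow> real ^ 'n" where
  "disc_point h \<xi> = (\<chi> i. 2 / h * sin (h / 2 * \<xi> $ i))"

lemma G0_disc_eq: "G0_disc G h \<xi> = G (disc_point h \<xi>)"
  by (simp add: G0_disc_def disc_point_def)

lemma sin_near: "\<bar>sin t - t\<bar> \<le> \<bar>t\<bar> ^ 3 / 6" for t :: real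
  using Maclaurin_sin_bound[of t 3] by (simp add: numeral_3_eq_3 sin_coeff_def fact_numeral)

text \<open>Since pi < 4, |t| is at most 2, and the cubic error takes away at most two thirds of
  |t|.\<close>

lemma sin_lower:
  fixes t :: real
  assumes "\<bar>t\<bar> \<le> pi / 2"
  shows "\<bar>t\<bar> / 3 \<le> \<bar>sin t\<bar>"
proof -
  have "\<bar>t\<bar>\<^sup>2 \<le> 2\<^sup>2" using assms pi_less_4 by (intro power_mono) auto
  then have "\<bar>t\<bar> * \<bar>t\<bar>\<^sup>2 \<le> \<bar>t\<bar> * 4" by (intro mult_left_mono) auto
  then have "\<bar>t\<bar> ^ 3 / 6 \<le> 2 * \<bar>t\<bar> / 3" by (simp add: power2_eq_square power3_eq_cube)
  then show ?thesis using sin_near[of t] by linarith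
qed

lemma disc_coord:
  fixes h x :: real
  assumes h: "h > 0" and x: "\<bar>x\<bar> \<le> pi / h"
  defines "y \<equiv> 2 / h * sin (h / 2 * x)"
  shows "\<bar>y\<bar> \<le> \<bar>x\<bar>" "\<bar>x\<bar> / 3 \<le> \<bar>y\<bar>" "\<bar>x - y\<bar> \<le> h\<^sup>2 * \<bar>x\<bar> ^ 3" "0 \<le> x * y"
proof -
  define t where "t = h / 2 * x"
  have xt: "x = 2 / h * t" using h by (simp add: t_def)
  have y: "y = 2 / h * sin t" by (simp add: y_def t_def)
  have t: "\<bar>t\<bar> \<le> pi / 2" using x h by (simp add: t_def abs_mult field_simps)
  show "\<bar>y\<bar> \<le> \<bar>x\<bar>" unfolding y xt abs_mult using h abs_sin_x_le_abs_x[of t] by (intro mult_left_mono) auto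
  have "\<bar>2 / h\<bar> * (\<bar>t\<bar> / 3) \<le> \<bar>2 / h\<bar> * \<bar>sin t\<bar>" using sin_lower[OF t] by (intro mult_left_mono) auto
  then show "\<bar>x\<bar> / 3 \<le> \<bar>y\<bar>" unfolding y xt abs_mult by simp
  have "\<bar>x - y\<bar> = \<bar>2 / h\<bar> * \<bar>sin t - t\<bar>"
  proof -
    have "x - y = 2 / h * (t - sin t)" unfolding y xt by (simp only: right_diff_distrib)
    then show ?thesis by (simp only: abs_mult abs_minus_commute[of t])
  qed
  also have "\<dots> \<le> \<bar>2 / h\<bar> * (\<bar>t\<bar> ^ 3 / 6)" using sin_near[of t] by (intro mult_left_mono) auto
  also have "\<dots> = h\<^sup>2 * \<bar>x\<bar> ^ 3 / 24"
    using h by (simp add: t_def abs_mult power_mult_distrib power2_eq_square power3_eq_cube field_simps)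
  also have "\<dots> \<le> h\<^sup>2 * \<bar>x\<bar> ^ 3" by simp
  finally show "\<bar>x - y\<bar> \<le> h\<^sup>2 * \<bar>x\<bar> ^ 3" .
  have "0 \<le> t * sin t"
  proof (cases "t \<ge> 0")
    case True
    then show ?thesis using t by (intro mult_nonneg_nonneg sin_ge_zero) auto
  next
    case False
    then have "0 \<le> (- t) * sin (- t)" using t by (intro mult_nonneg_nonneg sin_ge_zero) auto
    then show ?thesis by simp
  qed
  moreover have "0 \<le> 2 / h * (2 / h)" using h by simp
  ultimately have "0 \<le> (2 / h * (2 / h)) * (t * sin t)" by (rule mult_nonneg_nonneg[rotated])
  then show "0 \<le> x * y" unfolding y xt by (simp add: mult_ac)
qed

lemma cube_coord: "\<xi> \<in> cube r \<Longrightarrow> \<bar>\<xi> $ i\<bar> \<le> r"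
  by (auto simp: cube_def abs_le_iff minus_le_iff)

text \<open>Coordinates of \<xi> and its discretisation have equal signs, so the segment between
  them stays in an annulus away from 0; there gradient bounds with negative exponents can be used.
  The last bound says that h |\<xi>| is bounded on the cube, so excess powers of it can be traded
  for a constant.\<close>

lemma disc_point_bounds:
  fixes \<xi> :: "real ^ 'n"
  assumes h: "h > 0" and \<xi>: "\<xi> \<in> cube (pi / h)"
  shows "norm \<xi> / 3 \<le> norm (disc_point h \<xi>)"
    "norm (\<xi> - disc_point h \<xi>) \<le> real CARD('n) * (h\<^sup>2 * norm \<xi> ^ 3)"
    "\<zeta> \<in> closed_segment (disc_point h \<xi>) \<xi> \<Longrightarrow> norm \<xi> / 3 \<le> norm \<zeta> \<and> norm \<zeta> \<le> norm \<xi>"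
    "h * norm \<xi> \<le> 4 * real CARD('n)"
proof -
  note c = disc_coord[OF h cube_coord[OF \<xi>]]
  have lower: "norm \<xi> / 3 \<le> norm \<zeta>" if "\<And>i. \<bar>\<xi> $ i\<bar> / 3 \<le> \<bar>\<zeta> $ i\<bar>" for \<zeta> :: "real ^ 'n"
  proof -
    have "norm ((1/3) *\<^sub>R \<xi>) \<le> norm \<zeta>" using that by (intro norm_le_componentwise_cart) simp
    then show ?thesis by simp
  qed
  show "norm \<xi> / 3 \<le> norm (disc_point h \<xi>)" using c(2) by (intro lower) (simp add: disc_point_def)
  show "norm (\<xi> - disc_point h \<xi>) \<le> real CARD('n) * (h\<^sup>2 * norm \<xi> ^ 3)"
  proof -
    have "norm (\<xi> - disc_point h \<xi>) \<le> (\<Sum>i\<in>UNIV. \<bar>(\<xi> - disc_point h \<xi>) $ i\<bar>)" by (rule norm_le_l1_cart)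
    also have "\<dots> \<le> (\<Sum>i\<in>(UNIV :: 'n set). h\<^sup>2 * norm \<xi> ^ 3)"
    proof (rule sum_mono)
      fix i
      have "\<bar>(\<xi> - disc_point h \<xi>) $ i\<bar> \<le> h\<^sup>2 * \<bar>\<xi> $ i\<bar> ^ 3" using c(3)[of i] by (simp add: disc_point_def)
      also have "\<dots> \<le> h\<^sup>2 * norm \<xi> ^ 3" using component_le_norm_cart[of \<xi> i] by (intro mult_left_mono power_mono) auto
      finally show "\<bar>(\<xi> - disc_point h \<xi>) $ i\<bar> \<le> h\<^sup>2 * norm \<xi> ^ 3" .
    qed
    finally show ?thesis by simp
  qed
  show "norm \<xi> / 3 \<le> norm \<zeta> \<and> norm \<zeta> \<le> norm \<xi>" if \<zeta>: "\<zeta> \<in> closed_segment (disc_point h \<xi>) \<xi>"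
  proof -
    obtain u where u: "0 \<le> u" "u \<le> 1" "\<zeta> = (1 - u) *\<^sub>R disc_point h \<xi> + u *\<^sub>R \<xi>"
      using \<zeta> by (auto simp: in_segment)
    have coord: "\<bar>\<xi> $ i\<bar> / 3 \<le> \<bar>\<zeta> $ i\<bar> \<and> \<bar>\<zeta> $ i\<bar> \<le> \<bar>\<xi> $ i\<bar>" for i
    proof -
      define x where "x = \<xi> $ i"
      define y where "y = disc_point h \<xi> $ i"
      have b: "\<bar>y\<bar> \<le> \<bar>x\<bar>" "\<bar>x\<bar> / 3 \<le> \<bar>y\<bar>" "0 \<le> x * y"
        using c(1,2,4)[of i] by (auto simp: x_def y_def disc_point_def)
      have z: "\<zeta> $ i = (1 - u) * y + u * x" by (simp add: u(3) x_def y_def)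
      have e: "(1 - u) * y + u * x = y + u * (x - y)" by (simp add: algebra_simps)
      show ?thesis
      proof (cases "0 \<le> x")
        case True
        have "0 \<le> y" using b True by (cases "x = 0") (auto simp: zero_le_mult_iff)
        moreover have "0 \<le> u * (x - y)" using b True calculation u by simp
        moreover have "u * (x - y) \<le> 1 * (x - y)" using b True calculation u by (intro mult_right_mono) auto
        ultimately show ?thesis using b True unfolding z e x_def[symmetric] by simp
      next
        case False
        have "y \<le> 0" using b False by (auto simp: zero_le_mult_iff)
        moreover have "0 \<le> u * (y - x)" using b False calculation u by simp
        moreover have "u * (y - x) \<le> 1 * (y - x)" using b False calculation u by (intro mult_right_mono) auto
        moreover have "u * (x - y) = - (u * (y - x))" by (simp add: algebra_simps)
        ultimately show ?thesis using b False unfolding z e x_def[symmetric] by simp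
      qed
    qed
    then show ?thesis using lower[of \<zeta>] norm_le_componentwise_cart[of \<zeta> \<xi>] by simp
  qed
  have "norm \<xi> \<le> (\<Sum>i\<in>UNIV. \<bar>\<xi> $ i\<bar>)" by (rule norm_le_l1_cart)
  also have "\<dots> \<le> (\<Sum>i\<in>(UNIV :: 'n set). 4 / h)"
  proof (rule sum_mono)
    fix i
    have "pi / h \<le> 4 / h" using h pi_less_4 by (intro divide_right_mono) auto
    then show "\<bar>\<xi> $ i\<bar> \<le> 4 / h" using cube_coord[OF \<xi>, of i] by linarith
  qed
  finally show "h * norm \<xi> \<le> 4 * real CARD('n)" using h by (simp add: field_simps)
qed

text \<open>The mean value theorem gives h^2 |\<xi>|^3. The factor (h |\<xi>|)^(2 - \<gamma>) is
  bounded on the cube, and h^\<gamma> |\<xi>|^(1 + \<gamma>) remains.\<close>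

lemma symbol_difference:
  fixes \<xi> :: "real ^ 'n" and F :: "real ^ 'n \<Rightarrow> real"
  assumes h: "h > 0" and \<xi>: "\<xi> \<in> cube (pi / h)" "\<xi> \<noteq> 0" and \<gamma>: "0 < \<gamma>" "\<gamma> \<le> 1"
    and F: "\<And>\<zeta>. norm \<xi> / 3 \<le> norm \<zeta> \<Longrightarrow> norm \<zeta> \<le> norm \<xi> \<Longrightarrow> GDERIV F \<zeta> :> dF \<zeta> \<and> norm (dF \<zeta>) \<le> B"
  shows "\<bar>F \<xi> - G0_disc F h \<xi>\<bar> \<le> B * (real CARD('n) * (4 * real CARD('n))\<^sup>2 * h powr \<gamma> * norm \<xi> powr (1 + \<gamma>))"
proof -
  note b = disc_point_bounds[OF h \<xi>(1)]
  define d where "d = real CARD('n)"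
  have d: "d \<ge> 1" by (simp add: d_def Suc_leI)
  let ?S = "closed_segment (disc_point h \<xi>) \<xi>"
  have n: "norm \<xi> > 0" using \<xi> by simp
  have B: "B \<ge> 0" using F[of \<xi>] n norm_ge_zero[of "dF \<xi>"] by linarith
  have "norm (F \<xi> - F (disc_point h \<xi>)) \<le> B * norm (\<xi> - disc_point h \<xi>)"
  proof (rule differentiable_bound[where S="?S" and f'="\<lambda>\<zeta> v. v \<bullet> dF \<zeta>"])
    fix \<zeta> assume \<zeta>: "\<zeta> \<in> ?S"
    from F b(3)[OF \<zeta>] have D: "GDERIV F \<zeta> :> dF \<zeta>" "norm (dF \<zeta>) \<le> B" by auto
    show "(F has_derivative (\<lambda>v. v \<bullet> dF \<zeta>)) (at \<zeta> within ?S)"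
      using D(1) unfolding gderiv_def by (rule has_derivative_at_withinI)
    have "onorm (\<lambda>v. v \<bullet> dF \<zeta>) \<le> norm (dF \<zeta>)"
    proof (rule onorm_le)
      fix v show "norm (v \<bullet> dF \<zeta>) \<le> norm (dF \<zeta>) * norm v"
        using Cauchy_Schwarz_ineq2[of v "dF \<zeta>"] by (simp add: mult.commute)
    qed
    then show "onorm (\<lambda>v. v \<bullet> dF \<zeta>) \<le> B" using D(2) by simp
  qed auto
  also have "\<dots> \<le> B * (d * (h\<^sup>2 * norm \<xi> ^ 3))" using b(2) B by (intro mult_left_mono) (auto simp: d_def)
  also have "h\<^sup>2 * norm \<xi> ^ 3 = (h * norm \<xi>) powr (2 - \<gamma>) * (h powr \<gamma> * norm \<xi> powr (1 + \<gamma>))"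
  proof -
    have "h\<^sup>2 * norm \<xi> ^ 3 = h powr 2 * norm \<xi> powr 3" using h n by (simp add: powr_numeral)
    also have "\<dots> = (h powr (2 - \<gamma>) * h powr \<gamma>) * (norm \<xi> powr (2 - \<gamma>) * norm \<xi> powr (1 + \<gamma>))"
      by (simp flip: powr_add)
    also have "\<dots> = (h * norm \<xi>) powr (2 - \<gamma>) * (h powr \<gamma> * norm \<xi> powr (1 + \<gamma>))"
      using h n by (simp add: powr_mult)
    finally show ?thesis .
  qed
  also have "B * (d * ((h * norm \<xi>) powr (2 - \<gamma>) * (h powr \<gamma> * norm \<xi> powr (1 + \<gamma>))))
     \<le> B * (d * ((4 * d)\<^sup>2 * (h powr \<gamma> * norm \<xi> powr (1 + \<gamma>))))"
  proof (intro mult_left_mono mult_right_mono)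
    have "(h * norm \<xi>) powr (2 - \<gamma>) \<le> (4 * d) powr (2 - \<gamma>)"
      using b(4) h \<gamma> by (intro powr_mono2) (auto simp: d_def)
    also have "\<dots> \<le> (4 * d) powr 2" using d \<gamma> by (intro powr_mono) auto
    also have "\<dots> = (4 * d)\<^sup>2" using d by (simp add: powr_numeral)
    finally show "(h * norm \<xi>) powr (2 - \<gamma>) \<le> (4 * d)\<^sup>2" .
  qed (use B d in auto)
  finally show ?thesis by (simp add: G0_disc_eq d_def mult_ac)
qed

text \<open>What the resolvent comparison retains of the three cases: the symbol controls the
  weight, and its discretisation error costs at most two weights. The bound 1 on \<gamma> is the
  accuracy of cell functions, and \<gamma> <= \<alpha> lets one weight absorb
  |\<xi>|^\<gamma>.\<close>

definition good_symbol :: "real \<Rightarrow> real \<Rightarrow> real \<Rightarrow> (real ^ 'n \<Rightarrow> real) \<Rightarrow> bool" where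
  "good_symbol \<alpha> \<gamma> C G \<longleftrightarrow> continuous_on UNIV G \<and> (\<forall>\<xi>. 0 \<le> G \<xi>) \<and> G 0 = 0 \<and> 0 < \<gamma> \<and> \<gamma> \<le> 1 \<and> \<gamma> \<le> \<alpha> \<and> C > 0 \<and>
     (\<forall>\<xi>. (1 + norm \<xi>) powr \<alpha> \<le> C * (1 + G \<xi>)) \<and>
     (\<forall>h>0. \<forall>\<xi>\<in>cube (pi / h). \<bar>G \<xi> - G0_disc G h \<xi>\<bar> \<le> C * h powr \<gamma> * (1 + norm \<xi>) powr (2 * \<alpha>))"

lemma symbol_growth:
  fixes G :: "real ^ 'n \<Rightarrow> real"
  assumes \<alpha>: "\<alpha> > 0" and G: "\<And>\<xi>. 0 \<le> G \<xi>" and c: "c > 0" "\<And>\<xi>. norm \<xi> \<ge> c0 \<Longrightarrow> c * norm \<xi> powr \<alpha> \<le> G \<xi>"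
  shows "\<exists>C>0. \<forall>\<xi>. (1 + norm \<xi>) powr \<alpha> \<le> C * (1 + G \<xi>)"
proof -
  define r where "r = max c0 1"
  define C where "C = (1 + r) powr \<alpha> + 2 powr \<alpha> / c"
  have r: "r \<ge> 1" by (simp add: r_def)
  have C: "C > 0" using c r by (simp add: C_def add_pos_pos)
  have "(1 + norm \<xi>) powr \<alpha> \<le> C * (1 + G \<xi>)" for \<xi>
  proof (cases "norm \<xi> \<le> r")
    case True
    then have "(1 + norm \<xi>) powr \<alpha> \<le> (1 + r) powr \<alpha>" using \<alpha> by (intro powr_mono2) auto
    also have "\<dots> \<le> C" using c by (simp add: C_def)
    also have "\<dots> \<le> C * (1 + G \<xi>)" using C G[of \<xi>] by simp
    finally show ?thesis .
  next
    case False
    then have n: "norm \<xi> \<ge> 1" "norm \<xi> \<ge> c0" using r by (auto simp: r_def)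
    then have "(1 + norm \<xi>) powr \<alpha> \<le> (2 * norm \<xi>) powr \<alpha>" using \<alpha> by (intro powr_mono2) auto
    also have "\<dots> = 2 powr \<alpha> / c * (c * norm \<xi> powr \<alpha>)" using n c by (simp add: powr_mult)
    also have "\<dots> \<le> 2 powr \<alpha> / c * G \<xi>" using c(2)[OF n(2)] c(1) by (intro mult_left_mono) auto
    also have "\<dots> \<le> C * (1 + G \<xi>)" using c(1) C G[of \<xi>] by (intro mult_mono) (auto simp: C_def)
    finally show ?thesis .
  qed
  then show ?thesis using C by blast
qed

lemma powr_le_one_plus:
  fixes x :: real
  assumes "x > 0" "0 \<le> s" "s \<le> t"
  shows "x powr s \<le> (1 + x) powr t"
proof -
  have "x powr s \<le> (1 + x) powr s" using assms by (intro powr_mono2) auto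
  also have "\<dots> \<le> (1 + x) powr t" using assms by (intro powr_mono) auto
  finally show ?thesis .
qed

text \<open>Only a negative exponent loses the factor 3^|\<beta>|; the absolute value merges both
  signs.\<close>

lemma powr_annulus:
  fixes x y :: real
  assumes x: "x > 0" and y: "x / 3 \<le> y" "y \<le> x"
  shows "y powr \<beta> \<le> 3 powr \<bar>\<beta>\<bar> * x powr \<beta>"
proof (cases "\<beta> \<ge> 0")
  case True
  have "y powr \<beta> \<le> 1 * x powr \<beta>" using x y True powr_mono2[of \<beta> y x] by simp
  also have "\<dots> \<le> 3 powr \<bar>\<beta>\<bar> * x powr \<beta>" by (intro mult_right_mono ge_one_powr_ge_zero) auto
  finally show ?thesis .
next
  case False
  then have "y powr \<beta> \<le> (x / 3) powr \<beta>" using x y by (intro powr_mono2') auto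
  also have "\<dots> = 3 powr \<bar>\<beta>\<bar> * x powr \<beta>" using False x by (simp add: powr_divide powr_minus_divide)
  finally show ?thesis .
qed

lemma symbol_difference_powr:
  fixes F :: "real ^ 'n \<Rightarrow> real"
  assumes \<gamma>: "0 < \<gamma>" "\<gamma> \<le> 1" and \<beta>: "0 \<le> 1 + \<beta> + \<gamma>" "1 + \<beta> + \<gamma> \<le> s" and c: "c \<ge> 0"
    and F: "\<And>\<zeta>. \<zeta> \<noteq> 0 \<Longrightarrow> GDERIV F \<zeta> :> dF \<zeta> \<and> norm (dF \<zeta>) \<le> c * norm \<zeta> powr \<beta>"
    and h: "h > 0" and \<xi>: "\<xi> \<in> cube (pi / h)"
  shows "\<bar>F \<xi> - G0_disc F h \<xi>\<bar> \<le> c * 3 powr \<bar>\<beta>\<bar> * (real CARD('n) * (4 * real CARD('n))\<^sup>2) * h powr \<gamma> * (1 + norm \<xi>) powr s"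
proof (cases "\<xi> = 0")
  case True
  then have "F \<xi> - G0_disc F h \<xi> = 0" by (simp add: G0_disc_def zero_vec_def)
  then show ?thesis using c by simp
next
  case False
  then have n: "norm \<xi> > 0" by simp
  define D where "D = real CARD('n) * (4 * real CARD('n))\<^sup>2"
  have "\<bar>F \<xi> - G0_disc F h \<xi>\<bar> \<le> (c * (3 powr \<bar>\<beta>\<bar> * norm \<xi> powr \<beta>)) * (D * h powr \<gamma> * norm \<xi> powr (1 + \<gamma>))"
    unfolding D_def
  proof (rule symbol_difference[OF h \<xi> False \<gamma>])
    fix \<zeta> :: "real ^ 'n" assume \<zeta>: "norm \<xi> / 3 \<le> norm \<zeta>" "norm \<zeta> \<le> norm \<xi>"
    then have "\<zeta> \<noteq> 0" using n by auto
    moreover have "c * norm \<zeta> powr \<beta> \<le> c * (3 powr \<bar>\<beta>\<bar> * norm \<xi> powr \<beta>)"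
      using powr_annulus[OF n \<zeta>] c by (intro mult_left_mono)
    ultimately show "GDERIV F \<zeta> :> dF \<zeta> \<and> norm (dF \<zeta>) \<le> c * (3 powr \<bar>\<beta>\<bar> * norm \<xi> powr \<beta>)"
      using F[of \<zeta>] by auto
  qed
  also have "\<dots> = c * 3 powr \<bar>\<beta>\<bar> * D * h powr \<gamma> * (norm \<xi> powr \<beta> * norm \<xi> powr (1 + \<gamma>))" by (simp add: mult_ac)
  also have "norm \<xi> powr \<beta> * norm \<xi> powr (1 + \<gamma>) = norm \<xi> powr (1 + \<beta> + \<gamma>)" by (simp add: algebra_simps flip: powr_add)
  also have "c * 3 powr \<bar>\<beta>\<bar> * D * h powr \<gamma> * norm \<xi> powr (1 + \<beta> + \<gamma>) \<le> c * 3 powr \<bar>\<beta>\<bar> * D * h powr \<gamma> * (1 + norm \<xi>) powr s"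
    using powr_le_one_plus[OF n \<beta>] c by (intro mult_left_mono) (auto simp: D_def)
  finally show ?thesis by (simp add: D_def)
qed

text \<open>The gradient of |\<xi>|^\<alpha> has exponent \<alpha> - 1, and \<gamma> <= \<alpha>
  bounds the resulting exponent \<alpha> + \<gamma> by 2 \<alpha>.\<close>

lemma symbol_difference_norm_powr:
  fixes \<xi> :: "real ^ 'n"
  assumes \<alpha>: "0 < \<alpha>" "\<alpha> \<le> 1" and \<gamma>: "0 < \<gamma>" "\<gamma> \<le> \<alpha>" and h: "h > 0" and \<xi>: "\<xi> \<in> cube (pi / h)"
  shows "\<bar>norm \<xi> powr \<alpha> - G0_disc (\<lambda>\<xi>. norm \<xi> powr \<alpha>) h \<xi>\<bar>
    \<le> \<alpha> * 3 powr \<bar>\<alpha> - 1\<bar> * (real CARD('n) * (4 * real CARD('n))\<^sup>2) * h powr \<gamma> * (1 + norm \<xi>) powr (2 * \<alpha>)"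
proof (rule symbol_difference_powr[where dF="\<lambda>\<zeta>. (\<alpha> * norm \<zeta> powr (\<alpha> - 1)) *\<^sub>R sgn \<zeta>"])
  fix \<zeta> :: "real ^ 'n" assume \<zeta>: "\<zeta> \<noteq> 0"
  have "DERIV (\<lambda>x. x powr \<alpha>) (norm \<zeta>) :> \<alpha> * norm \<zeta> powr (\<alpha> - 1)"
    using \<zeta> by (auto intro!: derivative_eq_intros simp: powr_diff)
  from GDERIV_DERIV_compose[OF GDERIV_norm[OF \<zeta>] this] 
  show "GDERIV (\<lambda>\<xi>. norm \<xi> powr \<alpha>) \<zeta> :> (\<alpha> * norm \<zeta> powr (\<alpha> - 1)) *\<^sub>R sgn \<zeta> \<and>
      norm ((\<alpha> * norm \<zeta> powr (\<alpha> - 1)) *\<^sub>R sgn \<zeta>) \<le> \<alpha> * norm \<zeta> powr (\<alpha> - 1)"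
    using \<zeta> \<alpha> by (simp add: norm_sgn)
qed (use assms in auto)

text \<open>In case (i), and for the differentiable part in case (ii), \<gamma> <= 2\<alpha> -
  \<beta> - 1 says precisely that the exponent 1 + \<beta> + \<gamma> of the error is at most
  2\<alpha>. It also gives \<gamma> <= \<alpha>, since \<alpha> <= 1 + \<beta> in both cases. The
  pure power only needs \<gamma> <= \<alpha>.\<close>

lemma admissible_symbol_good:
  fixes G :: "real ^ 'n \<Rightarrow> real"
  assumes adm: "admissible_symbol p G" and \<gamma>: "0 < \<gamma>" "\<gamma> \<le> 1" "\<gamma> \<le> symbol_exponent p"
  shows "\<exists>\<alpha> C. good_symbol \<alpha> \<gamma> C G"
proof -
  define D where "D = real CARD('n) * (4 * real CARD('n))\<^sup>2"
  have D: "D > 0" by (simp add: D_def)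
  have norm_cont: "continuous_on UNIV (\<lambda>\<xi>::real ^ 'n. norm \<xi> powr \<alpha>)" if "\<alpha> > 0" for \<alpha> :: real
    using that by (intro continuous_on_powr' continuous_intros) auto
  have finish: "\<exists>\<alpha> C. good_symbol \<alpha> \<gamma> C G"
    if asm: "continuous_on UNIV G" "\<And>\<xi>. 0 \<le> G \<xi>" "G 0 = 0" "\<gamma> \<le> \<alpha>" "c > 0" "\<And>\<xi>. norm \<xi> \<ge> c0 \<Longrightarrow> c * norm \<xi> powr \<alpha> \<le> G \<xi>"
      "\<And>h \<xi>. h > 0 \<Longrightarrow> \<xi> \<in> cube (pi / h) \<Longrightarrow> \<bar>G \<xi> - G0_disc G h \<xi>\<bar> \<le> E * h powr \<gamma> * (1 + norm \<xi>) powr (2 * \<alpha>)"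
    for \<alpha> c c0 E
  proof -
    have "\<alpha> > 0" using \<gamma> asm(4) by linarith
    then obtain C1 where C1: "C1 > 0" "\<And>\<xi>. (1 + norm \<xi>) powr \<alpha> \<le> C1 * (1 + G \<xi>)"
      using symbol_growth[of \<alpha> G c c0] asm(2,5,6) by auto
    define C where "C = max C1 E"
    have "C1 \<le> C" by (simp add: C_def)
    then have "(1 + norm \<xi>) powr \<alpha> \<le> C * (1 + G \<xi>)" for \<xi>
      using C1(2)[of \<xi>] mult_right_mono[of C1 C "1 + G \<xi>"] asm(2)[of \<xi>] by linarith
    moreover have "\<bar>G \<xi> - G0_disc G h \<xi>\<bar> \<le> C * h powr \<gamma> * (1 + norm \<xi>) powr (2 * \<alpha>)" if "h > 0" "\<xi> \<in> cube (pi / h)" for h \<xi>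
    proof -
      have "E * h powr \<gamma> * (1 + norm \<xi>) powr (2 * \<alpha>) \<le> C * h powr \<gamma> * (1 + norm \<xi>) powr (2 * \<alpha>)"
        by (intro mult_right_mono) (auto simp: C_def)
      then show ?thesis using asm(7)[OF that] by linarith
    qed
    ultimately show ?thesis
      using asm(1-4) \<gamma> C1 unfolding good_symbol_def by (intro exI[of _ \<alpha>] exI[of _ C]) (auto simp: C_def)
  qed
  show ?thesis
  proof (cases p)
    case (Case_i \<alpha> \<beta>)
    then have s: "symbol_i \<alpha> \<beta> G" and \<gamma>e: "\<gamma> \<le> 2 * \<alpha> - \<beta> - 1" using adm \<gamma> by auto
    obtain c c0 where c: "c > 0" "\<And>\<xi>. norm \<xi> \<ge> c0 \<Longrightarrow> G \<xi> \<ge> c * norm \<xi> powr \<alpha>"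
      using s unfolding symbol_i_def by blast
    obtain dG c' where dG: "\<And>\<xi>. GDERIV G \<xi> :> dG \<xi>" "c' > 0" "\<And>\<xi>. \<xi> \<noteq> 0 \<Longrightarrow> norm (dG \<xi>) \<le> c' * norm \<xi> powr \<beta>"
      using s unfolding symbol_i_def by blast
    have G: "\<And>\<xi>. 0 \<le> G \<xi>" "G 0 = 0" "\<beta> > -1/2" "\<alpha> \<le> 1 + \<beta>" using s by (auto simp: symbol_i_def)
    have "continuous_on UNIV G"
      using dG(1) unfolding gderiv_def by (intro continuous_at_imp_continuous_on ballI has_derivative_continuous) blast
    then show ?thesis
    proof (rule finish[OF _ G(1,2) _ c])
      show "\<gamma> \<le> \<alpha>" using \<gamma>e G by linarith
      show "\<bar>G \<xi> - G0_disc G h \<xi>\<bar> \<le> (c' * 3 powr \<bar>\<beta>\<bar> * D) * h powr \<gamma> * (1 + norm \<xi>) powr (2 * \<alpha>)"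
        if "h > 0" "\<xi> \<in> cube (pi / h)" for h \<xi>
        unfolding D_def
        by (rule symbol_difference_powr[OF \<gamma>(1,2), where dF=dG]) (use dG G \<gamma> \<gamma>e that in auto)
    qed
  next
    case (Case_ii \<alpha> \<beta>)
    then have s: "symbol_ii \<alpha> \<beta> G" and \<gamma>e: "\<gamma> \<le> 2 * \<alpha> - \<beta> - 1" using adm \<gamma> by auto
    then have ab: "1/2 < \<alpha>" "\<alpha> \<le> 1" "\<beta> \<ge> 0" by (auto simp: symbol_ii_def)
    obtain G1 dG where G1: "\<And>\<xi>. G \<xi> = norm \<xi> powr \<alpha> + G1 \<xi>" "\<And>\<xi>. G1 \<xi> \<ge> 0" "G1 0 = 0"
        "continuous_on UNIV dG" "\<And>\<xi>. GDERIV G1 \<xi> :> dG \<xi>"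
        "\<exists>c>0. \<exists>c0>0. \<forall>\<xi>. norm \<xi> \<ge> c0 \<longrightarrow> norm (dG \<xi>) \<le> c * norm \<xi> powr \<beta>"
      using s unfolding symbol_ii_def by blast
    obtain c c0 where c: "c > 0" "c0 > 0" "\<And>\<xi>. norm \<xi> \<ge> c0 \<Longrightarrow> norm (dG \<xi>) \<le> c * norm \<xi> powr \<beta>"
      using G1(6) by blast
    \<comment> \<open>The gradient bound is given for large \<xi> only. Continuity on a compact ball
      extends it to all \<xi>, with 1 + |\<xi>| in place of |\<xi>|.\<close>
    have "compact (dG ` cball 0 c0)"
      using continuous_on_subset[OF G1(4)] by (intro compact_continuous_image) auto
    then obtain K where K: "K > 0" "\<And>\<xi>. norm \<xi> \<le> c0 \<Longrightarrow> norm (dG \<xi>) \<le> K"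
      using compact_imp_bounded[of "dG ` cball 0 c0"] by (auto simp: bounded_pos)
    have dG: "norm (dG \<xi>) \<le> (c + K) * (1 + norm \<xi>) powr \<beta>" for \<xi>
    proof (cases "norm \<xi> \<le> c0")
      case True
      have "norm (dG \<xi>) \<le> K * 1" using K(2)[OF True] by simp
      also have "\<dots> \<le> (c + K) * (1 + norm \<xi>) powr \<beta>"
        using c K ab by (intro mult_mono ge_one_powr_ge_zero) auto
      finally show ?thesis .
    next
      case False
      then have "norm (dG \<xi>) \<le> c * norm \<xi> powr \<beta>" using c by simp
      also have "\<dots> \<le> (c + K) * (1 + norm \<xi>) powr \<beta>"
        using c K ab by (intro mult_mono powr_mono2) auto
      finally show ?thesis .
    qed
    have G1_cont: "continuous_on UNIV G1"
      using G1(5) unfolding gderiv_def by (intro continuous_at_imp_continuous_on ballI has_derivative_continuous) blast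
    have G_eq: "G = (\<lambda>\<xi>. norm \<xi> powr \<alpha> + G1 \<xi>)" using G1(1) by auto
    have "continuous_on UNIV G" unfolding G_eq using norm_cont[of \<alpha>] G1_cont ab by (intro continuous_on_add) auto
    then show ?thesis
    proof (rule finish[where \<alpha>=\<alpha> and c=1 and c0=0])
      show "0 \<le> G \<xi>" "1 * norm \<xi> powr \<alpha> \<le> G \<xi>" for \<xi> using G1(2)[of \<xi>] by (auto simp: G1(1))
      show "G 0 = 0" using ab by (simp add: G1)
      show "\<gamma> \<le> \<alpha>" using \<gamma>e ab by linarith
      show "\<bar>G \<xi> - G0_disc G h \<xi>\<bar> \<le> (\<alpha> * 3 powr \<bar>\<alpha> - 1\<bar> * D + (c + K) * D) * h powr \<gamma> * (1 + norm \<xi>) powr (2 * \<alpha>)"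
        if h: "h > 0" and \<xi>: "\<xi> \<in> cube (pi / h)" for h \<xi>
      proof -
        have 1: "\<bar>norm \<xi> powr \<alpha> - G0_disc (\<lambda>\<xi>. norm \<xi> powr \<alpha>) h \<xi>\<bar> \<le> \<alpha> * 3 powr \<bar>\<alpha> - 1\<bar> * D * h powr \<gamma> * (1 + norm \<xi>) powr (2 * \<alpha>)"
          unfolding D_def by (rule symbol_difference_norm_powr) (use ab \<gamma> \<gamma>e h \<xi> in auto)
        have 2: "\<bar>G1 \<xi> - G0_disc G1 h \<xi>\<bar> \<le> (c + K) * D * h powr \<gamma> * (1 + norm \<xi>) powr (2 * \<alpha>)"
        proof (cases "\<xi> = 0")
          case True
          then have "G1 \<xi> - G0_disc G1 h \<xi> = 0" by (simp add: G0_disc_def zero_vec_def)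
          then show ?thesis using c K D by simp
        next
          case False
          then have n: "norm \<xi> > 0" by simp
          have "\<bar>G1 \<xi> - G0_disc G1 h \<xi>\<bar> \<le> ((c + K) * (1 + norm \<xi>) powr \<beta>) * (D * h powr \<gamma> * norm \<xi> powr (1 + \<gamma>))"
            unfolding D_def
          proof (rule symbol_difference[OF h \<xi> False \<gamma>(1,2)])
            fix \<zeta> :: "real ^ 'n" assume \<zeta>: "norm \<zeta> \<le> norm \<xi>"
            have "norm (dG \<zeta>) \<le> (c + K) * (1 + norm \<zeta>) powr \<beta>" by (rule dG)
            also have "\<dots> \<le> (c + K) * (1 + norm \<xi>) powr \<beta>"
              using c K ab \<zeta> by (intro mult_left_mono powr_mono2) auto
            finally show "GDERIV G1 \<zeta> :> dG \<zeta> \<and> norm (dG \<zeta>) \<le> (c + K) * (1 + norm \<xi>) powr \<beta>"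
              using G1(5) by blast
          qed
          also have "\<dots> \<le> ((c + K) * (1 + norm \<xi>) powr \<beta>) * (D * h powr \<gamma> * (1 + norm \<xi>) powr (1 + \<gamma>))"
            using c K D n \<gamma> by (intro mult_left_mono powr_mono2) auto
          also have "\<dots> = (c + K) * D * h powr \<gamma> * (1 + norm \<xi>) powr (\<beta> + (1 + \<gamma>))"
            by (simp add: powr_add mult_ac)
          also have "\<dots> \<le> (c + K) * D * h powr \<gamma> * (1 + norm \<xi>) powr (2 * \<alpha>)"
            using c K D \<gamma>e by (intro mult_left_mono powr_mono) auto
          finally show ?thesis .
        qed
        have "\<bar>G \<xi> - G0_disc G h \<xi>\<bar> \<le> \<bar>norm \<xi> powr \<alpha> - G0_disc (\<lambda>\<xi>. norm \<xi> powr \<alpha>) h \<xi>\<bar> + \<bar>G1 \<xi> - G0_disc G1 h \<xi>\<bar>"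
          unfolding G0_disc_eq G1(1) by linarith
        also have "\<dots> \<le> (\<alpha> * 3 powr \<bar>\<alpha> - 1\<bar> * D + (c + K) * D) * h powr \<gamma> * (1 + norm \<xi>) powr (2 * \<alpha>)"
          using 1 2 by (simp add: distrib_right)
        finally show ?thesis .
      qed
    qed auto
  next
    case (Case_iii \<alpha>)
    then have s: "0 < \<alpha>" "\<alpha> \<le> 1" "\<And>\<xi>. G \<xi> = norm \<xi> powr \<alpha>" "\<gamma> \<le> \<alpha>" using adm \<gamma> by (auto simp: symbol_iii_def)
    have G: "G = (\<lambda>\<xi>. norm \<xi> powr \<alpha>)" using s(3) by auto
    have "continuous_on UNIV G" unfolding G by (rule norm_cont[OF s(1)])
    then show ?thesis
    proof (rule finish[where \<alpha>=\<alpha> and c=1 and c0=0])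
      show "\<bar>G \<xi> - G0_disc G h \<xi>\<bar> \<le> (\<alpha> * 3 powr \<bar>\<alpha> - 1\<bar> * D) * h powr \<gamma> * (1 + norm \<xi>) powr (2 * \<alpha>)"
        if "h > 0" "\<xi> \<in> cube (pi / h)" for h \<xi>
        unfolding D_def G by (rule symbol_difference_norm_powr) (use s \<gamma> that in auto)
    qed (use s in auto)
  qed
qed

section \<open>Comparison of the resolvents\<close>

text \<open>\<open>F\<close> and \<open>K\<close> will be weighted versions of the functions in the
  forms, so that a pointwise error containing weights is bounded by weighted norms.\<close>

lemma L2_ip_diff_le:
  assumes L2: "f \<in> L2 M" "g \<in> L2 M" "f' \<in> L2 M" "g' \<in> L2 M" "F \<in> L2 M" "K \<in> L2 M" and c: "c \<ge> 0"
    and le: "AE x in M. cmod (cnj (f x) * g x - cnj (f' x) * g' x) \<le> c * (cmod (F x) * cmod (K x))"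
  shows "\<bar>L2_ip M f g - L2_ip M f' g'\<bar> \<le> c * (L2_norm M F * L2_norm M K)"
proof -
  note [measurable] = L2_measurable[OF L2(1)] L2_measurable[OF L2(2)] L2_measurable[OF L2(3)] L2_measurable[OF L2(4)]
  have "\<bar>L2_ip M f g - L2_ip M f' g'\<bar> \<le> cmod (L2_inner M f g - L2_inner M f' g')"
    unfolding L2_ip_def using abs_Re_le_cmod[of "L2_inner M f g - L2_inner M f' g'"] by simp
  also have "L2_inner M f g - L2_inner M f' g' = (LINT x|M. cnj (f x) * g x - cnj (f' x) * g' x)"
    unfolding L2_inner_def by (intro Bochner_Integration.integral_diff[symmetric] L2_prod_integrable L2)
  also have "cmod \<dots> \<le> (LINT x|M. cmod (cnj (f x) * g x - cnj (f' x) * g' x))" by (rule integral_norm_bound)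
  also have "\<dots> \<le> (LINT x|M. c * (cmod (F x) * cmod (K x)))"
  proof (rule integral_mono_AE[OF _ _ le])
    show "integrable M (\<lambda>x. cmod (cnj (f x) * g x - cnj (f' x) * g' x))"
      by (intro integrable_norm Bochner_Integration.integrable_diff L2_prod_integrable L2)
    show "integrable M (\<lambda>x. c * (cmod (F x) * cmod (K x)))"
      using L2_prod_integrable[OF L2(5,6), THEN integrable_norm] by (simp add: norm_mult)
  qed
  also have "\<dots> = c * (LINT x|M. cmod (F x) * cmod (K x))" by simp
  also have "\<dots> \<le> c * (L2_norm M F * L2_norm M K)" by (intro mult_left_mono L2_prod_norm_le L2 c)
  finally show ?thesis .
qed

lemma L2_ip_le:
  assumes L2: "f \<in> L2 M" "g \<in> L2 M" "F \<in> L2 M" "K \<in> L2 M" and c: "c \<ge> 0"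
    and le: "AE x in M. cmod (f x) * cmod (g x) \<le> c * (cmod (F x) * cmod (K x))"
  shows "\<bar>L2_ip M f g\<bar> \<le> c * (L2_norm M F * L2_norm M K)"
proof -
  have "\<bar>L2_ip M f g - L2_ip M 0 0\<bar> \<le> c * (L2_norm M F * L2_norm M K)"
    using le by (intro L2_ip_diff_le L2 L2.S_closed(1) c) (simp add: norm_mult)
  then show ?thesis by (simp add: L2_ip_def L2_inner_def)
qed

context resolvent_operator
begin

lemma R_norms:
  assumes q: "q \<in> L2 M" and m1: "m + 1 \<le> mu"
  shows "L2_norm M (R q) \<le> L2_norm M q" "L2_norm M (kin (R q)) \<le> (1 + mu + m) * L2_norm M q"
proof -
  have m0: "0 \<le> m" using W_bound[of undefined] by linarith
  have i: "1 / (mu - m) \<le> 1" "0 < mu - m" using m1 by auto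
  show "L2_norm M (R q) \<le> L2_norm M q"
    using R_bound[OF q] mult_right_mono[OF i(1) L2_norm_nonneg[of M q]] by linarith
  have "(\<bar>mu\<bar> + m) * (1 / (mu - m)) \<le> (\<bar>mu\<bar> + m) * 1" using i m0 by (intro mult_left_mono) auto
  then have "1 + (\<bar>mu\<bar> + m) / (mu - m) \<le> 1 + mu + m" using m0 m1 by simp
  from mult_right_mono[OF this L2_norm_nonneg[of M q]]
  show "L2_norm M (kin (R q)) \<le> (1 + mu + m) * L2_norm M q" using kin_R_norm[OF q] by linarith
qed

text \<open>The weight is dominated by 1 + g, and both R q and its kinetic part are bounded by
  \<open>q\<close>.\<close>

lemma R_weighted:
  fixes \<omega> :: "_ \<Rightarrow> real"
  assumes q: "q \<in> L2 M" and m1: "m + 1 \<le> mu" and [measurable]: "\<omega> \<in> borel_measurable N"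
    and c: "c \<ge> 0" "\<And>\<xi>. \<xi> \<in> space N \<Longrightarrow> 0 \<le> \<omega> \<xi> \<and> \<omega> \<xi> \<le> c * (1 + g \<xi>)"
  shows "(\<lambda>\<xi>. of_real (\<omega> \<xi>) * A (R q) \<xi>) \<in> L2 N"
    "L2_norm N (\<lambda>\<xi>. of_real (\<omega> \<xi>) * A (R q) \<xi>) \<le> c * (2 + mu + m) * L2_norm M q"
proof -
  let ?gA = "\<lambda>\<xi>. of_real (g \<xi>) * A (R q) \<xi>" and ?w = "\<lambda>\<xi>. of_real (\<omega> \<xi>) * A (R q) \<xi>"
  have A: "A (R q) \<in> L2 N" by (rule A_L2[OF R_L2[OF q]])
  note [measurable] = L2_measurable[OF A]
  have gA: "?gA \<in> L2 N" by (rule domD(2)[OF R(1)[OF q]])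
  have s: "A (R q) + ?gA \<in> L2 N" by (rule L2.S_closed(2)[OF A gA])
  have le: "AE \<xi> in N. cmod (?w \<xi>) \<le> c * cmod ((A (R q) + ?gA) \<xi>)"
  proof (rule AE_I2)
    fix \<xi> assume \<xi>: "\<xi> \<in> space N"
    have "(A (R q) + ?gA) \<xi> = of_real (1 + g \<xi>) * A (R q) \<xi>" by (simp add: algebra_simps)
    moreover have "cmod (?w \<xi>) = \<omega> \<xi> * cmod (A (R q) \<xi>)" using c(2)[OF \<xi>] by (simp add: norm_mult)
    moreover have "\<omega> \<xi> * cmod (A (R q) \<xi>) \<le> c * (1 + g \<xi>) * cmod (A (R q) \<xi>)"
      using c(2)[OF \<xi>] by (intro mult_right_mono) auto
    moreover have "cmod (of_real (1 + g \<xi>) * A (R q) \<xi>) = (1 + g \<xi>) * cmod (A (R q) \<xi>)"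
      unfolding norm_mult norm_of_real using g_nonneg[of \<xi>] by simp
    ultimately show "cmod (?w \<xi>) \<le> c * cmod ((A (R q) + ?gA) \<xi>)" by (simp only: mult.assoc)
  qed
  note dom = L2_dominated[OF s _ c(1) le]
  show "?w \<in> L2 N" by (rule dom(1)) measurable
  have "L2_norm N ?w \<le> c * L2_norm N (A (R q) + ?gA)" by (rule dom(2)) measurable
  also have "\<dots> \<le> c * ((2 + mu + m) * L2_norm M q)"
  proof (rule mult_left_mono[OF _ c(1)])
    have "L2_norm N (A (R q) + ?gA) \<le> L2_norm M (R q) + L2_norm M (kin (R q))"
      using L2.nrm_triangle[OF A gA] A_norm[OF R_L2[OF q]] kin_norm[OF R(1)[OF q]] by simp
    also have "\<dots> \<le> L2_norm M q + (1 + mu + m) * L2_norm M q" by (intro add_mono R_norms q m1)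
    finally show "L2_norm N (A (R q) + ?gA) \<le> (2 + mu + m) * L2_norm M q" by (simp add: algebra_simps)
  qed
  finally show "L2_norm N ?w \<le> c * (2 + mu + m) * L2_norm M q" by simp
qed

end

lemma hoelder_continuous:
  fixes V :: "'a::metric_space \<Rightarrow> real" and L \<theta> :: real
  assumes \<theta>: "\<theta> > 0" and V: "\<And>x y. \<bar>V x - V y\<bar> \<le> L * dist x y powr \<theta>"
  shows "continuous_on UNIV V"
  unfolding continuous_on_def
proof
  fix x :: 'a
  have "((\<lambda>y. dist y x) \<longlongrightarrow> 0) (at x)"
    by (rule iffD1[OF tendsto_dist_iff tendsto_ident_at])
  then have "((\<lambda>y. dist y x powr \<theta>) \<longlongrightarrow> 0) (at x)"
    by (rule tendsto_zero_powrI[OF _ tendsto_const _ \<theta>]) simp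
  then have "((\<lambda>y. L * dist y x powr \<theta>) \<longlongrightarrow> 0) (at x)"
    by (rule tendsto_mult_right_zero)
  moreover have "\<forall>\<^sub>F y in at x. norm (V y - V x) \<le> L * dist y x powr \<theta>"
    unfolding real_norm_def by (rule always_eventually, rule allI, rule V)
  ultimately have "((\<lambda>y. V y - V x) \<longlongrightarrow> 0) (at x)"
    by (rule Lim_null_comparison[rotated])
  then show "(V \<longlongrightarrow> V x) (at x)" by (simp add: LIM_zero_iff)
qed

lemma cell_index_near:
  fixes x :: "real ^ 'n"
  assumes h: "h > 0"
  shows "dist x (h *\<^sub>R zvec (cell_index h x)) \<le> real CARD('n) * h"
proof -
  have "\<bar>(x - h *\<^sub>R zvec (cell_index h x)) $ i\<bar> \<le> h" for i
  proof -
    have "h * (of_int (cell_index h x $ i) - 1 / 2) \<le> x $ i" "x $ i < h * (of_int (cell_index h x $ i) + 1 / 2)"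
      using cell_index_eq_iff[OF h, of x "cell_index h x"] by auto
    then show ?thesis using h by (auto simp: zvec_def abs_le_iff algebra_simps)
  qed
  then have "(\<Sum>i\<in>UNIV. \<bar>(x - h *\<^sub>R zvec (cell_index h x)) $ i\<bar>) \<le> (\<Sum>i\<in>(UNIV :: 'n set). h)"
    by (rule sum_mono)
  then show ?thesis using norm_le_l1_cart[of "x - h *\<^sub>R zvec (cell_index h x)"] by (simp add: dist_norm)
qed

lemma disc_point_continuous: "continuous_on UNIV (disc_point h)"
  unfolding disc_point_def by (intro continuous_intros)

lemma G0_disc_continuous:
  assumes "continuous_on UNIV G"
  shows "continuous_on UNIV (G0_disc G h)"
  using continuous_on_compose2[OF assms disc_point_continuous, of h] by (simp add: G0_disc_eq[abs_def])

lemma space_torus [simp]: "space (torus h) = cube (pi / h)"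
  by (simp add: torus_def space_restrict_space)

lemma torus_measurable_real:
  fixes f :: "real ^ 'n \<Rightarrow> real"
  shows "continuous_on UNIV f \<Longrightarrow> f \<in> borel_measurable (torus h)"
  unfolding torus_def by (intro measurable_restrict_space1) (simp add: borel_measurable_continuous_onI)

lemma continuous_bounded_cube:
  fixes f :: "real ^ 'n \<Rightarrow> real"
  assumes "continuous_on UNIV f"
  shows "\<exists>B\<ge>0. \<forall>\<xi>\<in>cube r. \<bar>f \<xi>\<bar> \<le> B"
proof -
  have "compact (f ` cube r)"
    unfolding cube_eq_cbox by (rule compact_continuous_image[OF continuous_on_subset[OF assms subset_UNIV] compact_cbox])
  then have "bounded (f ` cube r)" by (rule compact_imp_bounded)
  then obtain B where B: "\<And>\<xi>. \<xi> \<in> cube r \<Longrightarrow> \<bar>f \<xi>\<bar> \<le> B" unfolding bounded_iff real_norm_def by blast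
  have "\<bar>f \<xi>\<bar> \<le> max 0 B" if "\<xi> \<in> cube r" for \<xi> using B[OF that] by simp
  then show ?thesis by (intro exI[of _ "max 0 B"]) simp
qed

text \<open>One mesh width at a time. The condition m + 1 <= mu bounds both resolvents by 1, and
  \<gamma> <= \<theta> <= 1 keeps the error of the potential within O(h^\<gamma>).\<close>

locale discretisation =
  fixes G V :: "real ^ 'n \<Rightarrow> real" and \<alpha> \<gamma> C L \<theta> m mu h D :: real
  assumes good: "good_symbol \<alpha> \<gamma> C G"
    and V_bound: "\<And>x. \<bar>V x\<bar> \<le> m" and V_hoelder: "\<And>x y. \<bar>V x - V y\<bar> \<le> L * dist x y powr \<theta>" and L: "0 \<le> L"
    and \<theta>: "\<gamma> \<le> \<theta>" "\<theta> \<le> 1" and h: "0 < h" "h \<le> 1" and D: "D = real CARD('n)"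
    and mu: "m + 1 \<le> mu"
    and res_c: "complex_of_real (- mu) \<in> resolvent_H G V"
    and res_d: "complex_of_real (- mu) \<in> resolvent_Hh G V h"
begin

lemma good': "continuous_on UNIV G" "0 \<le> G \<xi>" "0 < \<gamma>" "\<gamma> \<le> 1" "\<gamma> \<le> \<alpha>" "0 < C"
  "(1 + norm \<xi>) powr \<alpha> \<le> C * (1 + G \<xi>)"
  "\<xi> \<in> cube (pi / h) \<Longrightarrow> \<bar>G \<xi> - G0_disc G h \<xi>\<bar> \<le> C * h powr \<gamma> * (1 + norm \<xi>) powr (2 * \<alpha>)"
  using good h unfolding good_symbol_def by blast+

lemma V_continuous: "continuous_on UNIV V"
  using hoelder_continuous[OF _ V_hoelder] \<theta> good'(3) by simp

lemma [measurable]: "G \<in> borel_measurable borel" "V \<in> borel_measurable borel"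
  using good'(1) V_continuous by (auto intro: borel_measurable_continuous_onI)

lemma multiplier_c: "multiplier_operator lborel lborel fourier G V m"
  by unfold_locales (use unitary_fourier good'(2) V_bound in auto)

lemma multiplier_d: "multiplier_operator (lattice h) (torus h) (dft h) (G0_disc G h) (\<lambda>k. V (h *\<^sub>R zvec k)) m"
proof unfold_locales
  show "G0_disc G h \<in> borel_measurable (torus h)"
    by (intro torus_measurable_real G0_disc_continuous good')
qed (use unitary_dft[OF h(1)] good'(2) V_bound in \<open>auto simp: G0_disc_eq\<close>)

lemma opdom_c: "multiplier_operator.opdom lborel lborel fourier G = H_dom G"
  unfolding multiplier_operator.opdom_def[OF multiplier_c] H_dom_def ..

lemma op_c: "multiplier_operator.op lborel lborel fourier G V = H_op G V"
  unfolding multiplier_operator.op_def[OF multiplier_c, abs_def] H_op_def[abs_def] ..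

lemma op_d: "multiplier_operator.op (lattice h) (torus h) (dft h) (G0_disc G h) (\<lambda>k. V (h *\<^sub>R zvec k)) = Hh_op G V h"
  unfolding multiplier_operator.op_def[OF multiplier_d, abs_def] Hh_op_def[abs_def] ..

text \<open>The discretised symbol is continuous, hence bounded on the compact cube, and
  multiplication by it restricts no lattice function.\<close>

lemma opdom_d: "multiplier_operator.opdom (lattice h) (torus h) (dft h) (G0_disc G h) = L2 (lattice h)"
proof -
  obtain B where B: "B \<ge> 0" "\<And>\<xi>. \<xi> \<in> cube (pi / h) \<Longrightarrow> \<bar>G0_disc G h \<xi>\<bar> \<le> B"
    using continuous_bounded_cube[OF G0_disc_continuous[OF good'(1)]] by blast
  have [measurable]: "G0_disc G h \<in> borel_measurable (torus h)"
    by (intro torus_measurable_real G0_disc_continuous good'(1))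
  have "(\<lambda>\<xi>. of_real (G0_disc G h \<xi>) * dft h f \<xi>) \<in> L2 (torus h)" if f: "f \<in> L2 (lattice h)" for f
  proof (rule L2_bounded_mult(1)[OF dft_L2[OF h(1) f] _ B(1)])
    show "(\<lambda>\<xi>. complex_of_real (G0_disc G h \<xi>)) \<in> borel_measurable (torus h)" by measurable
  qed (use B in auto)
  then show ?thesis unfolding multiplier_operator.opdom_def[OF multiplier_d] by auto
qed

end

sublocale discretisation \<subseteq> c: resolvent_operator lborel lborel fourier G V m mu
proof -
  interpret multiplier_operator lborel lborel fourier G V m by (rule multiplier_c)
  show "resolvent_operator lborel lborel fourier G V m mu"
    by unfold_locales (use mu res_c opdom_c op_c in auto)
qed

sublocale discretisation \<subseteq>
  d: resolvent_operator "lattice h" "torus h" "dft h" "G0_disc G h" "\<lambda>k. V (h *\<^sub>R zvec k)" m mu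
proof -
  interpret multiplier_operator "lattice h" "torus h" "dft h" "G0_disc G h" "\<lambda>k. V (h *\<^sub>R zvec k)" m
    by (rule multiplier_d)
  show "resolvent_operator (lattice h) (torus h) (dft h) (G0_disc G h) (\<lambda>k. V (h *\<^sub>R zvec k)) m mu"
    by unfold_locales (use mu res_d opdom_d op_d in auto)
qed

context discretisation
begin

abbreviation "J \<equiv> cell_embed h"

definition "\<omega> \<xi> = (1 + norm (\<xi> :: real ^ 'n)) powr \<alpha>"

text \<open>Bounds the weighted transform of either resolvent. The factor 3^\<alpha> is lost in
  \<open>\<omega>_le_d\<close>; 2 + mu + m collects the bounds 1 for the resolvent and 1 + mu + m
  for its kinetic part.\<close>

definition "B = 3 powr \<alpha> * C * (2 + mu + m)"

text \<open>The first three summands belong to \<open>kinetic_estimate\<close> (symbol error and two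
  tails), \<open>L * D\<close> to the potential and the last one to
  \<open>regular_near_cell\<close>. No summand contains h, so one constant serves all mesh
  widths.\<close>

definition "cc = C * B\<^sup>2 + B * (1 + mu + m) + (1 + mu + m) * (D * B) + L * D + (3 * D + 1) * B"

lemma \<omega>_continuous: "continuous_on UNIV \<omega>"
  unfolding \<omega>_def[abs_def] by (intro continuous_intros) (auto simp: add_nonneg_eq_0_iff)

lemma \<omega>_nonneg: "0 \<le> \<omega> \<xi>" by (simp add: \<omega>_def)

lemma D_ge_1: "1 \<le> D" by (simp add: D)

lemma m_nonneg: "0 \<le> m" using V_bound[of undefined] by linarith

lemma B_nonneg: "0 \<le> B" using good'(6) mu m_nonneg by (simp add: B_def)

text \<open>Interpolation: min 1 t <= t^\<gamma> for 0 < \<gamma> <= 1. This converts first order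
  accuracy in h |\<xi>| into the rate h^\<gamma> at the price of one weight.\<close>

lemma min_le_\<omega>: "min 1 (h * norm \<xi>) \<le> h powr \<gamma> * \<omega> \<xi>"
proof -
  have "min 1 (h * norm \<xi>) \<le> (h * norm \<xi>) powr \<gamma>"
  proof (cases "h * norm \<xi> \<le> 1")
    case True
    then have "(h * norm \<xi>) powr 1 \<le> (h * norm \<xi>) powr \<gamma>" using good'(4) h by (intro powr_mono') auto
    then show ?thesis using h by simp
  next
    case False
    then show ?thesis using good'(3) by (simp add: ge_one_powr_ge_zero)
  qed
  also have "\<dots> = h powr \<gamma> * norm \<xi> powr \<gamma>" using h by (simp add: powr_mult)
  also have "\<dots> \<le> h powr \<gamma> * \<omega> \<xi>"
  proof (rule mult_left_mono)
    have "norm \<xi> powr \<gamma> \<le> (1 + norm \<xi>) powr \<gamma>" using good'(3) by (intro powr_mono2) auto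
    also have "\<dots> \<le> \<omega> \<xi>" unfolding \<omega>_def using good'(5) by (intro powr_mono) auto
    finally show "norm \<xi> powr \<gamma> \<le> \<omega> \<xi>" .
  qed simp
  finally show ?thesis .
qed

lemma outside_cube: "\<xi> \<notin> cube (pi / h) \<Longrightarrow> 1 \<le> h powr \<gamma> * \<omega> \<xi>"
proof -
  assume "\<xi> \<notin> cube (pi / h)"
  then obtain i where "\<not> (- (pi / h) \<le> \<xi> $ i \<and> \<xi> $ i \<le> pi / h)" unfolding cube_def by blast
  then have "pi / h < \<bar>\<xi> $ i\<bar>" by arith
  then have "pi / h < norm \<xi>" using component_le_norm_cart[of \<xi> i] by linarith
  then have "1 \<le> h * norm \<xi>" using h pi_gt3 by (simp add: field_simps)
  then show ?thesis using min_le_\<omega>[of \<xi>] by simp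
qed

text \<open>The quadratic bound is used for h |\<xi>| <= 1 and the trivial bound 1 <= D^2 beyond;
  together they give the square of D min 1 (h |\<xi>|).\<close>

lemma cell_factor_defect: "1 - (cmod (cell_factor (h *\<^sub>R \<xi>)))\<^sup>2 \<le> (D * h powr \<gamma> * \<omega> \<xi>)\<^sup>2"
proof -
  have 1: "(D * min 1 (h * norm \<xi>))\<^sup>2 \<le> (D * (h powr \<gamma> * \<omega> \<xi>))\<^sup>2"
    using D_ge_1 h by (intro power_mono mult_left_mono min_le_\<omega>) auto
  have "1 - (cmod (cell_factor (h *\<^sub>R \<xi>)))\<^sup>2 \<le> (D * min 1 (h * norm \<xi>))\<^sup>2"
  proof (cases "h * norm \<xi> \<le> 1")
    case True
    then show ?thesis using cell_factor_near_1(2)[of "h *\<^sub>R \<xi>"] h by (simp add: D)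
  next
    case False
    have "1 \<le> D\<^sup>2" using D_ge_1 by (simp add: power2_eq_square mult_ge1_I)
    then have "1 - (cmod (cell_factor (h *\<^sub>R \<xi>)))\<^sup>2 \<le> D\<^sup>2" by (smt (verit) zero_le_power2)
    then show ?thesis using False by simp
  qed
  then show ?thesis using 1 by (simp add: mult.assoc)
qed

lemma cell_factor_near: "cmod (1 - cell_factor (h *\<^sub>R \<xi>)) \<le> 2 * D * h powr \<gamma> * \<omega> \<xi>"
proof -
  have "cmod (1 - cell_factor (h *\<^sub>R \<xi>)) \<le> 2 * D * min 1 (h * norm \<xi>)"
  proof (cases "h * norm \<xi> \<le> 1")
    case True
    have "0 \<le> D * (h * norm \<xi>)" using D_ge_1 h by simp
    moreover have "cmod (1 - cell_factor (h *\<^sub>R \<xi>)) \<le> D * (h * norm \<xi>)"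
      using cell_factor_near_1(1)[of "h *\<^sub>R \<xi>"] h by (simp add: D)
    moreover have "min 1 (h * norm \<xi>) = h * norm \<xi>" using True by simp
    ultimately show ?thesis by (simp only: mult.assoc)
  next
    case False
    have "cmod (1 - cell_factor (h *\<^sub>R \<xi>)) \<le> 1 + 1"
      using norm_triangle_ineq4[of 1 "cell_factor (h *\<^sub>R \<xi>)"] cell_factor_le_1[of "h *\<^sub>R \<xi>"] by simp
    then show ?thesis using False D_ge_1 by simp
  qed
  also have "\<dots> \<le> 2 * D * (h powr \<gamma> * \<omega> \<xi>)" using D_ge_1 by (intro mult_left_mono min_le_\<omega>) auto
  finally show ?thesis by (simp add: mult.assoc)
qed

lemma three_powr: "1 \<le> 3 powr \<alpha>"
  using good'(3,5) by (intro ge_one_powr_ge_zero) auto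

lemma \<omega>_le_c: "\<omega> \<xi> \<le> 3 powr \<alpha> * C * (1 + G \<xi>)"
proof -
  have "1 * (C * (1 + G \<xi>)) \<le> 3 powr \<alpha> * (C * (1 + G \<xi>))"
    using three_powr good'(2,6) by (intro mult_right_mono) auto
  then show ?thesis using good'(7)[of \<xi>] by (simp add: \<omega>_def mult.assoc)
qed

text \<open>On the cube |\<xi>| is at most three times the norm of the discretised point, where the
  growth bound of the symbol applies.\<close>

lemma \<omega>_le_d:
  assumes \<xi>: "\<xi> \<in> cube (pi / h)"
  shows "\<omega> \<xi> \<le> 3 powr \<alpha> * C * (1 + G0_disc G h \<xi>)"
proof -
  have "1 + norm \<xi> \<le> 3 * (1 + norm (disc_point h \<xi>))" using disc_point_bounds(1)[OF h(1) \<xi>] by simp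
  then have "\<omega> \<xi> \<le> (3 * (1 + norm (disc_point h \<xi>))) powr \<alpha>"
    unfolding \<omega>_def using good'(3,5) by (intro powr_mono2) auto
  also have "\<dots> = 3 powr \<alpha> * (1 + norm (disc_point h \<xi>)) powr \<alpha>" by (rule powr_mult)
  also have "\<dots> \<le> 3 powr \<alpha> * (C * (1 + G (disc_point h \<xi>)))" by (intro mult_left_mono good'(7)) auto
  finally show ?thesis by (simp add: G0_disc_eq mult.assoc)
qed

lemma weighted_c:
  assumes "q \<in> L2 lborel"
  shows "(\<lambda>\<xi>. of_real (\<omega> \<xi>) * fourier (c.R q) \<xi>) \<in> L2 lborel"
    "L2_norm lborel (\<lambda>\<xi>. of_real (\<omega> \<xi>) * fourier (c.R q) \<xi>) \<le> B * L2_norm lborel q"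
proof -
  have w: "\<omega> \<in> borel_measurable lborel" using borel_measurable_continuous_onI[OF \<omega>_continuous] by simp
  have c: "0 \<le> 3 powr \<alpha> * C" using good'(6) by simp
  have le: "0 \<le> \<omega> \<xi> \<and> \<omega> \<xi> \<le> 3 powr \<alpha> * C * (1 + G \<xi>)" for \<xi>
    using \<omega>_nonneg \<omega>_le_c by simp
  show "(\<lambda>\<xi>. of_real (\<omega> \<xi>) * fourier (c.R q) \<xi>) \<in> L2 lborel"
    "L2_norm lborel (\<lambda>\<xi>. of_real (\<omega> \<xi>) * fourier (c.R q) \<xi>) \<le> B * L2_norm lborel q"
    unfolding B_def by (rule c.R_weighted[OF assms mu w c le])+
qed

lemma weighted_d:
  assumes "q \<in> L2 (lattice h)"
  shows "(\<lambda>\<xi>. of_real (\<omega> \<xi>) * dft h (d.R q) \<xi>) \<in> L2 (torus h)"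
    "L2_norm (torus h) (\<lambda>\<xi>. of_real (\<omega> \<xi>) * dft h (d.R q) \<xi>) \<le> B * L2_norm (lattice h) q"
proof -
  have w: "\<omega> \<in> borel_measurable (torus h)" by (rule torus_measurable_real[OF \<omega>_continuous])
  have c: "0 \<le> 3 powr \<alpha> * C" using good'(6) by simp
  have le: "0 \<le> \<omega> \<xi> \<and> \<omega> \<xi> \<le> 3 powr \<alpha> * C * (1 + G0_disc G h \<xi>)" if \<xi>: "\<xi> \<in> space (torus h)" for \<xi>
  proof
    show "0 \<le> \<omega> \<xi>" by (rule \<omega>_nonneg)
    have "\<xi> \<in> cube (pi / h)" using \<xi> unfolding space_torus .
    then show "\<omega> \<xi> \<le> 3 powr \<alpha> * C * (1 + G0_disc G h \<xi>)" by (rule \<omega>_le_d)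
  qed
  have BB: "B = 3 powr \<alpha> * C * (2 + mu + m)" by (rule B_def)
  show "(\<lambda>\<xi>. of_real (\<omega> \<xi>) * dft h (d.R q) \<xi>) \<in> L2 (torus h)"
    by (rule d.R_weighted(1)[OF assms mu w c le])
  show "L2_norm (torus h) (\<lambda>\<xi>. of_real (\<omega> \<xi>) * dft h (d.R q) \<xi>) \<le> B * L2_norm (lattice h) q"
    unfolding BB
    by (rule d.R_weighted(2)[OF assms mu w c le])
qed

end

context discretisation
begin

lemma fourier_cell_split:
  fixes v :: "int ^ 'n \<Rightarrow> complex"
  assumes v: "v \<in> L2 (lattice h)"
  defines "X \<equiv> \<lambda>\<xi>. indicator (cube (pi / h)) \<xi> * (cell_factor (h *\<^sub>R \<xi>) * dft h v \<xi>)"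
    and "T \<equiv> \<lambda>\<xi>. indicator (- cube (pi / h)) \<xi> * fourier (J v) \<xi>"
  shows "X \<in> L2 lborel" "T \<in> L2 lborel" "fourier (J v) \<in> L2 lborel"
    "AE \<xi> in lborel. fourier (J v) \<xi> = (X + T) \<xi>"
    "L2_norm lborel (fourier (J v)) = L2_norm (lattice h) v"
proof -
  show F: "fourier (J v) \<in> L2 lborel" by (rule c.A_L2[OF cell_embed_L2[OF h(1) v]])
  show "X \<in> L2 lborel" unfolding X_def by (rule L2_cube_bounded(1)[OF dft_L2[OF h(1) v]])
  show "T \<in> L2 lborel" unfolding T_def
    by (rule L2_bounded_mult(1)[OF F, of _ 1]) (auto simp: indicator_def)
  show "AE \<xi> in lborel. fourier (J v) \<xi> = (X + T) \<xi>"
    using fourier_cell_embed[OF h(1) v] unfolding X_def T_def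
    by eventually_elim (auto simp: indicator_def split: if_splits)
  show "L2_norm lborel (fourier (J v)) = L2_norm (lattice h) v"
    using c.A_norm[OF cell_embed_L2[OF h(1) v]] cell_embed_norm[OF h(1), of v] by simp
qed

lemma tail_bound:
  fixes v :: "int ^ 'n \<Rightarrow> complex"
  assumes v: "v \<in> L2 (lattice h)" and y: "(\<lambda>\<xi>. of_real (\<omega> \<xi>) * dft h v \<xi>) \<in> L2 (torus h)"
    "L2_norm (torus h) (\<lambda>\<xi>. of_real (\<omega> \<xi>) * dft h v \<xi>) \<le> k"
  shows "L2_norm lborel (\<lambda>\<xi>. indicator (- cube (pi / h)) \<xi> * fourier (J v) \<xi>) \<le> D * h powr \<gamma> * k"
proof -
  have D0: "0 \<le> D * h powr \<gamma>" using D_ge_1 by simp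
  have "L2_norm lborel (\<lambda>\<xi>. indicator (- cube (pi / h)) \<xi> * fourier (J v) \<xi>)
      \<le> D * h powr \<gamma> * L2_norm (torus h) (\<lambda>\<xi>. of_real (\<omega> \<xi>) * dft h v \<xi>)"
    by (rule fourier_cell_embed_tail[OF h(1) v D0 cell_factor_defect y(1)])
  also have "\<dots> \<le> D * h powr \<gamma> * k" by (rule mult_left_mono[OF y(2) D0])
  finally show ?thesis .
qed

text \<open>On the cube the difference is governed by the error of the symbol. Off the cube the two
  terms have no counterparts, and each is small by itself, thanks to the regularity of one of its
  two factors.\<close>

lemma kinetic_estimate:
  assumes f: "f \<in> L2 lborel" and u: "u \<in> L2 (lattice h)"
  shows "\<bar>L2_ip lborel (c.R f) (J (d.kin (d.R u))) - L2_ip lborel (c.kin (c.R f)) (J (d.R u))\<bar>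
    \<le> (C * B\<^sup>2 + B * (1 + mu + m) + (1 + mu + m) * (D * B)) * h powr \<gamma> * (L2_norm lborel f * L2_norm (lattice h) u)"
proof -
  define w where "w = c.R f"
  define v where "v = d.R u"
  define a where "a = d.kin v"
  define p where "p = fourier w"
  define Gp where "Gp = (\<lambda>\<xi>::real ^ 'n. of_real (G \<xi>) * p \<xi>)"
  define \<omega>p where "\<omega>p = (\<lambda>\<xi>::real ^ 'n. of_real (\<omega> \<xi>) * p \<xi>)"
  define I where "I = (\<lambda>\<xi>::real ^ 'n. indicator (cube (pi / h)) \<xi> :: complex)"
  define X where "X = (\<lambda>\<xi>::real ^ 'n. I \<xi> * (cell_factor (h *\<^sub>R \<xi>) * dft h a \<xi>))"
  define X' where "X' = (\<lambda>\<xi>::real ^ 'n. I \<xi> * (cell_factor (h *\<^sub>R \<xi>) * dft h v \<xi>))"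
  define T where "T = (\<lambda>\<xi>::real ^ 'n. indicator (- cube (pi / h)) \<xi> * fourier (J a) \<xi>)"
  define T' where "T' = (\<lambda>\<xi>::real ^ 'n. indicator (- cube (pi / h)) \<xi> * fourier (J v) \<xi>)"
  define y where "y = (\<lambda>\<xi>::real ^ 'n. I \<xi> * (of_real (\<omega> \<xi>) * dft h v \<xi>))"
  let ?f = "L2_norm lborel f" and ?u = "L2_norm (lattice h) u" and ?t = "h powr \<gamma>" and ?K = "1 + mu + m"
  have v: "v \<in> L2 (lattice h)" and vd: "v \<in> d.opdom" unfolding v_def by (rule d.R_L2[OF u], rule d.R(1)[OF u])
  have w: "w \<in> L2 lborel" and wd: "w \<in> c.opdom" unfolding w_def by (rule c.R_L2[OF f], rule c.R(1)[OF f])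
  have a: "a \<in> L2 (lattice h)" unfolding a_def by (rule d.kin(1)[OF vd])
  have p: "p \<in> L2 lborel" unfolding p_def by (rule c.A_L2[OF w])
  have Gp: "Gp \<in> L2 lborel" unfolding Gp_def p_def by (rule c.domD(2)[OF wd])
  have \<omega>p: "\<omega>p \<in> L2 lborel" "L2_norm lborel \<omega>p \<le> B * ?f"
    unfolding \<omega>p_def p_def w_def by (rule weighted_c[OF f])+
  have y: "y \<in> L2 lborel" "L2_norm lborel y \<le> B * ?u"
    using weighted_d[OF u] unfolding y_def I_def v_def torus_L2_iff torus_norm by auto
  note sa = fourier_cell_split[OF a, folded X_def[unfolded I_def] T_def]
  note sv = fourier_cell_split[OF v, folded X'_def[unfolded I_def] T'_def]
  have nGp: "L2_norm lborel Gp \<le> ?K * ?f"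
    using c.R_norms(2)[OF f mu] c.kin_norm[OF wd] unfolding Gp_def p_def w_def by simp
  have na: "L2_norm (lattice h) a \<le> ?K * ?u"
    unfolding a_def v_def by (rule d.R_norms(2)[OF u mu])
  have nT': "L2_norm lborel T' \<le> D * ?t * (B * ?u)"
    unfolding T'_def v_def by (rule tail_bound[OF d.R_L2[OF u] weighted_d[OF u]])
  have e1: "L2_ip lborel w (J a) = L2_ip lborel p X + L2_ip lborel p T"
  proof -
    have "L2_ip lborel w (J a) = L2_ip lborel p (fourier (J a))"
      unfolding L2_ip_def p_def c.A_inner[OF w cell_embed_L2[OF h(1) a]] ..
    also have "\<dots> = L2_ip lborel p (X + T)"
      unfolding L2_ip_def
      by (intro arg_cong[where f=Re] L2_inner_cong_AE L2_measurable p sa(3,4) L2.S_closed(2)[OF sa(1,2)]) simp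
    also have "\<dots> = L2_ip lborel p X + L2_ip lborel p T" by (rule L2.ip_add_right[OF sa(1,2) p])
    finally show ?thesis .
  qed
  have e2: "L2_ip lborel (c.kin w) (J v) = L2_ip lborel Gp X' + L2_ip lborel Gp T'"
  proof -
    have "L2_ip lborel (c.kin w) (J v) = L2_ip lborel Gp (fourier (J v))"
      unfolding L2_ip_def Gp_def p_def c.kin(3)[OF wd cell_embed_L2[OF h(1) v]] ..
    also have "\<dots> = L2_ip lborel Gp (X' + T')"
      unfolding L2_ip_def
      by (intro arg_cong[where f=Re] L2_inner_cong_AE L2_measurable Gp sv(3,4) L2.S_closed(2)[OF sv(1,2)]) simp
    also have "\<dots> = L2_ip lborel Gp X' + L2_ip lborel Gp T'" by (rule L2.ip_add_right[OF sv(1,2) Gp])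
    finally show ?thesis .
  qed
  \<comment> \<open>Both integrands contain p, the cell factor and the transform of
    \<open>v\<close>; they differ by G_h - G, whose two weights go one to \<open>p\<close> and one
    to \<open>v\<close>.\<close>
  have b1: "\<bar>L2_ip lborel p X - L2_ip lborel Gp X'\<bar> \<le> C * ?t * (L2_norm lborel \<omega>p * L2_norm lborel y)"
  proof (rule L2_ip_diff_le[OF p sa(1) Gp sv(1) \<omega>p(1) y(1)])
    show "0 \<le> C * ?t" using good'(6) by simp
    have "AE \<xi> in lborel. \<xi> \<in> cube (pi / h) \<longrightarrow> dft h a \<xi> = of_real (G0_disc G h \<xi>) * dft h v \<xi>"
      using d.kin(2)[OF vd] unfolding a_def torus_AE_iff .
    then show "AE \<xi> in lborel. cmod (cnj (p \<xi>) * X \<xi> - cnj (Gp \<xi>) * X' \<xi>) \<le> C * ?t * (cmod (\<omega>p \<xi>) * cmod (y \<xi>))"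
    proof eventually_elim
      case (elim \<xi>)
      show ?case
      proof (cases "\<xi> \<in> cube (pi / h)")
        case False
        then show ?thesis by (simp add: X_def X'_def y_def I_def)
      next
        case True
        have "cnj (p \<xi>) * X \<xi> - cnj (Gp \<xi>) * X' \<xi> =
            cnj (p \<xi>) * (cell_factor (h *\<^sub>R \<xi>) * (of_real (G0_disc G h \<xi> - G \<xi>) * dft h v \<xi>))"
          using True elim by (simp add: X_def X'_def Gp_def I_def algebra_simps)
        then have "cmod (cnj (p \<xi>) * X \<xi> - cnj (Gp \<xi>) * X' \<xi>)
            = cmod (p \<xi>) * (cmod (cell_factor (h *\<^sub>R \<xi>)) * (\<bar>G0_disc G h \<xi> - G \<xi>\<bar> * cmod (dft h v \<xi>)))"
          by (simp only: norm_mult norm_of_real complex_mod_cnj)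
        also have "\<dots> \<le> cmod (p \<xi>) * (1 * (\<bar>G0_disc G h \<xi> - G \<xi>\<bar> * cmod (dft h v \<xi>)))"
          by (intro mult_left_mono mult_right_mono cell_factor_le_1) auto
        also have "\<dots> \<le> cmod (p \<xi>) * (1 * ((C * ?t * (\<omega> \<xi> * \<omega> \<xi>)) * cmod (dft h v \<xi>)))"
        proof -
          have "(1 + norm \<xi>) powr (2 * \<alpha>) = \<omega> \<xi> * \<omega> \<xi>" unfolding \<omega>_def by (simp add: powr_add[symmetric])
          then have "\<bar>G0_disc G h \<xi> - G \<xi>\<bar> \<le> C * ?t * (\<omega> \<xi> * \<omega> \<xi>)"
            using good'(8)[OF True] by (simp add: abs_minus_commute)
          then show ?thesis by (intro mult_left_mono mult_right_mono) auto
        qed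
        also have "\<dots> = C * ?t * (cmod (\<omega>p \<xi>) * cmod (y \<xi>))"
          using True \<omega>_nonneg[of \<xi>] by (simp add: \<omega>p_def y_def I_def norm_mult mult_ac)
        finally show ?thesis .
      qed
    qed
  qed
  \<comment> \<open>\<open>a\<close> is a kinetic part and has no weight to spare, so the smallness
    comes from \<open>p\<close>: off the cube 1 <= h^\<gamma> \<omega>.\<close>
  have b2: "\<bar>L2_ip lborel p T\<bar> \<le> ?t * (L2_norm lborel \<omega>p * L2_norm lborel (fourier (J a)))"
  proof (rule L2_ip_le[OF p sa(2) \<omega>p(1) sa(3)])
    show "AE \<xi> in lborel. cmod (p \<xi>) * cmod (T \<xi>) \<le> ?t * (cmod (\<omega>p \<xi>) * cmod (fourier (J a) \<xi>))"
    proof (rule AE_I2)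
      fix \<xi> :: "real ^ 'n"
      show "cmod (p \<xi>) * cmod (T \<xi>) \<le> ?t * (cmod (\<omega>p \<xi>) * cmod (fourier (J a) \<xi>))"
      proof (cases "\<xi> \<in> cube (pi / h)")
        case True
        then show ?thesis by (simp add: T_def)
      next
        case False
        have "1 * (cmod (p \<xi>) * cmod (fourier (J a) \<xi>)) \<le> (?t * \<omega> \<xi>) * (cmod (p \<xi>) * cmod (fourier (J a) \<xi>))"
          by (intro mult_right_mono outside_cube False) auto
        then show ?thesis using False \<omega>_nonneg[of \<xi>] by (simp add: T_def \<omega>p_def norm_mult mult_ac)
      qed
    qed
  qed simp
  \<comment> \<open>Roles exchanged: \<open>Gp\<close> has consumed the regularity of
    \<open>w\<close>, and the tail of \<open>J v\<close> is small because \<open>v\<close> has a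
    weighted bound.\<close>
  have b3: "\<bar>L2_ip lborel Gp T'\<bar> \<le> L2_norm lborel Gp * L2_norm lborel T'"
    by (rule L2.Cauchy_Schwarz[OF Gp sv(2)])
  note bs = B_nonneg good'(6) D_ge_1 m_nonneg mu
  have "L2_norm lborel \<omega>p * L2_norm lborel y \<le> (B * ?f) * (B * ?u)"
    using bs by (intro mult_mono \<omega>p(2) y(2)) auto
  then have c1: "C * ?t * (L2_norm lborel \<omega>p * L2_norm lborel y) \<le> C * ?t * ((B * ?f) * (B * ?u))"
    using bs by (intro mult_left_mono) auto
  have "L2_norm lborel \<omega>p * L2_norm lborel (fourier (J a)) \<le> (B * ?f) * (?K * ?u)"
    unfolding sa(5) using bs by (intro mult_mono \<omega>p(2) na) auto
  then have c2: "?t * (L2_norm lborel \<omega>p * L2_norm lborel (fourier (J a))) \<le> ?t * ((B * ?f) * (?K * ?u))"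
    by (intro mult_left_mono) auto
  have c3: "L2_norm lborel Gp * L2_norm lborel T' \<le> (?K * ?f) * (D * ?t * (B * ?u))"
    using bs by (intro mult_mono nGp nT') auto
  have "(C * B\<^sup>2 + B * ?K + ?K * (D * B)) * ?t * (?f * ?u)
      = C * ?t * ((B * ?f) * (B * ?u)) + ?t * ((B * ?f) * (?K * ?u)) + (?K * ?f) * (D * ?t * (B * ?u))"
    by (simp add: algebra_simps power2_eq_square)
  then show ?thesis
    using b1 b2 b3 c1 c2 c3 e1 e2 unfolding w_def[symmetric] v_def[symmetric] a_def[symmetric] by linarith
qed

text \<open>\<open>J\<close> turns the sampled potential into \<open>V\<close> evaluated at the
  centre of the cell of x, which lies within D h of x.\<close>

lemma potential_estimate:
  assumes w: "w \<in> L2 lborel" and v: "v \<in> L2 (lattice h)"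
  shows "\<bar>L2_ip lborel w (J (\<lambda>k. of_real (V (h *\<^sub>R zvec k)) * v k)) - L2_ip lborel (\<lambda>x. of_real (V x) * w x) (J v)\<bar>
    \<le> L * D * h powr \<gamma> * (L2_norm lborel w * L2_norm (lattice h) v)"
proof -
  have Jv: "J v \<in> L2 lborel" by (rule cell_embed_L2[OF h(1) v])
  have "\<bar>L2_ip lborel w (J (\<lambda>k. of_real (V (h *\<^sub>R zvec k)) * v k)) - L2_ip lborel (\<lambda>x. of_real (V x) * w x) (J v)\<bar>
    \<le> (L * D * h powr \<gamma>) * (L2_norm lborel w * L2_norm lborel (J v))"
  proof (rule L2_ip_diff_le[OF w cell_embed_L2[OF h(1) d.W_L2(1)[OF v]] c.W_L2(1)[OF w] Jv w Jv])
    show "0 \<le> L * D * h powr \<gamma>" using L D_ge_1 by simp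
    show "AE x in lborel. cmod (cnj (w x) * J (\<lambda>k. of_real (V (h *\<^sub>R zvec k)) * v k) x - cnj (of_real (V x) * w x) * J v x)
       \<le> L * D * h powr \<gamma> * (cmod (w x) * cmod (J v x))"
    proof (rule AE_I2)
      fix x :: "real ^ 'n"
      let ?x = "h *\<^sub>R zvec (cell_index h x)"
      have "cnj (w x) * J (\<lambda>k. of_real (V (h *\<^sub>R zvec k)) * v k) x - cnj (of_real (V x) * w x) * J v x
          = of_real (V ?x - V x) * (cnj (w x) * J v x)"
        by (simp add: cell_embed_def algebra_simps)
      then have "cmod (cnj (w x) * J (\<lambda>k. of_real (V (h *\<^sub>R zvec k)) * v k) x - cnj (of_real (V x) * w x) * J v x)
          = \<bar>V ?x - V x\<bar> * (cmod (w x) * cmod (J v x))"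
        by (simp only: norm_mult norm_of_real complex_mod_cnj)
      also have "\<dots> \<le> L * D * h powr \<gamma> * (cmod (w x) * cmod (J v x))"
      proof (rule mult_right_mono)
        have "dist ?x x powr \<theta> \<le> (D * h) powr \<theta>"
          using cell_index_near[OF h(1), of x] good'(3) \<theta>(1) by (intro powr_mono2) (auto simp: dist_commute D)
        also have "\<dots> = D powr \<theta> * h powr \<theta>" by (rule powr_mult)
        \<comment> \<open>Here D >= 1 and \<theta> <= 1 are used for \<open>D\<close>, and h <= 1
          and \<gamma> <= \<theta> for \<open>h\<close>.\<close>
        also have "\<dots> \<le> D powr 1 * h powr \<gamma>"
          using D_ge_1 h \<theta> by (intro mult_mono powr_mono powr_mono') auto
        finally have "dist ?x x powr \<theta> \<le> D * h powr \<gamma>" using D_ge_1 by simp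
        then have "L * dist ?x x powr \<theta> \<le> L * (D * h powr \<gamma>)" using L by (rule mult_left_mono)
        then show "\<bar>V ?x - V x\<bar> \<le> L * D * h powr \<gamma>" using V_hoelder[of ?x x] by simp
      qed simp
      finally show "cmod (cnj (w x) * J (\<lambda>k. of_real (V (h *\<^sub>R zvec k)) * v k) x - cnj (of_real (V x) * w x) * J v x)
         \<le> L * D * h powr \<gamma> * (cmod (w x) * cmod (J v x))" .
    qed
  qed
  then show ?thesis using cell_embed_norm[OF h(1), of v] by simp
qed

text \<open>Write J u as J (H_h + mu) v and f as (H + mu) w, and move the resolvent of H to the
  other side. The terms with mu cancel; what remains is the kinetic and the potential
  difference.\<close>

lemma resolvent_estimate:
  assumes f: "f \<in> L2 lborel" and u: "u \<in> L2 (lattice h)"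
  shows "\<bar>L2_ip lborel f (c.R (J u) - J (d.R u))\<bar> \<le> cc * h powr \<gamma> * (L2_norm lborel f * L2_norm (lattice h) u)"
proof -
  define w where "w = c.R f"
  define v where "v = d.R u"
  let ?Vv = "\<lambda>k. of_real (V (h *\<^sub>R zvec k)) * v k" and ?Vw = "\<lambda>x. of_real (V x) * w x"
  let ?f = "L2_norm lborel f" and ?u = "L2_norm (lattice h) u" and ?t = "h powr \<gamma>"
  have v: "v \<in> L2 (lattice h)" and vd: "v \<in> d.opdom" unfolding v_def by (rule d.R_L2[OF u], rule d.R(1)[OF u])
  have w: "w \<in> L2 lborel" and wd: "w \<in> c.opdom" unfolding w_def by (rule c.R_L2[OF f], rule c.R(1)[OF f])
  have Ju: "J u \<in> L2 lborel" and Jv: "J v \<in> L2 lborel" by (rule cell_embed_L2[OF h(1)], fact)+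
  have Ja: "J (d.kin v) \<in> L2 lborel" and JV: "J ?Vv \<in> L2 lborel"
    by (rule cell_embed_L2[OF h(1)] d.kin(1)[OF vd] d.W_L2(1)[OF v])+
  have eq: "J u = J (d.kin v) + J ?Vv + mu *\<^sub>R J v"
  proof
    fix x
    have "AE k in lattice h. d.op v k + of_real mu * v k = u k" unfolding v_def by (rule d.R(2)[OF u])
    then have "u k = d.op v k + of_real mu * v k" for k unfolding lattice_AE_iff[OF h(1)] by simp
    from this[of "cell_index h x"] fun_cong[OF d.op_eq[of v], of "cell_index h x"]
    show "J u x = (J (d.kin v) + J ?Vv + mu *\<^sub>R J v) x"
      unfolding cell_embed_def plus_fun_def scaleR_fun_def by (simp only: scaleR_conv_of_real)
  qed
  have "L2_ip lborel f (c.R (J u)) = L2_ip lborel w (J u)"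
    using c.R_symmetric_bounded f Ju unfolding L2.symmetric_bounded_def w_def by simp
  also have "\<dots> = L2_ip lborel w (J (d.kin v)) + L2_ip lborel w (J ?Vv) + mu * L2_ip lborel w (J v)"
    unfolding eq using w Ja JV Jv by (simp only: L2.S_closed L2.ip_simps)
  finally have 1: "L2_ip lborel f (c.R (J u)) = \<dots>" .
  have "L2_ip lborel f (J v) = L2_ip lborel (c.op w) (J v) + mu * L2_ip lborel w (J v)"
    unfolding w_def by (rule c.R_ip[OF f Jv])
  also have "L2_ip lborel (c.op w) (J v) = L2_ip lborel (c.kin w) (J v) + L2_ip lborel ?Vw (J v)"
    unfolding c.op_eq by (rule L2.ip_add_left[OF c.kin(1)[OF wd] c.W_L2(1)[OF w] Jv])
  finally have 2: "L2_ip lborel f (J v) = L2_ip lborel (c.kin w) (J v) + L2_ip lborel ?Vw (J v) + mu * L2_ip lborel w (J v)" .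
  have 3: "L2_ip lborel f (c.R (J u) - J v) = L2_ip lborel f (c.R (J u)) - L2_ip lborel f (J v)"
    by (rule L2.ip_diff_right[OF c.R_L2[OF Ju] Jv f])
  have "L2_norm lborel w * L2_norm (lattice h) v \<le> ?f * ?u"
    unfolding w_def v_def by (intro mult_mono c.R_norms(1) d.R_norms(1) f u mu) auto
  then have 4: "L * D * ?t * (L2_norm lborel w * L2_norm (lattice h) v) \<le> L * D * ?t * (?f * ?u)"
    using L D_ge_1 by (intro mult_left_mono) auto
  \<comment> \<open>This summand of \<open>cc\<close> is reserved for
    \<open>regular_near_cell\<close>; here only its sign matters.\<close>
  have "0 \<le> (3 * D + 1) * B * ?t * (?f * ?u)" using D_ge_1 B_nonneg by simp
  moreover have "cc * ?t * (?f * ?u) = (C * B\<^sup>2 + B * (1 + mu + m) + (1 + mu + m) * (D * B)) * ?t * (?f * ?u)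
      + L * D * ?t * (?f * ?u) + (3 * D + 1) * B * ?t * (?f * ?u)"
    unfolding cc_def by (simp add: distrib_right)
  ultimately show ?thesis
    using 1 2 3 4 kinetic_estimate[OF f u, folded w_def v_def] potential_estimate[OF w v]
    unfolding v_def[symmetric] by linarith
qed

lemma cc_pos: "0 < cc"
proof -
  have "0 < B" unfolding B_def using good'(6) mu m_nonneg by simp
  then have "0 < (3 * D + 1) * B" using D_ge_1 by simp
  moreover have "0 \<le> C * B\<^sup>2 + B * (1 + mu + m) + (1 + mu + m) * (D * B) + L * D"
    using good'(6) B_nonneg m_nonneg mu D_ge_1 L by simp
  ultimately show ?thesis unfolding cc_def by linarith
qed

lemma R_cell_near:
  assumes u: "u \<in> L2 (lattice h)"
  shows "L2_norm lborel (c.R (J u) - J (d.R u)) \<le> cc * h powr \<gamma> * L2_norm (lattice h) u"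
proof (rule L2.nrm_le_dual)
  show S: "c.R (J u) - J (d.R u) \<in> L2 lborel"
    by (intro L2.S_closed c.R_L2 cell_embed_L2[OF h(1)] d.R_L2 u)
  show "0 \<le> cc * h powr \<gamma> * L2_norm (lattice h) u"
    using cc_pos by simp
  fix f :: "real ^ 'n \<Rightarrow> complex" assume "f \<in> L2 lborel"
  from resolvent_estimate[OF this u]
  show "L2_ip lborel f (c.R (J u) - J (d.R u)) \<le> cc * h powr \<gamma> * L2_norm (lattice h) u * L2_norm lborel f"
    by (simp add: mult_ac)
qed

text \<open>Replacing the Fourier transform by its restriction to the cube approximates the range of \<open>c.R\<close> by cell functions.\<close>

lemma regular_near_cell:
  assumes q: "q \<in> L2 lborel"
  shows "\<exists>v\<in>L2 (lattice h). L2_norm lborel (c.R q - J v) \<le> cc * h powr \<gamma> * L2_norm lborel q"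
proof -
  define p where "p = fourier (c.R q)"
  let ?t = "h powr \<gamma>" and ?q = "L2_norm lborel q"
  have Rq: "c.R q \<in> L2 lborel" by (rule c.R_L2[OF q])
  have p: "p \<in> L2 lborel" unfolding p_def by (rule c.A_L2[OF Rq])
  define \<omega>p where "\<omega>p = (\<lambda>\<xi>::real ^ 'n. of_real (\<omega> \<xi>) * p \<xi>)"
  have \<omega>p: "\<omega>p \<in> L2 lborel" "L2_norm lborel \<omega>p \<le> B * ?q"
    unfolding \<omega>p_def p_def by (rule weighted_c[OF q])+
  obtain v where v: "v \<in> L2 (lattice h)" "AE \<xi> in torus h. dft h v \<xi> = p \<xi>"
    using d.A_surj[OF L2_lborel_torus[OF p]] by blast
  note dv = dft_L2[OF h(1) v(1)]
  have ae: "AE \<xi> in torus h. of_real (\<omega> \<xi>) * dft h v \<xi> = \<omega>p \<xi>"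
    using v(2) by eventually_elim (simp add: \<omega>p_def)
  have mw: "(\<lambda>\<xi>. of_real (\<omega> \<xi>) * dft h v \<xi>) \<in> borel_measurable (torus h)"
    using torus_measurable_real[OF \<omega>_continuous, of h] L2_measurable[OF dv] by measurable
  have wt: "\<omega>p \<in> L2 (torus h)" by (rule L2_lborel_torus[OF \<omega>p(1)])
  have y: "(\<lambda>\<xi>. of_real (\<omega> \<xi>) * dft h v \<xi>) \<in> L2 (torus h)"
    by (rule L2_cong_AE[OF wt mw]) (use ae in \<open>eventually_elim, simp\<close>)
  have "L2_norm (torus h) (\<lambda>\<xi>. of_real (\<omega> \<xi>) * dft h v \<xi>) = L2_norm (torus h) \<omega>p"
    by (rule L2_norm_cong_AE[OF mw L2_measurable[OF wt] ae])
  also have "\<dots> \<le> L2_norm lborel \<omega>p" unfolding torus_norm by (rule L2_cube(2)[OF \<omega>p(1)])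
  finally have yn: "L2_norm (torus h) (\<lambda>\<xi>. of_real (\<omega> \<xi>) * dft h v \<xi>) \<le> B * ?q" using \<omega>p(2) by linarith
  define X where "X = (\<lambda>\<xi>::real ^ 'n. indicator (cube (pi / h)) \<xi> * (cell_factor (h *\<^sub>R \<xi>) * dft h v \<xi>))"
  define T where "T = (\<lambda>\<xi>::real ^ 'n. indicator (- cube (pi / h)) \<xi> * fourier (J v) \<xi>)"
  note sv = fourier_cell_split[OF v(1), folded X_def T_def]
  have Jv: "J v \<in> L2 lborel" by (rule cell_embed_L2[OF h(1) v(1)])
  have "L2_norm lborel (c.R q - J v) = L2_norm lborel (p - fourier (J v))"
  proof -
    have "(L2_norm lborel (c.R q - J v))\<^sup>2 = (L2_norm lborel (p - fourier (J v)))\<^sup>2"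
      using Rq Jv p sv(3) c.A_inner[OF Rq Rq] c.A_inner[OF Rq Jv] c.A_inner[OF Jv Rq] c.A_inner[OF Jv Jv]
      by (simp only: L2.nrm_sq L2.S_closed L2.ip_simps) (simp add: L2_ip_def p_def)
    then show ?thesis by (simp add: power2_eq_iff_nonneg)
  qed
  also have "\<dots> = L2_norm lborel ((p - X) - T)"
  proof (rule L2_norm_cong_AE)
    show "AE \<xi> in lborel. (p - fourier (J v)) \<xi> = (p - X - T) \<xi>"
      using sv(4) by eventually_elim simp
  qed (intro L2_measurable L2.S_closed p sv)+
  also have "\<dots> \<le> L2_norm lborel (p - X) + L2_norm lborel T"
    by (intro L2.nrm_diff_le L2.S_closed p sv)
  also have "L2_norm lborel T \<le> D * ?t * (B * ?q)" unfolding T_def by (rule tail_bound[OF v(1) y yn])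
  \<comment> \<open>On the cube p - X is (1 - cell factor) p, which costs 2 D h^\<gamma> \<omega>.
    Off the cube X vanishes and h^\<gamma> \<omega> >= 1 absorbs p. The constant 2 D + 1 covers
    both.\<close>
  also have "L2_norm lborel (p - X) \<le> (2 * D + 1) * ?t * L2_norm lborel \<omega>p"
  proof (rule L2_dominated(2)[OF \<omega>p(1)])
    show "p - X \<in> borel_measurable lborel" by (intro L2_measurable L2.S_closed p sv)
    show "0 \<le> (2 * D + 1) * ?t" using D_ge_1 by simp
    show "AE \<xi> in lborel. cmod ((p - X) \<xi>) \<le> (2 * D + 1) * ?t * cmod (\<omega>p \<xi>)"
      using v(2)[unfolded torus_AE_iff]
    proof eventually_elim
      case (elim \<xi>)
      have n: "cmod (\<omega>p \<xi>) = \<omega> \<xi> * cmod (p \<xi>)" using \<omega>_nonneg[of \<xi>] by (simp add: \<omega>p_def norm_mult)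
      have le: "cmod ((p - X) \<xi>) \<le> ((2 * D + 1) * (?t * \<omega> \<xi>)) * cmod (p \<xi>)"
      proof (cases "\<xi> \<in> cube (pi / h)")
        case True
        then have "(p - X) \<xi> = (1 - cell_factor (h *\<^sub>R \<xi>)) * p \<xi>" using elim by (simp add: X_def algebra_simps)
        then have "cmod ((p - X) \<xi>) = cmod (1 - cell_factor (h *\<^sub>R \<xi>)) * cmod (p \<xi>)" by (simp add: norm_mult)
        also have "\<dots> \<le> (2 * D * ?t * \<omega> \<xi>) * cmod (p \<xi>)" by (intro mult_right_mono cell_factor_near) auto
        also have "\<dots> \<le> ((2 * D + 1) * (?t * \<omega> \<xi>)) * cmod (p \<xi>)"
          using \<omega>_nonneg[of \<xi>] by (intro mult_right_mono) (auto simp: algebra_simps)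
        finally show ?thesis .
      next
        case False
        have "1 * 1 \<le> (2 * D + 1) * (?t * \<omega> \<xi>)" using D_ge_1 by (intro mult_mono outside_cube False) auto
        from mult_right_mono[OF this, of "cmod (p \<xi>)"] show ?thesis using False by (simp add: X_def)
      qed
      show ?case using le unfolding n by (simp only: mult.assoc)
    qed
  qed
  also have "(2 * D + 1) * ?t * L2_norm lborel \<omega>p \<le> (2 * D + 1) * ?t * (B * ?q)"
    using D_ge_1 by (intro mult_left_mono \<omega>p(2)) auto
  finally have "L2_norm lborel (c.R q - J v) \<le> (2 * D + 1) * ?t * (B * ?q) + D * ?t * (B * ?q)" by simp
  also have "\<dots> = (3 * D + 1) * B * (?t * ?q)" by (simp add: algebra_simps)
  also have "\<dots> \<le> cc * (?t * ?q)"
    unfolding cc_def using good'(6) B_nonneg m_nonneg mu D_ge_1 L by (intro mult_right_mono) auto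
  finally show ?thesis using v(1) by (intro bexI[of _ v]) (simp_all only: mult.assoc)
qed

text \<open>\<open>J\<close> is isometric, so \<open>J u\<close> is an approximate eigenvector with
  error 2 e: one e from \<open>u\<close>, one from \<open>R_cell_near\<close>. The smallness
  assumption supplies the condition r <= k / 2 of \<open>spectrum_near\<close>, and 1 / k = l + mu
  yields the square.\<close>

lemma spectrum_d_to_c:
  assumes l: "- mu < l" "complex_of_real l \<notin> resolvent_Hh G V h" and small: "8 * (cc * h powr \<gamma>) * (l + mu) \<le> 1"
  shows "\<exists>l'. complex_of_real l' \<notin> resolvent_H G V \<and> \<bar>l' - l\<bar> \<le> 8 * (cc * h powr \<gamma>) * (l + mu)\<^sup>2"
proof -
  define e where "e = cc * h powr \<gamma>"
  define k where "k = 1 / (l + mu)"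
  have e: "e > 0" using cc_pos h by (simp add: e_def)
  have k: "k > 0" "1 / k = l + mu" using l by (auto simp: k_def)
  have ek: "8 * e \<le> k" using small l unfolding e_def k_def by (simp add: pos_le_divide_eq)
  obtain u where u: "u \<in> L2 (lattice h)" "0 < L2_norm (lattice h) u"
      "L2_norm (lattice h) (d.R u - k *\<^sub>R u) \<le> e * L2_norm (lattice h) u"
    using d.spectrum_imp_approx[unfolded opdom_d op_d, OF l] e unfolding L2.approx_eigenvalue_def k_def by blast
  have Ju: "J u \<in> L2 lborel" by (rule cell_embed_L2[OF h(1) u(1)])
  have nJ: "L2_norm lborel (J u) = L2_norm (lattice h) u" by (rule cell_embed_norm[OF h(1)])
  have JR: "J (d.R u) \<in> L2 lborel" by (rule cell_embed_L2[OF h(1) d.R_L2[OF u(1)]])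
  have "L2_norm lborel (c.R (J u) - k *\<^sub>R J u) \<le> L2_norm lborel (c.R (J u) - J (d.R u)) + L2_norm lborel (J (d.R u) - k *\<^sub>R J u)"
    by (rule L2.nrm_triangle_diff[OF c.R_L2[OF Ju] JR L2.S_closed(4)[OF Ju]])
  also have "J (d.R u) - k *\<^sub>R J u = J (d.R u - k *\<^sub>R u)" by (simp add: cell_embed_def fun_eq_iff)
  also have "L2_norm lborel (J (d.R u - k *\<^sub>R u)) = L2_norm (lattice h) (d.R u - k *\<^sub>R u)" by (rule cell_embed_norm[OF h(1)])
  finally have "L2_norm lborel (c.R (J u) - k *\<^sub>R J u) \<le> (2 * e) * L2_norm lborel (J u)"
    using u(3) R_cell_near[OF u(1), folded e_def] unfolding nJ by linarith
  moreover have "0 < L2_norm lborel (J u)" "2 * e \<le> k / 2" using u(2) nJ ek k by auto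
  ultimately obtain l' where l': "complex_of_real l' \<notin> resolvent_H G V" "\<bar>l' - (1 / k - mu)\<bar> \<le> 2 * (2 * e) / k\<^sup>2"
    using c.spectrum_near[unfolded opdom_c op_c, OF Ju _ k(1)] by blast
  have "2 * (2 * e) / k\<^sup>2 = 4 * e * (l + mu)\<^sup>2" unfolding k(2)[symmetric] by (simp add: power_one_over)
  also have "\<dots> \<le> 8 * e * (l + mu)\<^sup>2" using e by (intro mult_right_mono) auto
  finally show ?thesis using l' unfolding k(2) e_def by (intro exI[of _ l']) auto
qed

text \<open>The approximate eigenvector is \<open>z\<close>, the image of \<open>x\<close> under the
  adjoint of \<open>J\<close>. The loss |x| <= 2 |z| doubles the error 2 e, and
  \<open>spectrum_near\<close> doubles it again, whence the factor 8.\<close>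

lemma spectrum_c_to_d:
  assumes l: "- mu < l" "complex_of_real l \<notin> resolvent_H G V" and small: "8 * (cc * h powr \<gamma>) * (l + mu) \<le> 1"
  shows "\<exists>l'. complex_of_real l' \<notin> resolvent_Hh G V h \<and> \<bar>l' - l\<bar> \<le> 8 * (cc * h powr \<gamma>) * (l + mu)\<^sup>2"
proof -
  define e where "e = cc * h powr \<gamma>"
  define k where "k = 1 / (l + mu)"
  have e: "e > 0" using cc_pos h by (simp add: e_def)
  have k: "k > 0" "1 / k = l + mu" using l by (auto simp: k_def)
  have ek: "8 * e \<le> k" using small l unfolding e_def k_def by (simp add: pos_le_divide_eq)
  obtain x where x: "x \<in> L2 lborel" "0 < L2_norm lborel x" "L2_norm lborel (c.R x - k *\<^sub>R x) \<le> e * L2_norm lborel x"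
    using c.spectrum_imp_approx[unfolded opdom_c op_c, OF l] e unfolding L2.approx_eigenvalue_def k_def by blast
  let ?n = "L2_norm lborel x"
  note Rx = c.R_L2[OF x(1)]
  obtain v where v: "v \<in> L2 (lattice h)" "L2_norm lborel (c.R x - J v) \<le> e * ?n"
    using regular_near_cell[OF x(1)] unfolding e_def by blast
  obtain z where z: "z \<in> L2 (lattice h)" "\<And>u. u \<in> L2 (lattice h) \<Longrightarrow> L2_inner lborel (J u) x = L2_inner (lattice h) u z"
    using L2_adjoint_exists[of "lattice h" J lborel x] cell_embed_L2[OF h(1)] cell_embed_inner[OF h(1)] x(1) by blast
  have zip: "L2_ip lborel (J u) x = L2_ip (lattice h) u z" if "u \<in> L2 (lattice h)" for u
    unfolding L2_ip_def z(2)[OF that] ..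
  have Jz: "J z \<in> L2 lborel" and Jv: "J v \<in> L2 lborel" using cell_embed_L2[OF h(1)] z(1) v(1) by auto
  \<comment> \<open>k x is within (k/4) |x| of the cell function \<open>J v\<close>. Hence <J v, x>
    is close to k |x|^2, but it equals <v, z>, so \<open>z\<close> cannot be small.\<close>
  have zn: "?n \<le> 2 * L2_norm (lattice h) z"
  proof -
    let ?z = "L2_norm (lattice h) z"
    have kx: "k *\<^sub>R x \<in> L2 lborel" by (rule L2.S_closed(4)[OF x(1)])
    have d: "k *\<^sub>R x - J v \<in> L2 lborel" by (rule L2.S_closed(3)[OF kx Jv])
    have "L2_norm lborel (k *\<^sub>R x - J v) \<le> L2_norm lborel (k *\<^sub>R x - c.R x) + L2_norm lborel (c.R x - J v)"
      by (rule L2.nrm_triangle_diff[OF kx Rx Jv])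
    also have "L2_norm lborel (k *\<^sub>R x - c.R x) = L2_norm lborel (c.R x - k *\<^sub>R x)" by (rule L2.nrm_commute[OF kx Rx])
    also have "\<dots> + L2_norm lborel (c.R x - J v) \<le> e * ?n + e * ?n" by (rule add_mono[OF x(3) v(2)])
    also have "\<dots> = (2 * e) * ?n" by simp
    also have "\<dots> \<le> (k / 4) * ?n" using ek by (intro mult_right_mono) auto
    finally have 1: "L2_norm lborel (k *\<^sub>R x - J v) \<le> (k / 4) * ?n" .
    have "L2_norm (lattice h) v \<le> L2_norm lborel (k *\<^sub>R x) + L2_norm lborel (J v - k *\<^sub>R x)"
      using L2.nrm_triangle_le[OF Jv kx] cell_embed_norm[OF h(1), of v] by simp
    also have "L2_norm lborel (J v - k *\<^sub>R x) = L2_norm lborel (k *\<^sub>R x - J v)" by (rule L2.nrm_commute[OF Jv kx])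
    also have "L2_norm lborel (k *\<^sub>R x) = k * ?n" using L2.nrm_scale[OF x(1), of k] k by simp
    finally have 2: "L2_norm (lattice h) v \<le> (5 * k / 4) * ?n" using 1 by linarith
    have "k * (?n * ?n) = L2_ip lborel (J v) x + L2_ip lborel (k *\<^sub>R x - J v) x"
      using L2.nrm_sq[OF x(1)] L2.ip_diff_left[OF kx Jv x(1)] L2.ip_scale_left[OF x(1) x(1), of k]
      by (simp add: power2_eq_square)
    also have "L2_ip lborel (J v) x \<le> L2_norm (lattice h) v * ?z"
      using L2.Cauchy_Schwarz[OF v(1) z(1)] zip[OF v(1)] by linarith
    also have "\<dots> \<le> (5 * k / 4) * ?n * ?z" by (rule mult_right_mono[OF 2]) simp
    also have "L2_ip lborel (k *\<^sub>R x - J v) x \<le> L2_norm lborel (k *\<^sub>R x - J v) * ?n"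
      using L2.Cauchy_Schwarz[OF d x(1)] by linarith
    also have "\<dots> \<le> (k / 4) * ?n * ?n" by (rule mult_right_mono[OF 1]) simp
    finally have "(k * ?n) * ?n \<le> (k * ?n) * (5 / 4 * ?z + 1 / 4 * ?n)" by (simp add: algebra_simps)
    then have "?n \<le> 5 / 4 * ?z + 1 / 4 * ?n" using x(2) k(1) by simp
    then show ?thesis using L2_norm_nonneg[of "lattice h" z] by linarith
  qed
  \<comment> \<open>Testing with \<open>u\<close> moves the lattice resolvent and the adjoint of
    \<open>J\<close> onto \<open>u\<close>. There remain the error of \<open>x\<close> and the
    difference of the resolvents, each contributing e.\<close>
  have Rz: "L2_norm (lattice h) (d.R z - k *\<^sub>R z) \<le> 2 * e * ?n"
  proof (rule L2.nrm_le_dual)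
    show "d.R z - k *\<^sub>R z \<in> L2 (lattice h)" by (intro L2.S_closed d.R_L2 z(1))
    show "0 \<le> 2 * e * ?n" using e by simp
    fix u :: "int ^ 'n \<Rightarrow> complex" assume u: "u \<in> L2 (lattice h)"
    have Ru: "d.R u \<in> L2 (lattice h)" by (rule d.R_L2[OF u])
    have Ju: "J u \<in> L2 lborel" and JR: "J (d.R u) \<in> L2 lborel" using cell_embed_L2[OF h(1)] u Ru by auto
    have "L2_ip (lattice h) u (d.R z - k *\<^sub>R z) = L2_ip (lattice h) (d.R u) z - k * L2_ip (lattice h) u z"
      using u z(1) d.R_L2[OF z(1)] d.R_symmetric_bounded unfolding L2.symmetric_bounded_def
      by (simp only: L2.ip_simps L2.S_closed)
    also have "\<dots> = L2_ip lborel (J (d.R u)) x - k * L2_ip lborel (J u) x" by (simp only: zip u Ru)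
    also have "\<dots> = L2_ip lborel (J u) (c.R x - k *\<^sub>R x) - L2_ip lborel (c.R (J u) - J (d.R u)) x"
      using x(1) Rx Ju JR c.R_L2[OF Ju] c.R_symmetric_bounded unfolding L2.symmetric_bounded_def
      by (simp only: L2.ip_simps L2.S_closed)
    also have "\<dots> \<le> L2_norm lborel (J u) * (e * ?n) + (e * L2_norm (lattice h) u) * ?n"
    proof -
      have "L2_ip lborel (J u) (c.R x - k *\<^sub>R x) \<le> L2_norm lborel (J u) * L2_norm lborel (c.R x - k *\<^sub>R x)"
        using L2.Cauchy_Schwarz[OF Ju L2.S_closed(3)[OF Rx L2.S_closed(4)[OF x(1), of k]]] by linarith
      also have "\<dots> \<le> L2_norm lborel (J u) * (e * ?n)" by (intro mult_left_mono x(3)) auto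
      finally have 1: "L2_ip lborel (J u) (c.R x - k *\<^sub>R x) \<le> \<dots>" .
      have "- L2_ip lborel (c.R (J u) - J (d.R u)) x \<le> L2_norm lborel (c.R (J u) - J (d.R u)) * ?n"
        using L2.Cauchy_Schwarz[OF L2.S_closed(3)[OF c.R_L2[OF Ju] JR] x(1)] by linarith
      also have "\<dots> \<le> (e * L2_norm (lattice h) u) * ?n"
        using R_cell_near[OF u] by (intro mult_right_mono) (auto simp: e_def)
      finally show ?thesis using 1 by linarith
    qed
    finally show "L2_ip (lattice h) u (d.R z - k *\<^sub>R z) \<le> 2 * e * ?n * L2_norm (lattice h) u"
      by (simp add: cell_embed_norm[OF h(1)] algebra_simps)
  qed
  have "L2_norm (lattice h) (d.R z - k *\<^sub>R z) \<le> (4 * e) * L2_norm (lattice h) z"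
    using Rz mult_left_mono[OF zn, of "2 * e"] e by linarith
  moreover have "0 < L2_norm (lattice h) z" "4 * e \<le> k / 2" using x(2) zn ek by auto
  ultimately obtain l' where l': "complex_of_real l' \<notin> resolvent_Hh G V h" "\<bar>l' - (1 / k - mu)\<bar> \<le> 2 * (4 * e) / k\<^sup>2"
    using d.spectrum_near[unfolded opdom_d op_d, OF z(1) _ k(1)] by blast
  have "2 * (4 * e) / k\<^sup>2 = 8 * e * (l + mu)\<^sup>2" unfolding k(2)[symmetric] by (simp add: power_one_over)
  then show ?thesis using l' unfolding k(2) e_def by (intro exI[of _ l']) auto
qed

end

section \<open>Comparison of the spectra\<close>

lemma emeasure_ball_pos_finite:
  fixes c :: "'a::euclidean_space"
  assumes "r > 0"
  shows "0 < emeasure lborel (ball c r)" "emeasure lborel (ball c r) < \<infinity>"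
proof -
  show f: "emeasure lborel (ball c r) < \<infinity>" by (rule emeasure_lborel_ball_finite)
  then have "emeasure lborel (ball c r) = ennreal (measure lborel (ball c r))"
    by (intro emeasure_eq_ennreal_measure) auto
  then show "0 < emeasure lborel (ball c r)" using content_ball_pos[OF assms, of c] by simp
qed

lemma spectra_close:
  fixes G V :: "real ^ 'n \<Rightarrow> real"
  assumes good: "good_symbol \<alpha> \<gamma> C G"
    and V: "\<And>x. \<bar>V x\<bar> \<le> m" "\<And>x y. \<bar>V x - V y\<bar> \<le> L * dist x y powr \<theta>" "0 \<le> L"
    and \<theta>: "\<gamma> \<le> \<theta>" "\<theta> \<le> 1" and mu: "m + 1 \<le> mu"
    and res_c: "complex_of_real (- mu) \<in> resolvent_H G V"
    and res_d: "\<And>h. h > 0 \<Longrightarrow> complex_of_real (- mu) \<in> resolvent_Hh G V h"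
  shows "\<exists>c>0. \<forall>h l. 0 < h \<and> h \<le> 1 \<and> - mu < l \<and> c * h powr \<gamma> * (l + mu) \<le> 1 \<longrightarrow>
     (complex_of_real l \<in> spectrum_Hh G V h \<longrightarrow>
        (\<exists>l'. complex_of_real l' \<in> spectrum_H G V \<and> \<bar>l' - l\<bar> \<le> c * h powr \<gamma> * (l + mu)\<^sup>2)) \<and>
     (complex_of_real l \<in> spectrum_H G V \<longrightarrow>
        (\<exists>l'. complex_of_real l' \<in> spectrum_Hh G V h \<and> \<bar>l' - l\<bar> \<le> c * h powr \<gamma> * (l + mu)\<^sup>2))"
proof -
  have disc: "discretisation G V \<alpha> \<gamma> C L \<theta> m mu h (real CARD('n))" if "0 < h" "h \<le> 1" for h
    by unfold_locales (use assms that in auto)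
  \<comment> \<open>\<open>cc\<close> does not involve the mesh width, so its value at h = 1 is its
    value for every h.\<close>
  interpret d1: discretisation G V \<alpha> \<gamma> C L \<theta> m mu 1 "real CARD('n)" by (rule disc) auto
  define c where "c = 8 * d1.cc"
  have "c > 0" using d1.cc_pos by (simp add: c_def)
  moreover have "(complex_of_real l \<in> spectrum_Hh G V h \<longrightarrow>
        (\<exists>l'. complex_of_real l' \<in> spectrum_H G V \<and> \<bar>l' - l\<bar> \<le> c * h powr \<gamma> * (l + mu)\<^sup>2)) \<and>
     (complex_of_real l \<in> spectrum_H G V \<longrightarrow>
        (\<exists>l'. complex_of_real l' \<in> spectrum_Hh G V h \<and> \<bar>l' - l\<bar> \<le> c * h powr \<gamma> * (l + mu)\<^sup>2))"
    if "0 < h" "h \<le> 1" "- mu < l" "c * h powr \<gamma> * (l + mu) \<le> 1" for h l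
  proof -
    interpret dh: discretisation G V \<alpha> \<gamma> C L \<theta> m mu h "real CARD('n)" by (rule disc) fact+
    have "8 * (d1.cc * h powr \<gamma>) * (l + mu) \<le> 1" using that(4) by (simp add: c_def mult.assoc)
    then show ?thesis
      using dh.spectrum_d_to_c[OF that(3)] dh.spectrum_c_to_d[OF that(3)]
      unfolding spectrum_def c_def by (simp add: mult.assoc)
  qed
  ultimately show ?thesis by blast
qed

lemma local_hausdorff_real_le:
  assumes "0 \<le> c"
    and XY: "\<And>l. a \<le> l \<Longrightarrow> l \<le> b \<Longrightarrow> complex_of_real l \<in> X \<Longrightarrow> \<exists>l'. complex_of_real l' \<in> Y \<and> \<bar>l' - l\<bar> \<le> c"
    and YX: "\<And>l. a \<le> l \<Longrightarrow> l \<le> b \<Longrightarrow> complex_of_real l \<in> Y \<Longrightarrow> \<exists>l'. complex_of_real l' \<in> X \<and> \<bar>l' - l\<bar> \<le> c"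
  shows "local_hausdorff (complex_of_real ` {a..b}) X Y \<le> ereal c"
proof -
  have *: "(SUP x\<in>X \<inter> complex_of_real ` {a..b}. ereal (infdist x Y)) \<le> ereal c"
    if XY: "\<And>l. a \<le> l \<Longrightarrow> l \<le> b \<Longrightarrow> complex_of_real l \<in> X \<Longrightarrow> \<exists>l'. complex_of_real l' \<in> Y \<and> \<bar>l' - l\<bar> \<le> c"
    for X Y
  proof (rule SUP_least)
    fix x assume "x \<in> X \<inter> complex_of_real ` {a..b}"
    then obtain l where l: "x = of_real l" "a \<le> l" "l \<le> b" "complex_of_real l \<in> X" by auto
    obtain l' where l': "complex_of_real l' \<in> Y" "\<bar>l' - l\<bar> \<le> c" using XY[OF l(2-4)] by blast
    have "infdist x Y \<le> dist x (of_real l')" by (rule infdist_le[OF l'(1)])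
    also have "\<dots> = \<bar>l' - l\<bar>"
      by (simp add: l(1) dist_norm norm_minus_commute flip: of_real_diff)
    finally show "ereal (infdist x Y) \<le> ereal c" using l'(2) by simp
  qed
  show ?thesis unfolding local_hausdorff_def using *[of X Y] *[of Y X] XY YX assms(1) by simp
qed

section \<open>The free operators: zero potential\<close>

lemma (in multiplier_operator) essential_range_spectrum:
  assumes W: "\<And>x. W x = 0"
    and S: "\<And>e. e > 0 \<Longrightarrow> \<exists>S\<in>sets N. 0 < emeasure N S \<and> emeasure N S < \<infinity> \<and> (\<forall>\<xi>\<in>S. \<bar>g \<xi> - l\<bar> \<le> e)"
  shows "complex_of_real l \<notin> resolvent_set M opdom op"
proof (rule multiplication_spectrum[OF W])
  fix e :: real assume e: "e > 0"
  obtain S where S: "S \<in> sets N" "0 < emeasure N S" "emeasure N S < \<infinity>" "\<And>\<xi>. \<xi> \<in> S \<Longrightarrow> \<bar>g \<xi> - l\<bar> \<le> e"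
    using S[OF e] by blast
  note [measurable] = S(1)
  \<comment> \<open>The indicator of a set of positive finite measure on which g is nearly
    \<open>l\<close> is an approximate eigenvector of multiplication by g.\<close>
  define w where "w = (\<lambda>\<xi>. indicator S \<xi> :: complex)"
  have w: "w \<in> L2 N" unfolding w_def by (rule L2_indicator[OF S(1,3)])
  have mw: "w \<in> borel_measurable N" by (rule L2_measurable[OF w])
  have "0 < L2_norm N w"
  proof (rule ccontr)
    assume "\<not> 0 < L2_norm N w"
    then have "L2_norm N w = 0" using L2_norm_nonneg[of N w] by linarith
    then have "AE \<xi> in N. w \<xi> = 0" using L2_norm_eq_0_iff[OF w] by simp
    then have "AE \<xi> in N. \<xi> \<notin> S" by eventually_elim (auto simp: w_def indicator_def split: if_splits)
    moreover have "{\<xi> \<in> space N. \<not> \<xi> \<notin> S} = S" using sets.sets_into_space[OF S(1)] by auto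
    ultimately have "emeasure N S = 0" using AE_iff_measurable[of S N "\<lambda>\<xi>. \<xi> \<notin> S"] S(1) by simp
    then show False using S(2) by simp
  qed
  moreover have "(\<lambda>\<xi>. of_real (g \<xi>) * w \<xi>) \<in> L2 N"
  proof (rule L2_dominated(1)[OF w, of _ "\<bar>l\<bar> + e"])
    show "AE \<xi> in N. cmod (of_real (g \<xi>) * w \<xi>) \<le> (\<bar>l\<bar> + e) * cmod (w \<xi>)"
    proof (rule AE_I2)
      fix \<xi>
      show "cmod (of_real (g \<xi>) * w \<xi>) \<le> (\<bar>l\<bar> + e) * cmod (w \<xi>)"
        using S(4)[of \<xi>] by (cases "\<xi> \<in> S") (auto simp: w_def)
    qed
  qed (use e mw in auto)
  moreover have "L2_norm N (\<lambda>\<xi>. of_real (g \<xi> - l) * w \<xi>) \<le> e * L2_norm N w"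
  proof (rule L2_dominated(2)[OF w])
    show "AE \<xi> in N. cmod (of_real (g \<xi> - l) * w \<xi>) \<le> e * cmod (w \<xi>)"
    proof (rule AE_I2)
      fix \<xi>
      show "cmod (of_real (g \<xi> - l) * w \<xi>) \<le> e * cmod (w \<xi>)"
        using S(4)[of \<xi>] by (cases "\<xi> \<in> S") (auto simp: w_def norm_mult simp del: of_real_diff)
    qed
  qed (use e mw in auto)
  ultimately show "\<exists>w\<in>L2 N. 0 < L2_norm N w \<and> (\<lambda>\<xi>. of_real (g \<xi>) * w \<xi>) \<in> L2 N \<and>
     L2_norm N (\<lambda>\<xi>. of_real (g \<xi> - l) * w \<xi>) \<le> e * L2_norm N w" using w by blast
qed

context discretisation
begin

lemma free_spectrum_c:
  assumes V0: "\<And>x. V x = 0"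
  shows "complex_of_real (G \<xi>0) \<notin> resolvent_H G V"
proof (rule c.essential_range_spectrum[OF V0, unfolded opdom_c op_c])
  fix e :: real assume "e > 0"
  then obtain \<delta> where \<delta>: "\<delta> > 0" "\<And>\<xi>. dist \<xi> \<xi>0 < \<delta> \<Longrightarrow> dist (G \<xi>) (G \<xi>0) < e"
    using good'(1) unfolding continuous_on_iff by (metis UNIV_I)
  show "\<exists>S\<in>sets lborel. 0 < emeasure lborel S \<and> emeasure lborel S < \<infinity> \<and> (\<forall>\<xi>\<in>S. \<bar>G \<xi> - G \<xi>0\<bar> \<le> e)"
  proof (intro bexI[of _ "ball \<xi>0 \<delta>"] conjI ballI)
    show "0 < emeasure lborel (ball \<xi>0 \<delta>)" "emeasure lborel (ball \<xi>0 \<delta>) < \<infinity>"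
      by (rule emeasure_ball_pos_finite[OF \<delta>(1)])+
  qed (use \<delta> in \<open>auto simp: dist_commute dist_real_def less_imp_le\<close>)
qed

lemma free_spectrum_d:
  assumes V0: "\<And>x. V x = 0" and \<xi>0: "norm \<xi>0 < pi / h"
  shows "complex_of_real (G0_disc G h \<xi>0) \<notin> resolvent_Hh G V h"
proof (rule d.essential_range_spectrum[OF V0, unfolded opdom_d op_d])
  fix e :: real assume "e > 0"
  then obtain \<delta> where \<delta>: "\<delta> > 0" "\<And>\<xi>. dist \<xi> \<xi>0 < \<delta> \<Longrightarrow> dist (G0_disc G h \<xi>) (G0_disc G h \<xi>0) < e"
    using G0_disc_continuous[OF good'(1)] unfolding continuous_on_iff by (metis UNIV_I)
  \<comment> \<open>The second radius keeps the ball inside the cube, so that it has the same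
    measure on the torus; this is where \<xi>0 has to be interior.\<close>
  define S where "S = ball \<xi>0 (min \<delta> (pi / h - norm \<xi>0))"
  have S: "S \<subseteq> cube (pi / h)"
  proof
    fix \<xi> assume "\<xi> \<in> S"
    then have "norm \<xi> < pi / h" using norm_triangle_ineq2[of \<xi> \<xi>0] by (simp add: S_def dist_norm norm_minus_commute)
    then have "\<bar>\<xi> $ i\<bar> \<le> pi / h" for i using component_le_norm_cart[of \<xi> i] by linarith
    then show "\<xi> \<in> cube (pi / h)" unfolding cube_def by (auto simp: abs_le_iff minus_le_iff)
  qed
  have eS: "emeasure (torus h) S = emeasure lborel S"
    unfolding torus_def using S by (intro emeasure_restrict_space) auto
  show "\<exists>S\<in>sets (torus h). 0 < emeasure (torus h) S \<and> emeasure (torus h) S < \<infinity> \<and> (\<forall>\<xi>\<in>S. \<bar>G0_disc G h \<xi> - G0_disc G h \<xi>0\<bar> \<le> e)"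
  proof (intro bexI[of _ S] conjI ballI)
    show "0 < emeasure (torus h) S" "emeasure (torus h) S < \<infinity>"
      unfolding eS unfolding S_def using \<delta>(1) \<xi>0 by (intro emeasure_ball_pos_finite; simp)+
    show "S \<in> sets (torus h)" unfolding torus_def using S by (subst sets_restrict_space_iff) (auto simp: S_def)
  qed (use \<delta> in \<open>auto simp: S_def dist_commute dist_real_def less_imp_le\<close>)
qed

text \<open>Solve with arcsin along the axis. The strict bound t < 2 / h keeps the solution inside
  the cube, as \<open>free_spectrum_d\<close> requires.\<close>

lemma disc_point_axis:
  assumes t: "0 \<le> t" "t < 2 / h"
  shows "\<exists>\<xi>. norm \<xi> < pi / h \<and> disc_point h \<xi> = t *\<^sub>R (axis i 1 :: real ^ 'n)"
proof -
  define s where "s = 2 / h * arcsin (h * t / 2)"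
  have r: "0 \<le> h * t / 2" "h * t / 2 < 1" using t h by (auto simp: field_simps)
  have a: "0 \<le> arcsin (h * t / 2)" "arcsin (h * t / 2) < pi / 2"
    using r arcsin_le_arcsin[of 0 "h * t / 2"] arcsin_lt_bounded[of "h * t / 2"] by auto
  have s: "0 \<le> s" "s < pi / h" using a h by (auto simp: s_def field_simps)
  have "h / 2 * s = arcsin (h * t / 2)" using h by (simp add: s_def)
  then have "2 / h * sin (h / 2 * s) = t" using r h by simp
  then have "disc_point h (s *\<^sub>R axis i 1 :: real ^ 'n) = t *\<^sub>R axis i 1"
    by (auto simp: disc_point_def vec_eq_iff axis_def)
  moreover have "norm (s *\<^sub>R axis i (1::real) :: real ^ 'n) < pi / h" using s by simp
  ultimately show ?thesis by blast
qed

end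

text \<open>Intermediate values along one axis, starting from G 0 = 0. \<open>T\<close> is chosen
  with T^\<alpha> = C (1 + b), so that the growth bound gives G >= b at distance T.\<close>

lemma symbol_onto:
  fixes G :: "real ^ 'n \<Rightarrow> real"
  assumes good: "good_symbol \<alpha> \<gamma> C G" and b: "0 \<le> b"
  shows "\<exists>T\<ge>0. \<forall>l. 0 \<le> l \<and> l \<le> b \<longrightarrow> (\<exists>t. 0 \<le> t \<and> t \<le> T \<and> G (t *\<^sub>R axis i 1) = l)"
proof -
  have G: "continuous_on UNIV G" "G 0 = 0" "\<alpha> > 0" "C > 0" "\<And>\<xi>. (1 + norm \<xi>) powr \<alpha> \<le> C * (1 + G \<xi>)"
    using good unfolding good_symbol_def by auto
  define T where "T = (C * (1 + b)) powr (1 / \<alpha>)"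
  have T: "T \<ge> 0" by (simp add: T_def)
  have "C * (1 + b) = T powr \<alpha>" using G b by (simp add: T_def powr_powr)
  also have "\<dots> \<le> (1 + T) powr \<alpha>" using G T by (intro powr_mono2) auto
  also have "\<dots> \<le> C * (1 + G (T *\<^sub>R axis i 1))" using G(5)[of "T *\<^sub>R axis i 1"] T by simp
  finally have bT: "b \<le> G (T *\<^sub>R axis i 1)" using G(4) by simp
  have cont: "continuous_on {0..T} (\<lambda>t. G (t *\<^sub>R axis i 1))"
    by (rule continuous_on_compose2[OF G(1)]) (auto intro!: continuous_intros)
  have "\<exists>t. 0 \<le> t \<and> t \<le> T \<and> G (t *\<^sub>R axis i 1) = l" if "0 \<le> l" "l \<le> b" for l
    using IVT'[of "\<lambda>t. G (t *\<^sub>R axis i 1)" 0 l T] that G(2) bT T cont by auto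
  then show ?thesis using T by blast
qed

text \<open>Values l <= -\<mu> are excluded by hypothesis, negative l above -\<mu> by non-negativity
  of the operators, and every l in [0, b] is a value of both symbols once the range of the
  discretisation reaches far enough.\<close>

lemma free_spectra_agree:
  fixes G V :: "real ^ 'n \<Rightarrow> real"
  assumes good: "good_symbol \<alpha> \<gamma> C G" and V0: "\<And>x. V x = 0" and \<mu>: "\<mu> > 0"
    and below_c: "complex_of_real ` {.. -\<mu>} \<subseteq> resolvent_H G V"
    and below_d: "\<And>h. h > 0 \<Longrightarrow> complex_of_real ` {.. -\<mu>} \<subseteq> resolvent_Hh G V h"
  shows "\<exists>h0>0. \<forall>h l. 0 < h \<and> h \<le> h0 \<and> l \<le> b \<longrightarrow>
    (complex_of_real l \<in> spectrum_Hh G V h \<longleftrightarrow> complex_of_real l \<in> spectrum_H G V)"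
proof -
  define b' where "b' = max 0 b"
  define i :: 'n where "i = undefined"
  obtain T where T: "T \<ge> 0" "\<And>l. 0 \<le> l \<Longrightarrow> l \<le> b' \<Longrightarrow> \<exists>t. 0 \<le> t \<and> t \<le> T \<and> G (t *\<^sub>R axis i 1) = l"
    using symbol_onto[OF good, of b' i] by (auto simp: b'_def)
  have \<gamma>: "\<gamma> \<le> 1" using good unfolding good_symbol_def by auto
  \<comment> \<open>For h <= 1 / (T + 1) one has T < 2 / h, so every axis point needed is of the
    form \<open>disc_point h \<xi>\<close>.\<close>
  define h0 where "h0 = min 1 (1 / (T + 1))"
  have "h0 > 0" using T by (simp add: h0_def)
  moreover have "complex_of_real l \<in> spectrum_Hh G V h \<longleftrightarrow> complex_of_real l \<in> spectrum_H G V"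
    if hb: "0 < h" "h \<le> h0" and l: "l \<le> b" for h l
  proof -
    have "complex_of_real (- (\<mu> + 1)) \<in> resolvent_H G V" "complex_of_real (- (\<mu> + 1)) \<in> resolvent_Hh G V h"
      by (rule subsetD[OF below_c] subsetD[OF below_d[OF hb(1)]], rule imageI, simp)+
    \<comment> \<open>For the zero potential m = 0, L = 0 and \<theta> = 1 are valid data, and \<mu>
      + 1 meets the requirement m + 1 <= mu.\<close>
    then interpret discretisation G V \<alpha> \<gamma> C 0 1 0 "\<mu> + 1" h "real CARD('n)"
      by unfold_locales (use good V0 \<mu> \<gamma> hb in \<open>auto simp: h0_def\<close>)
    show ?thesis
    proof (cases "0 \<le> l")
      case True
      then obtain t where t: "0 \<le> t" "t \<le> T" "G (t *\<^sub>R axis i 1) = l" using T(2)[of l] l by (auto simp: b'_def)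
      have "h \<le> 1 / (T + 1)" using hb by (simp add: h0_def)
      then have "h * (T + 1) \<le> 1" using T(1) by (simp add: pos_le_divide_eq)
      moreover have "t * h \<le> T * h" using t(2) hb(1) by (intro mult_right_mono) auto
      ultimately have "t * h < 2" using hb(1) distrib_left[of h T 1] mult.commute[of h T] by linarith
      then have "t < 2 / h" using h(1) by (simp add: pos_less_divide_eq)
      then obtain \<xi> where \<xi>: "norm \<xi> < pi / h" "disc_point h \<xi> = t *\<^sub>R axis i 1" using disc_point_axis[OF t(1)] by blast
      have "complex_of_real l \<in> spectrum_Hh G V h"
        using free_spectrum_d[OF V0 \<xi>(1)] \<xi>(2) t(3) by (simp add: spectrum_def G0_disc_eq)
      moreover have "complex_of_real l \<in> spectrum_H G V"
        using free_spectrum_c[OF V0, of "t *\<^sub>R axis i 1"] t(3) by (simp add: spectrum_def)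
      ultimately show ?thesis by simp
    next
      case False
      show ?thesis
      proof (cases "l \<le> - \<mu>")
        case True
        then show ?thesis using below_c below_d[OF hb(1)] by (auto simp: spectrum_def)
      next
        case neg: False
        have "complex_of_real l \<in> resolvent_H G V" "complex_of_real l \<in> resolvent_Hh G V h"
          using c.below_resolvent[of l, unfolded opdom_c op_c] d.below_resolvent[of l, unfolded opdom_d op_d] False neg by auto
        then show ?thesis by (simp add: spectrum_def)
      qed
    qed
  qed
  ultimately show ?thesis by blast
qed

lemma symbol_exponent_pos: "admissible_symbol p G \<Longrightarrow> 0 < symbol_exponent p"
  by (cases p) (auto simp: symbol_i_def symbol_ii_def symbol_iii_def)

lemma free_case:
  fixes V G0 :: "real ^ 'n \<Rightarrow> real"
  assumes adm: "admissible_symbol p G0" and V0: "\<And>x. V x = 0" and \<mu>: "\<mu> > 0"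
    and res_c: "complex_of_real ` {.. -\<mu>} \<subseteq> resolvent_H G0 V"
    and res_d: "\<And>h. h > 0 \<Longrightarrow> complex_of_real ` {.. -\<mu>} \<subseteq> resolvent_Hh G0 V h"
  shows "\<exists>h0>0. \<forall>h. 0 < h \<and> h \<le> h0 \<longrightarrow>
    local_hausdorff (complex_of_real ` {a..b}) (spectrum_Hh G0 V h) (spectrum_H G0 V) \<le> 0"
proof -
  \<comment> \<open>The exponent may exceed 1, which \<open>good_symbol\<close> excludes. Capping it
    costs nothing, because the spectra coincide up to b and the symbol enters only
    qualitatively.\<close>
  obtain \<alpha> C where good: "good_symbol \<alpha> (min 1 (symbol_exponent p)) C G0"
    using admissible_symbol_good[OF adm, of "min 1 (symbol_exponent p)"] symbol_exponent_pos[OF adm] by auto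
  obtain h0 where h0: "h0 > 0" "\<And>h l. 0 < h \<Longrightarrow> h \<le> h0 \<Longrightarrow> l \<le> b \<Longrightarrow>
      complex_of_real l \<in> spectrum_Hh G0 V h \<longleftrightarrow> complex_of_real l \<in> spectrum_H G0 V"
    using free_spectra_agree[OF good V0 \<mu> res_c res_d, of b] by blast
  have "local_hausdorff (complex_of_real ` {a..b}) (spectrum_Hh G0 V h) (spectrum_H G0 V) \<le> ereal 0"
    if h: "0 < h" "h \<le> h0" for h
  proof (rule local_hausdorff_real_le)
    fix l assume l: "l \<le> b"
    show "complex_of_real l \<in> spectrum_Hh G0 V h \<Longrightarrow> \<exists>l'. complex_of_real l' \<in> spectrum_H G0 V \<and> \<bar>l' - l\<bar> \<le> 0"
      "complex_of_real l \<in> spectrum_H G0 V \<Longrightarrow> \<exists>l'. complex_of_real l' \<in> spectrum_Hh G0 V h \<and> \<bar>l' - l\<bar> \<le> 0"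
      using h0(2)[OF h l] by auto
  qed simp
  then show ?thesis using h0(1) by (auto simp: zero_ereal_def)
qed

section \<open>Operators with a potential\<close>

lemma spectral_gap:
  fixes G V :: "real ^ 'n \<Rightarrow> real"
  assumes disc: "discretisation G V \<alpha> \<gamma> C L \<theta> m mu h D" and \<mu>: "\<mu> < mu"
    and res: "complex_of_real ` {.. -\<mu>} \<subseteq> resolvent_H G V"
  shows "\<exists>\<delta>>0. \<forall>l. complex_of_real l \<in> spectrum_H G V \<longrightarrow> \<delta> \<le> l + \<mu>"
proof -
  interpret discretisation G V \<alpha> \<gamma> C L \<theta> m mu h D by (rule disc)
  have "complex_of_real (- \<mu>) \<in> resolvent_H G V" by (rule subsetD[OF res], rule imageI) simp
  then obtain \<delta> where \<delta>: "\<delta> > 0" "\<And>l. \<bar>l - (- \<mu>)\<bar> < \<delta> \<Longrightarrow> complex_of_real l \<in> resolvent_H G V"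
    using c.resolvent_open_real[of "- \<mu>", unfolded opdom_c op_c] \<mu> by auto
  have "\<delta> \<le> l + \<mu>" if l: "complex_of_real l \<in> spectrum_H G V" for l
  proof (rule ccontr)
    assume n: "\<not> \<delta> \<le> l + \<mu>"
    show False
    proof (cases "l \<le> - \<mu>")
      case True
      then have "complex_of_real l \<in> resolvent_H G V" using res by auto
      then show False using l by (simp add: spectrum_def)
    next
      case False
      then have "complex_of_real l \<in> resolvent_H G V" using n by (intro \<delta>(2)) auto
      then show False using l by (simp add: spectrum_def)
    qed
  qed
  then show ?thesis using \<delta>(1) by blast
qed

lemma powr_le_near_0:
  fixes \<gamma> x :: real
  assumes "\<gamma> > 0" "x > 0"
  shows "\<exists>h0>0. h0 \<le> 1 \<and> (\<forall>h. 0 < h \<and> h \<le> h0 \<longrightarrow> h powr \<gamma> \<le> x)"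
proof (intro exI[of _ "min 1 (x powr (1 / \<gamma>))"] conjI allI impI)
  fix h assume h: "0 < h \<and> h \<le> min 1 (x powr (1 / \<gamma>))"
  then have "h powr \<gamma> \<le> (x powr (1 / \<gamma>)) powr \<gamma>" using assms by (intro powr_mono2) auto
  then show "h powr \<gamma> \<le> x" using assms by (simp add: powr_powr)
qed (use assms in auto)

text \<open>
  The estimate between the resolvents needs a spectral parameter \<open>-mu\<close> below \<open>- sup \<bar>V\<bar>\<close>, so it yields
  the factor \<open>(b + mu)\<^sup>2\<close>. As \<open>-\<mu>\<close> lies in the open resolvent set of \<open>H\<close>, the spectrum of \<open>H\<close> stays
  at a distance \<open>\<delta>\<close> above \<open>-\<mu>\<close>, and \<open>b + mu\<close> is bounded by a multiple of \<open>b + \<mu>\<close> unless \<open>{a..b}\<close>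
  contains no spectrum at all.
\<close>

lemma interacting_case:
  fixes V G0 :: "real ^ 'n \<Rightarrow> real"
  assumes adm: "admissible_symbol p G0" and \<gamma>: "0 < \<gamma>" "\<gamma> \<le> symbol_exponent p" "\<gamma> \<le> \<theta>" "\<theta> \<le> 1"
    and V: "\<And>x. \<bar>V x\<bar> \<le> m" "\<And>x y. \<bar>V x - V y\<bar> \<le> L * dist x y powr \<theta>" "0 \<le> L"
    and res_c: "complex_of_real ` {.. -\<mu>} \<subseteq> resolvent_H G0 V"
    and res_d: "\<And>h. h > 0 \<Longrightarrow> complex_of_real ` {.. -\<mu>} \<subseteq> resolvent_Hh G0 V h"
  shows "\<exists>C>0. \<forall>a b. -\<mu> < a \<and> a \<le> b \<longrightarrow> (\<exists>h0>0. \<forall>h. 0 < h \<and> h \<le> h0 \<longrightarrow>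
      local_hausdorff (complex_of_real ` {a..b}) (spectrum_Hh G0 V h) (spectrum_H G0 V)
        \<le> ereal ((b + \<mu>)\<^sup>2 * C * h powr \<gamma>))"
proof -
  define mu where "mu = max (\<mu> + 1) (m + 1)"
  have mu: "m + 1 \<le> mu" "\<mu> < mu" by (auto simp: mu_def)
  have mc: "complex_of_real (- mu) \<in> resolvent_H G0 V"
    by (rule subsetD[OF res_c], rule imageI) (use mu in simp)
  have md: "complex_of_real (- mu) \<in> resolvent_Hh G0 V h" if "h > 0" for h
    by (rule subsetD[OF res_d[OF that]], rule imageI) (use mu in simp)
  obtain \<alpha> C where good: "good_symbol \<alpha> \<gamma> C G0"
    using admissible_symbol_good[OF adm \<gamma>(1)] \<gamma> by auto
  obtain c where c: "c > 0" and close: "\<And>h l. 0 < h \<Longrightarrow> h \<le> 1 \<Longrightarrow> - mu < l \<Longrightarrow> c * h powr \<gamma> * (l + mu) \<le> 1 \<Longrightarrow>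
     (complex_of_real l \<in> spectrum_Hh G0 V h \<longrightarrow>
        (\<exists>l'. complex_of_real l' \<in> spectrum_H G0 V \<and> \<bar>l' - l\<bar> \<le> c * h powr \<gamma> * (l + mu)\<^sup>2)) \<and>
     (complex_of_real l \<in> spectrum_H G0 V \<longrightarrow>
        (\<exists>l'. complex_of_real l' \<in> spectrum_Hh G0 V h \<and> \<bar>l' - l\<bar> \<le> c * h powr \<gamma> * (l + mu)\<^sup>2))"
    using spectra_close[OF good V \<gamma>(3,4) mu(1) mc md] by blast
  have "discretisation G0 V \<alpha> \<gamma> C L \<theta> m mu 1 (real CARD('n))"
    by unfold_locales (use good V \<gamma> mu mc md in auto)
  then obtain \<delta> where \<delta>: "\<delta> > 0" "\<And>l. complex_of_real l \<in> spectrum_H G0 V \<Longrightarrow> \<delta> \<le> l + \<mu>"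
    using spectral_gap[OF _ mu(2) res_c] by blast
  \<comment> \<open>If b + \<mu> >= \<delta> / 2, then mu - \<mu> is at most (q - 1) (b + \<mu>),
    hence b + mu <= q (b + \<mu>).\<close>
  define q where "q = 1 + (mu - \<mu>) / (\<delta> / 2)"
  have q: "q > 0" using \<delta>(1) mu by (simp add: q_def add_pos_nonneg)
  have "\<exists>h0>0. \<forall>h. 0 < h \<and> h \<le> h0 \<longrightarrow>
      local_hausdorff (complex_of_real ` {a..b}) (spectrum_Hh G0 V h) (spectrum_H G0 V)
        \<le> ereal ((b + \<mu>)\<^sup>2 * (c * q\<^sup>2) * h powr \<gamma>)" if ab: "-\<mu> < a" "a \<le> b" for a b
  proof -
    define s where "s = b + mu"
    have s: "s > 0" using ab mu by (simp add: s_def)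
    \<comment> \<open>The first bound makes \<open>spectra_close\<close> applicable for all l up to
      b; the second one limits every displacement to \<delta> / 2.\<close>
    define x where "x = min (1 / (c * s)) (\<delta> / 2 / (c * s\<^sup>2))"
    have "x > 0" using c s \<delta>(1) by (simp add: x_def)
    then obtain h0 where h0: "h0 > 0" "h0 \<le> 1" "\<And>h. 0 < h \<Longrightarrow> h \<le> h0 \<Longrightarrow> h powr \<gamma> \<le> x"
      using powr_le_near_0[OF \<gamma>(1)] by blast
    have "local_hausdorff (complex_of_real ` {a..b}) (spectrum_Hh G0 V h) (spectrum_H G0 V)
        \<le> ereal ((b + \<mu>)\<^sup>2 * (c * q\<^sup>2) * h powr \<gamma>)" if h: "0 < h" "h \<le> h0" for h
    proof (rule local_hausdorff_real_le)
      show "0 \<le> (b + \<mu>)\<^sup>2 * (c * q\<^sup>2) * h powr \<gamma>" using c by simp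
      have t: "c * h powr \<gamma> * s \<le> 1" "c * h powr \<gamma> * s\<^sup>2 \<le> \<delta> / 2"
      proof -
        have "h powr \<gamma> \<le> 1 / (c * s)" "h powr \<gamma> \<le> \<delta> / 2 / (c * s\<^sup>2)"
          using h0(3)[OF h] by (auto simp: x_def)
        then show "c * h powr \<gamma> * s \<le> 1" "c * h powr \<gamma> * s\<^sup>2 \<le> \<delta> / 2"
          using c s by (simp_all add: pos_le_divide_eq mult_ac)
      qed
      have wide: "c * h powr \<gamma> * s\<^sup>2 \<le> (b + \<mu>)\<^sup>2 * (c * q\<^sup>2) * h powr \<gamma>" if "\<delta> / 2 \<le> b + \<mu>"
      proof -
        define r where "r = (mu - \<mu>) / (\<delta> / 2)"
        have "r * (\<delta> / 2) \<le> r * (b + \<mu>)"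
          using that mu \<delta>(1) by (intro mult_left_mono) (auto simp: r_def)
        moreover have "r * (\<delta> / 2) = mu - \<mu>" using \<delta>(1) by (simp add: r_def)
        moreover have "q * (b + \<mu>) = (b + \<mu>) + r * (b + \<mu>)" by (simp add: q_def r_def distrib_right)
        ultimately have "s \<le> q * (b + \<mu>)" unfolding s_def by linarith
        then have "s\<^sup>2 \<le> (q * (b + \<mu>))\<^sup>2" using s by (intro power_mono) auto
        then have "c * h powr \<gamma> * s\<^sup>2 \<le> c * h powr \<gamma> * (q * (b + \<mu>))\<^sup>2" using c by (intro mult_left_mono) auto
        then show ?thesis by (simp add: power2_eq_square mult_ac)
      qed
      fix l assume l: "a \<le> l" "l \<le> b"
      have lm: "- mu < l" "0 < l + mu" "l + mu \<le> s" using l ab mu by (auto simp: s_def)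
      have e: "c * h powr \<gamma> * (l + mu)\<^sup>2 \<le> c * h powr \<gamma> * s\<^sup>2"
        using c lm by (intro mult_left_mono power_mono) auto
      have "c * h powr \<gamma> * (l + mu) \<le> c * h powr \<gamma> * s" using c lm by (intro mult_left_mono) auto
      then have "c * h powr \<gamma> * (l + mu) \<le> 1" using t(1) by linarith
      note cl = close[OF h(1) order_trans[OF h(2) h0(2)] lm(1) this]
      show "\<exists>l'. complex_of_real l' \<in> spectrum_H G0 V \<and> \<bar>l' - l\<bar> \<le> (b + \<mu>)\<^sup>2 * (c * q\<^sup>2) * h powr \<gamma>"
        if sp: "complex_of_real l \<in> spectrum_Hh G0 V h"
      proof -
        obtain l' where l': "complex_of_real l' \<in> spectrum_H G0 V" "\<bar>l' - l\<bar> \<le> c * h powr \<gamma> * (l + mu)\<^sup>2"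
          using cl sp by blast
        \<comment> \<open>The gap is known for H only. The nearby point l' has \<delta> <= l' +
          \<mu>, and a displacement of at most \<delta> / 2 leaves half of the gap for l.\<close>
        then have "\<delta> / 2 \<le> b + \<mu>" using \<delta>(2)[OF l'(1)] e t(2) l by linarith
        then show ?thesis using l' e wide by (intro exI[of _ l']) linarith
      qed
      show "\<exists>l'. complex_of_real l' \<in> spectrum_Hh G0 V h \<and> \<bar>l' - l\<bar> \<le> (b + \<mu>)\<^sup>2 * (c * q\<^sup>2) * h powr \<gamma>"
        if sp: "complex_of_real l \<in> spectrum_H G0 V"
      proof -
        obtain l' where l': "complex_of_real l' \<in> spectrum_Hh G0 V h" "\<bar>l' - l\<bar> \<le> c * h powr \<gamma> * (l + mu)\<^sup>2"
          using cl sp by blast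
        have "\<delta> / 2 \<le> b + \<mu>" using \<delta>(2)[OF sp] \<delta>(1) l by linarith
        then show ?thesis using l' e wide by (intro exI[of _ l']) linarith
      qed
    qed
    then show ?thesis using h0(1) by blast
  qed
  moreover have "c * q\<^sup>2 > 0" using c q by simp
  ultimately show ?thesis by blast
qed

theorem theorem5p5:
  fixes \<phi>0 \<psi>0 :: "real ^ 'n \<Rightarrow> complex"
    and V G0 :: "real ^ 'n \<Rightarrow> real"
    and \<theta> \<tau> \<mu> :: real
    and p :: symbol_params
  assumes "admissible \<phi>0 \<psi>0 V G0 \<theta> \<tau> p"
    and "\<mu> > 0"
    and "complex_of_real ` {.. -\<mu>} \<subseteq> resolvent_H G0 V"
    and "\<And>h. h > 0 \<Longrightarrow> complex_of_real ` {.. -\<mu>} \<subseteq> resolvent_Hh G0 V h"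
  shows "\<exists>C>0. \<forall>a b. -\<mu> < a \<and> a \<le> b \<longrightarrow>
    (\<exists>h0>0. \<forall>h. 0 < h \<and> h \<le> h0 \<longrightarrow>
      local_hausdorff (complex_of_real ` {a..b}) (spectrum_Hh G0 V h) (spectrum_H G0 V)
        \<le> ereal ((b + \<mu>)\<^sup>2 * C * h powr rate_exponent V \<theta> \<tau> p))"
proof -
  have adm: "admissible_symbol p G0" and pot: "admissible_potential V \<psi>0 \<theta> \<tau>"
    using assms(1) by (auto simp: admissible_def)
  show ?thesis
  proof (cases "\<forall>x. V x = 0")
    case True
    then have V0: "\<And>x. V x = 0" by blast
    show ?thesis
    \<comment> \<open>The distance is 0 for small h, so any positive constant serves.\<close>
    proof (rule exI[of _ 1], intro conjI allI impI)
      fix a b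
      obtain h0 where h0: "h0 > 0" "\<And>h. 0 < h \<Longrightarrow> h \<le> h0 \<Longrightarrow>
          local_hausdorff (complex_of_real ` {a..b}) (spectrum_Hh G0 V h) (spectrum_H G0 V) \<le> 0"
        using free_case[OF adm V0 assms(2-4), of a b] by blast
      have "local_hausdorff (complex_of_real ` {a..b}) (spectrum_Hh G0 V h) (spectrum_H G0 V)
          \<le> ereal ((b + \<mu>)\<^sup>2 * 1 * h powr rate_exponent V \<theta> \<tau> p)" if "0 < h" "h \<le> h0" for h
        by (rule order_trans[OF h0(2)[OF that]]) simp
      then show "\<exists>h0>0. \<forall>h. 0 < h \<and> h \<le> h0 \<longrightarrow>
          local_hausdorff (complex_of_real ` {a..b}) (spectrum_Hh G0 V h) (spectrum_H G0 V)
          \<le> ereal ((b + \<mu>)\<^sup>2 * 1 * h powr rate_exponent V \<theta> \<tau> p)" using h0(1) by blast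
    qed simp
  next
    case False
    then have \<tau>: "\<tau> > real CARD('n)" and \<theta>: "0 < \<theta>" "\<theta> \<le> 1"
      using pot by (auto simp: admissible_potential_def)
    obtain m where m: "\<And>x. \<bar>V x\<bar> \<le> m"
      using pot by (auto simp: admissible_potential_def bounded_iff)
    obtain L where L: "\<And>x y. \<bar>V x - V y\<bar> \<le> L * dist x y powr \<theta>"
      using pot by (auto simp: admissible_potential_def)
    have L': "\<bar>V x - V y\<bar> \<le> \<bar>L\<bar> * dist x y powr \<theta>" for x y
      using L[of x y] mult_right_mono[OF abs_ge_self[of L], of "dist x y powr \<theta>"] by simp
    define r where "r = 1 / (1 / \<theta> + 1 / (\<tau> - real CARD('n)))"
    have rate: "rate_exponent V \<theta> \<tau> p = min (symbol_exponent p) r"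
      unfolding rate_exponent_def r_def by (rule if_not_P[OF False])
    have i: "1 / \<theta> > 0" "1 / (\<tau> - real CARD('n)) > 0" using \<theta> \<tau> by auto
    \<comment> \<open>The summand 1 / (\<tau> - d) is positive; dropping it gives r <= \<theta>,
      which also keeps the rate at most 1.\<close>
    have "r \<le> 1 / (1 / \<theta>)" unfolding r_def using i by (intro divide_left_mono mult_pos_pos add_pos_pos) auto
    then have r: "0 < r" "r \<le> \<theta>" using i by (simp_all add: r_def add_pos_pos)
    show ?thesis
      unfolding rate using symbol_exponent_pos[OF adm] r \<theta>
      by (intro interacting_case[OF adm _ _ _ _ m L' _ assms(3,4)]) auto
  qed
qed

end
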